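(* Let $b$ be a prime. Let $m,s,\alpha,d\in\mathbb{N}$ with $\alpha\ge 2$, and let $\boldsymbol{\gamma}=(\gamma_u)_{u\subseteq I_s}$ be a set of non-negative weights, where $I_s=\{1,\ldots,s\}$. Let $p\in\mathbb{F}_b[x]$ with $\deg(p)=m$ and $\boldsymbol{q}=(q_1,\ldots,q_{ds})\in(\mathbb{F}_b[x])^{ds}$, let $P_{b^m,ds}(\boldsymbol{q},p)$ be the corresponding polynomial lattice point set in $[0,1)^{ds}$, and let $D^{\perp}(\boldsymbol{q},p)\subseteq \mathbb{N}_0^{ds}$ be its dual net. Let $P_{b^m}=\{\boldsymbol{x}_0,\ldots,\boldsymbol{x}_{b^m-1}\}\subset[0,1)^s$ be the higher order digital net $\boldsymbol{x}_n=\mathcal{D}_d(\boldsymbol{y}_n)$ obtained by digit interlacing the points $\boldsymbol{y}_n$ of $P_{b^m,ds}(\boldsymbol{q},p)$. Then the mean square worst-case error of $P_{b^m}$ in $H_{s,\alpha,\boldsymbol{\gamma}}$ with respect to a random digital shift satisfies $$\tilde{e}^2(P_{b^m},H_{s,\alpha,\boldsymbol{\gamma}})\le \sum_{\emptyset\ne w\subseteq I_{ds}}\gamma_{\phi(w)}\,\tilde{D}_{\alpha,b,d}^{|\phi(w)|}\sum_{\substack{\boldsymbol{l}_w\in\mathbb{N}^{|w|}\\(\boldsymbol{l}_w,\boldsymbol{0})\in D^{\perp}(\boldsymbol{q},p)}}r_{\alpha,d}(\boldsymbol{l}_w).$$ Here $\tilde{D}_{\alpha,b,d}=b^{(2d-1)\alpha}D_{\alpha,b}$;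 $(\boldsymbol{l}_w,\boldsymbol{0})$ is the $ds$-dimensional vector whose $j$-th component is $l_j$ if $j\in w$ and $0$ otherwise; $\phi(w)=\{1\le j\le s:\ w\cap\{d(j-1)+1,\ldots,dj\}\ne\emptyset\}$; and $r_{\alpha,d}(\boldsymbol{l}_w)=\prod_{j\in w}r_{\alpha,d}(l_j)$ with $r_{\alpha,d}(0)=1$ and $r_{\alpha,d}(l)=b^{-2\min(\alpha,d)\mu_1(l)-\alpha}$ for $l\ge 1$.
   Context: Notation: $\mathbb{N}=\{1,2,\ldots\}$, $\mathbb{N}_0=\mathbb{N}\cup\{0\}$, $I_n=\{1,\ldots,n\}$, $\mathbb{F}_b=\{0,\ldots,b-1\}$ the field of $b$ elements. All $b$-adic expansions of $x\in[0,1)$ are those with infinitely many digits different from $b-1$. $x\oplus x'$ denotes digitwise addition modulo $b$ of the $b$-adic expansions, applied componentwise to vectors. Point sets are multisets. Weight $\mu_1$: $\mu_1(0)=0$, and for $l\in\mathbb{N}$, $\mu_1(l)$ is the number of $b$-adic digits of $l$, i.e. $\mu_1(l)=a$ if $b^{a-1}\le l<b^a$. Constant $D_{\alpha,b}$: $D_{\alpha,b}=\max_{1\le\nu\le\alpha}\big(C'_{\alpha,b,\nu}+\tilde{C}_{2\alpha,b}b^{-2(\alpha-\nu)}\big)$, where $C'_{\alpha,b,\nu}=\sum_{\tau=\nu}^{\alpha}C_{\tau,b}^2b^{-2(\tau-\nu)}$, $C_{1,b}=(2\sin(\pi/b))^{-1}$, $C_{\tau,b}=(1+1/b+1/(b(b+1)))^{\tau-2}/(2\sin(\pi/b))^{\tau}$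 for $\tau\ge 2$, and $\tilde{C}_{2\alpha,b}=2(1+1/b+1/(b(b+1)))^{2\alpha-2}/(2\sin(\pi/b))^{2\alpha}$. Polynomial lattice point set: identify an integer $n=\nu_0+\nu_1b+\cdots$ (base $b$ digits) with the polynomial $n(x)=\nu_0+\nu_1x+\cdots\in\mathbb{F}_b[x]$. Define $v_m:\mathbb{F}_b((x^{-1}))\to[0,1)$ by $v_m(\sum_{l=w}^{\infty}t_lx^{-l})=\sum_{l=\max(1,w)}^{m}t_lb^{-l}$. For $\deg(p)=m$ and $\boldsymbol{q}\in(\mathbb{F}_b[x])^{t}$, $P_{b^m,t}(\boldsymbol{q},p)=\{\boldsymbol{y}_0,\ldots,\boldsymbol{y}_{b^m-1}\}$ with $\boldsymbol{y}_n=(v_m(n(x)q_1(x)/p(x)),\ldots,v_m(n(x)q_t(x)/p(x)))$, $0\le n<b^m$. Dual net: for $k=\kappa_0+\kappa_1b+\cdots\in\mathbb{N}_0$ let $\mathrm{tr}_m(k)(x)=\kappa_0+\kappa_1x+\cdots+\kappa_{m-1}x^{m-1}$. Then $D^{\perp}(\boldsymbol{q},p)=\{\boldsymbol{k}=(k_1,\ldots,k_t)\in\mathbb{N}_0^t:\ \sum_{j=1}^{t}\mathrm{tr}_m(k_j)\,q_j\equiv 0\pmod p\}$. Digit interlacing: for $(y_1,\ldots,y_d)\in[0,1)^d$ with $y_r=\sum_{a\ge1}\eta_{r,a}b^{-a}$, $\mathcal{D}_d(y_1,\ldots,y_d)=\sum_{a=1}^{\infty}\sum_{r=1}^{d}\eta_{r,a}b^{-(r+(a-1)d)}$;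 for $\boldsymbol{y}\in[0,1)^{ds}$, $\mathcal{D}_d(\boldsymbol{y})=(\mathcal{D}_d(y_1,\ldots,y_d),\ldots,\mathcal{D}_d(y_{d(s-1)+1},\ldots,y_{ds}))$. Function space: $H_{s,\alpha,\boldsymbol{\gamma}}$ is the reproducing kernel Hilbert space (weighted unanchored Sobolev space of order $\alpha$) of real functions on $[0,1)^s$ with kernel $$K_{s,\alpha,\boldsymbol{\gamma}}(\boldsymbol{x},\boldsymbol{y})=\sum_{u\subseteq I_s}\gamma_u\prod_{j\in u}\Big(\sum_{r=1}^{\alpha}\frac{B_r(x_j)B_r(y_j)}{(r!)^2}+(-1)^{\alpha+1}\frac{B_{2\alpha}(|x_j-y_j|)}{(2\alpha)!}\Big),$$ $B_r$ the Bernoulli polynomial of degree $r$, empty product $=1$. (Its inner product is $\langle f,g\rangle=\sum_{u\subseteq I_s}\gamma_u^{-1}\sum_{v\subseteq u}\sum_{\boldsymbol{r}_{u\setminus v}\in\{1,\ldots,\alpha-1\}^{|u\setminus v|}}\int_{[0,1)^{|v|}}\big(\int_{[0,1)^{s-|v|}}f^{(\boldsymbol{r}_{u\setminus v},\boldsymbol{\alpha}_v,\boldsymbol{0})}d\boldsymbol{x}_{-v}\big)\big(\int_{[0,1)^{s-|v|}}g^{(\boldsymbol{r}_{u\setminus v},\boldsymbol{\alpha}_v,\boldsymbol{0})}d\boldsymbol{x}_{-v}\big)d\boldsymbol{x}_v$, where the derivative has order $r_j$ in $x_j$ for $j\in u\setminus v$, $\alpha$ for $j\in v$, $0$ for $j\notin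 u$; when $\gamma_u=0$ the corresponding inner sum is assumed to be $0$ and $0/0=0$.) Errors: for $P_N=\{\boldsymbol{x}_0,\ldots,\boldsymbol{x}_{N-1}\}\subset[0,1)^s$, $e(P_N,H)=\sup_{\|f\|_H\le1}\big|\int_{[0,1)^s}f(\boldsymbol{x})d\boldsymbol{x}-\frac1N\sum_{n=0}^{N-1}f(\boldsymbol{x}_n)\big|$. With $P_{N,\boldsymbol{\sigma}}=\{\boldsymbol{x}_n\oplus\boldsymbol{\sigma}:0\le n<N\}$, the mean square worst-case error with respect to a random digital shift is $\tilde{e}^2(P_N,H)=\int_{[0,1)^s}e^2(P_{N,\boldsymbol{\sigma}},H)\,d\boldsymbol{\sigma}$. *)

theory Defs
  imports
    "HOL-Analysis.Analysis"
    "HOL-Computational_Algebra.Formal_Laurent_Series"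
    "HOL-Number_Theory.Cong"
    "HOL-Library.Log_Nat"
    "Berlekamp_Zassenhaus.Finite_Field"
begin

text \<open>
  Vectors with components indexed by \<open>1, \<dots>, t\<close> are extensional functions on \<open>{1..t}\<close>.
  The field of \<open>b\<close> elements, \<open>b\<close> prime, is \<open>'p mod_ring\<close> with \<open>'p :: prime_card\<close> and
  \<open>CARD('p) = b\<close>; its elements are identified with \<open>{0..<b}\<close> by \<open>to_int_mod_ring\<close>.
\<close>


subsection \<open>Base \<open>b\<close> expansions\<close>

text \<open>
  The \<open>a\<close>-th digit (\<open>a \<ge> 1\<close>) of \<open>x \<in> [0,1)\<close>.  The floor selects the expansion that has
  infinitely many digits different from \<open>b - 1\<close>; see the two lemmas below.
\<close>

definition badic_digit :: "nat \<Rightarrow> real \<Rightarrow> nat \<Rightarrow> nat" where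
  "badic_digit b x a = nat (\<lfloor>x * real b ^ a\<rfloor> mod int b)"

lemma badic_digit_less: "b > 0 \<Longrightarrow> badic_digit b x a < b"
  by (simp add: badic_digit_def nat_less_iff)

lemma badic_partial_sum:
  assumes "b > 0" "0 \<le> x" "x < 1"
  shows "(\<Sum>a<n. real (badic_digit b x (Suc a)) / real b ^ Suc a) = real_of_int \<lfloor>x * real b ^ n\<rfloor> / real b ^ n"
proof (induction n)
  case 0
  have "\<lfloor>x\<rfloor> = 0" using assms by linarith
  then show ?case by simp
next
  case (Suc n)
  have fl: "\<lfloor>x * real b ^ n\<rfloor> = \<lfloor>x * real b ^ Suc n\<rfloor> div int b"
  proof -
    have "\<lfloor>x * real b ^ n\<rfloor> = \<lfloor>(x * real b ^ Suc n) / real_of_int (int b)\<rfloor>"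
      using assms by simp
    also have "\<dots> = \<lfloor>x * real b ^ Suc n\<rfloor> div int b"
      by (rule floor_divide_real_eq_div) simp
    finally show ?thesis .
  qed
  have "real (badic_digit b x (Suc n)) = real_of_int (\<lfloor>x * real b ^ Suc n\<rfloor> mod int b)"
    using assms unfolding badic_digit_def by simp
  also have "\<dots> = real_of_int (\<lfloor>x * real b ^ Suc n\<rfloor> - int b * \<lfloor>x * real b ^ n\<rfloor>)"
    unfolding fl by (simp add: minus_mult_div_eq_mod)
  finally have "real (badic_digit b x (Suc n))
      = real_of_int \<lfloor>x * real b ^ Suc n\<rfloor> - real b * real_of_int \<lfloor>x * real b ^ n\<rfloor>"
    by simp
  then show ?case using Suc assms by (simp add: field_simps)
qed

lemma badic_expansion_sums:
  assumes "b > 1" "0 \<le> x" "x < 1"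
  shows "(\<lambda>a. real (badic_digit b x (Suc a)) / real b ^ Suc a) sums x"
proof -
  have "(\<lambda>n. real_of_int \<lfloor>x * real b ^ n\<rfloor> / real b ^ n) \<longlonglongrightarrow> x"
  proof (rule tendsto_sandwich)
    show "\<forall>\<^sub>F n in sequentially. x - (1 / real b) ^ n \<le> real_of_int \<lfloor>x * real b ^ n\<rfloor> / real b ^ n"
    proof (rule always_eventually, rule allI)
      fix n
      have "x * real b ^ n - 1 \<le> real_of_int \<lfloor>x * real b ^ n\<rfloor>" by linarith
      then have "(x * real b ^ n - 1) / real b ^ n \<le> real_of_int \<lfloor>x * real b ^ n\<rfloor> / real b ^ n"
        by (rule divide_right_mono) simp
      then show "x - (1 / real b) ^ n \<le> real_of_int \<lfloor>x * real b ^ n\<rfloor> / real b ^ n"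
        using assms by (simp add: diff_divide_distrib power_one_over)
    qed
    show "\<forall>\<^sub>F n in sequentially. real_of_int \<lfloor>x * real b ^ n\<rfloor> / real b ^ n \<le> x"
      using assms by (intro always_eventually allI) (simp add: divide_le_eq)
    have "(\<lambda>n. (1 / real b) ^ n) \<longlonglongrightarrow> 0"
      using assms by (intro LIMSEQ_power_zero) simp
    then show "(\<lambda>n. x - (1 / real b) ^ n) \<longlonglongrightarrow> x"
      using tendsto_diff[OF tendsto_const] by fastforce
  qed simp
  then show ?thesis
    using badic_partial_sum[of b x] assms by (simp add: sums_def)
qed

lemma badic_digit_infinitely_often:
  assumes "b > 1" "0 \<le> x" "x < 1"
  shows "\<exists>\<^sub>\<infinity>a. badic_digit b x a \<noteq> b - 1"
proof (rule ccontr)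
  assume "\<not> ?thesis"
  then obtain n where n: "\<And>a. a > n \<Longrightarrow> badic_digit b x a = b - 1"
    by (auto simp: INFM_nat)
  let ?f = "\<lambda>a. real (badic_digit b x (Suc a)) / real b ^ Suc a"
  have "(\<lambda>a. ?f (a + n)) sums (x - (\<Sum>a<n. ?f a))"
    using badic_expansion_sums[OF assms] by (rule sums_split_initial_segment)
  moreover have "(\<lambda>a. ?f (a + n)) = (\<lambda>a. (real b - 1) / real b ^ Suc n * (1 / real b) ^ a)"
    using assms by (intro ext) (simp add: n power_add power_one_over of_nat_diff field_simps)
  moreover have "(\<lambda>a. (real b - 1) / real b ^ Suc n * (1 / real b) ^ a) sums
      ((real b - 1) / real b ^ Suc n * (1 / (1 - 1 / real b)))"
    using assms by (intro sums_mult geometric_sums) simp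
  moreover have "(real b - 1) / real b ^ Suc n * (1 / (1 - 1 / real b)) = 1 / real b ^ n"
    using assms by (simp add: field_simps)
  ultimately have "x - real_of_int \<lfloor>x * real b ^ n\<rfloor> / real b ^ n = 1 / real b ^ n"
    using badic_partial_sum[of b x n] assms sums_unique2 by fastforce
  then have "x * real b ^ n = real_of_int \<lfloor>x * real b ^ n\<rfloor> + 1"
    using assms by (simp add: field_simps)
  then show False by linarith
qed

text \<open>
  Digitwise addition modulo \<open>b\<close>.  For fixed \<open>x\<close> the value may be \<open>1\<close> (all resulting digits
  equal to \<open>b - 1\<close>) for a null set of \<open>y\<close> only.
\<close>

definition digit_add :: "nat \<Rightarrow> real \<Rightarrow> real \<Rightarrow> real" where
  "digit_add b x y =
     (\<Sum>a. real ((badic_digit b x (Suc a) + badic_digit b y (Suc a)) mod b) / real b ^ Suc a)"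

definition vec_digit_add :: "nat \<Rightarrow> nat \<Rightarrow> (nat \<Rightarrow> real) \<Rightarrow> (nat \<Rightarrow> real) \<Rightarrow> (nat \<Rightarrow> real)" where
  "vec_digit_add b t x y = (\<lambda>j\<in>{1..t}. digit_add b (x j) (y j))"

definition mu1 :: "nat \<Rightarrow> nat \<Rightarrow> nat" where
  "mu1 b l = floorlog b l"

lemma mu1_0: "mu1 b 0 = 0"
  by (simp add: mu1_def floorlog_def)

lemma mu1_bounds: "b > 1 \<Longrightarrow> l \<ge> 1 \<Longrightarrow> b ^ (mu1 b l - 1) \<le> l \<and> l < b ^ mu1 b l"
  unfolding mu1_def by (rule floorlog_bounds) auto


subsection \<open>Polynomial lattice point sets, dual nets and digit interlacing\<close>

definition tr_poly :: "nat \<Rightarrow> nat \<Rightarrow> 'p::prime_card mod_ring poly" where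
  "tr_poly m k = (\<Sum>i<m. Polynomial.monom (of_nat (k div CARD('p) ^ i mod CARD('p))) i)"

definition nat_poly :: "nat \<Rightarrow> 'p::prime_card mod_ring poly" where
  "nat_poly n = tr_poly (floorlog CARD('p) n) n"

text \<open>
  A Laurent series in \<open>x\<^sup>-\<^sup>1\<close> is represented by a formal Laurent series whose indeterminate stands
  for \<open>x\<^sup>-\<^sup>1\<close>; so its coefficient of index \<open>l\<close> is the coefficient of \<open>x\<^sup>-\<^sup>l\<close>, and \<open>x\<close> itself is
  \<open>fls_X_inv\<close>.
\<close>

definition poly_to_fls_inv :: "'a::field poly \<Rightarrow> 'a fls" where
  "poly_to_fls_inv f = (\<Sum>i\<le>degree f. fls_const (Polynomial.coeff f i) * fls_X_inv ^ i)"

definition v_trunc :: "nat \<Rightarrow> 'p::prime_card mod_ring fls \<Rightarrow> real" where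
  "v_trunc m f = (\<Sum>l=1..m. real_of_int (to_int_mod_ring (fls_nth f (int l))) / real CARD('p) ^ l)"

definition poly_lattice_point ::
    "nat \<Rightarrow> nat \<Rightarrow> (nat \<Rightarrow> 'p::prime_card mod_ring poly) \<Rightarrow> 'p mod_ring poly \<Rightarrow> nat \<Rightarrow> (nat \<Rightarrow> real)" where
  "poly_lattice_point m t q p n =
     (\<lambda>j\<in>{1..t}. v_trunc m
        (poly_to_fls_inv (nat_poly n) * poly_to_fls_inv (q j) / poly_to_fls_inv p))"

definition dual_net ::
    "nat \<Rightarrow> nat \<Rightarrow> (nat \<Rightarrow> 'p::prime_card mod_ring poly) \<Rightarrow> 'p mod_ring poly \<Rightarrow> (nat \<Rightarrow> nat) set" where
  "dual_net m t q p =
     {k \<in> {1..t} \<rightarrow>\<^sub>E UNIV. [(\<Sum>j=1..t. tr_poly m (k j) * q j) = 0] (mod p)}"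

definition interlace :: "nat \<Rightarrow> nat \<Rightarrow> (nat \<Rightarrow> real) \<Rightarrow> real" where
  "interlace b d y =
     (\<Sum>a. \<Sum>r=1..d. real (badic_digit b (y r) (Suc a)) / real b ^ (r + a * d))"

definition vec_interlace :: "nat \<Rightarrow> nat \<Rightarrow> nat \<Rightarrow> (nat \<Rightarrow> real) \<Rightarrow> (nat \<Rightarrow> real)" where
  "vec_interlace b d s y = (\<lambda>j\<in>{1..s}. interlace b d (\<lambda>r. y (d * (j - 1) + r)))"


subsection \<open>The weighted Sobolev space\<close>

fun bernoulli_number :: "nat \<Rightarrow> real" where
  "bernoulli_number n =
     (if n = 0 then 1
      else - (\<Sum>k<n. real (Suc n choose k) * bernoulli_number k) / real (Suc n))"

declare bernoulli_number.simps [simp del]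

definition bernoulli_poly :: "nat \<Rightarrow> real \<Rightarrow> real" where
  "bernoulli_poly r x = (\<Sum>k\<le>r. real (r choose k) * bernoulli_number k * x ^ (r - k))"

definition sobolev_kernel ::
    "nat \<Rightarrow> nat \<Rightarrow> (nat set \<Rightarrow> real) \<Rightarrow> (nat \<Rightarrow> real) \<Rightarrow> (nat \<Rightarrow> real) \<Rightarrow> real" where
  "sobolev_kernel s \<alpha> \<gamma> x y =
     (\<Sum>u\<in>Pow {1..s}. \<gamma> u * (\<Prod>j\<in>u.
        (\<Sum>r=1..\<alpha>. bernoulli_poly r (x j) * bernoulli_poly r (y j) / (fact r)\<^sup>2)
        + (-1) ^ (\<alpha> + 1) * bernoulli_poly (2 * \<alpha>) \<bar>x j - y j\<bar> / fact (2 * \<alpha>)))"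

definition half_open_cube :: "nat \<Rightarrow> (nat \<Rightarrow> real) set" where
  "half_open_cube t = {1..t} \<rightarrow>\<^sub>E {0..<1}"

definition cube_measure :: "nat \<Rightarrow> (nat \<Rightarrow> real) measure" where
  "cube_measure t = (\<Pi>\<^sub>M j\<in>{1..t}. restrict_space lborel {0..<1})"

definition ip_norm :: "('f \<Rightarrow> 'f \<Rightarrow> real) \<Rightarrow> 'f \<Rightarrow> real" where
  "ip_norm ip f = sqrt (ip f f)"

text \<open>
  \<open>(H, ip)\<close> is the reproducing kernel Hilbert space of real functions on \<open>X\<close> with kernel \<open>K\<close>.
  Functions on \<open>X\<close> are represented by functions that vanish off \<open>X\<close>.  By the Moore-Aronszajn
  theorem a positive semidefinite \<open>K\<close> has exactly one such space (\<open>ip\<close> being relevant on \<open>H\<close> only).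
\<close>

locale rkhs =
  fixes X :: "'x set" and K :: "'x \<Rightarrow> 'x \<Rightarrow> real"
    and H :: "('x \<Rightarrow> real) set" and ip :: "('x \<Rightarrow> real) \<Rightarrow> ('x \<Rightarrow> real) \<Rightarrow> real"
  assumes vanish_off: "f \<in> H \<Longrightarrow> x \<notin> X \<Longrightarrow> f x = 0"
    and zero_mem: "(\<lambda>x. 0) \<in> H"
    and add_mem: "f \<in> H \<Longrightarrow> g \<in> H \<Longrightarrow> (\<lambda>x. f x + g x) \<in> H"
    and scale_mem: "f \<in> H \<Longrightarrow> (\<lambda>x. c * f x) \<in> H"
    and ip_commute: "f \<in> H \<Longrightarrow> g \<in> H \<Longrightarrow> ip f g = ip g f"
    and ip_add_left: "f \<in> H \<Longrightarrow> g \<in> H \<Longrightarrow> h \<in> H \<Longrightarrow> ip (\<lambda>x. f x + g x) h = ip f h + ip g h"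
    and ip_scale_left: "f \<in> H \<Longrightarrow> g \<in> H \<Longrightarrow> ip (\<lambda>x. c * f x) g = c * ip f g"
    and ip_nonneg: "f \<in> H \<Longrightarrow> 0 \<le> ip f f"
    and ip_definite: "f \<in> H \<Longrightarrow> ip f f = 0 \<Longrightarrow> f = (\<lambda>x. 0)"
    and complete: "(\<And>n. F n \<in> H) \<Longrightarrow>
        (\<And>e. e > 0 \<Longrightarrow> \<exists>M. \<forall>i\<ge>M. \<forall>j\<ge>M. ip_norm ip (\<lambda>x. F i x - F j x) < e) \<Longrightarrow>
        \<exists>f\<in>H. (\<lambda>n::nat. ip_norm ip (\<lambda>x. F n x - f x)) \<longlonglongrightarrow> 0"
    and kernel_mem: "y \<in> X \<Longrightarrow> (\<lambda>x. if x \<in> X then K x y else 0) \<in> H"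
    and reproducing: "f \<in> H \<Longrightarrow> y \<in> X \<Longrightarrow> ip f (\<lambda>x. if x \<in> X then K x y else 0) = f y"


subsection \<open>Integration errors\<close>

text \<open>
  A point set (multiset) of \<open>N\<close> points is given by an enumeration \<open>P\<close>, of which the values at
  \<open>n < N\<close> matter.
\<close>

definition worst_case_error ::
    "nat \<Rightarrow> ((nat \<Rightarrow> real) \<Rightarrow> real) set
      \<Rightarrow> (((nat \<Rightarrow> real) \<Rightarrow> real) \<Rightarrow> ((nat \<Rightarrow> real) \<Rightarrow> real) \<Rightarrow> real)
      \<Rightarrow> nat \<Rightarrow> (nat \<Rightarrow> (nat \<Rightarrow> real)) \<Rightarrow> ennreal" where
  "worst_case_error s H ip N P =
     (SUP f\<in>{f \<in> H. ip_norm ip f \<le> 1}.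
        ennreal \<bar>(LINT x|cube_measure s. f x) - (1 / real N) * (\<Sum>n<N. f (P n))\<bar>)"

definition mean_square_wce ::
    "nat \<Rightarrow> nat \<Rightarrow> ((nat \<Rightarrow> real) \<Rightarrow> real) set
      \<Rightarrow> (((nat \<Rightarrow> real) \<Rightarrow> real) \<Rightarrow> ((nat \<Rightarrow> real) \<Rightarrow> real) \<Rightarrow> real)
      \<Rightarrow> nat \<Rightarrow> (nat \<Rightarrow> (nat \<Rightarrow> real)) \<Rightarrow> ennreal" where
  "mean_square_wce b s H ip N P =
     (\<integral>\<^sup>+ \<sigma>. (worst_case_error s H ip N (\<lambda>n. vec_digit_add b s (P n) \<sigma>))\<^sup>2 \<partial>cube_measure s)"


subsection \<open>Constants of the error bound\<close>

definition C_const :: "nat \<Rightarrow> nat \<Rightarrow> real" where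
  "C_const \<tau> b =
     (if \<tau> = 1 then 1 / (2 * sin (pi / real b))
      else (1 + 1 / real b + 1 / (real b * (real b + 1))) ^ (\<tau> - 2) / (2 * sin (pi / real b)) ^ \<tau>)"

definition C_tilde :: "nat \<Rightarrow> nat \<Rightarrow> real" where
  "C_tilde \<alpha> b =
     2 * (1 + 1 / real b + 1 / (real b * (real b + 1))) ^ (2 * \<alpha> - 2)
       / (2 * sin (pi / real b)) ^ (2 * \<alpha>)"

definition C_prime :: "nat \<Rightarrow> nat \<Rightarrow> nat \<Rightarrow> real" where
  "C_prime \<alpha> b \<nu> = (\<Sum>\<tau>=\<nu>..\<alpha>. (C_const \<tau> b)\<^sup>2 / real b ^ (2 * (\<tau> - \<nu>)))"

definition D_const :: "nat \<Rightarrow> nat \<Rightarrow> real" where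
  "D_const \<alpha> b = Max ((\<lambda>\<nu>. C_prime \<alpha> b \<nu> + C_tilde \<alpha> b / real b ^ (2 * (\<alpha> - \<nu>))) ` {1..\<alpha>})"

definition D_tilde :: "nat \<Rightarrow> nat \<Rightarrow> nat \<Rightarrow> real" where
  "D_tilde \<alpha> b d = real b ^ ((2 * d - 1) * \<alpha>) * D_const \<alpha> b"

definition phi :: "nat \<Rightarrow> nat \<Rightarrow> nat set \<Rightarrow> nat set" where
  "phi d s w = {j \<in> {1..s}. w \<inter> {d * (j - 1) + 1..d * j} \<noteq> {}}"

definition r_weight :: "nat \<Rightarrow> nat \<Rightarrow> nat \<Rightarrow> nat \<Rightarrow> real" where
  "r_weight b \<alpha> d l = (if l = 0 then 1 else 1 / real b ^ (2 * min \<alpha> d * mu1 b l + \<alpha>))"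

definition zero_extend :: "nat \<Rightarrow> nat set \<Rightarrow> (nat \<Rightarrow> nat) \<Rightarrow> (nat \<Rightarrow> nat)" where
  "zero_extend t w l = (\<lambda>j\<in>{1..t}. if j \<in> w then l j else 0)"

end

theory Submission
  imports Defs
begin

text \<open>
  The mean square error over all digital shifts only sees the diagonal Walsh coefficients of the
  kernel: shifting turns \<open>K(x, x')\<close> into \<open>\<Sum>k. K_hat(k, k) * cnj (wal k x) * wal k x'\<close>, and
  averaging this over the pairs of net points keeps only the \<open>k\<close> in the dual net of the interlaced
  points.  In one variable \<open>K_hat(k, k)\<close> is
  \<open>\<Sum>r=1..\<alpha>. \<bar>prim ^ r wal k (0)\<bar>\<^sup>2 + \<integral>\<bar>prim ^ \<alpha> wal k\<bar>\<^sup>2\<close>, where \<open>prim\<close> takes the antiderivative of mean zero.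
  The antiderivative of \<open>wal k\<close> is \<open>b\<^sup>-\<^sup>a\<close> (\<open>a\<close> the number of digits of \<open>k\<close>) times a geometrically
  weighted combination of Walsh functions whose indices arise from \<open>k\<close> by deleting the leading
  digit, keeping \<open>k\<close>, or putting one digit in front.  Iterating this \<open>r\<close> times gains \<open>b\<^sup>-\<^sup>1\<close> to the
  power of the sum of the \<open>r\<close> leading digit positions, which bounds \<open>K_hat(k, k)\<close> by
  \<open>D_const \<alpha> b / b ^ (2 * mu \<alpha> k)\<close>.  Finally \<open>mu \<alpha> k\<close> is bounded below by the numbers of digits of
  the \<open>d\<close> parts into which interlacing splits \<open>k\<close>.
\<close>

subsection \<open>Walsh functions\<close>

text \<open>No infinite Walsh expansion is ever summed. For points with finite expansions, the
  partial sum of length \<open>b ^ n\<close> of the diagonal series is exactly the shift average of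
  the kernel with its values replaced by means over cells of side \<open>1 / b ^ n\<close>; uniform
  continuity of the kernel then gives convergence. The expansion of an antiderivative is cut off
  after \<open>C\<close> prepended positions with a uniform error of order \<open>1 / b ^ C\<close>;
  estimates are therefore stated for bounded linear functionals, and \<open>C\<close> tends to
  infinity while the index is fixed. Integration, too, is not represented by an element of
  \<open>H\<close>: grid averages stand in for it, and Cauchy-Schwarz is applied to finite
  combinations of kernel functions.

  Constants: \<open>2 * sin (pi / b)\<close> is the least distance from 1 to another
  \<open>b\<close>-th root of unity. In \<open>1 + 1 / b + 1 / (b * (b + 1))\<close> the summands
  belong to deleting the leading digit, keeping the index and prepending a digit. The power
  \<open>b ^ ((2 * d - 1) * \<alpha>)\<close> pays for comparing positions of digits in
  \<open>k\<close> with the lengths of its \<open>d\<close> parts, and for the extra exponent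
  \<open>\<alpha>\<close> in each \<open>r_weight\<close>.\<close>

locale radix =
  fixes b :: nat
  assumes b2: "2 \<le> b"
begin

lemma b_pos [simp]: "0 < b" "b \<noteq> 0" "Suc 0 < b" "real b > 1" "real b \<noteq> 1"
  using b2 by simp_all

definition omega :: complex where "omega = cis (2 * pi / real b)"

definition ndigit :: "nat \<Rightarrow> nat \<Rightarrow> nat" where "ndigit k i = k div b ^ i mod b"

lemma norm_omega [simp]: "norm omega = 1"
  by (simp add: omega_def)

lemma omega_power_b [simp]: "omega ^ b = 1"
proof -
  have "real b * (2 * pi / real b) = 2 * pi" by simp
  then show ?thesis by (simp only: omega_def Complex.DeMoivre cis_2pi)
qed

lemma omega_power_mod: "omega ^ (n mod b) = omega ^ n"
proof -
  have "omega ^ n = omega ^ (b * (n div b) + n mod b)" by simp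
  then show ?thesis by (simp only: power_add power_mult omega_power_b power_one mult_1)
qed

lemma omega_power_cong: "m mod b = n mod b \<Longrightarrow> omega ^ m = omega ^ n"
  by (metis omega_power_mod)

lemma omega_power_eq_iff: "omega ^ m = omega ^ n \<longleftrightarrow> m mod b = n mod b"
proof -
  have *: "omega ^ j = exp (2 * of_real pi * \<i> * of_nat j / of_nat b)" for j
    by (simp add: omega_def cis_conv_exp exp_of_nat_mult [symmetric] mult_ac)
  show ?thesis
    unfolding * using complex_root_unity_eq[of b m n] b2 by (simp add: cong_def)
qed

lemma cnj_omega_power: "omega ^ n * cnj (omega ^ n) = 1"
  by (metis complex_norm_square norm_omega norm_power of_real_1 power_one)

lemma root_sum:
  fixes z :: complex
  assumes "z ^ b = 1"
  shows "(\<Sum>e<b. z ^ e) = (if z = 1 then of_nat b else 0)"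
  using assms by (auto simp: geometric_sum)

text \<open>The summand is the \<open>e\<close>-th power of
  \<open>omega ^ k * cnj (omega ^ l)\<close>, a \<open>b\<close>-th root of unity that equals 1
  precisely when the residues agree; otherwise the geometric sum vanishes.\<close>

lemma omega_sum:
  "(\<Sum>e<b. omega ^ (k * e) * cnj (omega ^ (l * e))) = (if k mod b = l mod b then of_nat b else 0)"
proof -
  let ?z = "omega ^ k * cnj (omega ^ l)"
  have "?z ^ b = (omega ^ b) ^ k * cnj ((omega ^ b) ^ l)"
    by (simp only: power_mult_distrib complex_cnj_power power_mult [symmetric] mult.commute)
  then have 1: "?z ^ b = 1" by simp
  have 2: "?z = 1 \<longleftrightarrow> k mod b = l mod b"
  proof
    assume "?z = 1"
    then have "?z * omega ^ l = omega ^ l" by (simp only: mult_1)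
    moreover have "?z * omega ^ l = omega ^ k"
      using cnj_omega_power[of l] by (metis mult.assoc mult.commute mult.right_neutral)
    ultimately show "k mod b = l mod b" using omega_power_eq_iff by metis
  next
    assume "k mod b = l mod b"
    then have "omega ^ k = omega ^ l" by (rule omega_power_cong)
    then show "?z = 1" using cnj_omega_power by simp
  qed
  have "(\<Sum>e<b. omega ^ (k * e) * cnj (omega ^ (l * e))) = (\<Sum>e<b. ?z ^ e)"
    by (simp add: power_mult power_mult_distrib)
  then show ?thesis using root_sum[OF 1] 2 by simp
qed

section \<open>Base \<open>b\<close> digits of natural numbers\<close>

lemma ndigit_less: "ndigit k i < b"
  using b2 by (simp add: ndigit_def)

lemma ndigit_0 [simp]: "ndigit 0 i = 0"
  by (simp add: ndigit_def)

lemma ndigit_ge: "k < b ^ n \<Longrightarrow> n \<le> i \<Longrightarrow> ndigit k i = 0"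
proof -
  assume "k < b ^ n" "n \<le> i"
  moreover from this have "b ^ n \<le> b ^ i" by (intro power_increasing) (simp_all add: Suc_leI)
  ultimately have "k div b ^ i = 0" by (intro div_less) linarith
  then show ?thesis by (simp add: ndigit_def)
qed

lemma less_power: "k < b ^ k"
  using b2 by (metis less_exp less_le_trans power_mono zero_le)

lemma ndigit_ge_self: "k \<le> i \<Longrightarrow> ndigit k i = 0"
  using ndigit_ge less_power by blast

lemma ndigit_add_low: "i < n \<Longrightarrow> ndigit (v * b ^ n + k) i = ndigit k i"
proof -
  assume "i < n"
  then obtain c where c: "n = Suc (i + c)" using less_imp_Suc_add by blast
  have "v * b ^ n + k = k + (v * b ^ c * b) * b ^ i"
    by (simp add: c power_add)
  then have "(v * b ^ n + k) div b ^ i = v * b ^ c * b + k div b ^ i"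
    using b2 by (simp only: div_mult_self1) simp
  then show ?thesis by (simp add: ndigit_def)
qed

lemma ndigit_add_top: "k < b ^ n \<Longrightarrow> v < b \<Longrightarrow> ndigit (v * b ^ n + k) n = v"
  using b2 by (simp add: ndigit_def)

lemma ndigit_mod: "i < n \<Longrightarrow> ndigit (k mod b ^ n) i = ndigit k i"
  by (metis ndigit_add_low div_mult_mod_eq)

lemma sum_lessThan_power_Suc:
  fixes f :: "nat \<Rightarrow> 'a::comm_monoid_add"
  shows "(\<Sum>k<b ^ Suc n. f k) = (\<Sum>v<b. \<Sum>k<b ^ n. f (v * b ^ n + k))"
proof -
  have "(\<Sum>k<b ^ Suc n. f k) = (\<Sum>v<b. sum f {v * b ^ n..<v * b ^ n + b ^ n})"
    by (simp add: sum.nat_group)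
  also have "\<dots> = (\<Sum>v<b. \<Sum>k<b ^ n. f (v * b ^ n + k))"
    by (rule sum.cong[OF refl], subst sum.atLeastLessThan_shift_0) (simp add: atLeast0LessThan comp_def)
  finally show ?thesis .
qed

text \<open>A number below \<open>b ^ n\<close> is a free choice of \<open>n\<close> digits, so a
  sum of digitwise products factorises. The completeness of the Walsh functions and the character
  sum over the lattice points both rest on this.\<close>

lemma sum_ndigit_prod:
  fixes h :: "nat \<Rightarrow> nat \<Rightarrow> 'a::comm_semiring_1"
  shows "(\<Sum>k<b ^ n. \<Prod>i<n. h i (ndigit k i)) = (\<Prod>i<n. \<Sum>v<b. h i v)"
proof (induction n)
  case (Suc n)
  have "(\<Sum>k<b ^ Suc n. \<Prod>i<Suc n. h i (ndigit k i))
      = (\<Sum>v<b. \<Sum>k<b ^ n. (\<Prod>i<n. h i (ndigit k i)) * h n v)"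
    unfolding sum_lessThan_power_Suc
    by (intro sum.cong refl) (simp add: ndigit_add_top ndigit_add_low)
  also have "\<dots> = (\<Sum>k<b ^ n. \<Prod>i<n. h i (ndigit k i)) * (\<Sum>v<b. h n v)"
    by (simp add: sum_distrib_left sum_distrib_right)
  finally show ?case using Suc by simp
qed simp

lemma ndigit_eq_imp_eq:
  assumes "k < b ^ n" "l < b ^ n" "\<And>i. i < n \<Longrightarrow> ndigit k i = ndigit l i"
  shows "k = l"
  using assms
proof (induction n arbitrary: k l)
  case (Suc n)
  have "k mod b ^ n = l mod b ^ n"
  proof (rule Suc.IH)
    show "ndigit (k mod b ^ n) i = ndigit (l mod b ^ n) i" if "i < n" for i
      using Suc.prems(3)[of i] that by (simp only: ndigit_mod less_SucI)
  qed simp_all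
  moreover have "k div b ^ n = l div b ^ n"
  proof -
    have *: "x div b ^ n mod b = x div b ^ n" if "x < b ^ Suc n" for x
      using that by (simp add: less_mult_imp_div_less)
    show ?thesis
      using Suc.prems(3)[of n] by (simp only: ndigit_def * Suc.prems(1,2) lessI)
  qed
  ultimately show ?case by (metis div_mult_mod_eq)
qed simp

section \<open>Digits of reals and Walsh functions\<close>

definition rdigit :: "real \<Rightarrow> nat \<Rightarrow> nat" where "rdigit x a = badic_digit b x a"

lemma rdigit_less: "rdigit x a < b"
  using b2 by (simp add: rdigit_def badic_digit_less)

text \<open>Integer division of the floor at level \<open>n\<close> by a power of \<open>b\<close>
  gives the floor at a coarser level, so the first \<open>n\<close> digits of \<open>x\<close> are
  those of a single integer, read from the top.\<close>

lemma floor_power_ndigit: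
  assumes "j < n"
  shows "badic_digit b x (Suc j) = nat (\<lfloor>x * real b ^ n\<rfloor> div int b ^ (n - 1 - j) mod int b)"
proof -
  have "\<lfloor>x * real b ^ Suc j\<rfloor> = \<lfloor>x * real b ^ n / real_of_int (int b ^ (n - 1 - j))\<rfloor>"
  proof -
    have "real b ^ n = real b ^ Suc j * real b ^ (n - 1 - j)"
      using assms by (simp flip: power_add power_Suc)
    then show ?thesis using b2 by simp
  qed
  also have "\<dots> = \<lfloor>x * real b ^ n\<rfloor> div int b ^ (n - 1 - j)"
    by (rule floor_divide_real_eq_div) simp
  finally show ?thesis by (simp add: badic_digit_def)
qed

lemma rdigit_of_floor:
  assumes "j < n" "\<lfloor>x * real b ^ n\<rfloor> = int c"
  shows "rdigit x (Suc j) = ndigit c (n - 1 - j)"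
  unfolding rdigit_def floor_power_ndigit[OF assms(1)] assms(2) ndigit_def
  by (simp only: of_nat_power [symmetric] of_nat_div [symmetric] of_nat_mod [symmetric] nat_int)

lemma rdigit_grid: "j < n \<Longrightarrow> rdigit (real c / real b ^ n) (Suc j) = ndigit c (n - 1 - j)"
  using b2 by (intro rdigit_of_floor) simp_all

text \<open>Walsh functions are integrated over the closed interval. At its right end the digit
  formula yields zeros only, hence the value 1, the same as at 0.\<close>

lemma rdigit_1 [simp]: "rdigit 1 (Suc a) = 0"
proof -
  have "\<lfloor>1 * real b ^ Suc a\<rfloor> = int b * int b ^ a"
    by (metis floor_of_nat mult_1 of_nat_power power_Suc)
  then show ?thesis by (simp only: rdigit_def badic_digit_def mod_mult_self1_is_0 nat_0)
qed

text \<open>Digits of the index count from 0, those of the argument from 1, whence the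
  \<open>Suc\<close>. The range \<open>j < k\<close> reaches all nonzero digits of \<open>k\<close>
  because \<open>k < b ^ k\<close>; \<open>wal_eq\<close> replaces it by any sufficient
  length.\<close>

definition wal :: "nat \<Rightarrow> real \<Rightarrow> complex" where
  "wal k x = omega ^ (\<Sum>j<k. ndigit k j * rdigit x (Suc j))"

lemma wal_eq:
  assumes "k < b ^ n"
  shows "wal k x = omega ^ (\<Sum>j<n. ndigit k j * rdigit x (Suc j))"
proof -
  have "(\<Sum>j<k. ndigit k j * rdigit x (Suc j)) = (\<Sum>j<max k n. ndigit k j * rdigit x (Suc j))"
    by (rule sum.mono_neutral_left) (auto simp: ndigit_ge_self)
  also have "\<dots> = (\<Sum>j<n. ndigit k j * rdigit x (Suc j))"
    by (rule sum.mono_neutral_right) (auto simp: ndigit_ge[OF assms])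
  finally show ?thesis by (simp add: wal_def)
qed

lemma wal_eq_prod:
  assumes "k < b ^ n"
  shows "wal k x = (\<Prod>j<n. omega ^ (ndigit k j * rdigit x (Suc j)))"
  by (simp add: wal_eq[OF assms] power_sum)

lemma wal_0 [simp]: "wal 0 x = 1"
  by (simp add: wal_def)

lemma norm_wal [simp]: "norm (wal k x) = 1"
  by (simp add: wal_def norm_power)

lemma wal_cnj: "wal k x * cnj (wal k x) = 1"
  by (simp add: wal_def cnj_omega_power del: complex_cnj_power)

lemma wal_top:
  assumes "k < b ^ n" "v < b"
  shows "wal (v * b ^ n + k) x = wal k x * omega ^ (v * rdigit x (Suc n))"
proof -
  have "(Suc v) * b ^ n \<le> b * b ^ n"
    using assms(2) by (intro mult_right_mono) simp_all
  then have "v * b ^ n + k < b ^ Suc n" using assms by simp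
  then have "wal (v * b ^ n + k) x = omega ^ (\<Sum>j<Suc n. ndigit (v * b ^ n + k) j * rdigit x (Suc j))"
    by (rule wal_eq)
  also have "\<dots> = omega ^ ((\<Sum>j<n. ndigit k j * rdigit x (Suc j)) + v * rdigit x (Suc n))"
    using assms by (simp add: ndigit_add_top ndigit_add_low)
  finally show ?thesis by (simp add: wal_eq[OF assms(1)] power_add)
qed

lemma wal_cell:
  assumes "k < b ^ n" "\<lfloor>x * real b ^ n\<rfloor> = int c"
  shows "wal k x = wal k (real c / real b ^ n)"
  unfolding wal_eq[OF assms(1)]
  by (intro arg_cong[where f = "\<lambda>i. omega ^ i"] sum.cong refl)
     (simp add: rdigit_of_floor[OF _ assms(2)] rdigit_grid)

lemma wal_1 [simp]: "wal k 1 = 1"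
  by (simp add: wal_def)

text \<open>The sum runs over the index, not over the points. Digit \<open>i\<close> of the index
  meets digit \<open>i + 1\<close> of the grid point, which is digit \<open>n - 1 - i\<close> of
  \<open>c\<close>. Each digit contributes one sum of roots of unity, and
  \<open>ndigit_eq_imp_eq\<close> finds a vanishing factor if \<open>c\<close> and \<open>c'\<close>
  differ.\<close>

lemma wal_complete:
  assumes "c < b ^ n" "c' < b ^ n"
  shows "(\<Sum>k<b ^ n. wal k (real c / real b ^ n) * cnj (wal k (real c' / real b ^ n)))
    = (if c = c' then of_nat (b ^ n) else 0)"
proof -
  let ?h = "\<lambda>i e. omega ^ (ndigit c (n - 1 - i) * e) * cnj (omega ^ (ndigit c' (n - 1 - i) * e))"
  have "(\<Sum>k<b ^ n. wal k (real c / real b ^ n) * cnj (wal k (real c' / real b ^ n)))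
      = (\<Sum>k<b ^ n. \<Prod>i<n. ?h i (ndigit k i))"
    by (intro sum.cong refl) (simp add: wal_eq_prod rdigit_grid prod.distrib mult.commute)
  also have "\<dots> = (\<Prod>i<n. \<Sum>e<b. ?h i e)" by (rule sum_ndigit_prod)
  also have "\<dots> = (\<Prod>i<n. if ndigit c (n - 1 - i) = ndigit c' (n - 1 - i) then of_nat b else 0)"
    using ndigit_less by (intro prod.cong refl) (subst omega_sum, simp)
  also have "\<dots> = (\<Prod>i<n. if ndigit c i = ndigit c' i then of_nat b else 0)"
    by (rule prod.reindex_bij_witness[where i = "\<lambda>i. n - 1 - i" and j = "\<lambda>i. n - 1 - i"]) auto
  also have "\<dots> = (if c = c' then of_nat (b ^ n) else 0)"
  proof (cases "c = c'")
    case False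
    then obtain i where "i < n" "ndigit c i \<noteq> ndigit c' i" using ndigit_eq_imp_eq assms by blast
    then show ?thesis using False by (auto simp: prod_zero_iff)
  qed simp
  finally show ?thesis .
qed

section \<open>Reals given by digit sequences, and digitwise addition\<close>

lemma digit_sum_summable:
  assumes "\<And>a. t a < b"
  shows "summable (\<lambda>a. real (t a) / real b ^ Suc a)"
proof (rule summable_comparison_test)
  show "summable (\<lambda>a. (1 / real b) ^ a)" using b2 by (intro summable_geometric) simp
  show "\<exists>N. \<forall>n\<ge>N. norm (real (t n) / real b ^ Suc n) \<le> (1 / real b) ^ n"
    using assms b2 by (auto simp: field_simps power_one_over intro: less_imp_le)
qed

text \<open>Comparison with the constant digit sequence \<open>b - 1\<close>, whose sum is 1; the
  position \<open>c\<close> makes the comparison strict.\<close>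

lemma digit_sum_bounds:
  assumes "\<And>a. t a < b" "t c \<noteq> b - 1"
  shows "0 \<le> (\<Sum>a. real (t a) / real b ^ Suc a)" "(\<Sum>a. real (t a) / real b ^ Suc a) < 1"
proof -
  let ?f = "\<lambda>a. real (t a) / real b ^ Suc a" and ?g = "\<lambda>a. real (b - 1) / real b ^ Suc a"
  have f: "summable ?f" by (rule digit_sum_summable) fact
  show "0 \<le> suminf ?f" using f by (rule suminf_nonneg) simp
  have "(\<lambda>a. (real b - 1) / real b * (1 / real b) ^ a) sums ((real b - 1) / real b * (1 / (1 - 1 / real b)))"
    using b2 by (intro sums_mult geometric_sums) simp
  moreover have "(real b - 1) / real b * (1 / (1 - 1 / real b)) = 1"
    using b2 by (simp add: field_simps)
  moreover have "(\<lambda>a. (real b - 1) / real b * (1 / real b) ^ a) = ?g"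
    using b2 by (intro ext) (simp add: field_simps power_one_over of_nat_diff)
  ultimately have g: "?g sums 1" by simp
  have "0 < (\<Sum>a. ?g a - ?f a)"
  proof (rule suminf_pos2)
    show "summable (\<lambda>a. ?g a - ?f a)" using f g by (intro summable_diff) (auto simp: sums_iff)
    show "0 \<le> ?g n - ?f n" for n
      using assms(1)[of n] b2 by (simp add: divide_right_mono)
    have "t c < b - 1" using assms(1)[of c] assms(2) by simp
    then show "0 < ?g c - ?f c"
      using b2 by (simp add: divide_strict_right_mono)
  qed
  also have "\<dots> = 1 - suminf ?f"
    using f g by (simp add: suminf_diff[symmetric] sums_iff)
  finally show "suminf ?f < 1" by simp
qed

text \<open>A tail consisting of digits \<open>b - 1\<close> would sum to 1 and cause a carry.
  Excluding it keeps each scaled tail \<open>?z\<close> below 1, so the floor at level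
  \<open>n\<close> is the integer \<open>c n\<close> formed by the first \<open>n\<close>
  digits.\<close>

lemma digit_sum_rdigit:
  assumes t: "\<And>a. t a < b" and inf: "\<And>n. \<exists>c\<ge>n. t c \<noteq> b - 1"
  shows "rdigit (\<Sum>a. real (t a) / real b ^ Suc a) (Suc n) = t n"
proof -
  let ?f = "\<lambda>a. real (t a) / real b ^ Suc a"
  let ?y = "suminf ?f"
  define c where "c n = (\<Sum>a<n. t a * b ^ (n - Suc a))" for n
  have c_Suc: "c (Suc n) = b * c n + t n" for n
  proof -
    have "(\<Sum>a<n. t a * b ^ (Suc n - Suc a)) = (\<Sum>a<n. b * (t a * b ^ (n - Suc a)))"
    proof (intro sum.cong refl)
      fix a assume "a \<in> {..<n}"
      then have "Suc n - Suc a = Suc (n - Suc a)" by auto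
      then show "t a * b ^ (Suc n - Suc a) = b * (t a * b ^ (n - Suc a))"
        by (simp only: power_Suc mult_ac)
    qed
    then show ?thesis by (simp add: c_def sum_distrib_left)
  qed
  have fl: "\<lfloor>?y * real b ^ n\<rfloor> = int (c n)" for n
  proof -
    let ?z = "\<Sum>a. real (t (a + n)) / real b ^ Suc a"
    obtain d where "d \<ge> n" "t d \<noteq> b - 1" using inf by blast
    then have z: "0 \<le> ?z" "?z < 1"
      using digit_sum_bounds[of "\<lambda>a. t (a + n)" "d - n"] t by simp_all
    have s: "summable ?f" by (rule digit_sum_summable) fact
    have "?y = (\<Sum>a. ?f (a + n)) + (\<Sum>a<n. ?f a)"
      by (rule suminf_split_initial_segment[OF s])
    also have "(\<Sum>a. ?f (a + n)) = ?z / real b ^ n"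
      by (subst suminf_divide[symmetric])
         (use digit_sum_summable[of "\<lambda>a. t (a + n)"] t in \<open>simp_all add: power_add mult_ac\<close>)
    also have "(\<Sum>a<n. ?f a) = real (c n) / real b ^ n"
      unfolding c_def of_nat_sum sum_divide_distrib
    proof (intro sum.cong refl)
      fix a assume "a \<in> {..<n}"
      then have "real b ^ n = real b ^ Suc a * real b ^ (n - Suc a)" by (simp flip: power_add power_Suc)
      then show "?f a = real (t a * b ^ (n - Suc a)) / real b ^ n" using b2 by simp
    qed
    finally have "?y * real b ^ n = ?z + real (c n)" using b2 by (simp add: field_simps)
    then show ?thesis using z by linarith
  qed
  show ?thesis
    unfolding rdigit_def badic_digit_def fl c_Suc using t[of n] by simp
qed

lemma rdigit_infinitely_often:
  assumes "0 \<le> x" "x < 1"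
  shows "\<exists>c\<ge>n. rdigit x (Suc c) \<noteq> b - 1"
proof -
  have "\<exists>\<^sub>\<infinity>a. badic_digit b x a \<noteq> b - 1"
    using badic_digit_infinitely_often assms b2 by simp
  then obtain a where "a > n" "badic_digit b x a \<noteq> b - 1" by (auto simp: INFM_nat)
  then show ?thesis by (intro exI[of _ "a - 1"]) (auto simp: rdigit_def)
qed

text \<open>Beyond \<open>L\<close> the digits of the sum are those of \<open>y\<close>, infinitely
  many of which differ from \<open>b - 1\<close>; hence the digitwise sums form an admissible
  expansion and can be read off again.\<close>

lemma digit_add_facts:
  assumes x: "\<And>a. a \<ge> L \<Longrightarrow> rdigit x (Suc a) = 0" and y: "0 \<le> y" "y < 1"
  shows "0 \<le> digit_add b x y" "digit_add b x y < 1"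
    "rdigit (digit_add b x y) (Suc n) = (rdigit x (Suc n) + rdigit y (Suc n)) mod b"
proof -
  let ?t = "\<lambda>a. (rdigit x (Suc a) + rdigit y (Suc a)) mod b"
  have eq: "digit_add b x y = (\<Sum>a. real (?t a) / real b ^ Suc a)"
    by (simp add: digit_add_def rdigit_def)
  have t: "?t a < b" for a using b2 by simp
  have inf: "\<exists>c\<ge>n. ?t c \<noteq> b - 1" for n
  proof -
    obtain c where "c \<ge> max n L" "rdigit y (Suc c) \<noteq> b - 1"
      using rdigit_infinitely_often[OF y] by blast
    then show ?thesis using x[of c] rdigit_less[of y "Suc c"] by (intro exI[of _ c]) simp
  qed
  obtain c where c: "?t c \<noteq> b - 1" using inf by blast
  show "0 \<le> digit_add b x y" "digit_add b x y < 1"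
    unfolding eq using digit_sum_bounds[where t = ?t, OF t c] by blast+
  show "rdigit (digit_add b x y) (Suc n) = ?t n"
    unfolding eq by (rule digit_sum_rdigit) (use t inf in auto)
qed

lemma wal_digit_add:
  assumes x: "\<And>a. a \<ge> L \<Longrightarrow> rdigit x (Suc a) = 0" and y: "0 \<le> y" "y < 1"
  shows "wal k (digit_add b x y) = wal k x * wal k y"
proof -
  have *: "omega ^ (k * (n mod b)) = omega ^ (k * n)" for k n
    by (rule omega_power_cong) (rule mod_mult_right_eq)
  have "wal k (digit_add b x y) = (\<Prod>j<k. omega ^ (ndigit k j * rdigit (digit_add b x y) (Suc j)))"
    by (simp add: wal_def power_sum)
  also have "\<dots> = (\<Prod>j<k. omega ^ (ndigit k j * (rdigit x (Suc j) + rdigit y (Suc j))))"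
    by (intro prod.cong refl) (simp only: digit_add_facts(3)[OF x y] *)
  also have "\<dots> = wal k x * wal k y"
    by (simp add: wal_def power_sum power_add distrib_left prod.distrib)
  finally show ?thesis .
qed

end

subsection \<open>Bernoulli polynomials and antiderivatives of mean zero\<close>

text \<open>The factor \<open>1 / fact r\<close> makes each function the derivative of the next, so
  repeated integration by parts produces no numerical factors.\<close>

definition scaled_bernoulli :: "nat \<Rightarrow> real \<Rightarrow> real" where "scaled_bernoulli r x = bernoulli_poly r x / fact r"

lemma scaled_bernoulli_0 [simp]: "scaled_bernoulli 0 x = 1"
  by (simp add: scaled_bernoulli_def bernoulli_poly_def bernoulli_number.simps)

lemma scaled_bernoulli_1: "scaled_bernoulli (Suc 0) x = x - 1 / 2"
  by (simp add: scaled_bernoulli_def bernoulli_poly_def bernoulli_number.simps)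

lemma scaled_bernoulli_deriv: "(scaled_bernoulli (Suc r) has_real_derivative scaled_bernoulli r x) (at x within S)"
proof -
  have "(bernoulli_poly (Suc r) has_real_derivative real (Suc r) * bernoulli_poly r x) (at x within S)"
  proof -
    have "((\<lambda>x. \<Sum>k\<le>Suc r. real (Suc r choose k) * bernoulli_number k * x ^ (Suc r - k))
      has_real_derivative (\<Sum>k\<le>Suc r. real (Suc r choose k) * bernoulli_number k
        * (real (Suc r - k) * x ^ (Suc r - k - 1)))) (at x within S)"
      by (auto intro!: derivative_eq_intros sum.cong)
    moreover have "(\<Sum>k\<le>Suc r. real (Suc r choose k) * bernoulli_number k
        * (real (Suc r - k) * x ^ (Suc r - k - 1))) = real (Suc r) * bernoulli_poly r x"
      unfolding bernoulli_poly_def sum_distrib_left sum.atMost_Suc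
    proof -
      have "real (Suc r choose k) * bernoulli_number k * (real (Suc r - k) * x ^ (Suc r - k - 1))
        = real (Suc r) * (real (r choose k) * bernoulli_number k * x ^ (r - k))" if "k \<le> r" for k
      proof -
        have "(Suc r - k) * (Suc r choose k) = Suc r * (r choose k)"
          using binomial_absorb_comp[of "Suc r" k] by simp
        then have "real (Suc r choose k) * real (Suc r - k) = real (Suc r) * real (r choose k)"
          by (metis mult.commute of_nat_mult)
        then show ?thesis by (simp add: mult_ac)
      qed
      then have S: "(\<Sum>k\<le>r. real (Suc r choose k) * bernoulli_number k * (real (Suc r - k) * x ^ (Suc r - k - 1)))
        = (\<Sum>k\<le>r. real (Suc r) * (real (r choose k) * bernoulli_number k * x ^ (r - k)))"
        by (intro sum.cong[OF refl]) (simp only: atMost_iff)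
      show "(\<Sum>k\<le>r. real (Suc r choose k) * bernoulli_number k * (real (Suc r - k) * x ^ (Suc r - k - 1)))
        + real (Suc r choose Suc r) * bernoulli_number (Suc r) *
          (real (Suc r - Suc r) * x ^ (Suc r - Suc r - 1))
        = (\<Sum>n\<le>r. real (Suc r) * (real (r choose n) * bernoulli_number n * x ^ (r - n)))"
        unfolding S by simp
    qed
    ultimately show ?thesis by (simp only: bernoulli_poly_def[abs_def])
  qed
  then have "((\<lambda>x. bernoulli_poly (Suc r) x / fact (Suc r)) has_real_derivative
      real (Suc r) * bernoulli_poly r x / fact (Suc r)) (at x within S)"
    by (rule DERIV_cdivide)
  then show ?thesis by (simp add: scaled_bernoulli_def[abs_def] fact_Suc del: of_nat_Suc)
qed

lemma scaled_bernoulli_continuous [continuous_intros]: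
  "continuous_on S g \<Longrightarrow> continuous_on S (\<lambda>x. scaled_bernoulli r (g x))"
proof -
  have "continuous_on UNIV (scaled_bernoulli r)"
  proof (cases r)
    case 0
    then have "scaled_bernoulli r = (\<lambda>x. 1)" by (simp add: fun_eq_iff)
    then show ?thesis by simp
  next
    case (Suc r')
    then show ?thesis using scaled_bernoulli_deriv DERIV_continuous_on by blast
  qed
  then show "continuous_on S g \<Longrightarrow> continuous_on S (\<lambda>x. scaled_bernoulli r (g x))"
    by (rule continuous_on_compose2) simp_all
qed

text \<open>The recursion that defines the Bernoulli numbers is exactly the vanishing of the
  difference between the values at 1 and at 0, for every degree from 2 on.\<close>

lemma scaled_bernoulli_periodic: "scaled_bernoulli (Suc (Suc r)) 1 = scaled_bernoulli (Suc (Suc r)) 0"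
proof -
  let ?n = "Suc r"
  have "bernoulli_number ?n = - (\<Sum>k<?n. real (Suc ?n choose k) * bernoulli_number k) / real (Suc ?n)"
    by (subst bernoulli_number.simps) simp
  then have "real (Suc ?n) * bernoulli_number ?n = - (\<Sum>k<?n. real (Suc ?n choose k) * bernoulli_number k)"
    by simp
  moreover have "real (Suc ?n choose ?n) = real (Suc ?n)"
    using binomial_Suc_n[of ?n] by (simp only:)
  ultimately have *: "(\<Sum>k<Suc ?n. real (Suc ?n choose k) * bernoulli_number k) = 0"
    by (simp only: sum.lessThan_Suc)
  have p1: "bernoulli_poly (Suc ?n) 1 = (\<Sum>k<Suc ?n. real (Suc ?n choose k) * bernoulli_number k)
      + bernoulli_number (Suc ?n)"
    unfolding bernoulli_poly_def lessThan_Suc_atMost[symmetric] sum.lessThan_Suc[of _ "Suc ?n"]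
    by (simp only: power_one mult_1_right binomial_n_n of_nat_1 mult_1)
  have "bernoulli_poly (Suc ?n) 0 = (\<Sum>k\<le>Suc ?n. if k = Suc ?n then bernoulli_number k else 0)"
    unfolding bernoulli_poly_def by (intro sum.cong refl) (auto simp: power_0_left)
  also have "\<dots> = bernoulli_number (Suc ?n)"
    by (subst sum.delta) simp_all
  finally show ?thesis by (simp only: p1 * scaled_bernoulli_def add_0)
qed

text \<open>By induction both sides have the same derivative, so their difference \<open>?D\<close>
  is constant. Its antiderivative is built from the periodic function of the next degree, which
  forces the constant to be 0.\<close>

lemma scaled_bernoulli_reflect: "scaled_bernoulli r (1 - x) = (- 1) ^ r * scaled_bernoulli r x"
proof (induction r arbitrary: x)
  case (Suc r)
  let ?D = "\<lambda>x. scaled_bernoulli (Suc r) (1 - x) - (- 1) ^ Suc r * scaled_bernoulli (Suc r) x"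
  have "(?D has_real_derivative 0) (at x)" for x
  proof -
    have "(?D has_real_derivative (scaled_bernoulli r (1 - x) * (0 - 1) - (- 1) ^ Suc r * scaled_bernoulli r x)) (at x)"
      by (intro DERIV_diff DERIV_chain2[OF scaled_bernoulli_deriv] DERIV_cmult scaled_bernoulli_deriv DERIV_const DERIV_ident)
    then show ?thesis by (simp add: Suc)
  qed
  note d = this
  have c: "?D x = ?D y" for x y by (rule DERIV_isconst_all) (use d in blast)
  let ?E = "\<lambda>x. - scaled_bernoulli (Suc (Suc r)) (1 - x) - (- 1) ^ Suc r * scaled_bernoulli (Suc (Suc r)) x - ?D 0 * x"
  have "(?E has_real_derivative 0) (at x)" for x
  proof -
    have "(?E has_real_derivative (- (scaled_bernoulli (Suc r) (1 - x) * (0 - 1)) - (- 1) ^ Suc r * scaled_bernoulli (Suc r) x - ?D 0 * 1)) (at x)"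
      by (intro DERIV_diff DERIV_minus DERIV_chain2[OF scaled_bernoulli_deriv] DERIV_cmult scaled_bernoulli_deriv DERIV_const DERIV_ident)
    then show ?thesis using c[of x 0] by simp
  qed
  note d = this
  have "?E 1 = ?E 0" by (rule DERIV_isconst_all) (use d in blast)
  then have "?D 0 = 0" by (simp add: scaled_bernoulli_periodic)
  then have "?D x = 0" using c[of x 0] by (simp only:)
  then show ?case by (simp only: right_minus_eq)
qed simp

section \<open>Antiderivatives of mean zero and Bernoulli integrals\<close>

definition mean :: "(real \<Rightarrow> complex) \<Rightarrow> complex" where "mean f = integral {0..1} f"

text \<open>The term \<open>of_real t * mean f\<close> makes the result periodic for every
  integrable \<open>f\<close>, not only for those of mean zero. So \<open>prim\<close> is linear on
  all of them, sends constants to 0, and its boundary terms cancel against periodic factors.\<close>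

definition prim :: "(real \<Rightarrow> complex) \<Rightarrow> real \<Rightarrow> complex" where
  "prim f = (\<lambda>t. integral {0..t} f - of_real t * mean f - mean (\<lambda>u. integral {0..u} f - of_real u * mean f))"

text \<open>A class that contains the Walsh functions and is stable under \<open>prim\<close>;
  continuity off a finite set is what the fundamental theorem of calculus asks for.\<close>

definition pw_continuous :: "(real \<Rightarrow> complex) \<Rightarrow> bool" where
  "pw_continuous f \<longleftrightarrow> f integrable_on {0..1} \<and> (\<exists>S. finite S \<and> (\<forall>x\<in>{0<..<1} - S. isCont f x))"

lemma pw_continuousI: "continuous_on {0..1} f \<Longrightarrow> pw_continuous f"
  unfolding pw_continuous_def using integrable_continuous_interval[of 0 1 f]
  by (intro conjI exI[of _ "{}"]) (auto simp: continuous_on_interior)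

lemma pw_continuous_integrable: "pw_continuous f \<Longrightarrow> f integrable_on {0..1}"
  by (simp add: pw_continuous_def)

lemma prim_inner_cont:
  assumes "f integrable_on {0..1}"
  shows "continuous_on {0..1} (\<lambda>u. integral {0..u} f - of_real u * mean f)"
  by (intro continuous_intros indefinite_integral_continuous_1 assms)

lemma prim_cont: "f integrable_on {0..1} \<Longrightarrow> continuous_on {0..1} (prim f)"
  unfolding prim_def by (intro continuous_on_diff[OF prim_inner_cont] continuous_on_const)

lemma prim_pw_continuous: "pw_continuous f \<Longrightarrow> pw_continuous (prim f)"
  by (rule pw_continuousI[OF prim_cont[OF pw_continuous_integrable]])

lemma mean_cong: "(\<And>x. x \<in> {0..1} \<Longrightarrow> f x = g x) \<Longrightarrow> mean f = mean g"
  unfolding mean_def by (rule integral_cong)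

lemma mean_linear:
  assumes "f integrable_on {0..1}" "g integrable_on {0..1}"
  shows "mean (\<lambda>x. c * f x + g x) = c * mean f + mean g"
  unfolding mean_def by (subst integral_add) (auto intro: integrable_on_mult_right assms)

lemma mean_const [simp]: "mean (\<lambda>x. c) = c"
  by (simp add: mean_def)

lemma mean_prim: "f integrable_on {0..1} \<Longrightarrow> mean (prim f) = 0"
proof -
  assume f: "f integrable_on {0..1}"
  let ?F = "\<lambda>u. integral {0..u} f - of_real u * mean f"
  have "mean (prim f) = mean (\<lambda>t. 1 * ?F t + (- mean ?F))"
    by (rule mean_cong) (simp add: prim_def)
  also have "\<dots> = 1 * mean ?F + mean (\<lambda>t. - mean ?F)"
    by (rule mean_linear) (auto intro!: integrable_continuous_interval prim_inner_cont f)
  finally show ?thesis by simp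
qed

lemma prim_end: "prim f 1 = prim f 0"
  by (simp add: prim_def mean_def)

lemma prim_deriv:
  assumes "pw_continuous f"
  shows "\<exists>S. finite S \<and> (\<forall>x\<in>{0<..<1} - S. (prim f has_vector_derivative f x - mean f) (at x))"
proof -
  obtain S where S: "finite S" "\<And>x. x \<in> {0<..<1} - S \<Longrightarrow> isCont f x"
    using assms by (auto simp: pw_continuous_def)
  have "(prim f has_vector_derivative f x - mean f) (at x)" if x: "x \<in> {0<..<1} - S" for x
  proof -
    have "((\<lambda>u. integral {0..u} f) has_vector_derivative f x) (at x within {0..1} - S)"
      using x S assms by (intro integral_has_vector_derivative_continuous_at)
        (auto simp: pw_continuous_def continuous_at_imp_continuous_at_within)
    then have "((\<lambda>u. integral {0..u} f) has_vector_derivative f x) (at x within {0<..<1} - S)"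
      by (rule has_vector_derivative_within_subset) auto
    moreover have "open ({0<..<1::real} - S)" using S by (simp add: open_Diff finite_imp_closed)
    ultimately have 1: "((\<lambda>u. integral {0..u} f) has_vector_derivative f x) (at x)"
      using x by (metis at_within_open)
    have 2: "((\<lambda>u. of_real u * mean f) has_vector_derivative mean f) (at x)"
      by (auto intro!: derivative_eq_intros)
    show ?thesis
      unfolding prim_def
      using has_vector_derivative_diff[OF has_vector_derivative_diff[OF 1 2] has_vector_derivative_const]
      by simp
  qed
  then show ?thesis using S by blast
qed

lemma prim_linear:
  assumes f: "f integrable_on {0..1}" and g: "g integrable_on {0..1}" and t: "t \<in> {0..1}"
  shows "prim (\<lambda>x. c * f x + g x) t = c * prim f t + prim g t"
proof -
  have i: "integral {0..u} (\<lambda>x. c * f x + g x) = c * integral {0..u} f + integral {0..u} g"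
    if "u \<in> {0..1}" for u
  proof -
    have "f integrable_on {0..u}" "g integrable_on {0..u}"
      using f g that by (auto intro: integrable_on_subinterval)
    then show ?thesis by (subst integral_add) (auto intro: integrable_on_mult_right)
  qed
  have M: "mean (\<lambda>x. c * f x + g x) = c * mean f + mean g" using i[of 1] by (simp add: mean_def)
  let ?F = "\<lambda>f u. integral {0..u} f - of_real u * mean f"
  have "mean (?F (\<lambda>x. c * f x + g x)) = mean (\<lambda>u. c * ?F f u + ?F g u)"
    unfolding M by (rule mean_cong, simp only: i) (simp add: algebra_simps)
  also have "\<dots> = c * mean (?F f) + mean (?F g)"
    by (intro mean_linear integrable_continuous_interval prim_inner_cont f g)
  finally have fin: "mean (?F (\<lambda>x. c * f x + g x)) = c * mean (?F f) + mean (?F g)" .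
  show ?thesis
    unfolding prim_def unfolding fin unfolding i[OF t] M by (simp add: algebra_simps)
qed

lemma integral_bound01:
  fixes f :: "real \<Rightarrow> complex"
  assumes "f integrable_on {0..1}" "\<And>x. x \<in> {0..1} \<Longrightarrow> norm (f x) \<le> B" "u \<in> {0..1}"
  shows "norm (integral {0..u} f) \<le> B"
proof -
  have "norm (f 0) \<le> B" using assms(2) by simp
  then have "0 \<le> B" by (rule order_trans[OF norm_ge_zero])
  have "norm (integral {0..u} f) \<le> integral {0..u} (\<lambda>x. B)"
  proof (rule integral_norm_bound_integral)
    show "f integrable_on {0..u}" using assms(1,3) by (auto intro: integrable_on_subinterval)
  qed (use assms in auto)
  also have "\<dots> = B * u" using assms(3) by simp
  also have "\<dots> \<le> B * 1" using assms(3) \<open>0 \<le> B\<close> by (intro mult_left_mono) auto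
  finally show ?thesis by simp
qed

lemma mean_bound:
  assumes "f integrable_on {0..1}" "\<And>x. x \<in> {0..1} \<Longrightarrow> norm (f x) \<le> B"
  shows "norm (mean f) \<le> B"
  unfolding mean_def using integral_bound01[OF assms, of 1] by simp

text \<open>The constant is \<open>2 * 2\<close>: subtracting \<open>of_real u * mean f\<close>
  doubles the bound, and subtracting the mean of the result doubles it again.\<close>

lemma prim_bound:
  assumes f: "f integrable_on {0..1}" "\<And>x. x \<in> {0..1} \<Longrightarrow> norm (f x) \<le> B" and t: "t \<in> {0..1}"
  shows "norm (prim f t) \<le> 4 * B"
proof -
  have "norm (f 0) \<le> B" using f(2) by simp
  then have "0 \<le> B" by (rule order_trans[OF norm_ge_zero])
  have *: "norm (integral {0..u} f - of_real u * mean f) \<le> 2 * B" if u: "u \<in> {0..1}" for u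
  proof -
    have "norm (of_real u * mean f) \<le> 1 * B"
      unfolding norm_mult using u mean_bound[OF f] \<open>0 \<le> B\<close> by (intro mult_mono) auto
    then show ?thesis
      using integral_bound01[OF f u] norm_triangle_ineq4[of "integral {0..u} f" "of_real u * mean f"] by linarith
  qed
  have "norm (mean (\<lambda>u. integral {0..u} f - of_real u * mean f)) \<le> 2 * B"
    by (rule mean_bound[OF integrable_continuous_interval[OF prim_inner_cont[OF f(1)]] *])
  then show ?thesis
    using *[OF t] norm_triangle_ineq4[of "integral {0..t} f - of_real t * mean f"
        "mean (\<lambda>u. integral {0..u} f - of_real u * mean f)"]
    by (simp add: prim_def)
qed

lemma prim_const: "prim (\<lambda>x. c) t = 0" if "t \<in> {0..1}"
proof -
  have i: "integral {0..u} (\<lambda>x. c) - of_real u * mean (\<lambda>x. c) = 0" if "u \<in> {0..1}" for u :: real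
    using that by (simp add: scaleR_conv_of_real)
  have z: "mean (\<lambda>u. integral {0..u} (\<lambda>x. c) - of_real u * mean (\<lambda>x. c)) = 0"
    by (rule trans[OF mean_cong[OF i] mean_const])
  show ?thesis unfolding prim_def z i[OF that] by simp
qed

lemma ibp:
  assumes f: "pw_continuous f" "mean f = 0" and cd: "0 \<le> c" "c \<le> d" "d \<le> 1"
    and g: "\<And>x. (g has_real_derivative g' x) (at x)"
    and y: "((\<lambda>x. of_real (g' x) * prim f x) has_integral y) {c..d}"
  shows "((\<lambda>x. of_real (g x) * f x) has_integral of_real (g d) * prim f d - of_real (g c) * prim f c - y) {c..d}"
proof -
  obtain S where S: "finite S" "\<And>x. x \<in> {0<..<1} - S \<Longrightarrow> (prim f has_vector_derivative f x) (at x)"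
    using prim_deriv[OF f(1)] f(2) by auto
  have 1: "continuous_on {c..d} (prim f)"
    using prim_cont[OF pw_continuous_integrable[OF f(1)]] cd by (auto intro: continuous_on_subset)
  have 2: "continuous_on {c..d} (\<lambda>x. of_real (g x) :: complex)"
    using g by (intro continuous_intros) (meson DERIV_continuous_on DERIV_subset subset_UNIV)
  have 3: "((\<lambda>x. of_real (g x)) has_vector_derivative (of_real (g' x) :: complex)) (at x)" for x
    using g[of x] by (simp add: has_vector_derivative_of_real has_real_derivative_iff_has_vector_derivative)
  have "((\<lambda>x. f x * of_real (g x)) has_integral of_real (g d) * prim f d - of_real (g c) * prim f c - y) {c..d}"
  proof (rule integration_by_parts_interior_strong[OF bounded_bilinear_mult S(1) cd(2) 1 2 _ 3])
    show "(prim f has_vector_derivative f x) (at x)" if "x \<in> {c<..<d} - S" for x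
      using S(2)[of x] that cd by auto
    show "((\<lambda>x. prim f x * of_real (g' x)) has_integral prim f d * of_real (g d) - prim f c * of_real (g c)
      - (of_real (g d) * prim f d - of_real (g c) * prim f c - y)) {c..d}"
      using y by (simp add: mult.commute)
  qed
  then show ?thesis by (simp add: mult.commute)
qed

text \<open>Each integration by parts lowers the Bernoulli index and applies \<open>prim\<close>
  once more. The boundary terms cancel by periodicity until degree 1 is reached, where the increase
  by 1 from 0 to 1 leaves the value of the iterated antiderivative at 0.\<close>

lemma scaled_bernoulli_has_integral:
  assumes "pw_continuous f" "mean f = 0"
  shows "((\<lambda>s. of_real (scaled_bernoulli (Suc r) s) * f s) has_integral (- 1) ^ r * (prim ^^ Suc r) f 0) {0..1}"
  using assms
proof (induction r arbitrary: f)
  case 0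
  have "((\<lambda>x. of_real (scaled_bernoulli 0 x) * prim f x) has_integral 0) {0..1}"
    using mean_prim[OF pw_continuous_integrable[OF 0(1)]] prim_cont[OF pw_continuous_integrable[OF 0(1)]]
    by (simp add: mean_def) (metis integrable_continuous_interval integrable_integral)
  from ibp[OF 0 _ _ _ scaled_bernoulli_deriv this] show ?case
    by (simp add: scaled_bernoulli_1 prim_end field_simps)
next
  case (Suc r)
  have "((\<lambda>s. of_real (scaled_bernoulli (Suc r) s) * prim f s) has_integral (- 1) ^ r * (prim ^^ Suc r) (prim f) 0) {0..1}"
    using Suc.prems by (intro Suc.IH prim_pw_continuous mean_prim pw_continuous_integrable)
  from ibp[OF Suc.prems _ _ _ scaled_bernoulli_deriv this] show ?case
    by (simp add: scaled_bernoulli_periodic prim_end funpow_swap1)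
qed

text \<open>This is the convolution of \<open>f\<close> with the periodic continuation of the
  Bernoulli function, split at the point \<open>y\<close>: to the left of \<open>y\<close> the
  continuation is \<open>scaled_bernoulli (Suc r) (s - y + 1)\<close>, rewritten by the reflection
  formula. The jump in degree 1 sits at \<open>y\<close> and picks out the value there. Only the sum
  of the two pieces has a closed form, hence the existential \<open>A\<close> and
  \<open>B\<close>.\<close>

lemma scaled_bernoulli_convolution:
  assumes "pw_continuous f" "mean f = 0" "y \<in> {0..1}"
  shows "\<exists>A B. ((\<lambda>s. of_real ((- 1) ^ Suc r * scaled_bernoulli (Suc r) (y - s)) * f s) has_integral A) {0..y} \<and>
    ((\<lambda>s. of_real (scaled_bernoulli (Suc r) (s - y)) * f s) has_integral B) {y..1} \<and>
    A + B = (- 1) ^ r * (prim ^^ Suc r) f y"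
  using assms
proof (induction r arbitrary: f)
  case 0
  have c: "continuous_on {0..1} (prim f)" by (rule prim_cont[OF pw_continuous_integrable[OF 0(1)]])
  have i: "prim f integrable_on {0..y}" "prim f integrable_on {y..1}"
    using 0 c by (auto intro!: integrable_continuous_interval intro: continuous_on_subset)
  have d1: "((\<lambda>s. (- 1) ^ Suc 0 * scaled_bernoulli (Suc 0) (y - s)) has_real_derivative 1) (at s)" for s
    by (auto simp: scaled_bernoulli_1 intro!: derivative_eq_intros)
  have d2: "((\<lambda>s. scaled_bernoulli (Suc 0) (s - y)) has_real_derivative 1) (at s)" for s
    by (auto simp: scaled_bernoulli_1 intro!: derivative_eq_intros)
  have "((\<lambda>s. of_real 1 * prim f s) has_integral integral {0..y} (prim f)) {0..y}"
     "((\<lambda>s. of_real 1 * prim f s) has_integral integral {y..1} (prim f)) {y..1}"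
    using i by (simp_all add: integrable_integral)
  note H = ibp[OF 0(1,2) _ _ _ d1 this(1)] ibp[OF 0(1,2) _ _ _ d2 this(2)]
  have "integral {0..y} (prim f) + integral {y..1} (prim f) = mean (prim f)"
    unfolding mean_def using 0(3) integrable_continuous_interval[OF c]
    by (intro Henstock_Kurzweil_Integration.integral_combine) auto
  then have "integral {0..y} (prim f) = - integral {y..1} (prim f)"
    using mean_prim[OF pw_continuous_integrable[OF 0(1)]] by (simp add: eq_neg_iff_add_eq_0)
  then show ?case
    using H 0(3) by (intro exI conjI) (auto simp: scaled_bernoulli_1 prim_end algebra_simps)
next
  case (Suc r)
  have "\<exists>A B. ((\<lambda>s. of_real ((- 1) ^ Suc r * scaled_bernoulli (Suc r) (y - s)) * prim f s) has_integral A) {0..y} \<and>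
    ((\<lambda>s. of_real (scaled_bernoulli (Suc r) (s - y)) * prim f s) has_integral B) {y..1} \<and>
    A + B = (- 1) ^ r * (prim ^^ Suc r) (prim f) y"
    using Suc.prems by (intro Suc.IH prim_pw_continuous mean_prim pw_continuous_integrable)
  then obtain A B where AB: "((\<lambda>s. of_real ((- 1) ^ Suc r * scaled_bernoulli (Suc r) (y - s)) * prim f s) has_integral A) {0..y}"
    "((\<lambda>s. of_real (scaled_bernoulli (Suc r) (s - y)) * prim f s) has_integral B) {y..1}"
    "A + B = (- 1) ^ r * (prim ^^ Suc r) (prim f) y" by blast
  have d1: "((\<lambda>s. (- 1) ^ Suc (Suc r) * scaled_bernoulli (Suc (Suc r)) (y - s)) has_real_derivative
      (- 1) ^ Suc r * scaled_bernoulli (Suc r) (y - s)) (at s)" for s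
    using DERIV_cmult[OF DERIV_chain2[OF scaled_bernoulli_deriv[of "Suc r" "y - s" UNIV] DERIV_diff[OF DERIV_const DERIV_ident]], of "(- 1) ^ Suc (Suc r)"]
    by simp
  have d2: "((\<lambda>s. scaled_bernoulli (Suc (Suc r)) (s - y)) has_real_derivative scaled_bernoulli (Suc r) (s - y)) (at s)" for s
    using DERIV_chain2[OF scaled_bernoulli_deriv[of "Suc r" "s - y" UNIV] DERIV_diff[OF DERIV_ident DERIV_const]]
    by simp
  have s0: "(- 1) ^ r * scaled_bernoulli (Suc (Suc r)) 0 = scaled_bernoulli (Suc (Suc r)) 0"
    using scaled_bernoulli_reflect[of "Suc (Suc r)" 0] scaled_bernoulli_periodic[of r] by simp
  have s1: "scaled_bernoulli (Suc (Suc r)) (1 - y) = (- 1) ^ r * scaled_bernoulli (Suc (Suc r)) y"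
    by (simp add: scaled_bernoulli_reflect)
  note H = ibp[OF Suc(2,3) _ _ _ d1 AB(1)] ibp[OF Suc(2,3) _ _ _ d2 AB(2)]
  have "B = (- 1) ^ r * (prim ^^ Suc r) (prim f) y - A" using AB(3) by (simp add: eq_diff_eq add.commute)
  then show ?case
    using H Suc.prems(3) s0 s1 by (intro exI conjI) (auto simp: prim_end funpow_swap1 algebra_simps)
qed

text \<open>In even degree the reflection sign is 1, so both pieces of the convolution carry the
  same function of the distance from \<open>y\<close>. The minus sign is
  \<open>(- 1) ^ (2 * \<alpha> - 1)\<close>.\<close>

lemma scaled_bernoulli_abs_has_integral:
  assumes "pw_continuous f" "mean f = 0" "y \<in> {0..1}" "\<alpha> \<ge> 1"
  shows "((\<lambda>s. of_real (scaled_bernoulli (2 * \<alpha>) \<bar>s - y\<bar>) * f s) has_integral - (prim ^^ (2 * \<alpha>)) f y) {0..1}"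
proof -
  obtain r where r: "2 * \<alpha> = Suc r" "odd r" using assms(4) by (metis One_nat_def Suc_le_D even_Suc even_mult_iff even_numeral
      mult_2 add_Suc)
  obtain A B where AB: "((\<lambda>s. of_real ((- 1) ^ Suc r * scaled_bernoulli (Suc r) (y - s)) * f s) has_integral A) {0..y}"
    "((\<lambda>s. of_real (scaled_bernoulli (Suc r) (s - y)) * f s) has_integral B) {y..1}"
    "A + B = (- 1) ^ r * (prim ^^ Suc r) f y"
    using scaled_bernoulli_convolution[OF assms(1-3), of r] by blast
  have "((\<lambda>s. of_real (scaled_bernoulli (2 * \<alpha>) \<bar>s - y\<bar>) * f s) has_integral A) {0..y}"
    using AB(1) by (rule has_integral_eq[rotated]) (use r in auto)
  moreover have "((\<lambda>s. of_real (scaled_bernoulli (2 * \<alpha>) \<bar>s - y\<bar>) * f s) has_integral B) {y..1}"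
    using AB(2) by (rule has_integral_eq[rotated]) (use r in auto)
  ultimately have "((\<lambda>s. of_real (scaled_bernoulli (2 * \<alpha>) \<bar>s - y\<bar>) * f s) has_integral A + B) {0..1}"
    using assms(3) by (intro has_integral_combine[of 0 y 1]) auto
  then show ?thesis using AB(3) r by simp
qed

subsection \<open>The kernel of the univariate space\<close>

definition sob :: "nat \<Rightarrow> real \<Rightarrow> real \<Rightarrow> real" where
  "sob \<alpha> x y = (\<Sum>r=1..\<alpha>. scaled_bernoulli r x * scaled_bernoulli r y) + (- 1) ^ (\<alpha> + 1) * scaled_bernoulli (2 * \<alpha>) \<bar>x - y\<bar>"

lemma sob_sobolev:
  "(\<Sum>r=1..\<alpha>. bernoulli_poly r x * bernoulli_poly r y / (fact r)\<^sup>2)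
    + (-1) ^ (\<alpha> + 1) * bernoulli_poly (2 * \<alpha>) \<bar>x - y\<bar> / fact (2 * \<alpha>) = sob \<alpha> x y"
  by (simp add: sob_def scaled_bernoulli_def power2_eq_square)

lemma sob_continuous [continuous_intros]:
  "continuous_on S f \<Longrightarrow> continuous_on S g \<Longrightarrow> continuous_on S (\<lambda>z. sob \<alpha> (f z) (g z))"
  unfolding sob_def by (intro continuous_intros)

lemma sob_has_integral:
  assumes "pw_continuous f" "mean f = 0" "y \<in> {0..1}" "\<alpha> \<ge> 1"
  shows "((\<lambda>s. of_real (sob \<alpha> s y) * f s) has_integral
    (\<Sum>r=1..\<alpha>. of_real (scaled_bernoulli r y) * ((- 1) ^ (r - 1) * (prim ^^ r) f 0)) + (- 1) ^ \<alpha> * (prim ^^ (2 * \<alpha>)) f y) {0..1}"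
proof -
  have "((\<lambda>s. of_real (scaled_bernoulli r y) * (of_real (scaled_bernoulli r s) * f s)) has_integral
      of_real (scaled_bernoulli r y) * ((- 1) ^ (r - 1) * (prim ^^ r) f 0)) {0..1}" if "r \<in> {1..\<alpha>}" for r
  proof -
    have "Suc (r - 1) = r" using that by simp
    then show ?thesis
      using scaled_bernoulli_has_integral[OF assms(1,2), of "r - 1"] by (intro has_integral_mult_right) (simp only:)
  qed
  then have "((\<lambda>s. \<Sum>r=1..\<alpha>. of_real (scaled_bernoulli r y) * (of_real (scaled_bernoulli r s) * f s)) has_integral
     (\<Sum>r=1..\<alpha>. of_real (scaled_bernoulli r y) * ((- 1) ^ (r - 1) * (prim ^^ r) f 0))) {0..1}"
    by (intro has_integral_sum) simp_all
  note has_integral_add[OF this has_integral_mult_right[OF scaled_bernoulli_abs_has_integral[OF assms], of "(- 1) ^ (\<alpha> + 1)"]]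
  then have "((\<lambda>s. (\<Sum>r=1..\<alpha>. of_real (scaled_bernoulli r y) * (of_real (scaled_bernoulli r s) * f s))
      + (- 1) ^ (\<alpha> + 1) * (of_real (scaled_bernoulli (2 * \<alpha>) \<bar>s - y\<bar>) * f s)) has_integral
    (\<Sum>r=1..\<alpha>. of_real (scaled_bernoulli r y) * ((- 1) ^ (r - 1) * (prim ^^ r) f 0)) + (- 1) ^ \<alpha> * (prim ^^ (2 * \<alpha>)) f y) {0..1}"
    by (simp only: power_add power_one_right mult_minus1_right mult_minus_right mult_minus_left minus_minus mult_1_right)
  moreover have "of_real (sob \<alpha> s y) * f s = (\<Sum>r=1..\<alpha>. of_real (scaled_bernoulli r y) * (of_real (scaled_bernoulli r s) * f s))
      + (- 1) ^ (\<alpha> + 1) * (of_real (scaled_bernoulli (2 * \<alpha>) \<bar>s - y\<bar>) * f s)" for s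
    unfolding sob_def of_real_add distrib_right of_real_sum sum_distrib_right
    by (simp add: mult_ac)
  ultimately show ?thesis by (simp only:)
qed

text \<open>Skew-adjointness of \<open>prim\<close>: integration by parts, with boundary terms that
  cancel because both antiderivatives take equal values at 0 and 1.\<close>

lemma prim_adjoint:
  assumes f: "continuous_on {0..1} f" "mean f = 0" and h: "pw_continuous h" "mean h = 0"
  shows "((\<lambda>x. prim f x * cnj (h x)) has_integral - mean (\<lambda>x. f x * cnj (prim h x))) {0..1}"
proof -
  have nf: "pw_continuous f" using f by (simp add: pw_continuousI)
  obtain S where S: "finite S" "\<And>x. x \<in> {0<..<1} - S \<Longrightarrow> (prim f has_vector_derivative f x) (at x)"
    using prim_deriv[OF nf] f(2) by auto
  obtain T where T: "finite T" "\<And>x. x \<in> {0<..<1} - T \<Longrightarrow> (prim h has_vector_derivative h x) (at x)"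
    using prim_deriv[OF h(1)] h(2) by auto
  have 1: "continuous_on {0..1} (\<lambda>x. cnj (prim h x))"
    by (intro continuous_intros prim_cont pw_continuous_integrable h)
  have 2: "continuous_on {0..1} (prim f)"
    by (intro prim_cont pw_continuous_integrable nf)
  have "(\<lambda>x. cnj (prim h x) * f x) integrable_on {0..1}"
    by (intro integrable_continuous_interval continuous_on_mult 1 f)
  then have 3: "((\<lambda>x. cnj (prim h x) * f x) has_integral mean (\<lambda>x. f x * cnj (prim h x))) {0..1}"
    by (simp add: mean_def mult.commute integrable_integral)
  have "((\<lambda>x. cnj (h x) * prim f x) has_integral - mean (\<lambda>x. f x * cnj (prim h x))) {0..1}"
  proof (rule integration_by_parts_interior_strong[OF bounded_bilinear_mult _ _ 1 2, of "S \<union> T"])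
    show "((\<lambda>x. cnj (prim h x)) has_vector_derivative cnj (h x)) (at x)" if "x \<in> {0<..<1} - (S \<union> T)" for x
      using T(2)[of x] that by (intro has_vector_derivative_cnj) auto
  qed (use S T 3 in \<open>auto simp: prim_end\<close>)
  then show ?thesis by (simp add: mult.commute)
qed

lemma prim_power_pw_continuous: "pw_continuous f \<Longrightarrow> pw_continuous ((prim ^^ r) f)"
  by (induction r) (auto intro: prim_pw_continuous)

lemma prim_power_cont: "pw_continuous f \<Longrightarrow> r \<ge> 1 \<Longrightarrow> continuous_on {0..1} ((prim ^^ r) f)"
  by (cases r) (auto intro!: prim_cont pw_continuous_integrable prim_power_pw_continuous)

lemma mean_prim_power: "pw_continuous f \<Longrightarrow> mean f = 0 \<Longrightarrow> mean ((prim ^^ r) f) = 0"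
  by (cases r) (auto intro!: mean_prim pw_continuous_integrable prim_power_pw_continuous)

text \<open>Each move across the inner product contributes a factor -1. For
  \<open>j \<le> \<alpha>\<close> the left factor keeps at least one \<open>prim\<close> and so
  stays continuous, as \<open>prim_adjoint\<close> requires.\<close>

lemma prim_adjoint_power:
  assumes f: "pw_continuous f" "mean f = 0" and j: "j \<le> \<alpha>" "\<alpha> \<ge> 1"
  shows "mean (\<lambda>x. (prim ^^ (2 * \<alpha>)) f x * cnj (f x)) = (- 1) ^ j * mean (\<lambda>x. (prim ^^ (2 * \<alpha> - j)) f x * cnj ((prim ^^ j) f x))"
  using j
proof (induction j)
  case (Suc j)
  define i where "i = 2 * \<alpha> - Suc j"
  have i: "i \<ge> 1" "2 * \<alpha> - j = Suc i" using Suc.prems by (auto simp: i_def)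
  have "mean (\<lambda>x. prim ((prim ^^ i) f) x * cnj ((prim ^^ j) f x)) = - mean (\<lambda>x. (prim ^^ i) f x * cnj (prim ((prim ^^ j) f) x))"
    using prim_adjoint[of "(prim ^^ i) f" "(prim ^^ j) f"] f i
    by (simp add: mean_def[of "\<lambda>x. prim ((prim ^^ i) f) x * _ x"] integral_unique prim_power_cont prim_power_pw_continuous mean_prim_power)
  then show ?case using Suc i by (simp add: i_def[symmetric])
qed simp

text \<open>Each product of Bernoulli polynomials gives a square modulus, one factor from the inner
  and its conjugate from the outer integral. The last term of the kernel contributes
  \<open>2 * \<alpha>\<close> antiderivatives on one side; moving half of them over produces the
  sign \<open>(- 1) ^ \<alpha>\<close>, which cancels the sign of the kernel term. What remains is a
  sum of nonnegative terms.\<close>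

lemma sob_quadratic:
  assumes f: "pw_continuous f" "mean f = 0" and a: "\<alpha> \<ge> 1"
  shows "((\<lambda>y. integral {0..1} (\<lambda>s. of_real (sob \<alpha> s y) * f s) * cnj (f y)) has_integral
    (\<Sum>r=1..\<alpha>. (prim ^^ r) f 0 * cnj ((prim ^^ r) f 0)) + mean (\<lambda>x. (prim ^^ \<alpha>) f x * cnj ((prim ^^ \<alpha>) f x))) {0..1}"
proof -
  have 1: "((\<lambda>y. (- 1) ^ (r - 1) * (prim ^^ r) f 0 * (of_real (scaled_bernoulli r y) * cnj (f y))) has_integral
      (prim ^^ r) f 0 * cnj ((prim ^^ r) f 0)) {0..1}" if "r \<in> {1..\<alpha>}" for r
  proof -
    have "((\<lambda>s. of_real (scaled_bernoulli r s) * f s) has_integral (- 1) ^ (r - 1) * (prim ^^ r) f 0) {0..1}"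
    proof -
      have "Suc (r - 1) = r" using that by simp
      then show ?thesis using scaled_bernoulli_has_integral[OF f, of "r - 1"] by (simp only:)
    qed
    then have "((\<lambda>s. of_real (scaled_bernoulli r s) * cnj (f s)) has_integral (- 1) ^ (r - 1) * cnj ((prim ^^ r) f 0)) {0..1}"
      by (subst (asm) has_integral_cnj[symmetric]) (simp add: comp_def)
    from has_integral_mult_right[OF this, of "(- 1) ^ (r - 1) * (prim ^^ r) f 0"] show ?thesis
      by (simp add: mult_ac flip: power_mult_distrib power_add mult_2)
  qed
  have "((\<lambda>x. prim ((prim ^^ (2 * \<alpha> - 1)) f) x * cnj (f x)) has_integral
     - mean (\<lambda>x. (prim ^^ (2 * \<alpha> - 1)) f x * cnj (prim f x))) {0..1}"
    using f a by (intro prim_adjoint prim_power_cont mean_prim_power) auto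
  moreover have "prim ((prim ^^ (2 * \<alpha> - 1)) f) = (prim ^^ (2 * \<alpha>)) f"
    using a by (cases "2 * \<alpha>") auto
  ultimately have "((\<lambda>x. (prim ^^ (2 * \<alpha>)) f x * cnj (f x)) has_integral mean (\<lambda>x. (prim ^^ (2 * \<alpha>)) f x * cnj (f x))) {0..1}"
    by (metis mean_def has_integral_iff)
  then have 2: "((\<lambda>x. (prim ^^ (2 * \<alpha>)) f x * cnj (f x)) has_integral
      (- 1) ^ \<alpha> * mean (\<lambda>x. (prim ^^ \<alpha>) f x * cnj ((prim ^^ \<alpha>) f x))) {0..1}"
    using prim_adjoint_power[OF f order_refl a] by simp
  have "((\<lambda>y. (\<Sum>r=1..\<alpha>. (- 1) ^ (r - 1) * (prim ^^ r) f 0 * (of_real (scaled_bernoulli r y) * cnj (f y)))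
      + (- 1) ^ \<alpha> * ((prim ^^ (2 * \<alpha>)) f y * cnj (f y))) has_integral
    (\<Sum>r=1..\<alpha>. (prim ^^ r) f 0 * cnj ((prim ^^ r) f 0)) +
      (- 1) ^ \<alpha> * ((- 1) ^ \<alpha> * mean (\<lambda>x. (prim ^^ \<alpha>) f x * cnj ((prim ^^ \<alpha>) f x)))) {0..1}"
    by (intro has_integral_add has_integral_sum has_integral_mult_right 1 2) auto
  moreover have "(- 1) ^ \<alpha> * ((- 1) ^ \<alpha> * c) = c" for c :: complex
    by (simp flip: power_mult_distrib mult.assoc)
  ultimately have "((\<lambda>y. (\<Sum>r=1..\<alpha>. (- 1) ^ (r - 1) * (prim ^^ r) f 0 * (of_real (scaled_bernoulli r y) * cnj (f y)))
      + (- 1) ^ \<alpha> * ((prim ^^ (2 * \<alpha>)) f y * cnj (f y))) has_integral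
    (\<Sum>r=1..\<alpha>. (prim ^^ r) f 0 * cnj ((prim ^^ r) f 0)) + mean (\<lambda>x. (prim ^^ \<alpha>) f x * cnj ((prim ^^ \<alpha>) f x))) {0..1}"
    by (simp only:)
  then show ?thesis
  proof (rule has_integral_eq[rotated])
    fix y :: real assume y: "y \<in> {0..1}"
    show "(\<Sum>r=1..\<alpha>. (- 1) ^ (r - 1) * (prim ^^ r) f 0 * (of_real (scaled_bernoulli r y) * cnj (f y)))
      + (- 1) ^ \<alpha> * ((prim ^^ (2 * \<alpha>)) f y * cnj (f y))
      = integral {0..1} (\<lambda>s. of_real (sob \<alpha> s y) * f s) * cnj (f y)"
      unfolding integral_unique[OF sob_has_integral[OF f y a]]
      unfolding distrib_right sum_distrib_right by (simp only: mult_ac)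
  qed
qed

text \<open>Bernoulli polynomials of positive degree have mean zero, and for the function of the
  distance the antiderivatives on both sides of \<open>y\<close> cancel by reflection and by
  \<open>scaled_bernoulli (2 * \<alpha> + 1) 0 = 0\<close>. This removes the index 0 from the Walsh
  series and all integral terms from the squared error.\<close>

lemma sob_mean_zero:
  assumes "y \<in> {0..1}" "\<alpha> \<ge> 1"
  shows "((\<lambda>s. sob \<alpha> s y) has_integral 0) {0..1}"
proof -
  have 1: "(scaled_bernoulli r has_integral 0) {0..1}" if r: "r \<ge> 1" for r
  proof -
    obtain r' where "r = Suc r'" using r by (cases r) auto
    moreover have "(scaled_bernoulli r has_integral scaled_bernoulli (Suc r) 1 - scaled_bernoulli (Suc r) 0) {0..1}"
      by (intro fundamental_theorem_of_calculus)
         (auto simp: has_real_derivative_iff_has_vector_derivative[symmetric] intro: scaled_bernoulli_deriv)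
    ultimately show ?thesis by (simp add: scaled_bernoulli_periodic)
  qed
  let ?n = "2 * \<alpha>"
  have "((\<lambda>s. scaled_bernoulli ?n \<bar>s - y\<bar>) has_integral - scaled_bernoulli (Suc ?n) (y - y) - (- scaled_bernoulli (Suc ?n) (y - 0))) {0..y}"
  proof (rule has_integral_eq[rotated])
    show "((\<lambda>s. scaled_bernoulli ?n (y - s)) has_integral - scaled_bernoulli (Suc ?n) (y - y) - (- scaled_bernoulli (Suc ?n) (y - 0))) {0..y}"
    proof (rule fundamental_theorem_of_calculus)
      show "((\<lambda>s. - scaled_bernoulli (Suc ?n) (y - s)) has_vector_derivative scaled_bernoulli ?n (y - s)) (at s within {0..y})" for s
        unfolding has_real_derivative_iff_has_vector_derivative[symmetric]
        using DERIV_minus[OF DERIV_chain2[OF scaled_bernoulli_deriv[of ?n "y - s" UNIV] DERIV_diff[OF DERIV_const DERIV_ident]]]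
        by simp
    qed (use assms in auto)
  qed auto
  moreover have "((\<lambda>s. scaled_bernoulli ?n \<bar>s - y\<bar>) has_integral scaled_bernoulli (Suc ?n) (1 - y) - scaled_bernoulli (Suc ?n) (y - y)) {y..1}"
  proof (rule has_integral_eq[rotated])
    show "((\<lambda>s. scaled_bernoulli ?n (s - y)) has_integral scaled_bernoulli (Suc ?n) (1 - y) - scaled_bernoulli (Suc ?n) (y - y)) {y..1}"
    proof (rule fundamental_theorem_of_calculus)
      show "((\<lambda>s. scaled_bernoulli (Suc ?n) (s - y)) has_vector_derivative scaled_bernoulli ?n (s - y)) (at s within {y..1})" for s
        unfolding has_real_derivative_iff_has_vector_derivative[symmetric]
        using DERIV_chain2[OF scaled_bernoulli_deriv[of ?n "s - y" UNIV] DERIV_diff[OF DERIV_ident DERIV_const]]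
        by simp
    qed (use assms in auto)
  qed auto
  ultimately have "((\<lambda>s. scaled_bernoulli ?n \<bar>s - y\<bar>) has_integral (- scaled_bernoulli (Suc ?n) (y - y) - (- scaled_bernoulli (Suc ?n) (y - 0)))
     + (scaled_bernoulli (Suc ?n) (1 - y) - scaled_bernoulli (Suc ?n) (y - y))) {0..1}"
    using assms by (intro has_integral_combine[of 0 y 1]) auto
  moreover have "scaled_bernoulli (Suc ?n) 0 = 0"
  proof -
    have "scaled_bernoulli (Suc ?n) (1 - 0) = - scaled_bernoulli (Suc ?n) 0" unfolding scaled_bernoulli_reflect by simp
    moreover obtain k where "?n = Suc k" using assms(2) by (cases ?n) auto
    ultimately show ?thesis using scaled_bernoulli_periodic[of k] by simp
  qed
  ultimately have 2: "((\<lambda>s. scaled_bernoulli ?n \<bar>s - y\<bar>) has_integral 0) {0..1}"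
    by (simp add: scaled_bernoulli_reflect)
  have "((\<lambda>s. (\<Sum>r=1..\<alpha>. scaled_bernoulli r s * scaled_bernoulli r y) + (- 1) ^ (\<alpha> + 1) * scaled_bernoulli ?n \<bar>s - y\<bar>) has_integral
    (\<Sum>r=1..\<alpha>. 0 * scaled_bernoulli r y) + (- 1) ^ (\<alpha> + 1) * 0) {0..1}"
    by (intro has_integral_add has_integral_sum has_integral_mult_right has_integral_mult_left 1 2) auto
  then show ?thesis by (simp add: sob_def)
qed

section \<open>Uniform continuity and Riemann sums of the kernel\<close>

lemma integral_split:
  fixes f :: "real \<Rightarrow> 'a::banach"
  assumes f: "f integrable_on {0..1}" and N: "N > 0"
  shows "integral {0..1} f = (\<Sum>c<N. integral {real c / real N..real (Suc c) / real N} f)"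
proof -
  have "integral {0..real n / real N} f = (\<Sum>c<n. integral {real c / real N..real (Suc c) / real N} f)"
    if "n \<le> N" for n
    using that
  proof (induction n)
    case (Suc n)
    have "real (Suc n) / real N \<le> 1" using Suc.prems N by simp
    then have "f integrable_on {0..real (Suc n) / real N}"
      using f by (auto intro: integrable_on_subinterval)
    then have "integral {0..real n / real N} f + integral {real n / real N..real (Suc n) / real N} f
        = integral {0..real (Suc n) / real N} f"
      by (intro Henstock_Kurzweil_Integration.integral_combine) (auto simp: divide_right_mono)
    then show ?case using Suc by simp
  qed simp
  from this[of N] show ?thesis using N by simp
qed

lemma sob_uniform:
  assumes "e > 0"
  shows "\<exists>d>0. \<forall>x\<in>{0..1}. \<forall>y\<in>{0..1}. \<forall>x'\<in>{0..1}. \<forall>y'\<in>{0..1}.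
    \<bar>x - x'\<bar> < d \<longrightarrow> \<bar>y - y'\<bar> < d \<longrightarrow> \<bar>sob \<alpha> x y - sob \<alpha> x' y'\<bar> < e"
proof -
  have "continuous_on ({0..1} \<times> {0..1}) (\<lambda>z. sob \<alpha> (fst z) (snd z))"
    by (intro continuous_intros)
  then have "uniformly_continuous_on ({0..1} \<times> {0..1}) (\<lambda>z. sob \<alpha> (fst z) (snd z))"
    by (rule compact_uniformly_continuous) (intro compact_Times compact_Icc)
  then obtain d where d: "d > 0" "\<And>z z'. z \<in> {0..1} \<times> {0..1} \<Longrightarrow> z' \<in> {0..1} \<times> {0..1} \<Longrightarrow>
      dist z' z < d \<Longrightarrow> dist (sob \<alpha> (fst z') (snd z')) (sob \<alpha> (fst z) (snd z)) < e"
    unfolding uniformly_continuous_on_def using assms by metis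
  show ?thesis
  proof (intro exI[of _ "d / 2"] conjI ballI impI)
    fix x y x' y' :: real
    assume *: "x \<in> {0..1}" "y \<in> {0..1}" "x' \<in> {0..1}" "y' \<in> {0..1}" "\<bar>x - x'\<bar> < d / 2" "\<bar>y - y'\<bar> < d / 2"
    have "dist (x, y) (x', y') \<le> \<bar>x - x'\<bar> + \<bar>y - y'\<bar>"
      unfolding dist_Pair_Pair dist_real_def by (rule order_trans[OF sqrt_sum_squares_le_sum_abs]) simp
    then have "dist (x, y) (x', y') < d" using * by linarith
    then show "\<bar>sob \<alpha> x y - sob \<alpha> x' y'\<bar> < e"
      using d(2)[of "(x', y')" "(x, y)"] * by (simp add: dist_real_def)
  qed (use d in simp)
qed

lemma sob_bounded: "\<exists>C\<ge>0. \<forall>x\<in>{0..1}. \<forall>y\<in>{0..1}. \<bar>sob \<alpha> x y\<bar> \<le> C"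
proof -
  have "continuous_on ({0..1} \<times> {0..1}) (\<lambda>z. sob \<alpha> (fst z) (snd z))"
    by (intro continuous_intros)
  then have "bounded ((\<lambda>z. sob \<alpha> (fst z) (snd z)) ` ({0..1} \<times> {0..1}))"
    by (intro compact_imp_bounded compact_continuous_image compact_Times compact_Icc)
  then obtain C where C: "\<forall>v\<in>(\<lambda>z. sob \<alpha> (fst z) (snd z)) ` ({0..1} \<times> {0..1}). norm v \<le> C"
    unfolding bounded_iff by blast
  have "\<forall>x\<in>{0..1}. \<forall>y\<in>{0..1}. \<bar>sob \<alpha> x y\<bar> \<le> max C 0"
  proof (intro ballI)
    fix x y :: real assume "x \<in> {0..1}" "y \<in> {0..1}"
    then have "norm (sob \<alpha> (fst (x, y)) (snd (x, y))) \<le> C" by (intro bspec[OF C] imageI) simp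
    then show "\<bar>sob \<alpha> x y\<bar> \<le> max C 0" by simp
  qed
  then show ?thesis by (intro exI[of _ "max C 0"]) simp
qed

text \<open>On each cell uniform continuity bounds the deviation from the left end point, and the
  integrals over the cells add up to 0. Uniformity in \<open>y\<close> is needed for double grid
  averages, where \<open>y\<close> itself runs through the grid.\<close>

lemma sob_riemann:
  assumes "e > 0" "\<alpha> \<ge> 1"
  shows "\<exists>N0. \<forall>N\<ge>N0. \<forall>y\<in>{0..1}. \<bar>(\<Sum>a<N. sob \<alpha> (real a / real N) y) / real N\<bar> \<le> e"
proof -
  obtain d where d: "d > 0" "\<And>x y x' y'. x \<in> {0..1} \<Longrightarrow> y \<in> {0..1} \<Longrightarrow> x' \<in> {0..1} \<Longrightarrow> y' \<in> {0..1} \<Longrightarrow>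
    \<bar>x - x'\<bar> < d \<Longrightarrow> \<bar>y - y'\<bar> < d \<Longrightarrow> \<bar>sob \<alpha> x y - sob \<alpha> x' y'\<bar> < e"
    using sob_uniform[OF assms(1)] by metis
  obtain N0 where N0: "real N0 > 1 / d" using reals_Archimedean2 by blast
  show ?thesis
  proof (intro exI[of _ "Suc N0"] allI impI ballI)
    fix N y assume N: "Suc N0 \<le> N" and y: "y \<in> {0..1::real}"
    have Npos: "N > 0" using N by simp
    have "1 / d < real N" using N N0 by linarith
    then have Nd: "1 / real N < d" using d(1) Npos by (simp add: field_simps)
    have i: "(\<lambda>s. sob \<alpha> s y) integrable_on {a..b}" for a b
      by (intro integrable_continuous_interval continuous_intros)
    have cell: "\<bar>sob \<alpha> (real a / real N) y / real N - integral {real a / real N..real (Suc a) / real N} (\<lambda>s. sob \<alpha> s y)\<bar>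
        \<le> e / real N" if a: "a < N" for a
    proof -
      let ?I = "{real a / real N..real (Suc a) / real N}"
      have le: "real (Suc a) / real N \<le> 1" using a Npos by simp
      have len: "real (Suc a) / real N - real a / real N = 1 / real N" by (simp add: diff_divide_distrib [symmetric])
      have "norm (integral ?I (\<lambda>s. sob \<alpha> (real a / real N) y - sob \<alpha> s y)) \<le> integral ?I (\<lambda>s. e)"
      proof (rule integral_norm_bound_integral)
        show "(\<lambda>s. sob \<alpha> (real a / real N) y - sob \<alpha> s y) integrable_on ?I"
          by (intro integrable_continuous_interval continuous_intros)
        fix s assume s: "s \<in> ?I"
        have "0 \<le> real a / real N" by simp
        moreover have "0 \<le> s" by (rule order_trans[of _ "real a / real N"]) (use s in auto)
        ultimately have "s \<in> {0..1}" "real a / real N \<in> {0..1}" "\<bar>real a / real N - s\<bar> < d"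
          using s le len Nd by (auto simp: abs_if)
        then show "norm (sob \<alpha> (real a / real N) y - sob \<alpha> s y) \<le> e"
          using d(2)[of "real a / real N" y s y] d(1) y by simp
      qed (intro integrable_continuous_interval continuous_intros)
      also have "integral ?I (\<lambda>s. sob \<alpha> (real a / real N) y - sob \<alpha> s y)
          = sob \<alpha> (real a / real N) y / real N - integral ?I (\<lambda>s. sob \<alpha> s y)"
        by (subst integral_diff) (auto simp: i divide_right_mono len simp del: of_nat_Suc)
      finally show ?thesis by (simp add: divide_right_mono len del: of_nat_Suc)
    qed
    have "(\<Sum>a<N. integral {real a / real N..real (Suc a) / real N} (\<lambda>s. sob \<alpha> s y)) = 0"
      using integral_split[OF i Npos] sob_mean_zero[OF y assms(2)] by (simp add: integral_unique)
    then have "(\<Sum>a<N. sob \<alpha> (real a / real N) y) / real N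
      = (\<Sum>a<N. sob \<alpha> (real a / real N) y / real N - integral {real a / real N..real (Suc a) / real N} (\<lambda>s. sob \<alpha> s y))"
      by (simp only: sum_subtractf sum_divide_distrib diff_0_right)
    also have "\<bar>\<dots>\<bar> \<le> (\<Sum>a<N. e / real N)"
      by (rule order_trans[OF sum_abs sum_mono]) (use cell in auto)
    also have "\<dots> = e" using Npos by simp
    finally show "\<bar>(\<Sum>a<N. sob \<alpha> (real a / real N) y) / real N\<bar> \<le> e" .
  qed
qed

subsection \<open>The worst-case error as a quadratic form\<close>

context rkhs
begin

lemma sum_mem: "finite I \<Longrightarrow> (\<And>i. i \<in> I \<Longrightarrow> g i \<in> H) \<Longrightarrow> (\<lambda>x. \<Sum>i\<in>I. c i * g i x) \<in> H"
  by (induction I rule: finite_induct) (simp_all add: zero_mem add_mem scale_mem)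

lemma ip_sum_left:
  "finite I \<Longrightarrow> (\<And>i. i \<in> I \<Longrightarrow> g i \<in> H) \<Longrightarrow> h \<in> H \<Longrightarrow>
   ip (\<lambda>x. \<Sum>i\<in>I. c i * g i x) h = (\<Sum>i\<in>I. c i * ip (g i) h)"
proof (induction I rule: finite_induct)
  case empty
  have "ip (\<lambda>x. 0 * (0::real)) h = 0 * ip (\<lambda>x. 0) h"
    using empty zero_mem by (intro ip_scale_left) auto
  then show ?case by simp
next
  case (insert i I)
  then show ?case
    by (simp add: ip_add_left[OF scale_mem sum_mem] ip_scale_left)
qed

lemma cauchy_schwarz:
  assumes f: "f \<in> H" and g: "g \<in> H"
  shows "(ip f g)\<^sup>2 \<le> ip f f * ip g g"
proof -
  have q: "0 \<le> ip f f + 2 * t * ip f g + t\<^sup>2 * ip g g" for t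
  proof -
    let ?h = "\<lambda>x. f x + t * g x"
    have tg: "(\<lambda>x. t * g x) \<in> H" by (rule scale_mem[OF g])
    have h: "?h \<in> H" by (rule add_mem[OF f tg])
    have "ip ?h ?h = ip f ?h + t * ip g ?h"
      by (simp add: ip_add_left[OF f tg h] ip_scale_left[OF g h])
    also have "\<dots> = ip ?h f + t * ip ?h g" by (simp add: ip_commute f g h)
    also have "\<dots> = ip f f + t * ip g f + t * (ip f g + t * ip g g)"
      by (simp add: ip_add_left[OF f tg] ip_scale_left[OF g] f g)
    also have "\<dots> = ip f f + 2 * t * ip f g + t\<^sup>2 * ip g g"
      by (simp add: ip_commute[OF g f] algebra_simps power2_eq_square)
    finally show ?thesis using ip_nonneg[OF h] by simp
  qed
  show ?thesis
  proof (cases "ip g g = 0")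
    case True
    have "ip f g = 0"
    proof (rule ccontr)
      assume n: "ip f g \<noteq> 0"
      \<comment> \<open>With \<open>ip g g = 0\<close> the quadratic in \<open>t\<close> degenerates
        to an affine function; this \<open>t\<close> gives it the value -1.\<close>
      have "0 \<le> ip f f + 2 * (- (ip f f + 1) / (2 * ip f g)) * ip f g" using q True by (metis add.right_neutral mult_zero_right)
      then show False using n by (simp add: field_simps)
    qed
    then show ?thesis using ip_nonneg[OF f] ip_nonneg[OF g] by simp
  next
    case False
    then have p: "ip g g > 0" using ip_nonneg[OF g] by simp
    have "0 \<le> ip g g * (ip f f + 2 * (- ip f g / ip g g) * ip f g + (- ip f g / ip g g)\<^sup>2 * ip g g)"
      by (rule mult_nonneg_nonneg[OF less_imp_le[OF p] q])
    also have "\<dots> = ip f f * ip g g - (ip f g)\<^sup>2"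
      using p by (simp add: field_simps power2_eq_square)
    finally show ?thesis by simp
  qed
qed

text \<open>A finite combination of point evaluations is represented by the same combination
  \<open>?h\<close> of kernel functions, whose squared norm is the quadratic form. Both claims then
  follow from Cauchy-Schwarz and positivity.\<close>

lemma functional_bound:
  assumes f: "f \<in> H" and I: "finite I" and x: "\<And>i. i \<in> I \<Longrightarrow> x i \<in> X"
  shows "(\<Sum>i\<in>I. c i * f (x i))\<^sup>2 \<le> ip f f * (\<Sum>i\<in>I. \<Sum>j\<in>I. c i * c j * K (x i) (x j))"
    and "0 \<le> (\<Sum>i\<in>I. \<Sum>j\<in>I. c i * c j * K (x i) (x j))"
proof -
  let ?k = "\<lambda>i z. if z \<in> X then K z (x i) else 0"
  let ?h = "\<lambda>z. \<Sum>i\<in>I. c i * ?k i z"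
  have k: "?k i \<in> H" if "i \<in> I" for i using kernel_mem[OF x[OF that]] .
  have h: "?h \<in> H" using I k by (rule sum_mem)
  have e: "ip g ?h = (\<Sum>i\<in>I. c i * g (x i))" if g: "g \<in> H" for g
  proof -
    have "ip g ?h = ip ?h g" by (rule ip_commute[OF g h])
    also have "\<dots> = (\<Sum>i\<in>I. c i * ip (?k i) g)" by (rule ip_sum_left[OF I k g])
    also have "\<dots> = (\<Sum>i\<in>I. c i * g (x i))"
      by (intro sum.cong refl arg_cong2[where f = "(*)"])
         (simp add: ip_commute[OF k g] reproducing[OF g x])
    finally show ?thesis .
  qed
  have hh: "ip ?h ?h = (\<Sum>i\<in>I. \<Sum>j\<in>I. c i * c j * K (x i) (x j))"
    unfolding e[OF h] by (intro sum.cong refl) (simp add: x sum_distrib_left mult_ac)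
  show "(\<Sum>i\<in>I. c i * f (x i))\<^sup>2 \<le> ip f f * (\<Sum>i\<in>I. \<Sum>j\<in>I. c i * c j * K (x i) (x j))"
    using cauchy_schwarz[OF f h] by (simp only: e[OF f] hh)
  show "0 \<le> (\<Sum>i\<in>I. \<Sum>j\<in>I. c i * c j * K (x i) (x j))"
    using ip_nonneg[OF h] by (simp only: hh)
qed

lemma eval_bound:
  assumes "f \<in> H" "x \<in> X"
  shows "(f x)\<^sup>2 \<le> ip f f * K x x"
  using functional_bound(1)[of f "{0::nat}" "\<lambda>_. x" "\<lambda>_. 1"] assms by simp

lemma diff_bound:
  assumes "f \<in> H" "x \<in> X" "y \<in> X"
  shows "(f x - f y)\<^sup>2 \<le> ip f f * (K x x - K x y - K y x + K y y)"
  using functional_bound(1)[of f "{True, False}" "\<lambda>i. if i then x else y" "\<lambda>i. if i then 1 else - 1"] assms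
  by (simp add: algebra_simps)

end

section \<open>Integration over the unit cube: products, cells and step functions\<close>

definition unit_measure :: "real measure" where "unit_measure = restrict_space lborel {0..<1}"

lemma space_unit_measure [simp]: "space unit_measure = {0..<1}"
  by (simp add: unit_measure_def space_restrict_space)

lemma prob_unit_measure [simp]: "emeasure unit_measure {0..<1} = 1"
  by (simp add: unit_measure_def emeasure_restrict_space)

lemma space_unit_measure_sets [simp]: "{0..<1} \<in> sets unit_measure"
  using sets.top[of unit_measure] by simp

interpretation unit_measure: finite_measure unit_measure
  by standard simp

interpretation unit_cube: product_sigma_finite "\<lambda>_::nat. unit_measure"
  by standard

lemma cube_measure_eq: "cube_measure s = PiM {1..s} (\<lambda>_. unit_measure)"
  by (simp add: cube_measure_def unit_measure_def)

lemma space_cube: "space (cube_measure s) = half_open_cube s"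
  by (simp add: cube_measure_eq space_PiM half_open_cube_def)

lemma emeasure_cube: "emeasure (cube_measure s) (space (cube_measure s)) = 1"
  unfolding cube_measure_eq space_PiM by (subst unit_cube.emeasure_PiM) auto

lemma finite_measure_cube: "finite_measure (cube_measure s)"
  by standard (simp add: emeasure_cube)

lemma cube_integral_prod:
  fixes f :: "nat \<Rightarrow> real \<Rightarrow> real"
  assumes u: "u \<subseteq> {1..s}" and f: "\<And>l. l \<in> u \<Longrightarrow> integrable unit_measure (f l)"
  shows "integrable (cube_measure s) (\<lambda>x. \<Prod>l\<in>u. f l (x l))"
    "(LINT x|cube_measure s. (\<Prod>l\<in>u. f l (x l))) = (\<Prod>l\<in>u. LINT t|unit_measure. f l t)"
proof -
  let ?f = "\<lambda>l. if l \<in> u then f l else (\<lambda>_. 1)"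
  have i: "integrable unit_measure (?f l)" for l using f by auto
  have eq: "(\<Prod>l\<in>u. f l (x l)) = (\<Prod>l\<in>{1..s}. ?f l (x l))" for x
    using u by (intro prod.mono_neutral_cong_left) auto
  show "integrable (cube_measure s) (\<lambda>x. \<Prod>l\<in>u. f l (x l))"
    unfolding eq cube_measure_eq by (rule unit_cube.product_integrable_prod) (use i in auto)
  have "(LINT x|cube_measure s. (\<Prod>l\<in>u. f l (x l))) = (\<Prod>l\<in>{1..s}. LINT t|unit_measure. ?f l t)"
    unfolding eq cube_measure_eq by (rule unit_cube.product_integral_prod) (use i in auto)
  also have "\<dots> = (\<Prod>l\<in>u. LINT t|unit_measure. f l t)"
    using u prob_unit_measure by (intro prod.mono_neutral_cong_right) (auto simp: measure_def)
  finally show "(LINT x|cube_measure s. (\<Prod>l\<in>u. f l (x l))) = (\<Prod>l\<in>u. LINT t|unit_measure. f l t)" .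
qed

definition grid_point :: "nat \<Rightarrow> nat \<Rightarrow> (nat \<Rightarrow> nat) \<Rightarrow> nat \<Rightarrow> real" where
  "grid_point s N g = (\<lambda>j\<in>{1..s}. real (g j) / real N)"

definition grid_index :: "nat \<Rightarrow> nat \<Rightarrow> (nat \<Rightarrow> real) \<Rightarrow> nat \<Rightarrow> nat" where
  "grid_index s N x = (\<lambda>j\<in>{1..s}. nat \<lfloor>x j * real N\<rfloor>)"

lemma grid_index_mem: "x \<in> half_open_cube s \<Longrightarrow> N > 0 \<Longrightarrow> grid_index s N x \<in> {1..s} \<rightarrow>\<^sub>E {..<N}"
  unfolding half_open_cube_def grid_index_def
  by (auto simp: PiE_iff nat_less_iff floor_less_iff)

lemma grid_point_mem: "g \<in> {1..s} \<rightarrow>\<^sub>E {..<N} \<Longrightarrow> grid_point s N g \<in> half_open_cube s"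
  unfolding half_open_cube_def grid_point_def by (auto simp: PiE_iff)

lemma floor_eq_cell:
  assumes "N > 0" "0 \<le> t"
  shows "nat \<lfloor>t * real N\<rfloor> = c \<longleftrightarrow> t \<in> {real c / real N..<real (Suc c) / real N}"
proof -
  have "nat \<lfloor>t * real N\<rfloor> = c \<longleftrightarrow> \<lfloor>t * real N\<rfloor> = int c" using assms by auto
  also have "\<dots> \<longleftrightarrow> t \<in> {real c / real N..<real (Suc c) / real N}"
    using assms by (auto simp: floor_eq_iff field_simps)
  finally show ?thesis .
qed

definition cell :: "nat \<Rightarrow> nat \<Rightarrow> real set" where
  "cell N c = {real c / real N..<real (Suc c) / real N}"

lemma cell_unit_measure:
  assumes "c < N"
  shows "cell N c \<in> sets unit_measure" "emeasure unit_measure (cell N c) = ennreal (1 / real N)" "cell N c \<subseteq> {0..<1}"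
proof -
  have le: "real (Suc c) / real N \<le> 1" using assms by simp
  have "0 \<le> real c / real N" by simp
  then show s: "cell N c \<subseteq> {0..<1}" unfolding cell_def using le
    by (intro subsetI) (simp only: atLeastLessThan_iff, linarith)
  then show "cell N c \<in> sets unit_measure"
    unfolding unit_measure_def sets_restrict_space
    by (intro image_eqI[of _ _ "cell N c"]) (blast, simp add: cell_def)
  have "emeasure unit_measure (cell N c) = emeasure lborel (cell N c)"
    unfolding unit_measure_def using s by (intro emeasure_restrict_space) auto
  also have "\<dots> = ennreal (1 / real N)"
    unfolding cell_def by (subst emeasure_lborel_Ico) (auto simp: divide_right_mono diff_divide_distrib[symmetric])
  finally show "emeasure unit_measure (cell N c) = ennreal (1 / real N)" .
qed

lemma step_integral_unit_measure:
  fixes h :: "nat \<Rightarrow> real"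
  assumes N: "N > 0"
  shows "integrable unit_measure (\<lambda>t. h (nat \<lfloor>t * real N\<rfloor>))"
    "(LINT t|unit_measure. h (nat \<lfloor>t * real N\<rfloor>)) = (\<Sum>c<N. h c) / real N"
proof -
  have eq: "h (nat \<lfloor>t * real N\<rfloor>) = (\<Sum>c<N. h c * indicator (cell N c) t)" if t: "t \<in> space unit_measure" for t
  proof -
    let ?c = "nat \<lfloor>t * real N\<rfloor>"
    have "?c < N" using t N by (auto simp: nat_less_iff floor_less_iff)
    moreover have "t \<in> cell N c \<longleftrightarrow> c = ?c" for c
      using floor_eq_cell[OF N, of t c] t by (auto simp: cell_def)
    ultimately show ?thesis by (simp add: indicator_def)
  qed
  have i: "integrable unit_measure (indicator (cell N c) :: real \<Rightarrow> real)" if "c < N" for c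
    using cell_unit_measure[OF that] by (intro integrable_real_indicator) auto
  have m: "measure unit_measure (cell N c) = 1 / real N" if "c < N" for c
    using cell_unit_measure[OF that] by (simp add: measure_def)
  show "integrable unit_measure (\<lambda>t. h (nat \<lfloor>t * real N\<rfloor>))"
    by (subst Bochner_Integration.integrable_cong[OF refl eq], assumption) (intro Bochner_Integration.integrable_sum integrable_mult_right i, simp)
  have "(LINT t|unit_measure. h (nat \<lfloor>t * real N\<rfloor>)) = (LINT t|unit_measure. (\<Sum>c<N. h c * indicator (cell N c) t))"
    by (rule Bochner_Integration.integral_cong[OF refl eq])
  also have "\<dots> = (\<Sum>c<N. h c * measure unit_measure (cell N c))"
    using i cell_unit_measure by (subst Bochner_Integration.integral_sum) (auto simp: Int_absorb2)
  also have "\<dots> = (\<Sum>c<N. h c) / real N" by (simp add: m sum_divide_distrib)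
  finally show "(LINT t|unit_measure. h (nat \<lfloor>t * real N\<rfloor>)) = (\<Sum>c<N. h c) / real N" .
qed

lemma step_integral_cube:
  fixes h :: "(nat \<Rightarrow> nat) \<Rightarrow> real"
  assumes N: "N > 0"
  shows "integrable (cube_measure s) (\<lambda>x. h (grid_index s N x))"
    "(LINT x|cube_measure s. h (grid_index s N x)) = (\<Sum>g\<in>{1..s} \<rightarrow>\<^sub>E {..<N}. h g) / real N ^ s"
proof -
  let ?G = "{1..s} \<rightarrow>\<^sub>E {..<N}" and ?C = "\<lambda>g. PiE {1..s} (\<lambda>j. cell N (g j))"
  have fin: "finite ?G" by (intro finite_PiE) auto
  have eq: "h (grid_index s N x) = (\<Sum>g\<in>?G. h g * indicator (?C g) x)" if x: "x \<in> space (cube_measure s)" for x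
  proof -
    have xc: "x \<in> {1..s} \<rightarrow>\<^sub>E {0..<1}" using x by (simp add: space_cube half_open_cube_def)
    have "x \<in> ?C g \<longleftrightarrow> grid_index s N x = g" if g: "g \<in> ?G" for g
    proof -
      have "x \<in> ?C g \<longleftrightarrow> (\<forall>j\<in>{1..s}. x j \<in> cell N (g j))" using xc by (auto simp: PiE_iff)
      also have "\<dots> \<longleftrightarrow> (\<forall>j\<in>{1..s}. nat \<lfloor>x j * real N\<rfloor> = g j)"
        using floor_eq_cell[OF N] xc by (auto simp: cell_def PiE_iff)
      also have "\<dots> \<longleftrightarrow> grid_index s N x = g"
        using g by (auto simp: grid_index_def fun_eq_iff PiE_iff extensional_def)
      finally show ?thesis .
    qed
    then have "(\<Sum>g\<in>?G. h g * indicator (?C g) x) = (\<Sum>g\<in>?G. if grid_index s N x = g then h g else 0)"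
      by (intro sum.cong refl) (auto simp: indicator_def)
    also have "\<dots> = h (grid_index s N x)"
      using grid_index_mem[of x s N] x N fin by (simp add: space_cube)
    finally show ?thesis ..
  qed
  have C: "?C g \<in> sets (cube_measure s)" "emeasure (cube_measure s) (?C g) = ennreal ((1 / real N) ^ s)"
    if "g \<in> ?G" for g
  proof -
    have l: "g j < N" if "j \<in> {1..s}" for j using \<open>g \<in> ?G\<close> that by auto
    show "?C g \<in> sets (cube_measure s)"
      unfolding cube_measure_eq by (intro sets_PiM_I_finite) (use l cell_unit_measure in auto)
    have "emeasure (cube_measure s) (?C g) = (\<Prod>j\<in>{1..s}. emeasure unit_measure (cell N (g j)))"
      unfolding cube_measure_eq by (rule unit_cube.emeasure_PiM) (use l cell_unit_measure in auto)
    also have "\<dots> = (\<Prod>j\<in>{1..s}. ennreal (1 / real N))" using l cell_unit_measure by (intro prod.cong) auto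
    finally show "emeasure (cube_measure s) (?C g) = ennreal ((1 / real N) ^ s)"
      by (simp add: ennreal_power)
  qed
  have m: "measure (cube_measure s) (?C g) = (1 / real N) ^ s" if "g \<in> ?G" for g
    using C[OF that] by (simp add: measure_def)
  have i: "integrable (cube_measure s) (indicator (?C g) :: _ \<Rightarrow> real)" if "g \<in> ?G" for g
    using C[OF that] by (intro integrable_real_indicator) auto
  show "integrable (cube_measure s) (\<lambda>x. h (grid_index s N x))"
    by (subst Bochner_Integration.integrable_cong[OF refl eq], assumption) (intro Bochner_Integration.integrable_sum integrable_mult_right i, simp)
  have "(LINT x|cube_measure s. h (grid_index s N x)) = (LINT x|cube_measure s. (\<Sum>g\<in>?G. h g * indicator (?C g) x))"
    by (rule Bochner_Integration.integral_cong[OF refl eq])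
  also have "\<dots> = (\<Sum>g\<in>?G. h g * measure (cube_measure s) (?C g))"
  proof (subst Bochner_Integration.integral_sum)
    show "(\<Sum>g\<in>?G. LINT x|cube_measure s. h g * indicator (?C g) x) = (\<Sum>g\<in>?G. h g * measure (cube_measure s) (?C g))"
      using C(1)[THEN sets.sets_into_space] by (intro sum.cong refl) (simp add: Int_absorb2)
  qed (use i in auto)
  also have "\<dots> = (\<Sum>g\<in>?G. h g) / real N ^ s"
    unfolding sum_divide_distrib
    by (rule sum.cong[OF refl]) (simp only: m power_one_over times_divide_eq_right mult_1_right)
  finally show "(LINT x|cube_measure s. h (grid_index s N x)) = (\<Sum>g\<in>?G. h g) / real N ^ s" .
qed

lemma sobolev_kernel_sob:
  "sobolev_kernel s \<alpha> \<gamma> x y = (\<Sum>u\<in>Pow {1..s}. \<gamma> u * (\<Prod>j\<in>u. sob \<alpha> (x j) (y j)))"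
  by (simp only: sobolev_kernel_def sob_sobolev)

lemma grid_average_prod:
  fixes F :: "nat \<Rightarrow> nat \<Rightarrow> real"
  assumes u: "u \<subseteq> {1..s}" and N: "N > 0"
  shows "(\<Sum>g\<in>{1..s} \<rightarrow>\<^sub>E {..<N}. \<Prod>l\<in>u. F l (g l)) / real N ^ s = (\<Prod>l\<in>u. (\<Sum>a<N. F l a) / real N)"
proof -
  let ?F = "\<lambda>l a. if l \<in> u then F l a else 1"
  have "(\<Prod>l\<in>u. F l (g l)) = (\<Prod>l\<in>{1..s}. ?F l (g l))" for g
    using u by (intro prod.mono_neutral_cong_left) auto
  then have "(\<Sum>g\<in>{1..s} \<rightarrow>\<^sub>E {..<N}. \<Prod>l\<in>u. F l (g l)) = (\<Sum>g\<in>{1..s} \<rightarrow>\<^sub>E {..<N}. \<Prod>l\<in>{1..s}. ?F l (g l))"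
    by (simp only:)
  also have "\<dots> = (\<Prod>l\<in>{1..s}. \<Sum>a<N. ?F l a)"
    by (rule prod_sum_PiE[symmetric]) auto
  also have "\<dots> / real N ^ s = (\<Prod>l\<in>{1..s}. (\<Sum>a<N. ?F l a) / real N)"
    by (simp add: prod_dividef)
  also have "\<dots> = (\<Prod>l\<in>u. (\<Sum>a<N. F l a) / real N)"
    using u N by (intro prod.mono_neutral_cong_right) auto
  finally show ?thesis .
qed

lemma grid_point_component: "l \<in> {1..s} \<Longrightarrow> grid_point s N g l = real (g l) / real N"
  by (simp add: grid_point_def)

lemma cube_component: "x \<in> half_open_cube s \<Longrightarrow> l \<in> {1..s} \<Longrightarrow> x l \<in> {0..<1}"
  by (auto simp: half_open_cube_def)

lemma cube_component': "x \<in> half_open_cube s \<Longrightarrow> l \<in> {1..s} \<Longrightarrow> x l \<in> {0..1}"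
  using cube_component[of x s l] by auto

definition pair_avg :: "nat \<Rightarrow> nat \<Rightarrow> (nat \<Rightarrow> (nat \<Rightarrow> real)) \<Rightarrow> nat set \<Rightarrow> real" where
  "pair_avg \<alpha> B P u = (\<Sum>i<B. \<Sum>i'<B. \<Prod>l\<in>u. sob \<alpha> (P i l) (P i' l)) / (real B)\<^sup>2"

text \<open>What remains of the squared error when the integrals have dropped out: for nonempty
  \<open>u\<close> the terms containing an integral of the kernel vanish, and for empty
  \<open>u\<close> the three kinds of terms cancel as \<open>1 - 2 + 1\<close>.\<close>

definition err_form :: "nat \<Rightarrow> nat \<Rightarrow> (nat set \<Rightarrow> real) \<Rightarrow> nat \<Rightarrow> (nat \<Rightarrow> (nat \<Rightarrow> real)) \<Rightarrow> real" where
  "err_form s \<alpha> \<gamma> B P = (\<Sum>u\<in>Pow {1..s} - {{}}. \<gamma> u * pair_avg \<alpha> B P u)"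

lemma sob_grid_average:
  assumes "\<alpha> \<ge> 1" "\<And>n. y n \<in> {0..1}"
  shows "(\<lambda>n. (\<Sum>a<Suc n. sob \<alpha> (real a / real (Suc n)) (y n)) / real (Suc n)) \<longlonglongrightarrow> 0"
proof (rule LIMSEQ_I)
  fix r :: real assume "0 < r"
  then obtain N0 where N0: "\<forall>N\<ge>N0. \<forall>y\<in>{0..1}. \<bar>(\<Sum>a<N. sob \<alpha> (real a / real N) y) / real N\<bar> \<le> r / 2"
    using sob_riemann[of "r / 2" \<alpha>] assms(1) by auto
  show "\<exists>no. \<forall>n\<ge>no. norm ((\<Sum>a<Suc n. sob \<alpha> (real a / real (Suc n)) (y n)) / real (Suc n) - 0) < r"
  proof (intro exI allI impI)
    fix n assume "N0 \<le> n"
    then have "\<bar>(\<Sum>a<Suc n. sob \<alpha> (real a / real (Suc n)) (y n)) / real (Suc n)\<bar> \<le> r / 2"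
      using N0 assms(2)[of n] le_SucI by blast
    then show "norm ((\<Sum>a<Suc n. sob \<alpha> (real a / real (Suc n)) (y n)) / real (Suc n) - 0) < r"
      using \<open>0 < r\<close> by (simp only: real_norm_def diff_0_right)
  qed
qed

lemma sob_grid_average2:
  assumes "\<alpha> \<ge> 1"
  shows "(\<lambda>n. (\<Sum>a<Suc n. (\<Sum>a'<Suc n. sob \<alpha> (real a' / real (Suc n)) (real a / real (Suc n))) / real (Suc n)) / real (Suc n)) \<longlonglongrightarrow> 0"
proof (rule LIMSEQ_I)
  fix r :: real assume "0 < r"
  then obtain N0 where N0: "\<forall>N\<ge>N0. \<forall>y\<in>{0..1}. \<bar>(\<Sum>a<N. sob \<alpha> (real a / real N) y) / real N\<bar> \<le> r / 2"
    using sob_riemann[of "r / 2" \<alpha>] assms(1) by auto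
  show "\<exists>no. \<forall>n\<ge>no. norm ((\<Sum>a<Suc n. (\<Sum>a'<Suc n. sob \<alpha> (real a' / real (Suc n)) (real a / real (Suc n))) / real (Suc n)) / real (Suc n) - 0) < r"
  proof (intro exI allI impI)
    fix n assume n: "N0 \<le> n"
    let ?A = "\<lambda>a. (\<Sum>a'<Suc n. sob \<alpha> (real a' / real (Suc n)) (real a / real (Suc n))) / real (Suc n)"
    have "\<bar>?A a\<bar> \<le> r / 2" if "a < Suc n" for a
    proof -
      have "real a / real (Suc n) \<in> {0..1}" using that by simp
      then show ?thesis using N0 n le_SucI by blast
    qed
    then have "\<bar>\<Sum>a<Suc n. ?A a\<bar> \<le> (\<Sum>a<Suc n. r / 2)"
      by (intro order_trans[OF sum_abs sum_mono]) auto
    then have "\<bar>\<Sum>a<Suc n. ?A a\<bar> / real (Suc n) \<le> (\<Sum>a<Suc n. r / 2) / real (Suc n)"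
      by (rule divide_right_mono) simp
    also have "\<dots> = r / 2" by (simp add: field_simps)
    also have "\<dots> < r" using \<open>0 < r\<close> by simp
    finally show "norm ((\<Sum>a<Suc n. ?A a) / real (Suc n) - 0) < r"
      by (simp only: real_norm_def diff_0_right abs_divide abs_of_nat)
  qed
qed

locale sobolev_rkhs =
  fixes s \<alpha> :: nat and \<gamma> H ip
  assumes rk: "rkhs (half_open_cube s) (sobolev_kernel s \<alpha> \<gamma>) H ip" and alpha: "\<alpha> \<ge> 1"
begin

sublocale rkhs "half_open_cube s" "sobolev_kernel s \<alpha> \<gamma>" H ip
  by (rule rk)

lemma H_bounded:
  assumes f: "f \<in> H"
  shows "\<exists>C. \<forall>x\<in>half_open_cube s. \<bar>f x\<bar> \<le> C"
proof -
  obtain C where C': "C \<ge> 0" "\<forall>x\<in>{0..1}. \<forall>y\<in>{0..1}. \<bar>sob \<alpha> x y\<bar> \<le> C"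
    using sob_bounded[of \<alpha>] by blast
  have C: "\<bar>sob \<alpha> x y\<bar> \<le> C" if "x \<in> {0..1}" "y \<in> {0..1}" for x y
    using C'(2) that by blast
  let ?K = "\<Sum>u\<in>Pow {1..s}. \<bar>\<gamma> u\<bar> * C ^ card u"
  have "\<bar>f x\<bar> \<le> sqrt (ip f f * ?K)" if x: "x \<in> half_open_cube s" for x
  proof -
    have "sobolev_kernel s \<alpha> \<gamma> x x \<le> ?K"
      unfolding sobolev_kernel_sob
    proof (intro sum_mono)
      fix u assume u: "u \<in> Pow {1..s}"
      have "\<bar>\<Prod>j\<in>u. sob \<alpha> (x j) (x j)\<bar> \<le> (\<Prod>j\<in>u. C)"
        unfolding abs_prod using u x by (intro prod_mono conjI C cube_component') auto
      then have "\<bar>\<gamma> u\<bar> * \<bar>\<Prod>j\<in>u. sob \<alpha> (x j) (x j)\<bar> \<le> \<bar>\<gamma> u\<bar> * C ^ card u"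
        by (intro mult_left_mono) auto
      then show "\<gamma> u * (\<Prod>j\<in>u. sob \<alpha> (x j) (x j)) \<le> \<bar>\<gamma> u\<bar> * C ^ card u"
        by (metis abs_ge_self abs_mult order_trans)
    qed
    then have "(f x)\<^sup>2 \<le> ip f f * ?K"
      using eval_bound[OF f x] mult_left_mono[OF _ ip_nonneg[OF f]] order_trans by blast
    then show ?thesis by (intro real_le_rsqrt) (simp only: power2_abs)
  qed
  then show ?thesis by blast
qed

lemma grid_point_tendsto:
  assumes "l \<in> {1..s}" "x \<in> half_open_cube s"
  shows "(\<lambda>n. grid_point s (Suc n) (grid_index s (Suc n) x) l) \<longlonglongrightarrow> x l"
proof -
  have "\<bar>grid_point s (Suc n) (grid_index s (Suc n) x) l - x l\<bar> \<le> 1 / real (Suc n)" for n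
  proof -
    have x0: "0 \<le> x l" using cube_component[OF assms(2,1)] by simp
    then have "real (nat \<lfloor>x l * real (Suc n)\<rfloor>) = real_of_int \<lfloor>x l * real (Suc n)\<rfloor>"
      by (intro of_nat_nat) simp
    then have e: "grid_point s (Suc n) (grid_index s (Suc n) x) l - x l
        = (real_of_int \<lfloor>x l * real (Suc n)\<rfloor> - x l * real (Suc n)) / real (Suc n)"
      using assms(1) by (simp add: grid_point_def grid_index_def field_simps del: of_nat_Suc)
    have "\<bar>real_of_int \<lfloor>x l * real (Suc n)\<rfloor> - x l * real (Suc n)\<bar> \<le> 1" by linarith
    then show ?thesis unfolding e abs_divide abs_of_nat by (rule divide_right_mono) simp
  qed
  then have "(\<lambda>n. grid_point s (Suc n) (grid_index s (Suc n) x) l - x l) \<longlonglongrightarrow> 0"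
    by (intro Lim_null_comparison[OF always_eventually LIMSEQ_inverse_real_of_nat]) (simp add: inverse_eq_divide)
  then show ?thesis by (simp only: LIM_zero_iff)
qed

text \<open>Continuity of the elements of \<open>H\<close> is inherited from the kernel: by
  \<open>diff_bound\<close> the squared increment of \<open>f\<close> is at most
  \<open>ip f f\<close> times a second difference of the kernel, which tends to 0.\<close>

lemma H_grid_tendsto:
  assumes f: "f \<in> H" and x: "x \<in> half_open_cube s"
  shows "(\<lambda>n. f (grid_point s (Suc n) (grid_index s (Suc n) x))) \<longlonglongrightarrow> f x"
proof -
  let ?x = "\<lambda>n. grid_point s (Suc n) (grid_index s (Suc n) x)" and ?K = "sobolev_kernel s \<alpha> \<gamma>"
  have xn: "?x n \<in> half_open_cube s" for n
    by (intro grid_point_mem grid_index_mem x) simp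
  have sob_t: "(\<lambda>n. sob \<alpha> (a n) (b n)) \<longlonglongrightarrow> sob \<alpha> a' b'" if "a \<longlonglongrightarrow> a'" "b \<longlonglongrightarrow> b'" for a b a' b'
  proof -
    have "continuous_on UNIV (\<lambda>z. sob \<alpha> (fst z) (snd z))" by (intro continuous_intros)
    then have "isCont (\<lambda>z. sob \<alpha> (fst z) (snd z)) (a', b')" by (simp add: continuous_on_eq_continuous_at)
    from isCont_tendsto_compose[OF this tendsto_Pair[OF that]] show ?thesis by simp
  qed
  have K_t: "(\<lambda>n. ?K (a n) (b n)) \<longlonglongrightarrow> ?K x x"
    if "\<And>l. l \<in> {1..s} \<Longrightarrow> (\<lambda>n. a n l) \<longlonglongrightarrow> x l" "\<And>l. l \<in> {1..s} \<Longrightarrow> (\<lambda>n. b n l) \<longlonglongrightarrow> x l" for a b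
    unfolding sobolev_kernel_sob
    by (intro tendsto_sum tendsto_mult tendsto_const tendsto_prod sob_t that) auto
  have "(\<lambda>n. ip f f * (?K (?x n) (?x n) - ?K (?x n) x - ?K x (?x n) + ?K x x)) \<longlonglongrightarrow>
      ip f f * (?K x x - ?K x x - ?K x x + ?K x x)"
    by (intro tendsto_mult tendsto_const tendsto_add tendsto_diff K_t grid_point_tendsto x)
  then have lim: "(\<lambda>n. ip f f * (?K (?x n) (?x n) - ?K (?x n) x - ?K x (?x n) + ?K x x)) \<longlonglongrightarrow> 0"
    by simp
  have "(\<lambda>n. (f (?x n) - f x)\<^sup>2) \<longlonglongrightarrow> 0"
  proof (rule Lim_null_comparison[OF _ lim])
    show "\<forall>\<^sub>F n in sequentially. norm ((f (?x n) - f x)\<^sup>2)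
        \<le> ip f f * (?K (?x n) (?x n) - ?K (?x n) x - ?K x (?x n) + ?K x x)"
      using diff_bound[OF f xn x] by (intro always_eventually allI) (simp only: real_norm_def abs_power2)
  qed
  then have "(\<lambda>n. sqrt ((f (?x n) - f x)\<^sup>2)) \<longlonglongrightarrow> sqrt 0" by (rule tendsto_real_sqrt)
  then have "(\<lambda>n. f (?x n) - f x) \<longlonglongrightarrow> 0" by (simp add: tendsto_rabs_zero_iff)
  then show ?thesis by (simp only: LIM_zero_iff)
qed

text \<open>The step functions on the left converge pointwise to \<open>f\<close> and are uniformly
  bounded. This yields the measurability of \<open>f\<close> and, by dominated convergence,
  expresses integration as a limit of finite combinations of point evaluations.\<close>

lemma H_integral:
  assumes f: "f \<in> H"
  shows "(\<lambda>n. (\<Sum>g\<in>{1..s} \<rightarrow>\<^sub>E {..<Suc n}. f (grid_point s (Suc n) g)) / real (Suc n) ^ s)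
    \<longlonglongrightarrow> (LINT x|cube_measure s. f x)"
proof -
  obtain C where C: "\<And>x. x \<in> half_open_cube s \<Longrightarrow> \<bar>f x\<bar> \<le> C" using H_bounded[OF f] by blast
  interpret finite_measure "cube_measure s" by (rule finite_measure_cube)
  have i: "integrable (cube_measure s) (\<lambda>x. f (grid_point s (Suc n) (grid_index s (Suc n) x)))" for n
    by (rule step_integral_cube(1)[where h = "\<lambda>g. f (grid_point s (Suc n) g)"]) simp
  have lim: "(\<lambda>n. f (grid_point s (Suc n) (grid_index s (Suc n) x))) \<longlonglongrightarrow> f x" if "x \<in> space (cube_measure s)" for x
    using H_grid_tendsto[OF f] that by (simp add: space_cube)
  have m: "f \<in> borel_measurable (cube_measure s)"
  proof (rule borel_measurable_LIMSEQ_real[where u = "\<lambda>n x. f (grid_point s (Suc n) (grid_index s (Suc n) x))"])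
    show "(\<lambda>x. f (grid_point s (Suc n) (grid_index s (Suc n) x))) \<in> borel_measurable (cube_measure s)" for n
      using i by (rule borel_measurable_integrable)
  qed (rule lim)
  have "(\<lambda>n. LINT x|cube_measure s. f (grid_point s (Suc n) (grid_index s (Suc n) x))) \<longlonglongrightarrow> (LINT x|cube_measure s. f x)"
  proof (rule integral_dominated_convergence[where w = "\<lambda>_. C"])
    show "AE x in cube_measure s. (\<lambda>n. f (grid_point s (Suc n) (grid_index s (Suc n) x))) \<longlonglongrightarrow> f x"
      using lim by (intro AE_I2)
    show "AE x in cube_measure s. norm (f (grid_point s (Suc n) (grid_index s (Suc n) x))) \<le> C" for n
      using C grid_point_mem grid_index_mem by (intro AE_I2) (simp add: space_cube)
  qed (use m i in auto)
  moreover have "(LINT x|cube_measure s. f (grid_point s (Suc n) (grid_index s (Suc n) x)))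
      = (\<Sum>g\<in>{1..s} \<rightarrow>\<^sub>E {..<Suc n}. f (grid_point s (Suc n) g)) / real (Suc n) ^ s" for n
    by (rule step_integral_cube(2)[where h = "\<lambda>g. f (grid_point s (Suc n) g)"]) simp
  ultimately show ?thesis by (simp only:)
qed

text \<open>The index set is the disjoint union of the grid, with positive weights of sum 1, and the
  net, with weights \<open>- 1 / real B\<close>. The functional is therefore a grid average minus
  the net average. Terms involving the grid factorise over the coordinates into Riemann sums of
  \<open>sob\<close>, which tend to 0.\<close>

lemma quad_limit:
  assumes B: "B > 0" and P: "\<And>n. n < B \<Longrightarrow> P n \<in> half_open_cube s"
  defines "I \<equiv> \<lambda>n. ({1..s} \<rightarrow>\<^sub>E {..<Suc n}) <+> {..<B}"
    and "c \<equiv> \<lambda>n. case_sum (\<lambda>g::nat\<Rightarrow>nat. 1 / real (Suc n) ^ s) (\<lambda>i::nat. - 1 / real B)"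
    and "x \<equiv> \<lambda>n. case_sum (grid_point s (Suc n)) P"
  shows "(\<lambda>n. \<Sum>i\<in>I n. \<Sum>j\<in>I n. c n i * c n j * sobolev_kernel s \<alpha> \<gamma> (x n i) (x n j)) \<longlonglongrightarrow> err_form s \<alpha> \<gamma> B P"
proof -
  let ?G = "\<lambda>n. {1..s} \<rightarrow>\<^sub>E {..<Suc n}"
  let ?p = "\<lambda>u x y. \<Prod>l\<in>u. sob \<alpha> (x (l::nat)) (y l)"
  let ?N = "\<lambda>n. real (Suc n) ^ s"
  have fin: "finite (?G n)" for n by (intro finite_PiE) auto
  have sym: "sob \<alpha> x y = sob \<alpha> y x" for x y
    by (simp add: sob_def mult.commute abs_minus_commute)
  define gg where "gg = (\<lambda>n u. (\<Sum>g\<in>?G n. (\<Sum>g'\<in>?G n. ?p u (grid_point s (Suc n) g') (grid_point s (Suc n) g)) / ?N n) / ?N n)"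
  define gp where "gp = (\<lambda>n u i. (\<Sum>g\<in>?G n. ?p u (grid_point s (Suc n) g) (P i)) / ?N n)"
  have split: "(\<Sum>i\<in>I n. \<Sum>j\<in>I n. c n i * c n j * sobolev_kernel s \<alpha> \<gamma> (x n i) (x n j))
    = (\<Sum>u\<in>Pow {1..s}. \<gamma> u * (gg n u - 2 * (\<Sum>i<B. gp n u i) / real B + pair_avg \<alpha> B P u))" for n
  proof -
    have "(\<Sum>i\<in>I n. \<Sum>j\<in>I n. c n i * c n j * sobolev_kernel s \<alpha> \<gamma> (x n i) (x n j))
      = (\<Sum>i\<in>I n. \<Sum>j\<in>I n. \<Sum>u\<in>Pow {1..s}. \<gamma> u * (c n i * c n j * ?p u (x n i) (x n j)))"
      by (simp add: sobolev_kernel_sob sum_distrib_left mult_ac)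
    also have "\<dots> = (\<Sum>i\<in>I n. \<Sum>u\<in>Pow {1..s}. \<Sum>j\<in>I n. \<gamma> u * (c n i * c n j * ?p u (x n i) (x n j)))"
      by (intro sum.cong[OF refl] sum.swap)
    also have "\<dots> = (\<Sum>u\<in>Pow {1..s}. \<Sum>i\<in>I n. \<Sum>j\<in>I n. \<gamma> u * (c n i * c n j * ?p u (x n i) (x n j)))"
      by (rule sum.swap)
    also have "\<dots> = (\<Sum>u\<in>Pow {1..s}. \<gamma> u * (\<Sum>i\<in>I n. \<Sum>j\<in>I n. c n i * c n j * ?p u (x n i) (x n j)))"
      by (simp only: sum_distrib_left)
    also have "\<dots> = (\<Sum>u\<in>Pow {1..s}. \<gamma> u * (gg n u - 2 * (\<Sum>i<B. gp n u i) / real B + pair_avg \<alpha> B P u))"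
    proof (intro sum.cong[OF refl] arg_cong2[where f = "(*)"] refl)
      fix u
      have psym: "?p u x y = ?p u y x" for x y by (rule prod.cong[OF refl], rule sym)
      have 1: "(\<Sum>g\<in>?G n. \<Sum>g'\<in>?G n. 1 / ?N n * (1 / ?N n) * ?p u (grid_point s (Suc n) g) (grid_point s (Suc n) g')) = gg n u"
        unfolding gg_def sum_divide_distrib by (subst sum.swap) (intro sum.cong refl, simp)
      have 2: "(\<Sum>g\<in>?G n. \<Sum>i<B. 1 / ?N n * (- 1 / real B) * ?p u (grid_point s (Suc n) g) (P i)) = - (\<Sum>i<B. gp n u i) / real B"
        unfolding gp_def sum_divide_distrib sum_negf[symmetric]
        by (subst sum.swap) (intro sum.cong refl, simp)
      have 3: "(\<Sum>i<B. \<Sum>g\<in>?G n. (- 1 / real B) * (1 / ?N n) * ?p u (P i) (grid_point s (Suc n) g)) = - (\<Sum>i<B. gp n u i) / real B"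
        unfolding gp_def sum_divide_distrib sum_negf[symmetric]
        by (intro sum.cong refl) (subst psym, simp)
      have 4: "(\<Sum>i<B. \<Sum>i'<B. (- 1 / real B) * (- 1 / real B) * ?p u (P i) (P i')) = pair_avg \<alpha> B P u"
        unfolding pair_avg_def sum_divide_distrib
        by (intro sum.cong refl) (simp add: power2_eq_square)
      have "(\<Sum>i\<in>I n. \<Sum>j\<in>I n. c n i * c n j * ?p u (x n i) (x n j)) =
        ((\<Sum>g\<in>?G n. \<Sum>g'\<in>?G n. 1 / ?N n * (1 / ?N n) * ?p u (grid_point s (Suc n) g) (grid_point s (Suc n) g'))
        + (\<Sum>g\<in>?G n. \<Sum>i<B. 1 / ?N n * (- 1 / real B) * ?p u (grid_point s (Suc n) g) (P i)))
        + ((\<Sum>i<B. \<Sum>g\<in>?G n. (- 1 / real B) * (1 / ?N n) * ?p u (P i) (grid_point s (Suc n) g))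
        + (\<Sum>i<B. \<Sum>i'<B. (- 1 / real B) * (- 1 / real B) * ?p u (P i) (P i')))"
        unfolding I_def c_def x_def
        by (simp only: sum.Plus[OF fin finite_lessThan] comp_def sum.case sum.distrib)
      also have "\<dots> = gg n u - 2 * (\<Sum>i<B. gp n u i) / real B + pair_avg \<alpha> B P u"
        unfolding 1 2 3 4 by simp
      finally show "(\<Sum>i\<in>I n. \<Sum>j\<in>I n. c n i * c n j * ?p u (x n i) (x n j)) = gg n u - 2 * (\<Sum>i<B. gp n u i) / real B + pair_avg \<alpha> B P u" .
    qed
    finally show ?thesis .
  qed
  \<comment> \<open>The limit \<open>\<Prod>l\<in>u. 0\<close> is 1 for empty \<open>u\<close> and 0
    otherwise, so one formula covers both cases.\<close>
  have gp: "(\<lambda>n. gp n u i) \<longlonglongrightarrow> (\<Prod>l\<in>u. 0)" if u: "u \<in> Pow {1..s}" and i: "i < B" for u i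
  proof -
    have "gp n u i = (\<Prod>l\<in>u. (\<Sum>a<Suc n. sob \<alpha> (real a / real (Suc n)) (P i l)) / real (Suc n))" for n
    proof -
      have "gp n u i = (\<Sum>g\<in>?G n. \<Prod>l\<in>u. sob \<alpha> (real (g l) / real (Suc n)) (P i l)) / ?N n"
        unfolding gp_def using u
        by (intro arg_cong2[where f = "(/)"] sum.cong prod.cong refl) (subst grid_point_component, auto)
      then show ?thesis using grid_average_prod[of u s "Suc n" "\<lambda>l a. sob \<alpha> (real a / real (Suc n)) (P i l)"] u by simp
    qed
    moreover have "P i l \<in> {0..1}" if "l \<in> u" for l
      using cube_component'[OF P[OF i]] u that by auto
    ultimately show ?thesis
      by (simp only: tendsto_prod sob_grid_average alpha)
  qed
  have gg: "(\<lambda>n. gg n u) \<longlonglongrightarrow> (\<Prod>l\<in>u. 0)" if u: "u \<in> Pow {1..s}" for u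
  proof -
    have "gg n u = (\<Prod>l\<in>u. (\<Sum>a<Suc n. (\<Sum>a'<Suc n. sob \<alpha> (real a' / real (Suc n)) (real a / real (Suc n))) / real (Suc n)) / real (Suc n))" for n
    proof -
      have "(\<Sum>g'\<in>?G n. ?p u (grid_point s (Suc n) g') (grid_point s (Suc n) g)) / ?N n
        = (\<Prod>l\<in>u. (\<Sum>a'<Suc n. sob \<alpha> (real a' / real (Suc n)) (real (g l) / real (Suc n))) / real (Suc n))" for g
      proof -
        have "(\<Sum>g'\<in>?G n. ?p u (grid_point s (Suc n) g') (grid_point s (Suc n) g)) / ?N n
          = (\<Sum>g'\<in>?G n. \<Prod>l\<in>u. sob \<alpha> (real (g' l) / real (Suc n)) (real (g l) / real (Suc n))) / ?N n"
          using u by (intro arg_cong2[where f = "(/)"] sum.cong prod.cong refl arg_cong2[where f = "sob \<alpha>"] grid_point_component) auto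
        then show ?thesis
          using grid_average_prod[of u s "Suc n" "\<lambda>l a'. sob \<alpha> (real a' / real (Suc n)) (real (g l) / real (Suc n))"] u by simp
      qed
      then show ?thesis
        unfolding gg_def
        using grid_average_prod[of u s "Suc n" "\<lambda>l a. (\<Sum>a'<Suc n. sob \<alpha> (real a' / real (Suc n)) (real a / real (Suc n))) / real (Suc n)"] u
        by (simp only: Pow_iff zero_less_Suc)
    qed
    then show ?thesis by (simp only: tendsto_prod sob_grid_average2 alpha)
  qed
  have "(\<lambda>n. \<Sum>u\<in>Pow {1..s}. \<gamma> u * (gg n u - 2 * (\<Sum>i<B. gp n u i) / real B + pair_avg \<alpha> B P u)) \<longlonglongrightarrow>
    (\<Sum>u\<in>Pow {1..s}. \<gamma> u * ((\<Prod>l\<in>u. 0) - 2 * (\<Sum>i<B. (\<Prod>l\<in>u. 0)) / real B + pair_avg \<alpha> B P u))"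
    using B by (intro tendsto_sum tendsto_mult tendsto_add tendsto_diff tendsto_const tendsto_divide gp gg) auto
  also have "(\<Sum>u\<in>Pow {1..s}. \<gamma> u * ((\<Prod>l\<in>u. 0) - 2 * (\<Sum>i<B. (\<Prod>l\<in>u. 0)) / real B + pair_avg \<alpha> B P u)) = err_form s \<alpha> \<gamma> B P"
    unfolding err_form_def
  proof (rule sum.mono_neutral_cong_right)
    show "\<forall>u\<in>Pow {1..s} - (Pow {1..s} - {{}}). \<gamma> u * ((\<Prod>l\<in>u. 0) - 2 * (\<Sum>i<B. (\<Prod>l\<in>u. 0)) / real B + pair_avg \<alpha> B P u) = 0"
      using B by (auto simp: pair_avg_def power2_eq_square)
    fix u assume "u \<in> Pow {1..s} - {{}}"
    then have "finite u" "u \<noteq> {}" using finite_subset by auto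
    then have "(\<Prod>l\<in>u. 0::real) = 0" by auto
    then show "\<gamma> u * ((\<Prod>l\<in>u. 0) - 2 * (\<Sum>i<B. (\<Prod>l\<in>u. 0)) / real B + pair_avg \<alpha> B P u) = \<gamma> u * pair_avg \<alpha> B P u"
      by simp
  qed auto
  finally show ?thesis unfolding split .
qed

text \<open>For each grid size \<open>functional_bound\<close> estimates the difference of the two
  averages of \<open>f\<close> by the quadratic form \<open>q n\<close>; both sides converge.
  Nonnegativity of the limit is inherited from that of the forms.\<close>

lemma worst_case_error_bound:
  assumes B: "B > 0" and P: "\<And>n. n < B \<Longrightarrow> P n \<in> half_open_cube s"
  shows "(worst_case_error s H ip B P)\<^sup>2 \<le> ennreal (err_form s \<alpha> \<gamma> B P)"
    and "0 \<le> err_form s \<alpha> \<gamma> B P"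
proof -
  let ?Q = "err_form s \<alpha> \<gamma> B P"
  define I where "I = (\<lambda>n. ({1..s} \<rightarrow>\<^sub>E {..<Suc n}) <+> {..<B})"
  define c where "c = (\<lambda>n. case_sum (\<lambda>g::nat\<Rightarrow>nat. 1 / real (Suc n) ^ s) (\<lambda>i::nat. - 1 / real B))"
  define x where "x = (\<lambda>n. case_sum (grid_point s (Suc n)) P)"
  define q where "q = (\<lambda>n. \<Sum>i\<in>I n. \<Sum>j\<in>I n. c n i * c n j * sobolev_kernel s \<alpha> \<gamma> (x n i) (x n j))"
  have q: "q \<longlonglongrightarrow> ?Q"
    using quad_limit[OF B P] unfolding q_def I_def c_def x_def by simp
  have fin: "finite ({1..s} \<rightarrow>\<^sub>E {..<Suc n})" for n by (intro finite_PiE) auto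
  have finI: "finite (I n)" for n unfolding I_def using fin by simp
  have xI: "x n i \<in> half_open_cube s" if "i \<in> I n" for n i
    using that P grid_point_mem unfolding I_def x_def by auto
  have q0: "0 \<le> q n" for n
    unfolding q_def using functional_bound(2)[OF zero_mem finI xI] .
  show Q0: "0 \<le> ?Q" by (rule LIMSEQ_le_const[OF q]) (use q0 in blast)
  have main: "\<bar>(LINT x|cube_measure s. f x) - (1 / real B) * (\<Sum>n<B. f (P n))\<bar> \<le> sqrt ?Q"
    if f: "f \<in> H" "ip_norm ip f \<le> 1" for f
  proof -
    let ?a = "\<lambda>n. (\<Sum>g\<in>{1..s} \<rightarrow>\<^sub>E {..<Suc n}. f (grid_point s (Suc n) g)) / real (Suc n) ^ s - (1 / real B) * (\<Sum>n<B. f (P n))"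
    have ff: "ip f f \<le> 1" using f(2) by (simp add: ip_norm_def)
    have "(?a n)\<^sup>2 \<le> q n" for n
    proof -
      have "(\<Sum>i\<in>I n. c n i * f (x n i)) = ?a n"
        unfolding I_def c_def x_def
        unfolding sum.Plus[OF fin finite_lessThan] comp_def sum.case sum_divide_distrib sum_distrib_left
        by (simp add: sum_negf del: of_nat_Suc)
      then have "(?a n)\<^sup>2 \<le> ip f f * q n"
        using functional_bound(1)[where I = "I n" and x = "x n" and c = "c n", OF f(1) finI xI] unfolding q_def by simp
      also have "\<dots> \<le> 1 * q n" using ff q0 by (intro mult_right_mono)
      finally show ?thesis by simp
    qed
    moreover have "(\<lambda>n. (?a n)\<^sup>2) \<longlonglongrightarrow> ((LINT x|cube_measure s. f x) - (1 / real B) * (\<Sum>n<B. f (P n)))\<^sup>2"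
      by (intro tendsto_power tendsto_diff tendsto_const H_integral f)
    ultimately have "((LINT x|cube_measure s. f x) - (1 / real B) * (\<Sum>n<B. f (P n)))\<^sup>2 \<le> ?Q"
      using q by (intro LIMSEQ_le) auto
    then show ?thesis by (intro real_le_rsqrt) (simp only: power2_abs)
  qed
  have "worst_case_error s H ip B P \<le> ennreal (sqrt ?Q)"
    unfolding worst_case_error_def using main by (intro SUP_least ennreal_leI) auto
  then have "(worst_case_error s H ip B P)\<^sup>2 \<le> (ennreal (sqrt ?Q))\<^sup>2"
    by (intro power_mono) auto
  also have "\<dots> = ennreal ?Q" using Q0 by (simp add: ennreal_power)
  finally show "(worst_case_error s H ip B P)\<^sup>2 \<le> ennreal ?Q" .
qed

end

subsection \<open>Antiderivatives of Walsh functions\<close>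

context radix
begin

definition sin_const :: real where "sin_const = 1 / (2 * sin (pi / real b))"

lemma sin_pos: "0 < sin (pi / real b)"
proof (rule sin_gt_zero)
  show "pi / real b < pi" using b2 pi_gt_zero by (simp add: divide_less_eq)
qed simp

lemma sin_const_pos: "0 < sin_const"
  using sin_pos by (simp add: sin_const_def)

lemma norm_1_minus_cis: "norm (1 - cis t) = 2 * \<bar>sin (t / 2)\<bar>"
proof -
  have "(norm (1 - cis t))\<^sup>2 = (1 - cos t)\<^sup>2 + (sin t)\<^sup>2"
    by (simp add: cmod_power2)
  also have "\<dots> = 2 - 2 * cos t"
    using sin_cos_squared_add[of t] by (simp add: power2_eq_square algebra_simps)
  also have "\<dots> = (2 * \<bar>sin (t / 2)\<bar>)\<^sup>2"
    using cos_double_sin[of "t / 2"] by (simp add: power_mult_distrib)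
  finally show ?thesis by (rule power2_eq_imp_eq) simp_all
qed

text \<open>The modulus is \<open>2 * sin (pi * v / b)\<close>, and on the interval from
  \<open>pi / b\<close> to \<open>pi - pi / b\<close> the sine is least at the end points; for
  \<open>2 * v > b\<close> the argument is reflected to \<open>b - v\<close>.\<close>

lemma norm_1_minus_omega:
  assumes "1 \<le> v" "v < b"
  shows "2 * sin (pi / real b) \<le> norm (1 - omega ^ v)"
proof -
  have e: "norm (1 - omega ^ v) = 2 * \<bar>sin (pi * real v / real b)\<bar>"
  proof -
    have "real v * (2 * pi / real b) / 2 = pi * real v / real b" by simp
    then show ?thesis unfolding omega_def Complex.DeMoivre norm_1_minus_cis by (simp only:)
  qed
  have "sin (pi / real b) \<le> sin (pi * real v / real b)"
  proof (cases "2 * v \<le> b")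
    case True
    have "pi * real v / real b \<le> pi / 2"
    proof -
      have "2 * real v \<le> real b" using True by (metis of_nat_le_iff of_nat_mult of_nat_numeral)
      then have "real v / real b \<le> 1 / 2" by (simp add: field_simps)
      then have "pi * (real v / real b) \<le> pi * (1 / 2)" by (intro mult_left_mono) auto
      then show ?thesis by simp
    qed
    moreover have "pi / real b \<le> pi * real v / real b"
      using assms by (intro divide_right_mono) auto
    moreover have "- (pi / 2) \<le> pi / real b" by (rule order_trans[of _ 0]) auto
    ultimately show ?thesis by (intro sin_monotone_2pi_le) auto
  next
    case False
    have "sin (pi * real v / real b) = sin (pi * real (b - v) / real b)"
    proof -
      have "pi * real (b - v) / real b = pi - pi * real v / real b"
        using assms by (simp add: of_nat_diff field_simps)
      then show ?thesis by simp
    qed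
    moreover have "sin (pi / real b) \<le> sin (pi * real (b - v) / real b)"
    proof -
      have "pi * real (b - v) / real b \<le> pi / 2"
      proof -
        have "2 * real (b - v) \<le> real b" using False by linarith
        then have "real (b - v) / real b \<le> 1 / 2" by (simp add: field_simps)
        then have "pi * (real (b - v) / real b) \<le> pi * (1 / 2)" by (intro mult_left_mono) auto
        then show ?thesis by simp
      qed
      moreover have "pi / real b \<le> pi * real (b - v) / real b"
        using assms by (intro divide_right_mono) auto
      moreover have "- (pi / 2) \<le> pi / real b" by (rule order_trans[of _ 0]) auto
      ultimately show ?thesis by (intro sin_monotone_2pi_le) auto
    qed
    ultimately show ?thesis by simp
  qed
  then show ?thesis unfolding e by linarith
qed

text \<open>The factor of a geometric sum: integrating the top digit factor over consecutive cells
  adds up powers of \<open>omega ^ v\<close>.\<close>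

definition geom_const :: "nat \<Rightarrow> complex" where "geom_const v = 1 / (1 - omega ^ v)"

lemma omega_neq_1: "1 \<le> v \<Longrightarrow> v < b \<Longrightarrow> omega ^ v \<noteq> 1"
  using norm_1_minus_omega[of v] sin_pos by auto

lemma geom_const_bound:
  assumes "1 \<le> v" "v < b"
  shows "norm (geom_const v) \<le> sin_const"
  unfolding geom_const_def norm_divide sin_const_def norm_one
  using sin_pos norm_1_minus_omega[OF assms] by (intro divide_left_mono mult_pos_pos) auto

text \<open>Over the common denominator \<open>1 - omega ^ v\<close> the numerator is, up to sign, a
  convex combination of 1 and a root of unity, hence of modulus at most 1.\<close>

lemma geom_const_shift_bound:
  assumes v: "1 \<le> v" "v < b" and z: "0 \<le> z" "z \<le> 1"
  shows "norm (of_real z - geom_const v) \<le> norm (geom_const v)"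
proof -
  have n: "1 - omega ^ v \<noteq> 0" using omega_neq_1[OF v] by simp
  have "of_real z - geom_const v = - (of_real (1 - z) + of_real z * omega ^ v) / (1 - omega ^ v)"
    using n by (simp add: geom_const_def field_simps)
  moreover have "norm (of_real (1 - z) + of_real z * omega ^ v) \<le> 1"
    by (rule order_trans[OF norm_triangle_ineq]) (unfold norm_mult norm_of_real norm_power norm_omega, use z in simp)
  ultimately show ?thesis
    by (simp only: geom_const_def norm_divide norm_minus_cancel norm_one divide_right_mono norm_ge_zero)
qed

lemma half_geom_const_bound:
  assumes "1 \<le> v" "v < b"
  shows "norm (1 / 2 - geom_const v) \<le> sin_const"
  using geom_const_shift_bound[OF assms, of "1 / 2"] geom_const_bound[OF assms] by simp

section \<open>Fractional parts expanded into characters of the digits\<close>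

definition scaled_frac :: "nat \<Rightarrow> real \<Rightarrow> real" where "scaled_frac j x = frac (x * real b ^ j)"

lemma scaled_frac_bounds: "0 \<le> scaled_frac j x" "scaled_frac j x < 1"
  by (simp_all add: scaled_frac_def frac_lt_1)

lemma floor_div: "\<lfloor>x * real b ^ j\<rfloor> = \<lfloor>x * real b ^ Suc j\<rfloor> div int b"
proof -
  have "\<lfloor>x * real b ^ j\<rfloor> = \<lfloor>(x * real b ^ Suc j) / real_of_int (int b)\<rfloor>" by simp
  also have "\<dots> = \<lfloor>x * real b ^ Suc j\<rfloor> div int b" by (rule floor_divide_real_eq_div) simp
  finally show ?thesis .
qed

lemma scaled_frac_Suc: "scaled_frac j x = (real (rdigit x (Suc j)) + scaled_frac (Suc j) x) / real b"
proof -
  have "real (rdigit x (Suc j)) = real_of_int (\<lfloor>x * real b ^ Suc j\<rfloor> mod int b)"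
    by (simp add: rdigit_def badic_digit_def)
  also have "\<dots> = real_of_int (\<lfloor>x * real b ^ Suc j\<rfloor> - int b * (\<lfloor>x * real b ^ Suc j\<rfloor> div int b))"
    by (simp add: minus_mult_div_eq_mod)
  also have "\<dots> = real_of_int \<lfloor>x * real b ^ Suc j\<rfloor> - real b * real_of_int \<lfloor>x * real b ^ j\<rfloor>"
    by (simp add: floor_div)
  finally show ?thesis by (simp add: scaled_frac_def frac_def field_simps)
qed

definition sawtooth_coeff :: "nat \<Rightarrow> complex" where "sawtooth_coeff t = 1 / (cnj (omega ^ t) - 1)"

lemma sawtooth_coeff_bound:
  assumes "t \<in> {1..<b}"
  shows "norm (sawtooth_coeff t) \<le> sin_const"
proof -
  have "norm (cnj (omega ^ t) - 1) = norm (cnj (omega ^ t - 1))" by simp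
  also have "\<dots> = norm (1 - omega ^ t)" by (simp only: complex_mod_cnj norm_minus_commute)
  finally have "norm (sawtooth_coeff t) = norm (geom_const t)" by (simp add: sawtooth_coeff_def geom_const_def norm_divide)
  then show ?thesis using geom_const_bound assms by simp
qed

text \<open>The discrete Fourier expansion of the centred digit. Consecutive values of the
  right-hand side differ by 1, by a sum over roots of unity, and its values over one period sum to
  0; these two facts determine it.\<close>

lemma digit_fourier:
  assumes "x < b"
  shows "of_real (real x - (real b - 1) / 2) = (\<Sum>t=1..<b. sawtooth_coeff t * omega ^ (t * x))"
proof -
  let ?g = "\<lambda>x. \<Sum>t=1..<b. sawtooth_coeff t * omega ^ (t * x)"
  have g_eq: "?g x = ?g 0 + of_nat x" if "x < b" for x
    using that
  proof (induction x)
    case (Suc x)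
    have "?g (Suc x) - ?g x = (\<Sum>t=1..<b. - (omega ^ (Suc x * t)))"
      unfolding sum_subtractf[symmetric]
    proof (intro sum.cong refl)
      fix t assume t: "t \<in> {1..<b}"
      have "cnj (omega ^ t) \<noteq> 1"
        using omega_neq_1[of t] t by (metis atLeastLessThan_iff complex_cnj_cancel_iff complex_cnj_one)
      then have "sawtooth_coeff t * (cnj (omega ^ t) - 1) = 1" by (simp add: sawtooth_coeff_def)
      moreover have "omega ^ t - 1 = - (omega ^ t * (cnj (omega ^ t) - 1))"
        unfolding right_diff_distrib cnj_omega_power by simp
      then have "sawtooth_coeff t * (omega ^ t - 1) = - (omega ^ t * (sawtooth_coeff t * (cnj (omega ^ t) - 1)))"
        by (simp only: mult_minus_right mult.left_commute)
      ultimately have "sawtooth_coeff t * (omega ^ t - 1) = - (omega ^ t)" by (simp only: mult_1_right)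
      then have "sawtooth_coeff t * (omega ^ t - 1) * omega ^ (t * x) = - (omega ^ t * omega ^ (t * x))"
        by (simp only: mult_minus_left)
      then have "sawtooth_coeff t * omega ^ (t * x) * (omega ^ t - 1) = - (omega ^ t * omega ^ (t * x))"
        by (simp only: mult_ac)
      then show "sawtooth_coeff t * omega ^ (t * Suc x) - sawtooth_coeff t * omega ^ (t * x) = - (omega ^ (Suc x * t))"
        by (simp add: power_add algebra_simps)
    qed
    also have "\<dots> = 1 - (\<Sum>t<b. omega ^ (Suc x * t))"
    proof -
      have "{..<b} = insert 0 {1..<b}" by (auto simp: not_less_eq_eq)
      then show ?thesis by (simp add: sum_negf del: insert_iff)
    qed
    also have "(\<Sum>t<b. omega ^ (Suc x * t)) = 0"
      using omega_sum[of "Suc x" 0] Suc.prems by simp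
    finally have "?g (Suc x) = 1 + ?g x" by (simp only: diff_0_right diff_eq_eq)
    then show ?case by (simp only: Suc.IH[OF Suc_lessD[OF Suc.prems]] of_nat_Suc add_ac)
  qed simp
  have "(\<Sum>x<b. ?g x) = (\<Sum>t=1..<b. sawtooth_coeff t * (\<Sum>x<b. omega ^ (t * x)))"
    unfolding sum_distrib_left by (rule sum.swap)
  also have "\<dots> = 0" using omega_sum[of _ 0] by (intro sum.neutral ballI) simp
  finally have "(\<Sum>x<b. ?g 0 + of_nat x) = 0" using g_eq by simp
  moreover have "(\<Sum>x<b. of_nat x :: complex) = of_nat b * (of_nat b - 1) / 2"
  proof -
    have "(\<Sum>x<n. of_nat x :: complex) = of_nat n * (of_nat n - 1) / 2" for n
      by (induction n) (auto simp: field_simps)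
    then show ?thesis .
  qed
  ultimately have "of_nat b * (?g 0 + (of_nat b - 1) / 2) = 0"
    by (simp add: sum.distrib algebra_simps)
  then have "?g 0 + (of_nat b - 1) / 2 = 0" by (simp only: mult_eq_0_iff of_nat_eq_0_iff b_pos simp_thms)
  then have "?g 0 = - ((of_nat b - 1) / 2)" by (rule eq_neg_iff_add_eq_0[THEN iffD2])
  then show ?thesis unfolding g_eq[OF assms] by simp
qed

text \<open>Iterates \<open>scaled_frac_Suc\<close>. Centring at 1/2 splits into a centred digit and
  a centred fraction of the next level, so no constant terms appear and the last term is a remainder
  of order \<open>1 / b ^ C\<close>.\<close>

lemma scaled_frac_expansion:
  "of_real (scaled_frac j x - 1 / 2) = (\<Sum>c=1..C. (1 / of_nat b) ^ c * (\<Sum>t=1..<b. sawtooth_coeff t * omega ^ (t * rdigit x (j + c))))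
    + (1 / of_nat b) ^ C * of_real (scaled_frac (j + C) x - 1 / 2)"
proof (induction C)
  case (Suc C)
  have "of_real (scaled_frac (j + C) x - 1 / 2) = (1 / of_nat b) *
    (of_real (real (rdigit x (Suc (j + C))) - (real b - 1) / 2) + of_real (scaled_frac (Suc (j + C)) x - 1 / 2) :: complex)"
    by (subst scaled_frac_Suc) (simp add: field_simps)
  then have e: "of_real (scaled_frac (j + C) x - 1 / 2) = (1 / of_nat b) *
    ((\<Sum>t=1..<b. sawtooth_coeff t * omega ^ (t * rdigit x (j + Suc C))) + of_real (scaled_frac (j + Suc C) x - 1 / 2))"
    unfolding digit_fourier[OF rdigit_less] by (simp only: add_Suc_right)
  show ?case
    unfolding Suc.IH unfolding e by (simp add: distrib_left mult.assoc mult.left_commute del: of_real_diff)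
qed simp

section \<open>Integrals of Walsh functions\<close>

lemma wal_has_integral_cell:
  assumes k: "k < b ^ n" and x: "real c / real (b ^ n) \<le> x" "x \<le> real (Suc c) / real (b ^ n)"
  shows "(wal k has_integral of_real (x - real c / real (b ^ n)) * wal k (real c / real b ^ n)) {real c / real (b ^ n)..x}"
proof -
  let ?w = "wal k (real c / real b ^ n)"
  have "((\<lambda>_. ?w) has_integral of_real (x - real c / real (b ^ n)) * ?w) {real c / real (b ^ n)..x}"
    using has_integral_const_real[of ?w "real c / real (b ^ n)" x] x by (simp add: scaleR_conv_of_real)
  then show ?thesis
  proof (rule has_integral_spike_finite[where S = "{real (Suc c) / real (b ^ n)}", rotated 2])
    fix y assume y: "y \<in> {real c / real (b ^ n)..x} - {real (Suc c) / real (b ^ n)}"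
    then have "y < real (Suc c) / real (b ^ n)" using x by auto
    then have "\<lfloor>y * real b ^ n\<rfloor> = int c" using y by (auto simp: floor_eq_iff field_simps)
    then show "wal k y = ?w" by (rule wal_cell[OF k])
  qed simp
qed

lemma wal_coarse: "k < b ^ n \<Longrightarrow> wal k (real c / real b ^ Suc n) = wal k (real (c div b) / real b ^ n)"
proof (rule wal_cell)
  have "\<lfloor>real c / real b ^ Suc n * real b ^ n\<rfloor> = \<lfloor>real c / real b\<rfloor>" by simp
  also have "\<dots> = int (c div b)" by (rule floor_divide_of_nat_eq)
  finally show "\<lfloor>real c / real b ^ Suc n * real b ^ n\<rfloor> = int (c div b)" .
qed

text \<open>On a cell of level \<open>n\<close> the factor \<open>wal k\<close> is constant while
  the top digit factor runs through the powers of \<open>omega ^ v\<close> on the \<open>b\<close>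
  subcells. So the integral up to a grid point is a geometric sum \<open>?R c\<close> that returns
  to 0 at the end of each coarse cell; the incomplete last subcell contributes the term with
  \<open>scaled_frac\<close>.\<close>

lemma wal_has_integral:
  assumes k: "k < b ^ n" and v: "1 \<le> v" "v < b" and x: "x \<in> {0..1}"
  shows "(wal (v * b ^ n + k) has_integral
    (geom_const v * wal k x + wal (v * b ^ n + k) x * (of_real (scaled_frac (Suc n) x) - geom_const v)) / of_nat (b ^ Suc n)) {0..x}"
proof -
  let ?N = "b ^ Suc n" and ?k = "v * b ^ n + k"
  have kN: "?k < ?N"
  proof -
    have "Suc v * b ^ n \<le> b * b ^ n" using v(2) by (intro mult_right_mono) simp_all
    then show ?thesis using k by simp
  qed
  let ?R = "\<lambda>c. geom_const v * wal k (real c / real b ^ Suc n) * (1 - omega ^ (v * c)) / of_nat ?N"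
  have walk: "wal ?k (real c / real b ^ Suc n) = wal k (real c / real b ^ Suc n) * omega ^ (v * c)" for c
  proof -
    have "rdigit (real c / real b ^ Suc n) (Suc n) = c mod b"
      using rdigit_grid[of n "Suc n" c] by (simp add: ndigit_def)
    then have "wal ?k (real c / real b ^ Suc n) = wal k (real c / real b ^ Suc n) * omega ^ (v * (c mod b))"
      using wal_top[OF k v(2)] by simp
    moreover have "omega ^ (v * (c mod b)) = omega ^ (v * c)" by (rule omega_power_cong) (rule mod_mult_right_eq)
    ultimately show ?thesis by simp
  qed
  have inv: "geom_const v * (1 - omega ^ v) = 1" using omega_neq_1[OF v] by (simp add: geom_const_def)
  have grid: "(wal ?k has_integral ?R c) {0..real c / real ?N}" for c
  proof (induction c)
    case (Suc c)
    \<comment> \<open>The coarse factor changes only when \<open>b\<close> divides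
      \<open>Suc c\<close>, and precisely then \<open>1 - omega ^ (v * Suc c)\<close> is 0; so the
      old value of \<open>wal k\<close> may be used throughout.\<close>
    have peel: "wal k (real (Suc c) / real b ^ Suc n) * (1 - omega ^ (v * Suc c))
        = wal k (real c / real b ^ Suc n) * (1 - omega ^ (v * Suc c))"
    proof (cases "Suc c mod b = 0")
      case True
      then have "v * Suc c mod b = 0 mod b" by (metis mod_0 mod_mult_right_eq mult_0_right)
      then have "omega ^ (v * Suc c) = omega ^ 0" by (rule omega_power_cong)
      then show ?thesis by (simp del: mult_Suc_right)
    next
      case False
      then have "Suc c div b = c div b" by (simp add: div_Suc)
      then show ?thesis by (simp only: wal_coarse[OF k])
    qed
    have "?R (Suc c) - ?R c = (geom_const v * (wal k (real (Suc c) / real b ^ Suc n) * (1 - omega ^ (v * Suc c)))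
        - geom_const v * wal k (real c / real b ^ Suc n) * (1 - omega ^ (v * c))) / of_nat ?N"
      by (simp only: diff_divide_distrib mult.assoc)
    also have "\<dots> = (geom_const v * (1 - omega ^ v)) * wal k (real c / real b ^ Suc n) * omega ^ (v * c) / of_nat ?N"
      unfolding peel by (simp add: algebra_simps power_add)
    also have "\<dots> = wal ?k (real c / real b ^ Suc n) / of_nat ?N"
      unfolding inv walk by simp
    finally have R: "?R (Suc c) = ?R c + wal ?k (real c / real b ^ Suc n) / of_nat ?N"
      by (simp only: diff_eq_eq add.commute)
    have le: "real c / real ?N \<le> real (Suc c) / real ?N" by (rule divide_right_mono) simp_all
    have d: "real (Suc c) / real ?N - real c / real ?N = 1 / real ?N"
      by (simp only: diff_divide_distrib[symmetric]) simp
    have "(wal ?k has_integral of_real (1 / real ?N) * wal ?k (real c / real b ^ Suc n)) {real c / real ?N..real (Suc c) / real ?N}"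
      using wal_has_integral_cell[OF kN le order_refl] unfolding d .
    then have "(wal ?k has_integral ?R c + of_real (1 / real ?N) * wal ?k (real c / real b ^ Suc n)) {0..real (Suc c) / real ?N}"
      using le by (intro has_integral_combine[OF _ _ Suc.IH]) auto
    then show ?case unfolding R by (simp add: mult.commute)
  qed (simp add: has_integral_refl)
  define c where "c = nat \<lfloor>x * real b ^ Suc n\<rfloor>"
  have c: "real c = real_of_int \<lfloor>x * real b ^ Suc n\<rfloor>" "\<lfloor>x * real b ^ Suc n\<rfloor> = int c"
    using x by (auto simp: c_def)
  have cx: "real c / real ?N \<le> x" "x \<le> real (Suc c) / real ?N"
    using c(1) by (auto simp: field_simps) linarith+
  have z: "scaled_frac (Suc n) x = (x - real c / real ?N) * real ?N"
    using c(1) by (simp add: scaled_frac_def frac_def field_simps)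
  have w: "wal ?k x = wal ?k (real c / real b ^ Suc n)" by (rule wal_cell[OF kN c(2)])
  have w': "wal k x = wal k (real c / real b ^ Suc n)"
    by (rule wal_cell[OF _ c(2)]) (rule less_le_trans[OF k], use b2 in simp)
  have "(wal ?k has_integral ?R c + of_real (x - real c / real ?N) * wal ?k (real c / real b ^ Suc n)) {0..x}"
    by (rule has_integral_combine[OF _ _ grid wal_has_integral_cell[OF kN cx]]) (use cx in auto)
  also have "?R c + of_real (x - real c / real ?N) * wal ?k (real c / real b ^ Suc n)
    = (geom_const v * wal k x + wal ?k x * (of_real (scaled_frac (Suc n) x) - geom_const v)) / of_nat ?N"
    unfolding z w w' walk by (simp add: field_simps)
  finally show ?thesis .
qed

definition len :: "nat \<Rightarrow> nat" where "len k = mu1 b k"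
definition rest :: "nat \<Rightarrow> nat" where "rest k = k mod b ^ (len k - 1)"
definition lead :: "nat \<Rightarrow> nat" where "lead k = k div b ^ (len k - 1)"

lemma len_bounds: "k \<ge> 1 \<Longrightarrow> b ^ (len k - 1) \<le> k \<and> k < b ^ len k"
  unfolding len_def by (rule mu1_bounds) simp_all

lemma len_pos: "k \<ge> 1 \<Longrightarrow> len k \<ge> 1"
  using len_bounds[of k] by (cases "len k") auto

lemma len_0 [simp]: "len 0 = 0"
  by (simp add: len_def mu1_0)

lemma rest_0 [simp]: "rest 0 = 0"
  by (simp add: rest_def)

lemma len_decomp:
  assumes "k \<ge> 1"
  shows "lead k * b ^ (len k - 1) + rest k = k" "1 \<le> lead k" "lead k < b" "rest k < b ^ (len k - 1)" "Suc (len k - 1) = len k"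
proof -
  show "lead k * b ^ (len k - 1) + rest k = k" by (simp only: lead_def rest_def div_mult_mod_eq)
  show "1 \<le> lead k" using len_bounds[OF assms] by (simp add: lead_def Suc_le_eq div_greater_zero_iff)
  show s: "Suc (len k - 1) = len k" using len_pos[OF assms] by simp
  have "k < b * b ^ (len k - 1)" using len_bounds[OF assms] s by (metis power_Suc)
  then show "lead k < b" unfolding lead_def by (simp add: less_mult_imp_div_less)
qed (simp add: rest_def)

lemma rest_less: "k \<ge> 1 \<Longrightarrow> rest k < k"
  using len_decomp(4)[of k] len_bounds[of k] by linarith

lemma len_unique:
  assumes "b ^ n \<le> k" "k < b ^ Suc n"
  shows "len k = Suc n"
proof -
  have k1: "k \<ge> 1" using assms(1) by (metis One_nat_def Suc_leI b_pos(1) le_trans zero_less_power)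
  have "b ^ n < b ^ len k" using assms(1) len_bounds[OF k1] by linarith
  then have "n < len k" by (rule power_less_imp_less_exp[rotated]) simp
  moreover have "b ^ (len k - 1) < b ^ Suc n" using assms(2) len_bounds[OF k1] by linarith
  then have "len k - 1 < Suc n" by (rule power_less_imp_less_exp[rotated]) simp
  ultimately show ?thesis by simp
qed

lemma len_compose:
  assumes "k < b ^ n" "1 \<le> v" "v < b"
  shows "len (v * b ^ n + k) = Suc n" "rest (v * b ^ n + k) = k"
proof -
  have "Suc v * b ^ n \<le> b * b ^ n" using assms(3) by (intro mult_right_mono) simp_all
  then have "v * b ^ n + k < b ^ Suc n" using assms(1) by simp
  moreover have "1 * b ^ n \<le> v * b ^ n" using assms(2) by (intro mult_right_mono) simp_all
  then have "b ^ n \<le> v * b ^ n + k" by linarith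
  ultimately show t: "len (v * b ^ n + k) = Suc n" by (intro len_unique)
  show "rest (v * b ^ n + k) = k" using assms(1) by (simp add: rest_def t)
qed

lemma len_rest: "rest k \<ge> 1 \<Longrightarrow> len (rest k) < len k"
proof -
  assume r: "rest k \<ge> 1"
  then have k: "k \<ge> 1" by (cases k) auto
  have "b ^ (len (rest k) - 1) < b ^ (len k - 1)"
    using len_bounds[OF r] len_decomp(4)[OF k] by linarith
  then have "len (rest k) - 1 < len k - 1" by (rule power_less_imp_less_exp[rotated]) simp
  then show ?thesis using len_pos[OF r] by simp
qed

lemma wal_integral:
  assumes "k \<ge> 1" "x \<in> {0..1}"
  shows "(wal k has_integral
    (geom_const (lead k) * wal (rest k) x + wal k x * (of_real (scaled_frac (len k) x) - geom_const (lead k))) / of_nat (b ^ len k)) {0..x}"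
  using wal_has_integral[OF len_decomp(4,2,3)[OF assms(1)] assms(2)]
  by (simp only: len_decomp(1,5)[OF assms(1)])

lemma wal_integrable: "wal k integrable_on {0..1}"
proof (cases "k = 0")
  case True
  then have "wal k = (\<lambda>x. 1)" by (simp add: fun_eq_iff)
  then show ?thesis by (simp add: integrable_continuous_interval)
next
  case False
  then show ?thesis using wal_integral[of k 1] by auto
qed

lemma mean_wal: "k \<ge> 1 \<Longrightarrow> mean (wal k) = 0"
proof -
  assume k: "k \<ge> 1"
  have "scaled_frac (len k) 1 = 0" by (simp add: scaled_frac_def flip: of_nat_power)
  then show ?thesis using wal_integral[OF k, of 1] by (simp add: mean_def integral_unique)
qed

text \<open>As \<open>k < b ^ k\<close>, the function is constant on the open cells of level
  \<open>k\<close>, so discontinuities can occur only at the finitely many grid points.\<close>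

lemma wal_pw_continuous: "pw_continuous (wal k)"
  unfolding pw_continuous_def
proof (intro conjI exI ballI)
  let ?N = "b ^ k" and ?S = "(\<lambda>c. real c / real (b ^ k)) ` {..b ^ k}"
  show "wal k integrable_on {0..1}" by (rule wal_integrable)
  show "finite ?S" by simp
  fix x :: real assume x: "x \<in> {0<..<1} - ?S"
  define c where "c = nat \<lfloor>x * real ?N\<rfloor>"
  have c: "\<lfloor>x * real ?N\<rfloor> = int c" using x by (auto simp: c_def)
  have c1: "real c \<le> x * real ?N" "x * real ?N < real c + 1" using c by (simp_all add: floor_eq_iff)
  have "x * real ?N < 1 * real ?N" using x by (intro mult_strict_right_mono) auto
  then have "real c < real ?N" using c1(1) by linarith
  then have "c \<le> ?N" by (simp only: of_nat_less_iff less_imp_le)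
  then have "x \<noteq> real c / real ?N" using x by auto
  moreover have "real c / real ?N \<le> x" using c1(1) by (simp only: divide_le_eq of_nat_0_less_iff zero_less_power b_pos if_True)
  moreover have "x < real (Suc c) / real ?N" using c1(2) by (simp add: less_divide_eq)
  ultimately have xI: "x \<in> {real c / real ?N<..<real (Suc c) / real ?N}" by simp
  have "wal k y = wal k (real c / real b ^ k)" if "y \<in> {real c / real ?N<..<real (Suc c) / real ?N}" for y
  proof (rule wal_cell[OF less_power])
    show "\<lfloor>y * real b ^ k\<rfloor> = int c" using that by (auto simp: floor_eq_iff field_simps)
  qed
  then have "\<forall>\<^sub>F y in nhds x. wal k y = wal k (real c / real b ^ k)"
    using eventually_nhds_in_open[OF open_greaterThanLessThan xI] by (rule eventually_mono[rotated])
  then show "isCont (wal k) x" by (subst isCont_cong) auto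
qed

end

text \<open>
  The induction on the order of antidifferentiation runs over all functionals \<open>L \<circ> prim\<close>; this covers
  both the value of \<open>prim ^ r wal k\<close> at \<open>0\<close> and its inner products.
\<close>

definition linfun :: "((real \<Rightarrow> complex) \<Rightarrow> complex) \<Rightarrow> real \<Rightarrow> bool" where
  "linfun L R \<longleftrightarrow> 0 \<le> R \<and>
    (\<forall>f g c. f integrable_on {0..1} \<longrightarrow> g integrable_on {0..1} \<longrightarrow> L (\<lambda>x. c * f x + g x) = c * L f + L g) \<and>
    (\<forall>f B. f integrable_on {0..1} \<longrightarrow> (\<forall>x\<in>{0..1}. norm (f x) \<le> B) \<longrightarrow> norm (L f) \<le> R * B)"

lemma linfun_linear:
  "linfun L R \<Longrightarrow> f integrable_on {0..1} \<Longrightarrow> g integrable_on {0..1} \<Longrightarrow> L (\<lambda>x. c * f x + g x) = c * L f + L g"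
  by (simp add: linfun_def)

lemma linfun_bound:
  "linfun L R \<Longrightarrow> f integrable_on {0..1} \<Longrightarrow> (\<And>x. x \<in> {0..1} \<Longrightarrow> norm (f x) \<le> B) \<Longrightarrow> norm (L f) \<le> R * B"
  by (simp add: linfun_def)

lemma linfun_nonneg: "linfun L R \<Longrightarrow> 0 \<le> R"
  by (simp add: linfun_def)

text \<open>The bound clause, applied to the difference with \<open>B = 0\<close>, shows that a
  bounded functional depends only on the values on the unit interval.\<close>

lemma linfun_cong:
  assumes L: "linfun L R" and f: "f integrable_on {0..1}" and g: "g integrable_on {0..1}"
    and eq: "\<And>x. x \<in> {0..1} \<Longrightarrow> f x = g x"
  shows "L f = L g"
proof -
  have "(\<lambda>x. - 1 * f x + g x) integrable_on {0..1}"
    by (intro integrable_add integrable_on_mult_right f g)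
  then have "norm (L (\<lambda>x. - 1 * f x + g x)) \<le> R * 0"
    by (rule linfun_bound[OF L]) (simp add: eq)
  then show ?thesis unfolding linfun_linear[OF L f g] by simp
qed

lemma linfun_sum:
  assumes L: "linfun L R" and I: "finite I" and f: "\<And>i. i \<in> I \<Longrightarrow> f i integrable_on {0..1}"
    and g: "g integrable_on {0..1}"
  shows "(\<lambda>x. (\<Sum>i\<in>I. c i * f i x) + g x) integrable_on {0..1} \<and>
    L (\<lambda>x. (\<Sum>i\<in>I. c i * f i x) + g x) = (\<Sum>i\<in>I. c i * L (f i)) + L g"
  using I f
proof (induction I rule: finite_induct)
  case empty
  then show ?case using g by simp
next
  case (insert i I)
  have e: "(\<lambda>x. (\<Sum>i\<in>insert i I. c i * f i x) + g x) = (\<lambda>x. c i * f i x + ((\<Sum>i\<in>I. c i * f i x) + g x))"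
    using insert by (simp add: add.assoc)
  have i: "f i integrable_on {0..1}" "(\<lambda>x. (\<Sum>i\<in>I. c i * f i x) + g x) integrable_on {0..1}"
    using insert by auto
  have "(\<lambda>x. c i * f i x + ((\<Sum>i\<in>I. c i * f i x) + g x)) integrable_on {0..1}"
    by (rule integrable_add[OF integrable_on_mult_right[OF i(1)] i(2)])
  then show ?case
    unfolding e using linfun_linear[OF L i, of "c i"] insert by (simp add: add.assoc)
qed

lemma linfun_prim:
  assumes L: "linfun L R"
  shows "linfun (\<lambda>f. L (prim f)) (4 * R)"
  unfolding linfun_def
proof (intro conjI allI impI)
  show "0 \<le> 4 * R" using linfun_nonneg[OF L] by simp
next
  fix f g :: "real \<Rightarrow> complex" and c
  assume f: "f integrable_on {0..1}" and g: "g integrable_on {0..1}"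
  have Vi: "prim h integrable_on {0..1}" if "h integrable_on {0..1}" for h
    by (rule integrable_continuous_interval[OF prim_cont[OF that]])
  have i: "(\<lambda>x. c * f x + g x) integrable_on {0..1}" by (intro integrable_add integrable_on_mult_right f g)
  have "L (prim (\<lambda>x. c * f x + g x)) = L (\<lambda>x. c * prim f x + prim g x)"
    by (intro linfun_cong[OF L Vi[OF i]] integrable_add integrable_on_mult_right Vi f g prim_linear)
  then show "L (prim (\<lambda>x. c * f x + g x)) = c * L (prim f) + L (prim g)"
    by (simp add: linfun_linear[OF L Vi[OF f] Vi[OF g]])
next
  fix f :: "real \<Rightarrow> complex" and B
  assume f: "f integrable_on {0..1}" and B: "\<forall>x\<in>{0..1}. norm (f x) \<le> B"
  have "norm (L (prim f)) \<le> R * (4 * B)"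
    by (rule linfun_bound[OF L integrable_continuous_interval[OF prim_cont[OF f]] prim_bound[OF f]]) (use B in auto)
  then show "norm (L (prim f)) \<le> 4 * R * B" by simp
qed

lemma linfun_prim_const:
  assumes L: "linfun L R"
  shows "L (prim (\<lambda>_. c)) = 0"
proof -
  have "norm (L (prim (\<lambda>_. c))) \<le> R * 0"
    by (intro linfun_bound[OF L] integrable_continuous_interval prim_cont) (auto simp: prim_const)
  then show ?thesis by simp
qed

lemma linfun_prim_power:
  assumes L: "linfun L R" and L1: "L (\<lambda>_. 1) = 0"
  shows "\<exists>R. linfun (\<lambda>f. L ((prim ^^ r) f)) R" "L ((prim ^^ r) (\<lambda>_. 1)) = 0"
proof -
  have ex: "\<exists>R. linfun (\<lambda>f. L ((prim ^^ r) f)) R" for r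
  proof (induction r)
    case (Suc r)
    then obtain R' where "linfun (\<lambda>f. L ((prim ^^ r) f)) R'" by blast
    from linfun_prim[OF this] show ?case by (auto simp: funpow_swap1)
  qed (use L in auto)
  then show "\<exists>R. linfun (\<lambda>f. L ((prim ^^ r) f)) R" .
  show "L ((prim ^^ r) (\<lambda>_. 1)) = 0"
  proof (cases r)
    case (Suc r')
    obtain R' where "linfun (\<lambda>f. L ((prim ^^ r') f)) R'" using ex by blast
    from linfun_prim_const[OF this] show ?thesis by (simp add: Suc funpow_swap1)
  qed (use L1 in simp)
qed

context radix
begin

definition wal_prim :: "nat \<Rightarrow> real \<Rightarrow> complex" where "wal_prim k t = integral {0..t} (wal k)"

lemma wal_prim_integrable: "wal_prim k integrable_on {0..1}"
  unfolding wal_prim_def[abs_def]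
  by (rule integrable_continuous_interval[OF indefinite_integral_continuous_1[OF wal_integrable]])

text \<open>Puts the digit \<open>t\<close> at one-based position \<open>len k + c\<close>, with
  \<open>c - 1\<close> zeros between it and the leading digit of \<open>k\<close>.\<close>

definition prepend :: "nat \<Rightarrow> nat \<Rightarrow> nat \<Rightarrow> nat" where "prepend k c t = t * b ^ (len k + c - 1) + k"

lemma prepend_facts:
  assumes "k \<ge> 1" "c \<ge> 1" "t \<in> {1..<b}"
  shows "len (prepend k c t) = len k + c" "rest (prepend k c t) = k" "prepend k c t \<ge> 1"
    "wal (prepend k c t) x = wal k x * omega ^ (t * rdigit x (len k + c))"
proof -
  have "b ^ len k \<le> b ^ (len k + c - 1)" using assms(2) b2 by (intro power_increasing) auto
  then have k: "k < b ^ (len k + c - 1)" using len_bounds[OF assms(1)] by linarith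
  have s: "Suc (len k + c - 1) = len k + c" using assms(2) by simp
  show "len (prepend k c t) = len k + c" "rest (prepend k c t) = k"
    unfolding prepend_def using len_compose[OF k, of t] assms(3) s by auto
  show "prepend k c t \<ge> 1" using assms(1) by (simp add: prepend_def)
  show "wal (prepend k c t) x = wal k x * omega ^ (t * rdigit x (len k + c))"
    unfolding prepend_def using wal_top[OF k, of t x] assms(3) s by simp
qed

text \<open>The fraction in \<open>wal_integral\<close> is split as 1/2 plus its digit expansion.
  The part 1/2 modifies the coefficient of \<open>wal k\<close>, and multiplication by
  \<open>wal k\<close> turns each digit character into the Walsh function of a prepended
  index.\<close>

lemma wal_prim_expansion:
  assumes k: "k \<ge> 1" and x: "x \<in> {0..1}"
  shows "of_nat (b ^ len k) * wal_prim k x = geom_const (lead k) * wal (rest k) x + ((1 / 2 - geom_const (lead k)) * wal k x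
    + ((\<Sum>(c, t)\<in>{1..C} \<times> {1..<b}. (1 / of_nat b) ^ c * sawtooth_coeff t * wal (prepend k c t) x)
    + (1 / of_nat b) ^ C * (wal k x * of_real (scaled_frac (len k + C) x - 1 / 2))))"
proof -
  have "of_nat (b ^ len k) * wal_prim k x = geom_const (lead k) * wal (rest k) x + wal k x * (of_real (scaled_frac (len k) x) - geom_const (lead k))"
    unfolding wal_prim_def integral_unique[OF wal_integral[OF k x]] by simp
  also have "of_real (scaled_frac (len k) x) - geom_const (lead k) = (1 / 2 - geom_const (lead k)) + of_real (scaled_frac (len k) x - 1 / 2)"
    by simp
  also have "(of_real (scaled_frac (len k) x - 1 / 2) :: complex) = (\<Sum>c=1..C. (1 / of_nat b) ^ c * (\<Sum>t=1..<b. sawtooth_coeff t * omega ^ (t * rdigit x (len k + c))))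
    + (1 / of_nat b) ^ C * of_real (scaled_frac (len k + C) x - 1 / 2)"
    by (rule scaled_frac_expansion)
  also have "(\<Sum>c=1..C. (1 / of_nat b) ^ c * (\<Sum>t=1..<b. sawtooth_coeff t * omega ^ (t * rdigit x (len k + c))))
    = (\<Sum>(c, t)\<in>{1..C} \<times> {1..<b}. (1 / of_nat b) ^ c * sawtooth_coeff t * omega ^ (t * rdigit x (len k + c)))"
    by (simp add: sum.cartesian_product[symmetric] sum_distrib_left mult.assoc)
  finally have e: "of_nat (b ^ len k) * wal_prim k x = geom_const (lead k) * wal (rest k) x + wal k x * ((1 / 2 - geom_const (lead k)) +
    ((\<Sum>(c, t)\<in>{1..C} \<times> {1..<b}. (1 / of_nat b) ^ c * sawtooth_coeff t * omega ^ (t * rdigit x (len k + c)))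
    + (1 / of_nat b) ^ C * of_real (scaled_frac (len k + C) x - 1 / 2)))" .
  have "wal k x * (\<Sum>(c, t)\<in>{1..C} \<times> {1..<b}. (1 / of_nat b) ^ c * sawtooth_coeff t * omega ^ (t * rdigit x (len k + c)))
    = (\<Sum>(c, t)\<in>{1..C} \<times> {1..<b}. (1 / of_nat b) ^ c * sawtooth_coeff t * wal (prepend k c t) x)"
    unfolding sum_distrib_left
    by (intro sum.cong refl) (auto simp: prepend_facts(4)[OF k])
  then show ?thesis unfolding e by (simp add: distrib_left mult_ac)
qed

lemma linfun_wal_prim:
  assumes L: "linfun L R" and k: "k \<ge> 1"
  shows "norm (of_nat (b ^ len k) * L (wal_prim k) - (geom_const (lead k) * L (wal (rest k)) + (1 / 2 - geom_const (lead k)) * L (wal k)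
    + (\<Sum>(c, t)\<in>{1..C} \<times> {1..<b}. (1 / of_nat b) ^ c * sawtooth_coeff t * L (wal (prepend k c t))))) \<le> R * (1 / real b) ^ C"
proof -
  let ?I = "{1..C} \<times> {1..<b}"
  define rem where "rem = (\<lambda>x. (- 1) * (geom_const (lead k) * wal (rest k) x + ((1 / 2 - geom_const (lead k)) * wal k x
     + ((\<Sum>ct\<in>?I. ((1 / of_nat b) ^ fst ct * sawtooth_coeff (snd ct)) * wal (prepend k (fst ct) (snd ct)) x) + 0)))
     + of_nat (b ^ len k) * wal_prim k x)"
  have rem: "norm (rem x) \<le> (1 / real b) ^ C" if x: "x \<in> {0..1}" for x
  proof -
    have "rem x = (1 / of_nat b) ^ C * (wal k x * of_real (scaled_frac (len k + C) x - 1 / 2))"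
      unfolding rem_def wal_prim_expansion[OF k x, of C] by (simp add: case_prod_beta algebra_simps)
    then have "norm (rem x) = (1 / real b) ^ C * \<bar>scaled_frac (len k + C) x - 1 / 2\<bar>"
      by (simp only: norm_mult norm_power norm_wal norm_of_real) (simp add: norm_divide)
    also have "\<dots> \<le> (1 / real b) ^ C * 1"
      using scaled_frac_bounds[of "len k + C" x] by (intro mult_left_mono) auto
    finally show ?thesis by simp
  qed
  note s = linfun_sum[OF L finite_cartesian_product[OF finite_atLeastAtMost finite_atLeastLessThan] wal_integrable integrable_0,
      of "\<lambda>ct. (1 / of_nat b) ^ fst ct * sawtooth_coeff (snd ct)" "\<lambda>ct. prepend k (fst ct) (snd ct)" 1 C 1 b]
  let ?S = "\<lambda>x. (\<Sum>ct\<in>?I. ((1 / of_nat b) ^ fst ct * sawtooth_coeff (snd ct)) * wal (prepend k (fst ct) (snd ct)) x) + 0"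
  have iS: "?S integrable_on {0..1}" using s by blast
  have L0: "L (\<lambda>x. 0) = 0" using linfun_bound[OF L integrable_0, of 0] by simp
  let ?S2 = "\<lambda>x. (1 / 2 - geom_const (lead k)) * wal k x + ?S x"
  have iS2: "?S2 integrable_on {0..1}" by (rule integrable_add[OF integrable_on_mult_right[OF wal_integrable] iS])
  let ?S3 = "\<lambda>x. geom_const (lead k) * wal (rest k) x + ?S2 x"
  have iS3: "?S3 integrable_on {0..1}" by (rule integrable_add[OF integrable_on_mult_right[OF wal_integrable] iS2])
  have iJ: "(\<lambda>x. of_nat (b ^ len k) * wal_prim k x) integrable_on {0..1}"
    by (intro integrable_on_mult_right wal_prim_integrable)
  have irem: "rem integrable_on {0..1}"
    unfolding rem_def by (rule integrable_add[OF integrable_on_mult_right[OF iS3] iJ])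
  have "L (\<lambda>x. of_nat (b ^ len k) * wal_prim k x + 0) = of_nat (b ^ len k) * L (wal_prim k) + L (\<lambda>x. 0)"
    by (rule linfun_linear[OF L wal_prim_integrable integrable_0])
  then have LJ: "L (\<lambda>x. of_nat (b ^ len k) * wal_prim k x) = of_nat (b ^ len k) * L (wal_prim k)" using L0 by simp
  have "L rem = (- 1) * L ?S3 + of_nat (b ^ len k) * L (wal_prim k)"
    unfolding rem_def LJ[symmetric] by (rule linfun_linear[OF L iS3 iJ])
  also have "L ?S3 = geom_const (lead k) * L (wal (rest k)) + L ?S2"
    by (rule linfun_linear[OF L wal_integrable iS2])
  also have "L ?S2 = (1 / 2 - geom_const (lead k)) * L (wal k) + L ?S"
    by (rule linfun_linear[OF L wal_integrable iS])
  also have "L ?S = (\<Sum>(c, t)\<in>?I. (1 / of_nat b) ^ c * sawtooth_coeff t * L (wal (prepend k c t)))"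
    using s L0 by (simp add: case_prod_beta)
  finally have e: "L rem = (- 1) * (geom_const (lead k) * L (wal (rest k)) + ((1 / 2 - geom_const (lead k)) * L (wal k)
      + (\<Sum>(c, t)\<in>?I. (1 / of_nat b) ^ c * sawtooth_coeff t * L (wal (prepend k c t))))) + of_nat (b ^ len k) * L (wal_prim k)" .
  have alg: "n - (p + q + s) = (- 1) * (p + (q + s)) + n" for n p q s :: complex by simp
  show ?thesis unfolding alg e[symmetric] using linfun_bound[OF L irem rem] .
qed

text \<open>The coefficients of all three kinds are bounded by \<open>sin_const\<close> (for
  prepended indices up to the weight \<open>(1 / b) ^ c\<close>), which therefore comes out as a
  common factor.\<close>

lemma linfun_wal_prim_bound:
  assumes L: "linfun L R" and k: "k \<ge> 1"
  shows "norm (L (wal_prim k)) \<le> (1 / real b) ^ len k * (sin_const * (norm (L (wal (rest k))) + norm (L (wal k))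
    + (\<Sum>c=1..C. (1 / real b) ^ c * (\<Sum>t=1..<b. norm (L (wal (prepend k c t)))))) + R * (1 / real b) ^ C)"
proof -
  let ?I = "{1..C} \<times> {1..<b}"
  let ?M = "geom_const (lead k) * L (wal (rest k)) + (1 / 2 - geom_const (lead k)) * L (wal k)
    + (\<Sum>(c, t)\<in>?I. (1 / of_nat b) ^ c * sawtooth_coeff t * L (wal (prepend k c t)))"
  note ld = len_decomp(2,3)[OF k]
  have 1: "norm (geom_const (lead k) * L (wal (rest k))) \<le> sin_const * norm (L (wal (rest k)))"
    unfolding norm_mult by (intro mult_right_mono geom_const_bound ld) simp
  have 2: "norm ((1 / 2 - geom_const (lead k)) * L (wal k)) \<le> sin_const * norm (L (wal k))"
    unfolding norm_mult by (intro mult_right_mono half_geom_const_bound ld) simp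
  have "norm (\<Sum>(c, t)\<in>?I. (1 / of_nat b) ^ c * sawtooth_coeff t * L (wal (prepend k c t)))
    \<le> (\<Sum>(c, t)\<in>?I. (1 / real b) ^ c * (sin_const * norm (L (wal (prepend k c t)))))"
  proof (rule order_trans[OF norm_sum sum_mono])
    fix i assume "i \<in> ?I"
    then obtain c t where i: "i = (c, t)" "t \<in> {1..<b}" by auto
    have "(1 / real b) ^ c * (norm (sawtooth_coeff t) * norm (L (wal (prepend k c t)))) \<le> (1 / real b) ^ c * (sin_const * norm (L (wal (prepend k c t))))"
      using sawtooth_coeff_bound[OF i(2)] by (intro mult_left_mono mult_right_mono) auto
    then show "norm (case i of (c, t) \<Rightarrow> (1 / of_nat b) ^ c * sawtooth_coeff t * L (wal (prepend k c t)))
      \<le> (case i of (c, t) \<Rightarrow> (1 / real b) ^ c * (sin_const * norm (L (wal (prepend k c t)))))"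
      by (simp add: i(1) norm_mult norm_power norm_divide mult.assoc)
  qed
  also have "\<dots> = sin_const * (\<Sum>c=1..C. (1 / real b) ^ c * (\<Sum>t=1..<b. norm (L (wal (prepend k c t)))))"
    by (simp add: sum.cartesian_product[symmetric] sum_distrib_left mult_ac)
  finally have 3: "norm (\<Sum>(c, t)\<in>?I. (1 / of_nat b) ^ c * sawtooth_coeff t * L (wal (prepend k c t)))
    \<le> sin_const * (\<Sum>c=1..C. (1 / real b) ^ c * (\<Sum>t=1..<b. norm (L (wal (prepend k c t)))))" .
  have M: "norm ?M \<le> sin_const * (norm (L (wal (rest k))) + norm (L (wal k))
    + (\<Sum>c=1..C. (1 / real b) ^ c * (\<Sum>t=1..<b. norm (L (wal (prepend k c t))))))"
    using norm_triangle_le[OF add_mono[OF norm_triangle_le[OF add_mono[OF 1 2]] 3]]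
    by (simp only: distrib_left order_refl)
  have "norm (of_nat (b ^ len k) * L (wal_prim k)) \<le> norm ?M + R * (1 / real b) ^ C"
    using linfun_wal_prim[OF L k, of C] norm_triangle_sub[of "of_nat (b ^ len k) * L (wal_prim k)" ?M] by linarith
  then have "real b ^ len k * norm (L (wal_prim k)) \<le> sin_const * (norm (L (wal (rest k))) + norm (L (wal k))
    + (\<Sum>c=1..C. (1 / real b) ^ c * (\<Sum>t=1..<b. norm (L (wal (prepend k c t)))))) + R * (1 / real b) ^ C"
    using M by (simp add: norm_mult norm_power)
  then have "(1 / real b) ^ len k * (real b ^ len k * norm (L (wal_prim k))) \<le> (1 / real b) ^ len k * (sin_const * (norm (L (wal (rest k))) + norm (L (wal k))
    + (\<Sum>c=1..C. (1 / real b) ^ c * (\<Sum>t=1..<b. norm (L (wal (prepend k c t)))))) + R * (1 / real b) ^ C)"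
    by (rule mult_left_mono) simp
  moreover have "(1 / real b) ^ len k * (real b ^ len k * X) = X" for X :: real
    by (simp add: power_one_over)
  ultimately show ?thesis by simp
qed

text \<open>\<open>prim (wal k)\<close> and \<open>wal_prim k\<close> differ by a constant, and
  \<open>L\<close> does not see constants. This lets the explicit integral of \<open>wal k\<close>
  replace \<open>prim\<close> under a functional.\<close>

lemma prim_wal_wal_prim:
  assumes L: "linfun L R" "L (\<lambda>_. 1) = 0" and k: "k \<ge> 1"
  shows "L (prim (wal k)) = L (wal_prim k)"
proof -
  let ?c = "- mean (wal_prim k)"
  have "prim (wal k) t = ?c * 1 + wal_prim k t" if "t \<in> {0..1}" for t
    using mean_wal[OF k] by (simp add: prim_def wal_prim_def[abs_def])
  then have "L (prim (wal k)) = L (\<lambda>t. ?c * 1 + wal_prim k t)"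
    by (intro linfun_cong[OF L(1) integrable_continuous_interval[OF prim_cont[OF wal_integrable]]]
        integrable_add wal_prim_integrable) auto
  also have "\<dots> = ?c * L (\<lambda>_. 1) + L (wal_prim k)"
    by (rule linfun_linear[OF L(1) _ wal_prim_integrable]) (simp add: integrable_continuous_interval)
  finally show ?thesis using L(2) by simp
qed

end

subsection \<open>Decay of the diagonal Walsh coefficients of the kernel\<close>

context radix
begin

lemma b_ge_1 [simp]: "Suc 0 \<le> b"
  using b2 by simp

text \<open>Describes the dominant term of one antidifferentiation. Deleting the only nonzero digit
  would lead to index 0, whose term vanishes; then the term that keeps \<open>k\<close>
  dominates.\<close>

definition peel :: "nat \<Rightarrow> nat" where "peel k = (if rest k = 0 then k else rest k)"

text \<open>
  \<open>mu r k\<close> adds prepend the (one-based) positions of the \<open>r\<close> leading nonzero digits of \<open>k\<close>.  \<open>mu_per r k\<close>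
  counts the last of these repeatedly when \<open>k\<close> has fewer than \<open>r\<close> nonzero digits.
\<close>

fun mu_per :: "nat \<Rightarrow> nat \<Rightarrow> nat" where
  "mu_per 0 k = 0"
| "mu_per (Suc r) k = len k + mu_per r (peel k)"

fun mu :: "nat \<Rightarrow> nat \<Rightarrow> nat" where
  "mu 0 k = 0"
| "mu (Suc r) k = len k + mu r (rest k)"

function nonzero_digits :: "nat \<Rightarrow> nat" where
  "nonzero_digits k = (if k = 0 then 0 else Suc (nonzero_digits (rest k)))"
  by auto
termination by (relation "Wellfounded.measure (\<lambda>k. k)") (auto intro: rest_less)

declare nonzero_digits.simps [simp del]

lemma nonzero_digits_0 [simp]: "nonzero_digits 0 = 0"
  by (simp add: nonzero_digits.simps)

lemma nonzero_digits_pos: "k \<ge> 1 \<Longrightarrow> nonzero_digits k = Suc (nonzero_digits (rest k))"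
  by (subst nonzero_digits.simps) simp

lemma mu_per_peel_le: "mu_per r (peel k) \<le> mu_per r k"
proof (induction r arbitrary: k)
  case (Suc r)
  have "len (peel k) \<le> len k" using len_rest[of k] by (auto simp: peel_def)
  then show ?case using Suc[of "peel k"] by (auto simp: add_mono)
qed simp

lemma mu_per_rest_less:
  assumes "rest k \<ge> 1"
  shows "Suc (mu_per (Suc r) (rest k)) \<le> mu_per (Suc r) k" "mu_per (Suc r) (rest k) < len k + mu_per r k"
proof -
  have s: "peel k = rest k" using assms by (simp add: peel_def)
  have l: "len (rest k) < len k" by (rule len_rest[OF assms])
  show "Suc (mu_per (Suc r) (rest k)) \<le> mu_per (Suc r) k"
    using l mu_per_peel_le[of r "rest k"] by (simp add: s)
  show "mu_per (Suc r) (rest k) < len k + mu_per r k"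
    using l mu_per_peel_le[of r "rest k"] mu_per_peel_le[of r k] by (simp add: s)
qed

text \<open>Once all nonzero digits have been counted, each further step counts the last one again
  and adds at least 1. The surplus \<open>r - nonzero_digits k\<close> becomes the denominator
  \<open>b ^ (2 * (\<tau> - \<nu>))\<close> in \<open>C_prime\<close>.\<close>

lemma nonzero_digits_le_mu_per:
  "k \<ge> 1 \<Longrightarrow> nonzero_digits k \<le> r \<Longrightarrow> mu n k + (r - nonzero_digits k) \<le> mu_per r k"
proof (induction r arbitrary: k n)
  case 0
  then show ?case by (simp add: nonzero_digits_pos)
next
  case (Suc r)
  show ?case
  proof (cases "rest k = 0")
    case True
    have "nonzero_digits k = 1" using Suc.prems(1) True by (simp add: nonzero_digits_pos)
    have mp: "mu_per r k = r * len k" for r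
      by (induction r) (simp_all add: peel_def True)
    have m: "mu n k \<le> len k"
    proof (cases n)
      case (Suc n')
      have "mu n' 0 = 0" for n' by (induction n') simp_all
      then show ?thesis by (simp add: Suc True)
    qed simp
    have "r \<le> r * len k" using len_pos[OF Suc.prems(1)] by (cases "len k") simp_all
    with m have "mu n k + r \<le> len k + r * len k" by (rule add_mono)
    then show ?thesis by (simp only: mp mult_Suc \<open>nonzero_digits k = 1\<close> diff_Suc_1)
  next
    case False
    then have r1: "rest k \<ge> 1" by simp
    have nonzero_digits: "nonzero_digits k = Suc (nonzero_digits (rest k))" using Suc.prems(1) by (rule nonzero_digits_pos)
    show ?thesis
    proof (cases n)
      case 0
      then show ?thesis using Suc.IH[of "rest k" 0] r1 nonzero_digits Suc.prems False by (simp add: peel_def)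
    next
      case (Suc n')
      then show ?thesis using Suc.IH[of "rest k" n'] r1 nonzero_digits Suc.prems False by (simp add: peel_def)
    qed
  qed
qed

lemma mu_le_mu_per: "mu r k \<le> mu_per r k"
proof (induction r arbitrary: k)
  case (Suc r)
  show ?case
  proof (cases "rest k = 0")
    case True
    have "mu r 0 = 0" by (induction r) simp_all
    then show ?thesis by (simp add: True)
  next
    case False
    then show ?thesis using Suc[of "rest k"] by (simp add: peel_def)
  qed
qed simp

definition growth_const :: real where "growth_const = 1 + 1 / real b + 1 / (real b * (real b + 1))"

lemma growth_const_pos: "0 < growth_const" unfolding growth_const_def by (intro add_pos_nonneg) auto

text \<open>There are \<open>b - 1\<close> choices of a prepended digit; one factor
  \<open>(1 / b) ^ c\<close> is the coefficient in the expansion and the other the gain from the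
  higher leading position. The closed form is \<open>(1 - b ^ (- 2 * C)) / (b + 1)\<close>.\<close>

lemma geo_bound: "(\<Sum>c=1..C. (1 / real b) ^ c * ((real b - 1) * (1 / real b) ^ c)) \<le> 1 / (real b + 1)"
proof -
  have "(\<Sum>c=1..C. (1 / real b) ^ c * ((real b - 1) * (1 / real b) ^ c)) = 1 / (real b + 1) * (1 - ((1 / real b) ^ C)\<^sup>2)"
  proof (induction C)
    case (Suc C)
    have q: "real b + 1 \<noteq> 0" by (metis add.commute of_nat_Suc of_nat_eq_0_iff nat.distinct(1))
    have "(1 / real b) ^ Suc C * ((real b - 1) * (1 / real b) ^ Suc C) = ((1 / real b) ^ C)\<^sup>2 * (real b - 1) / (real b)\<^sup>2"
      by (simp add: power2_eq_square field_simps)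
    also have "\<dots> = 1 / (real b + 1) * (((1 / real b) ^ C)\<^sup>2 - ((1 / real b) ^ Suc C)\<^sup>2)"
    proof -
      have "1 / (real b + 1) * (X\<^sup>2 - (1 / real b * X)\<^sup>2) = X\<^sup>2 * (real b - 1) / (real b)\<^sup>2" for X
      proof -
        have "X\<^sup>2 - (1 / real b * X)\<^sup>2 = (real b + 1) * (X\<^sup>2 * (real b - 1) / (real b)\<^sup>2)"
          by (simp add: field_simps power2_eq_square)
        then show ?thesis using q by simp
      qed
      then show ?thesis by (simp only: power_Suc)
    qed
    finally have t: "(1 / real b) ^ Suc C * ((real b - 1) * (1 / real b) ^ Suc C) = 1 / (real b + 1) * (((1 / real b) ^ C)\<^sup>2 - ((1 / real b) ^ Suc C)\<^sup>2)" .
    have "(\<Sum>c=1..Suc C. (1 / real b) ^ c * ((real b - 1) * (1 / real b) ^ c))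
      = (1 / real b) ^ Suc C * ((real b - 1) * (1 / real b) ^ Suc C) + (\<Sum>c=1..C. (1 / real b) ^ c * ((real b - 1) * (1 / real b) ^ c))"
      by (rule sum.nat_ivl_Suc') simp
    moreover have "q * (x - y) + q * (1 - x) = q * (1 - y)" for q x y :: real by (simp add: algebra_simps)
    ultimately show ?case by (simp only: t Suc.IH)
  qed simp
  also have "\<dots> \<le> 1 / (real b + 1) * 1"
    by (intro mult_left_mono) auto
  finally show ?thesis by simp
qed

text \<open>One antidifferentiation costs a factor \<open>S * growth_const\<close> and gains the
  length of the index. \<open>R\<close> may depend on \<open>r\<close> but not on \<open>C\<close>,
  so the remainder disappears for fixed \<open>k\<close>. The starting order \<open>r0\<close> is a
  parameter because point values start at order 2 and inner products at order 1.\<close>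

lemma recursion_bound:
  fixes P :: "nat \<Rightarrow> nat \<Rightarrow> real"
  assumes rec: "\<And>r. r \<ge> r0 \<Longrightarrow> \<exists>R. \<forall>k C. k \<ge> 1 \<longrightarrow> P (Suc r) k \<le> (1 / real b) ^ len k *
      (S * (P r (rest k) + P r k + (\<Sum>c=1..C. (1 / real b) ^ c * (\<Sum>t=1..<b. P r (prepend k c t)))) + R * (1 / real b) ^ C)"
    and zero: "\<And>r. r \<ge> r0 \<Longrightarrow> P r 0 = 0"
    and base: "\<And>k. k \<ge> 1 \<Longrightarrow> P r0 k \<le> B * (1 / real b) ^ mu_per r0 k"
    and r0: "r0 \<ge> 1" and S: "S \<ge> 0" and B: "B \<ge> 0"
  shows "k \<ge> 1 \<Longrightarrow> P (r0 + i) k \<le> B * (S * growth_const) ^ i * (1 / real b) ^ mu_per (r0 + i) k"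
proof (induction i arbitrary: k)
  case 0
  then show ?case using base by simp
next
  case (Suc i)
  let ?y = "1 / real b" and ?Q = "B * (S * growth_const) ^ i"
  obtain r where r: "r0 + i = Suc r" using r0 by (cases "r0 + i") auto
  have Q: "0 \<le> ?Q" using B S growth_const_pos by simp
  have y: "0 < ?y" "?y \<le> 1" by simp_all
  note IH = Suc.IH[unfolded r]
  obtain R where R: "\<And>C. P (Suc (Suc r)) k \<le> ?y ^ len k *
      (S * (P (Suc r) (rest k) + P (Suc r) k + (\<Sum>c=1..C. ?y ^ c * (\<Sum>t=1..<b. P (Suc r) (prepend k c t)))) + R * ?y ^ C)"
    using rec[of "Suc r"] r Suc.prems by force
  let ?e = "mu_per (Suc r) (peel k)"
  have prepend: "P (Suc r) (prepend k c t) \<le> ?Q * ?y ^ (c + (len k + mu_per r k))" if "c \<ge> 1" "t \<in> {1..<b}" for c t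
  proof -
    note u = prepend_facts[OF Suc.prems that]
    have "peel (prepend k c t) = k" using u(2) Suc.prems by (simp add: peel_def)
    then have "mu_per (Suc r) (prepend k c t) = c + (len k + mu_per r k)" by (simp add: u(1))
    then show ?thesis using IH[OF u(3)] by simp
  qed
  have sum: "(\<Sum>c=1..C. ?y ^ c * (\<Sum>t=1..<b. P (Suc r) (prepend k c t))) \<le> ?Q * ?y ^ (len k + mu_per r k) * (1 / (real b + 1))" for C
  proof -
    have "(\<Sum>c=1..C. ?y ^ c * (\<Sum>t=1..<b. P (Suc r) (prepend k c t)))
      \<le> (\<Sum>c=1..C. ?y ^ c * (\<Sum>t=1..<b. ?Q * ?y ^ (c + (len k + mu_per r k))))"
      by (intro sum_mono mult_left_mono prepend) auto
    also have "\<dots> = ?Q * ?y ^ (len k + mu_per r k) * (\<Sum>c=1..C. ?y ^ c * ((real b - 1) * ?y ^ c))"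
    proof -
      have "real (b - Suc 0) = real b - 1" by (simp add: of_nat_diff Suc_leI)
      then show ?thesis by (simp add: sum_distrib_left power_add mult_ac)
    qed
    also have "\<dots> \<le> ?Q * ?y ^ (len k + mu_per r k) * (1 / (real b + 1))"
      using Q by (intro mult_left_mono geo_bound) auto
    finally show ?thesis .
  qed
  have main: "P (Suc r) (rest k) + P (Suc r) k + ?Q * ?y ^ (len k + mu_per r k) * (1 / (real b + 1)) \<le> ?Q * ?y ^ ?e * growth_const"
  proof (cases "rest k = 0")
    \<comment> \<open>Deletion contributes 0; the kept index is the main term, and prepending adds
      at most \<open>1 / (b + 1)\<close> of it.\<close>
    case True
    have s: "peel k = k" by (simp add: peel_def True)
    have "P (Suc r) (rest k) = 0" using zero[of "Suc r"] r True by simp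
    moreover have "P (Suc r) k \<le> ?Q * ?y ^ ?e" using IH[OF Suc.prems] s by simp
    moreover have "len k + mu_per r k = ?e" by (simp add: s)
    moreover have "1 + 1 / (real b + 1) \<le> growth_const"
    proof -
      have "1 / (real b + 1) \<le> 1 / real b" by (intro divide_left_mono) auto
      then show ?thesis by (simp add: growth_const_def add_increasing2)
    qed
    then have "?Q * ?y ^ ?e * (1 + 1 / (real b + 1)) \<le> ?Q * ?y ^ ?e * growth_const"
      using Q by (intro mult_left_mono) auto
    ultimately show ?thesis by (simp only: distrib_left mult_1_right)
  next
    \<comment> \<open>Deletion is the main term. By \<open>mu_per_rest_less\<close>, keeping the
      index or prepending to it loses at least one more factor \<open>1 / b\<close>.\<close>
    case False
    then have r1: "rest k \<ge> 1" by simp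
    have s: "peel k = rest k" using False by (simp add: peel_def)
    note ml = mu_per_rest_less[OF r1, of r]
    have 1: "P (Suc r) (rest k) \<le> ?Q * ?y ^ ?e" using IH[OF r1] s by simp
    have "P (Suc r) k \<le> ?Q * ?y ^ mu_per (Suc r) k" by (rule IH[OF Suc.prems])
    also have "\<dots> \<le> ?Q * ?y ^ Suc ?e" using Q y ml(1) s by (intro mult_left_mono power_decreasing) auto
    finally have 2: "P (Suc r) k \<le> ?Q * ?y ^ ?e * ?y" by (simp only: power_Suc mult_ac)
    have "?Q * ?y ^ (len k + mu_per r k) * (1 / (real b + 1)) \<le> ?Q * ?y ^ Suc ?e * (1 / (real b + 1))"
      using Q y ml(2) s by (intro mult_right_mono mult_left_mono power_decreasing) auto
    then have 3: "?Q * ?y ^ (len k + mu_per r k) * (1 / (real b + 1)) \<le> ?Q * ?y ^ ?e * (?y * (1 / (real b + 1)))"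
      by (simp only: power_Suc mult_ac)
    have "?Q * ?y ^ ?e + ?Q * ?y ^ ?e * ?y + ?Q * ?y ^ ?e * (?y * (1 / (real b + 1))) = ?Q * ?y ^ ?e * growth_const"
      unfolding growth_const_def by (simp add: algebra_simps)
    then show ?thesis using 1 2 3 by linarith
  qed
  let ?Z = "?y ^ len k * (S * (?Q * ?y ^ ?e * growth_const))"
  have le: "P (Suc (Suc r)) k \<le> ?Z + ?y ^ len k * R * ?y ^ C" for C
  proof -
    have A: "S * (P (Suc r) (rest k) + P (Suc r) k + (\<Sum>c=1..C. ?y ^ c * (\<Sum>t=1..<b. P (Suc r) (prepend k c t))))
      \<le> S * (?Q * ?y ^ ?e * growth_const)"
      using main sum[of C] S by (intro mult_left_mono) linarith+
    have "?y ^ len k * (S * (P (Suc r) (rest k) + P (Suc r) k + (\<Sum>c=1..C. ?y ^ c * (\<Sum>t=1..<b. P (Suc r) (prepend k c t)))) + R * ?y ^ C)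
      \<le> ?y ^ len k * (S * (?Q * ?y ^ ?e * growth_const) + R * ?y ^ C)"
      by (rule mult_left_mono[OF add_right_mono[OF A]]) simp
    then show ?thesis using R[of C] by (simp only: distrib_left mult.assoc)
  qed
  have "(\<lambda>C. ?Z + ?y ^ len k * R * ?y ^ C) \<longlonglongrightarrow> ?Z + ?y ^ len k * R * 0"
    by (intro tendsto_add tendsto_mult tendsto_const LIMSEQ_power_zero) simp
  then have "P (Suc (Suc r)) k \<le> ?Z + ?y ^ len k * R * 0"
    by (rule LIMSEQ_le_const) (use le in blast)
  moreover have "?Z + ?y ^ len k * R * 0 = B * (S * growth_const) ^ Suc i * ?y ^ mu_per (Suc (Suc r)) k"
    unfolding mu_per.simps(2)[of "Suc r"] power_add power_Suc by (simp only: mult_zero_right add_0_right mult_ac)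
  ultimately show ?case by (simp only: r add_Suc_right)
qed

end

context radix
begin

section \<open>Point values and inner products of iterated antiderivatives\<close>

lemma linfun_eval: "linfun (\<lambda>f. prim f 0) 4"
  unfolding linfun_def
  using prim_linear[of _ _ 0] prim_bound[of _ _ 0] by auto

lemma linfun_mean: "linfun mean 1"
  unfolding linfun_def using mean_linear mean_bound by auto

text \<open>The \<open>prim\<close> is built into the functional so that it annihilates constants,
  as the recursion demands.\<close>

lemma linfun_pair:
  assumes g: "continuous_on {0..1} g"
  shows "\<exists>R. linfun (\<lambda>f. mean (\<lambda>x. prim f x * cnj (g x))) R"
proof -
  obtain G where G': "\<forall>v\<in>g ` {0..1}. norm v \<le> G"
    using compact_imp_bounded[OF compact_continuous_image[OF g compact_Icc]] unfolding bounded_iff by blast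
  have G: "norm (g x) \<le> G" if "x \<in> {0..1}" for x
    using G' that by blast
  have G0: "0 \<le> G" by (rule order_trans[OF norm_ge_zero G[of 0]]) simp
  have i: "(\<lambda>x. prim f x * cnj (g x)) integrable_on {0..1}" if "f integrable_on {0..1}" for f
    by (intro integrable_continuous_interval continuous_on_mult continuous_on_cnj prim_cont[OF that] g)
  have "linfun (\<lambda>f. mean (\<lambda>x. prim f x * cnj (g x))) (4 * G)"
    unfolding linfun_def
  proof (intro conjI allI impI)
    fix f h :: "real \<Rightarrow> complex" and c assume f: "f integrable_on {0..1}" and h: "h integrable_on {0..1}"
    have "mean (\<lambda>x. prim (\<lambda>x. c * f x + h x) x * cnj (g x)) = mean (\<lambda>x. c * (prim f x * cnj (g x)) + prim h x * cnj (g x))"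
      by (rule mean_cong) (simp only: prim_linear[OF f h] distrib_right mult.assoc)
    then show "mean (\<lambda>x. prim (\<lambda>x. c * f x + h x) x * cnj (g x)) = c * mean (\<lambda>x. prim f x * cnj (g x)) + mean (\<lambda>x. prim h x * cnj (g x))"
      using mean_linear[OF i[OF f] i[OF h]] by simp
  next
    fix f :: "real \<Rightarrow> complex" and B assume f: "f integrable_on {0..1}" and B: "\<forall>x\<in>{0..1}. norm (f x) \<le> B"
    have "norm (prim f x * cnj (g x)) \<le> (4 * B) * G" if x: "x \<in> {0..1}" for x
    proof -
      have v: "norm (prim f x) \<le> 4 * B" by (rule prim_bound[OF f _ x]) (use B in auto)
      then have "0 \<le> 4 * B" by (rule order_trans[OF norm_ge_zero])
      then show ?thesis unfolding norm_mult complex_mod_cnj using v G[OF x] by (intro mult_mono) auto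
    qed
    then have "norm (mean (\<lambda>x. prim f x * cnj (g x))) \<le> (4 * B) * G" by (rule mean_bound[OF i[OF f]])
    then show "norm (mean (\<lambda>x. prim f x * cnj (g x))) \<le> 4 * G * B" by (simp add: mult_ac)
  qed (use G0 in simp)
  then show ?thesis by blast
qed

text \<open>The innermost \<open>prim\<close> is expanded while the outer \<open>r\<close> powers
  are absorbed into the functional; its bound \<open>R'\<close> depends on \<open>r\<close> only,
  neither on \<open>k\<close> nor on \<open>C\<close>.\<close>

lemma prim_recursion:
  assumes L: "linfun L R" "L (\<lambda>_. 1) = 0"
  shows "\<exists>R. \<forall>k C. k \<ge> 1 \<longrightarrow> norm (L ((prim ^^ Suc r) (wal k))) \<le> (1 / real b) ^ len k *
    (sin_const * (norm (L ((prim ^^ r) (wal (rest k)))) + norm (L ((prim ^^ r) (wal k)))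
      + (\<Sum>c=1..C. (1 / real b) ^ c * (\<Sum>t=1..<b. norm (L ((prim ^^ r) (wal (prepend k c t)))))))
     + R * (1 / real b) ^ C)"
proof -
  obtain R' where R': "linfun (\<lambda>f. L ((prim ^^ r) f)) R'" using linfun_prim_power(1)[OF L] by blast
  show ?thesis
  proof (intro exI allI impI)
    fix k C :: nat assume k: "k \<ge> 1"
    have "L ((prim ^^ Suc r) (wal k)) = L ((prim ^^ r) (prim (wal k)))" by (simp add: funpow_swap1)
    also have "\<dots> = L ((prim ^^ r) (wal_prim k))"
      by (rule prim_wal_wal_prim[OF R' linfun_prim_power(2)[OF L] k])
    finally show "norm (L ((prim ^^ Suc r) (wal k))) \<le> (1 / real b) ^ len k *
      (sin_const * (norm (L ((prim ^^ r) (wal (rest k)))) + norm (L ((prim ^^ r) (wal k)))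
        + (\<Sum>c=1..C. (1 / real b) ^ c * (\<Sum>t=1..<b. norm (L ((prim ^^ r) (wal (prepend k c t)))))))
       + R' * (1 / real b) ^ C)"
      using linfun_wal_prim_bound[OF R' k, of C] by simp
  qed
qed

lemma prim_wal_0:
  assumes "linfun L R" "L (\<lambda>_. 1) = 0"
  shows "L ((prim ^^ r) (wal 0)) = 0"
proof -
  have "wal 0 = (\<lambda>_. 1)" by (simp add: fun_eq_iff)
  then show ?thesis using linfun_prim_power(2)[OF assms] by simp
qed

lemma iterate_bound:
  assumes L: "linfun L R" "L (\<lambda>_. 1) = 0" and B: "B \<ge> 0"
    and base: "\<And>k. k \<ge> 1 \<Longrightarrow> norm (L ((prim ^^ r) (wal k))) \<le> B * (1 / real b) ^ mu_per (Suc r) k"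
    and k: "k \<ge> 1"
  shows "norm (L ((prim ^^ (r + i)) (wal k))) \<le> B * (sin_const * growth_const) ^ i * (1 / real b) ^ mu_per (Suc r + i) k"
proof -
  \<comment> \<open>For the functionals in question \<open>L\<close> itself contains one
    \<open>prim\<close>; \<open>n\<close> counts this one as well, which makes the order match the
    index of \<open>mu_per\<close>.\<close>
  let ?P = "\<lambda>n k. norm (L ((prim ^^ (n - 1)) (wal k)))"
  have "?P (Suc r + i) k \<le> B * (sin_const * growth_const) ^ i * (1 / real b) ^ mu_per (Suc r + i) k"
  proof (rule recursion_bound[where P = ?P])
    fix n assume n: "n \<ge> Suc r"
    then obtain n' where n': "n = Suc n'" by (cases n) auto
    show "\<exists>R. \<forall>k C. k \<ge> 1 \<longrightarrow> ?P (Suc n) k \<le> (1 / real b) ^ len k *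
      (sin_const * (?P n (rest k) + ?P n k + (\<Sum>c=1..C. (1 / real b) ^ c * (\<Sum>t=1..<b. ?P n (prepend k c t)))) + R * (1 / real b) ^ C)"
      using prim_recursion[OF L, of n'] unfolding n' diff_Suc_1 .
    show "?P n 0 = 0" using prim_wal_0[OF L] by simp
  qed (use base B k sin_const_pos in auto)
  then show ?thesis by simp
qed

lemma power_limit_0:
  fixes X R :: real
  assumes "\<And>C. X \<le> R * (1 / real b) ^ C"
  shows "X \<le> 0"
proof -
  have "(\<lambda>C. R * (1 / real b) ^ C) \<longlonglongrightarrow> R * 0"
    by (intro tendsto_mult tendsto_const LIMSEQ_power_zero) simp
  then have "X \<le> R * 0" by (rule LIMSEQ_le_const) (use assms in blast)
  then show ?thesis by simp
qed

lemma mean_wal_if: "mean (wal k) = (if k = 0 then 1 else 0)"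
proof (cases "k = 0")
  case True
  have "mean (wal 0) = mean (\<lambda>_. 1)" by (rule mean_cong) simp
  then show ?thesis using True by simp
qed (simp add: mean_wal)

text \<open>The functional \<open>mean\<close> sees only index 0. Kept and prepended indices are
  positive, so this index arises only by deleting the sole nonzero digit.\<close>

lemma mean_wal_prim:
  assumes k: "k \<ge> 1"
  shows "of_nat (b ^ len k) * mean (wal_prim k) = (if rest k = 0 then geom_const (lead k) else 0)"
proof -
  let ?v = "if rest k = 0 then geom_const (lead k) else 0"
  have "norm (of_nat (b ^ len k) * mean (wal_prim k) - ?v) \<le> 1 * (1 / real b) ^ C" for C
  proof -
    have "geom_const (lead k) * mean (wal (rest k)) + (1 / 2 - geom_const (lead k)) * mean (wal k)
      + (\<Sum>(c, t)\<in>{1..C} \<times> {1..<b}. (1 / of_nat b) ^ c * sawtooth_coeff t * mean (wal (prepend k c t))) = ?v + 0 + 0"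
    proof (intro arg_cong2[where f = "(+)"])
      show "(\<Sum>(c, t)\<in>{1..C} \<times> {1..<b}. (1 / of_nat b) ^ c * sawtooth_coeff t * mean (wal (prepend k c t))) = 0"
        using prepend_facts(3)[OF k] by (intro sum.neutral) (auto simp: mean_wal)
    qed (use k in \<open>auto simp: mean_wal_if\<close>)
    then show ?thesis using linfun_wal_prim[OF linfun_mean k, of C] by simp
  qed
  then have "norm (of_nat (b ^ len k) * mean (wal_prim k) - ?v) \<le> 0" by (rule power_limit_0)
  then show ?thesis by simp
qed

lemma prim_wal_eq:
  assumes k: "k \<ge> 1"
  shows "prim (wal k) x = wal_prim k x - mean (wal_prim k)"
  using mean_wal[OF k] by (simp add: prim_def wal_prim_def[abs_def])

lemma prim_wal_at_0:
  assumes k: "k \<ge> 1"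
  shows "norm (prim (wal k) 0) = (if rest k = 0 then norm (geom_const (lead k)) * (1 / real b) ^ len k else 0)"
proof -
  have "prim (wal k) 0 = - mean (wal_prim k)" using prim_wal_eq[OF k, of 0] by (simp add: wal_prim_def)
  moreover have "mean (wal_prim k) = (if rest k = 0 then geom_const (lead k) else 0) / of_nat (b ^ len k)"
    unfolding mean_wal_prim[OF k, symmetric] by simp
  ultimately show ?thesis by (simp add: norm_divide norm_power power_one_over)
qed

lemma eval_const: "prim (\<lambda>_. 1) 0 = 0"
  by (simp add: prim_const)

text \<open>The value of one antiderivative at 0 detects only indices with a single nonzero digit,
  and each further antidifferentiation deletes at most one digit. This is why the sum in
  \<open>C_prime\<close> starts at the number of nonzero digits.\<close>

lemma coeff_zero:
  "k \<ge> 1 \<Longrightarrow> nonzero_digits k > Suc r \<Longrightarrow> prim ((prim ^^ r) (wal k)) 0 = 0"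
proof (induction r arbitrary: k)
  case 0
  have "rest k \<noteq> 0"
  proof
    assume "rest k = 0"
    then show False using 0(2) nonzero_digits_pos[OF 0(1)] by simp
  qed
  then show ?case using prim_wal_at_0[OF 0(1)] by simp
next
  case (Suc r)
  obtain R where R: "\<And>k C. k \<ge> 1 \<Longrightarrow> norm (prim ((prim ^^ Suc r) (wal k)) 0) \<le> (1 / real b) ^ len k *
    (sin_const * (norm (prim ((prim ^^ r) (wal (rest k))) 0) + norm (prim ((prim ^^ r) (wal k)) 0)
      + (\<Sum>c=1..C. (1 / real b) ^ c * (\<Sum>t=1..<b. norm (prim ((prim ^^ r) (wal (prepend k c t))) 0))))
     + R * (1 / real b) ^ C)"
    using prim_recursion[OF linfun_eval eval_const, of r] by blast
  have n: "nonzero_digits (rest k) > Suc r" using Suc.prems by (simp add: nonzero_digits_pos)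
  then have "rest k \<ge> 1" by (cases "rest k") auto
  then have 1: "prim ((prim ^^ r) (wal (rest k))) 0 = 0" using n by (rule Suc.IH)
  have 2: "prim ((prim ^^ r) (wal k)) 0 = 0" using Suc.prems by (intro Suc.IH) auto
  have 3: "prim ((prim ^^ r) (wal (prepend k c t))) 0 = 0" if "c \<ge> 1" "t \<in> {1..<b}" for c t
    using Suc.prems prepend_facts(2,3)[OF Suc.prems(1) that] by (intro Suc.IH) (auto simp: nonzero_digits_pos)
  have "norm (prim ((prim ^^ Suc r) (wal k)) 0) \<le> ((1 / real b) ^ len k * R) * (1 / real b) ^ C" for C
  proof -
    have "(\<Sum>c=1..C. (1 / real b) ^ c * (\<Sum>t=1..<b. norm (prim ((prim ^^ r) (wal (prepend k c t))) 0))) = 0"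
      by (intro sum.neutral ballI) (simp add: 3)
    then show ?thesis using R[OF Suc.prems(1), of C] 1 2 by (simp add: mult.assoc)
  qed
  then have "norm (prim ((prim ^^ Suc r) (wal k)) 0) \<le> 0" by (rule power_limit_0)
  then show ?case by simp
qed

lemma C_const_1: "C_const 1 b = sin_const"
  by (simp add: C_const_def sin_const_def)

lemma C_const_ge: "C_const (Suc (Suc r)) b = sin_const\<^sup>2 * (sin_const * growth_const) ^ r"
  by (simp add: C_const_def sin_const_def growth_const_def power_mult_distrib power_divide power2_eq_square)

text \<open>At this order prepended indices have at least two nonzero digits and contribute 0, and
  of deleting and keeping at most one survives. So no growth factor arises, which explains the
  exponent \<open>\<tau> - 2\<close> in \<open>C_const\<close>.\<close>

lemma coeff_bound_2:
  assumes k: "k \<ge> 1"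
  shows "norm (prim (prim (wal k)) 0) \<le> sin_const\<^sup>2 * (1 / real b) ^ mu_per 2 k"
proof -
  let ?y = "1 / real b"
  obtain R where R: "\<And>k C. k \<ge> 1 \<Longrightarrow> norm (prim (prim (wal k)) 0) \<le> ?y ^ len k *
    (sin_const * (norm (prim (wal (rest k)) 0) + norm (prim (wal k) 0)
      + (\<Sum>c=1..C. ?y ^ c * (\<Sum>t=1..<b. norm (prim (wal (prepend k c t)) 0))))
     + R * ?y ^ C)"
    using prim_recursion[OF linfun_eval eval_const, of 0] by auto
  have m2: "mu_per 2 k = len k + len (peel k)" by (simp add: numeral_2_eq_2)
  have b: "norm (prim (wal k) 0) \<le> sin_const * ?y ^ len k" if "k \<ge> 1" for k
    unfolding prim_wal_at_0[OF that] using geom_const_bound[OF len_decomp(2,3)[OF that]] sin_const_pos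
    by (auto intro!: mult_right_mono)
  have m: "norm (prim (wal (rest k)) 0) + norm (prim (wal k) 0) \<le> sin_const * ?y ^ len (peel k)"
  proof (cases "rest k = 0")
    case True
    have "wal 0 = (\<lambda>_. 1)" by (simp add: fun_eq_iff)
    then show ?thesis using True b[OF k] by (simp add: peel_def eval_const)
  next
    case False
    then show ?thesis using prim_wal_at_0[OF k] b[of "rest k"] by (simp add: peel_def)
  qed
  have "norm (prim (prim (wal k)) 0) - sin_const\<^sup>2 * ?y ^ mu_per 2 k \<le> (?y ^ len k * R) * ?y ^ C" for C
  proof -
    have "norm (prim (wal (prepend k c t)) 0) = 0" if "c \<in> {1..C}" "t \<in> {1..<b}" for c t
      using prepend_facts(2,3)[OF k _ that(2), of c] that(1) k by (subst prim_wal_at_0) auto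
    then have "(\<Sum>c=1..C. ?y ^ c * (\<Sum>t=1..<b. norm (prim (wal (prepend k c t)) 0))) = 0"
      by (intro sum.neutral ballI) simp
    then have "norm (prim (prim (wal k)) 0) \<le> ?y ^ len k * (sin_const * (norm (prim (wal (rest k)) 0) + norm (prim (wal k) 0)) + R * ?y ^ C)"
      using R[OF k, of C] by simp
    also have "\<dots> \<le> ?y ^ len k * (sin_const * (sin_const * ?y ^ len (peel k)) + R * ?y ^ C)"
      using m sin_const_pos by (intro mult_left_mono add_right_mono) auto
    also have "\<dots> = sin_const\<^sup>2 * ?y ^ mu_per 2 k + (?y ^ len k * R) * ?y ^ C"
      unfolding m2 power_add by (simp add: power2_eq_square algebra_simps)
    finally show ?thesis by simp
  qed
  then have "norm (prim (prim (wal k)) 0) - sin_const\<^sup>2 * ?y ^ mu_per 2 k \<le> 0" by (rule power_limit_0)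
  then show ?thesis by simp
qed

lemma coeff_bound:
  assumes k: "k \<ge> 1" and r: "r \<ge> 1"
  shows "norm ((prim ^^ r) (wal k) 0) \<le> C_const r b * (1 / real b) ^ mu_per r k"
proof (cases "r = 1")
  case True
  have "norm (prim (wal k) 0) \<le> sin_const * (1 / real b) ^ len k"
    unfolding prim_wal_at_0[OF k] using geom_const_bound[OF len_decomp(2,3)[OF k]] sin_const_pos
    by (auto intro!: mult_right_mono)
  then show ?thesis using C_const_1 by (simp add: True)
next
  case False
  then have "r = Suc (Suc (r - 2))" using r by simp
  then obtain i where i: "r = Suc (Suc i)" by blast
  have "norm (prim ((prim ^^ (1 + i)) (wal k)) 0) \<le> sin_const\<^sup>2 * (sin_const * growth_const) ^ i * (1 / real b) ^ mu_per (Suc 1 + i) k"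
  proof (rule iterate_bound[OF linfun_eval eval_const _ _ k])
    show "norm (prim ((prim ^^ 1) (wal k)) 0) \<le> sin_const\<^sup>2 * (1 / real b) ^ mu_per (Suc 1) k" if "k \<ge> 1" for k
      using coeff_bound_2[OF that] by (simp only: One_nat_def funpow.simps comp_id numeral_2_eq_2)
  qed simp
  then show ?thesis
    unfolding i C_const_ge by (simp only: plus_1_eq_Suc One_nat_def add_Suc add_0 funpow.simps comp_apply)
qed

text \<open>
  The cross term integrates to \<open>0\<close>; this is what makes the constant in \<open>C_tilde\<close> a \<open>2\<close>
  rather than a \<open>4\<close>.
\<close>

lemma energy_bound:
  assumes k: "k \<ge> 1"
  shows "integral {0..1} (\<lambda>x. (norm (prim (wal k) x))\<^sup>2) \<le> 2 * sin_const\<^sup>2 * ((1 / real b) ^ len k)\<^sup>2"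
proof -
  let ?y = "(1 / real b) ^ len k" and ?A = "geom_const (lead k)" and ?N = "of_nat (b ^ len k) :: complex"
  note ld = len_decomp(2,3)[OF k]
  have cV: "continuous_on {0..1} (prim (wal k))" by (rule prim_cont[OF wal_integrable])
  have iV: "(\<lambda>x. (norm (prim (wal k) x))\<^sup>2) integrable_on {0..1}"
    by (intro integrable_continuous_interval continuous_intros cV)
  have AS: "(norm ?A)\<^sup>2 \<le> sin_const\<^sup>2" using geom_const_bound[OF ld] by (intro power_mono) auto
  have NJ: "?N * wal_prim k x = ?A * wal (rest k) x + wal k x * (of_real (scaled_frac (len k) x) - ?A)" if "x \<in> {0..1}" for x
    unfolding wal_prim_def integral_unique[OF wal_integral[OF k that]] by simp
  have yN: "norm (prim (wal k) x) = ?y * norm (?N * prim (wal k) x)" for x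
    by (simp add: norm_mult norm_power power_one_over)
  have zA: "norm (of_real (scaled_frac (len k) x) - ?A) \<le> norm ?A" for x
    using scaled_frac_bounds[of "len k" x] by (intro geom_const_shift_bound ld) auto
  show ?thesis
  proof (cases "rest k = 0")
    case True
    have "(norm (prim (wal k) x))\<^sup>2 \<le> sin_const\<^sup>2 * ?y\<^sup>2" if x: "x \<in> {0..1}" for x
    proof -
      have "?N * prim (wal k) x = wal k x * (of_real (scaled_frac (len k) x) - ?A)"
        using NJ[OF x] mean_wal_prim[OF k] True by (simp add: prim_wal_eq[OF k] right_diff_distrib)
      then have "norm (?N * prim (wal k) x) \<le> sin_const" using zA[of x] geom_const_bound[OF ld] by (simp add: norm_mult)
      then have "norm (prim (wal k) x) \<le> ?y * sin_const" unfolding yN by (intro mult_left_mono) auto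
      then have "(norm (prim (wal k) x))\<^sup>2 \<le> (?y * sin_const)\<^sup>2" by (intro power_mono) auto
      then show ?thesis by (simp add: power_mult_distrib mult.commute)
    qed
    note le = this
    have "integral {0..1} (\<lambda>x. (norm (prim (wal k) x))\<^sup>2) \<le> integral {0..1} (\<lambda>x::real. sin_const\<^sup>2 * ?y\<^sup>2)"
      by (rule Henstock_Kurzweil_Integration.integral_le[OF iV integrable_const_ivl le])
    also have "\<dots> = sin_const\<^sup>2 * ?y\<^sup>2" by simp
    also have "\<dots> \<le> 2 * (sin_const\<^sup>2 * ?y\<^sup>2)" by simp
    finally show ?thesis by (simp add: mult.assoc)
  next
    case False
    \<comment> \<open>\<open>l\<close> retains only the leading digit, so
      \<open>wal k = wal (rest k) * wal l\<close>. Up to the unimodular factor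
      \<open>wal (rest k)\<close> and the scale, the antiderivative is then
      \<open>?A + ?w x\<close>, and \<open>?w\<close> has mean 0 because
      \<open>geom_const (lead k)\<close> is the scaled mean of \<open>wal_prim l\<close>.\<close>
    define l where "l = lead k * b ^ (len k - 1)"
    have lf: "len l = len k" "rest l = 0" "lead l = lead k" "l \<ge> 1"
    proof -
      have l0: "l = lead k * b ^ (len k - 1) + 0" by (simp add: l_def)
      show ll: "len l = len k" and "rest l = 0"
        using len_compose[of 0 "len k - 1" "lead k"] ld len_decomp(5)[OF k] unfolding l0 by auto
      show "lead l = lead k" unfolding lead_def[of l] ll by (simp add: l_def)
      show "l \<ge> 1" using ld by (simp add: l_def)
    qed
    let ?w = "\<lambda>x. ?N * wal_prim l x - ?A"
    have Mw: "mean ?w = 0"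
    proof -
      have "mean (\<lambda>x. ?N * wal_prim l x + - ?A) = ?N * mean (wal_prim l) + mean (\<lambda>x. - ?A)"
        by (rule mean_linear[OF wal_prim_integrable]) (simp add: integrable_continuous_interval)
      then show ?thesis using mean_wal_prim[OF lf(4)] lf by simp
    qed
    have iw: "?w integrable_on {0..1}"
      by (intro integrable_diff integrable_on_mult_right wal_prim_integrable) (simp add: integrable_continuous_interval)
    have "(?w has_integral 0) {0..1}" using iw Mw by (simp add: mean_def has_integral_iff)
    then have "((\<lambda>x. cnj (?w x)) has_integral 0) {0..1}"
      using has_integral_cnj[of ?w 0 "{0..1}"] by (simp only: comp_def complex_cnj_zero)
    then have "((\<lambda>x. ?A * cnj (?w x)) has_integral ?A * 0) {0..1}"
      by (rule has_integral_mult_right)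
    from has_integral_linear[OF this bounded_linear_Re]
    have hRe: "((\<lambda>x. Re (?A * cnj (?w x))) has_integral 0) {0..1}" by (simp only: comp_def mult_zero_right zero_complex.sel)
    have hc: "((\<lambda>x::real. c) has_integral c) {0..1}" for c :: real
      using has_integral_const_real[of c 0 1] by simp
    have h: "((\<lambda>x. ?y\<^sup>2 * (2 * sin_const\<^sup>2 + 2 * Re (?A * cnj (?w x)))) has_integral ?y\<^sup>2 * (2 * sin_const\<^sup>2 + 2 * 0)) {0..1}"
      by (intro has_integral_mult_right has_integral_add hc hRe)
    have "(norm (prim (wal k) x))\<^sup>2 \<le> ?y\<^sup>2 * (2 * sin_const\<^sup>2 + 2 * Re (?A * cnj (?w x)))" if x: "x \<in> {0..1}" for x
    proof -
      let ?z = "of_real (scaled_frac (len k) x) - ?A"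
      have MJ: "mean (wal_prim k) = 0" using mean_wal_prim[OF k] False by simp
      have NV: "?N * prim (wal k) x = ?A * wal (rest k) x + wal k x * ?z"
        using NJ[OF x] by (simp add: prim_wal_eq[OF k] MJ)
      have wk: "wal k x = wal (rest k) x * wal l x"
        using wal_top[OF len_decomp(4)[OF k] ld(2), of x] wal_top[of 0 "len k - 1" "lead k" x] ld
          len_decomp(1)[OF k] by (simp add: l_def)
      have wl: "?w x = wal l x * ?z"
        unfolding wal_prim_def integral_unique[OF wal_integral[OF lf(4) x]] using lf by simp
      have "(norm (?N * prim (wal k) x))\<^sup>2 = (norm (?A + wal l x * ?z))\<^sup>2"
        unfolding NV wk by (simp add: norm_mult mult.assoc mult.commute[of ?A] flip: distrib_left)
      also have "\<dots> = (norm ?A)\<^sup>2 + (norm (?w x))\<^sup>2 + 2 * Re (?A * cnj (?w x))"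
        unfolding wl by (simp only: cmod_power2) (simp add: power2_eq_square algebra_simps)
      also have "(norm (?w x))\<^sup>2 \<le> sin_const\<^sup>2"
        unfolding wl norm_mult using zA[of x] geom_const_bound[OF ld] by (intro power_mono) auto
      finally have "(norm (?N * prim (wal k) x))\<^sup>2 \<le> 2 * sin_const\<^sup>2 + 2 * Re (?A * cnj (?w x))" using AS by linarith
      then have "?y\<^sup>2 * (norm (?N * prim (wal k) x))\<^sup>2 \<le> ?y\<^sup>2 * (2 * sin_const\<^sup>2 + 2 * Re (?A * cnj (?w x)))"
        by (rule mult_left_mono) simp
      then show ?thesis unfolding yN[of x] power_mult_distrib .
    qed
    then have "integral {0..1} (\<lambda>x. (norm (prim (wal k) x))\<^sup>2) \<le> ?y\<^sup>2 * (2 * sin_const\<^sup>2 + 2 * 0)"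
      by (rule has_integral_le[OF integrable_integral[OF iV] h])
    then show ?thesis by (simp add: mult_ac)
  qed
qed

text \<open>A weighted arithmetic-geometric mean inequality under the integral. The weights
  \<open>?q / ?p\<close> and \<open>?p / ?q\<close> balance the two energies, which are of order
  \<open>?p\<^sup>2\<close> and \<open>?q\<^sup>2\<close>.\<close>

lemma pair_bound_1:
  assumes k: "k \<ge> 1" and l: "l \<ge> 1"
  shows "norm (mean (\<lambda>x. prim (wal k) x * cnj (prim (wal l) x))) \<le> 2 * sin_const\<^sup>2 * (1 / real b) ^ len l * (1 / real b) ^ len k"
proof -
  let ?f = "prim (wal k)" and ?g = "prim (wal l)" and ?p = "(1 / real b) ^ len k" and ?q = "(1 / real b) ^ len l"
  have c: "continuous_on {0..1} ?f" "continuous_on {0..1} ?g" by (intro prim_cont[OF wal_integrable])+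
  have pq: "0 < ?p" "0 < ?q" by simp_all
  have "norm (mean (\<lambda>x. ?f x * cnj (?g x))) \<le> integral {0..1} (\<lambda>x. (?q / ?p * (norm (?f x))\<^sup>2 + ?p / ?q * (norm (?g x))\<^sup>2) / 2)"
    unfolding mean_def
  proof (rule integral_norm_bound_integral)
    show "(\<lambda>x. ?f x * cnj (?g x)) integrable_on {0..1}"
      by (intro integrable_continuous_interval continuous_intros c)
    show "(\<lambda>x. (?q / ?p * (norm (?f x))\<^sup>2 + ?p / ?q * (norm (?g x))\<^sup>2) / 2) integrable_on {0..1}"
      by (intro integrable_continuous_interval continuous_intros c) auto
    fix x :: real
    have "0 \<le> (?q * norm (?f x) - ?p * norm (?g x))\<^sup>2 / (?p * ?q)" using pq by simp
    also have "\<dots> = ?q / ?p * (norm (?f x))\<^sup>2 + ?p / ?q * (norm (?g x))\<^sup>2 - 2 * (norm (?f x) * norm (?g x))"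
    proof -
      have "(q * F - p * G)\<^sup>2 / (p * q) = q / p * F\<^sup>2 + p / q * G\<^sup>2 - 2 * (F * G)" if "p > 0" "q > 0" for p q F G :: real
        using that by (simp add: field_simps power2_eq_square)
      then show ?thesis using pq by blast
    qed
    finally show "norm (?f x * cnj (?g x)) \<le> (?q / ?p * (norm (?f x))\<^sup>2 + ?p / ?q * (norm (?g x))\<^sup>2) / 2"
      by (simp add: norm_mult)
  qed
  also have "\<dots> = (?q / ?p * integral {0..1} (\<lambda>x. (norm (?f x))\<^sup>2) + ?p / ?q * integral {0..1} (\<lambda>x. (norm (?g x))\<^sup>2)) / 2"
  proof -
    have i: "(\<lambda>x. (norm (?f x))\<^sup>2) integrable_on {0..1}" "(\<lambda>x. (norm (?g x))\<^sup>2) integrable_on {0..1}"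
      by (intro integrable_continuous_interval continuous_intros c)+
    show ?thesis
      by (intro integral_unique has_integral_divide has_integral_add has_integral_mult_right integrable_integral i)
  qed
  also have "\<dots> \<le> (?q / ?p * (2 * sin_const\<^sup>2 * ?p\<^sup>2) + ?p / ?q * (2 * sin_const\<^sup>2 * ?q\<^sup>2)) / 2"
    using energy_bound[OF k] energy_bound[OF l] pq
    by (intro divide_right_mono add_mono mult_left_mono) auto
  also have "\<dots> = 2 * sin_const\<^sup>2 * ?q * ?p"
  proof -
    have "(q / p * (2 * X * p\<^sup>2) + p / q * (2 * X * q\<^sup>2)) / 2 = 2 * X * q * p" if "p > 0" "q > 0" for p q X :: real
      using that by (simp add: field_simps power2_eq_square)
    then show ?thesis using pq by blast
  qed
  finally show ?thesis .
qed

lemma pair_const: "mean (\<lambda>x. prim (\<lambda>_. 1) x * cnj (g x)) = 0"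
proof -
  have "mean (\<lambda>x. prim (\<lambda>_. 1) x * cnj (g x)) = mean (\<lambda>_. 0)" by (rule mean_cong) (simp add: prim_const)
  then show ?thesis by simp
qed

lemma mean_cnj: "f integrable_on {0..1} \<Longrightarrow> mean (\<lambda>x. cnj (f x)) = cnj (mean f)"
  unfolding mean_def using integral_cnj[of "{0..1}" f] by simp

text \<open>Two rounds of the recursion, one for each side of the inner product. The first raises
  the order on the left against \<open>prim (wal l)\<close>; conjugate symmetry turns its result
  into the base case of the second, where the other side is already of order
  \<open>\<alpha>\<close>. Each round contributes \<open>\<alpha> - 1\<close> growth factors, hence
  the exponent \<open>2 * \<alpha> - 2\<close> in \<open>C_tilde\<close>.\<close>

lemma pair_bound:
  assumes k: "k \<ge> 1" and a: "\<alpha> \<ge> 1"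
  shows "norm (mean (\<lambda>x. (prim ^^ \<alpha>) (wal k) x * cnj ((prim ^^ \<alpha>) (wal k) x))) \<le> C_tilde \<alpha> b * ((1 / real b) ^ mu_per \<alpha> k)\<^sup>2"
proof -
  obtain i where i: "\<alpha> = Suc i" using a by (cases \<alpha>) auto
  let ?W = "\<lambda>k. (prim ^^ \<alpha>) (wal k)"
  have c: "continuous_on {0..1} (?W k)" for k by (rule prim_power_cont[OF wal_pw_continuous a])
  have c1: "continuous_on {0..1} (prim (wal l))" for l by (rule prim_cont[OF wal_integrable])
  have 1: "norm (mean (\<lambda>x. ?W k x * cnj (prim (wal l) x))) \<le> 2 * sin_const\<^sup>2 * (1 / real b) ^ len l * (sin_const * growth_const) ^ i * (1 / real b) ^ mu_per \<alpha> k"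
    if l: "l \<ge> 1" for l
  proof -
    obtain R where R: "linfun (\<lambda>f. mean (\<lambda>x. prim f x * cnj (prim (wal l) x))) R" using linfun_pair[OF c1] by blast
    have "norm (mean (\<lambda>x. prim ((prim ^^ (0 + i)) (wal k)) x * cnj (prim (wal l) x)))
      \<le> 2 * sin_const\<^sup>2 * (1 / real b) ^ len l * (sin_const * growth_const) ^ i * (1 / real b) ^ mu_per (Suc 0 + i) k"
    proof (rule iterate_bound[OF R pair_const _ _ k])
      show "norm (mean (\<lambda>x. prim ((prim ^^ 0) (wal k)) x * cnj (prim (wal l) x)))
        \<le> 2 * sin_const\<^sup>2 * (1 / real b) ^ len l * (1 / real b) ^ mu_per (Suc 0) k" if "k \<ge> 1" for k
        using pair_bound_1[OF that l] by simp
    qed simp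
    then show ?thesis by (simp only: i funpow.simps comp_apply add_0 add_Suc)
  qed
  obtain R where R: "linfun (\<lambda>f. mean (\<lambda>x. prim f x * cnj (?W k x))) R" using linfun_pair[OF c] by blast
  have "norm (mean (\<lambda>x. prim ((prim ^^ (0 + i)) (wal k)) x * cnj (?W k x)))
    \<le> 2 * sin_const\<^sup>2 * (sin_const * growth_const) ^ i * (1 / real b) ^ mu_per \<alpha> k * (sin_const * growth_const) ^ i * (1 / real b) ^ mu_per (Suc 0 + i) k"
  proof (rule iterate_bound[OF R pair_const _ _ k])
    show "0 \<le> 2 * sin_const\<^sup>2 * (sin_const * growth_const) ^ i * (1 / real b) ^ mu_per \<alpha> k" using sin_const_pos growth_const_pos by simp
    fix l :: nat assume l: "l \<ge> 1"
    have "mean (\<lambda>x. prim (wal l) x * cnj (?W k x)) = mean (\<lambda>x. cnj (?W k x * cnj (prim (wal l) x)))"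
      by (rule mean_cong) simp
    also have "\<dots> = cnj (mean (\<lambda>x. ?W k x * cnj (prim (wal l) x)))"
      by (intro mean_cnj integrable_continuous_interval continuous_intros c c1)
    finally have "norm (mean (\<lambda>x. prim (wal l) x * cnj (?W k x))) = norm (mean (\<lambda>x. ?W k x * cnj (prim (wal l) x)))" by simp
    then show "norm (mean (\<lambda>x. prim ((prim ^^ 0) (wal l)) x * cnj (?W k x)))
      \<le> 2 * sin_const\<^sup>2 * (sin_const * growth_const) ^ i * (1 / real b) ^ mu_per \<alpha> k * (1 / real b) ^ mu_per (Suc 0) l"
      using 1[OF l] by (simp add: mult_ac)
  qed
  also have "\<dots> = C_tilde \<alpha> b * ((1 / real b) ^ mu_per \<alpha> k)\<^sup>2"
  proof -
    have "C_tilde \<alpha> b = 2 * sin_const\<^sup>2 * (sin_const * growth_const) ^ i * (sin_const * growth_const) ^ i"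
    proof -
      have e: "2 * Suc i - 2 = i + i" "2 * Suc i = 2 + (i + i)" by simp_all
      have "2 * E ^ (i + i) / X ^ (2 + (i + i)) = 2 * (1 / X)\<^sup>2 * ((1 / X) * E) ^ i * ((1 / X) * E) ^ i" for E X :: real
        by (simp add: power_add power_mult_distrib power_one_over divide_inverse power_inverse power2_eq_square)
      then show ?thesis unfolding C_tilde_def i unfolding e(1) unfolding e(2) sin_const_def growth_const_def[symmetric] by (simp only:)
    qed
    then show ?thesis by (simp only: i power2_eq_square add_Suc add_0 mult_ac)
  qed
  finally show ?thesis by (simp only: i funpow.simps comp_apply add_0)
qed

definition kernel_coeff :: "nat \<Rightarrow> nat \<Rightarrow> complex" where
  "kernel_coeff \<alpha> k = integral {0..1} (\<lambda>y. integral {0..1} (\<lambda>s. of_real (sob \<alpha> s y) * wal k s) * cnj (wal k y))"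

lemma kernel_coeff_0: "\<alpha> \<ge> 1 \<Longrightarrow> kernel_coeff \<alpha> 0 = 0"
proof -
  assume a: "\<alpha> \<ge> 1"
  have "integral {0..1} (\<lambda>s. of_real (sob \<alpha> s y) * wal 0 s) = 0" if "y \<in> {0..1}" for y
    using has_integral_of_real[OF sob_mean_zero[OF that a], where 'b = complex] by (simp add: integral_unique)
  note z = this
  have "kernel_coeff \<alpha> 0 = integral {0..1} (\<lambda>y::real. 0)"
    unfolding kernel_coeff_def by (rule Henstock_Kurzweil_Integration.integral_cong) (simp only: z mult_zero_left)
  then show ?thesis by simp
qed

lemma C_const_nonneg: "0 \<le> C_const r b"
  using sin_pos by (simp add: C_const_def)

lemma C_tilde_nonneg: "0 \<le> C_tilde a b"
  by (simp add: C_tilde_def)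

lemma C_prime_nonneg: "0 \<le> C_prime \<alpha> b n"
  unfolding C_prime_def by (intro sum_nonneg) auto

lemma D_const_ge: "n \<in> {1..\<alpha>} \<Longrightarrow> C_prime \<alpha> b n + C_tilde \<alpha> b / real b ^ (2 * (\<alpha> - n)) \<le> D_const \<alpha> b"
  unfolding D_const_def by (rule Max_ge) auto

lemma D_const_nonneg: "\<alpha> \<ge> 1 \<Longrightarrow> 0 \<le> D_const \<alpha> b"
  using D_const_ge[of \<alpha> \<alpha>] C_prime_nonneg[of \<alpha> \<alpha>] C_tilde_nonneg[of \<alpha>] by simp

text \<open>Let \<open>\<nu>\<close> be the number of nonzero digits. Point values of order below
  \<open>\<nu>\<close> vanish, the others sum to \<open>C_prime\<close> at \<open>\<nu>\<close>, and
  the inner product gives \<open>C_tilde\<close>. If \<open>\<nu>\<close> exceeds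
  \<open>\<alpha>\<close>, only the inner product remains, and the entry at \<open>\<alpha>\<close>
  of the maximum covers it because \<open>C_prime\<close> is nonnegative.\<close>

lemma kernel_coeff_bound:
  assumes k: "k \<ge> 1" and a: "\<alpha> \<ge> 1"
  shows "norm (kernel_coeff \<alpha> k) \<le> D_const \<alpha> b * (1 / real b) ^ (2 * mu \<alpha> k)"
proof -
  let ?y = "1 / real b" and ?m = "mu \<alpha> k" and ?n = "nonzero_digits k"
  have y: "0 \<le> ?y" "?y \<le> 1" by simp_all
  have kh: "kernel_coeff \<alpha> k = (\<Sum>r=1..\<alpha>. (prim ^^ r) (wal k) 0 * cnj ((prim ^^ r) (wal k) 0))
     + mean (\<lambda>x. (prim ^^ \<alpha>) (wal k) x * cnj ((prim ^^ \<alpha>) (wal k) x))"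
    unfolding kernel_coeff_def by (rule integral_unique[OF sob_quadratic[OF wal_pw_continuous mean_wal[OF k] a]])
  have pw: "?y ^ (2 * (?m + d)) = ?y ^ (2 * ?m) / real b ^ (2 * d)" for d
    by (simp add: distrib_left power_add power_one_over)
  have n1: "?n \<ge> 1" using k by (simp add: nonzero_digits_pos)
  have t: "norm ((prim ^^ r) (wal k) 0 * cnj ((prim ^^ r) (wal k) 0)) \<le> (if r < ?n then 0 else (C_const r b)\<^sup>2 * ?y ^ (2 * (?m + (r - ?n))))"
    if r: "r \<in> {1..\<alpha>}" for r
  proof (cases "r < ?n")
    case True
    obtain r' where r': "r = Suc r'" using r by (cases r) auto
    show ?thesis using coeff_zero[OF k, of r'] True by (simp add: r')
  next
    case False
    have "norm ((prim ^^ r) (wal k) 0) \<le> C_const r b * ?y ^ mu_per r k" using k r by (intro coeff_bound) auto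
    also have "\<dots> \<le> C_const r b * ?y ^ (?m + (r - ?n))"
      using nonzero_digits_le_mu_per[OF k, of r \<alpha>] False y C_const_nonneg by (intro mult_left_mono power_decreasing) auto
    finally have "(norm ((prim ^^ r) (wal k) 0))\<^sup>2 \<le> (C_const r b * ?y ^ (?m + (r - ?n)))\<^sup>2"
      by (intro power_mono) auto
    then show ?thesis using False
      by (simp add: norm_mult power2_eq_square[symmetric] power_mult_distrib power_mult[symmetric] mult.commute)
  qed
  have p: "norm (mean (\<lambda>x. (prim ^^ \<alpha>) (wal k) x * cnj ((prim ^^ \<alpha>) (wal k) x))) \<le> C_tilde \<alpha> b * ?y ^ (2 * mu_per \<alpha> k)"
    using pair_bound[OF k a] by (simp add: power_mult[symmetric] mult.commute)
  have "norm (kernel_coeff \<alpha> k) \<le> (\<Sum>r=1..\<alpha>. if r < ?n then 0 else (C_const r b)\<^sup>2 * ?y ^ (2 * (?m + (r - ?n)))) + C_tilde \<alpha> b * ?y ^ (2 * mu_per \<alpha> k)"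
    unfolding kh by (rule norm_triangle_le[OF add_mono[OF order_trans[OF norm_sum sum_mono[OF t]] p]])
  also have "\<dots> \<le> D_const \<alpha> b * ?y ^ (2 * ?m)"
  proof (cases "?n \<le> \<alpha>")
    case True
    have "(\<Sum>r=1..\<alpha>. if r < ?n then 0 else (C_const r b)\<^sup>2 * ?y ^ (2 * (?m + (r - ?n))))
      = (\<Sum>r=?n..\<alpha>. (C_const r b)\<^sup>2 * ?y ^ (2 * (?m + (r - ?n))))"
      using n1 by (intro sum.mono_neutral_cong_right) auto
    also have "\<dots> = C_prime \<alpha> b ?n * ?y ^ (2 * ?m)"
      unfolding C_prime_def sum_distrib_right
      by (intro sum.cong refl) (simp only: pw times_divide_eq_left times_divide_eq_right)
    finally have 1: "(\<Sum>r=1..\<alpha>. if r < ?n then 0 else (C_const r b)\<^sup>2 * ?y ^ (2 * (?m + (r - ?n)))) = C_prime \<alpha> b ?n * ?y ^ (2 * ?m)" .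
    have "C_tilde \<alpha> b * ?y ^ (2 * mu_per \<alpha> k) \<le> C_tilde \<alpha> b * ?y ^ (2 * (?m + (\<alpha> - ?n)))"
      using nonzero_digits_le_mu_per[OF k True, of \<alpha>] y C_tilde_nonneg by (intro mult_left_mono power_decreasing) auto
    also have "\<dots> = C_tilde \<alpha> b / real b ^ (2 * (\<alpha> - ?n)) * ?y ^ (2 * ?m)"
      by (simp only: pw times_divide_eq_left times_divide_eq_right)
    finally have "C_prime \<alpha> b ?n * ?y ^ (2 * ?m) + C_tilde \<alpha> b * ?y ^ (2 * mu_per \<alpha> k)
      \<le> (C_prime \<alpha> b ?n + C_tilde \<alpha> b / real b ^ (2 * (\<alpha> - ?n))) * ?y ^ (2 * ?m)"
      unfolding distrib_right by (rule add_left_mono)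
    also have "\<dots> \<le> D_const \<alpha> b * ?y ^ (2 * ?m)"
      using n1 True by (intro mult_right_mono D_const_ge) auto
    finally show ?thesis unfolding 1 .
  next
    case False
    have "(\<Sum>r=1..\<alpha>. if r < ?n then 0 else (C_const r b)\<^sup>2 * ?y ^ (2 * (?m + (r - ?n)))) = 0"
      using False by (intro sum.neutral) auto
    moreover have "C_tilde \<alpha> b * ?y ^ (2 * mu_per \<alpha> k) \<le> C_tilde \<alpha> b * ?y ^ (2 * ?m)"
      using mu_le_mu_per[of \<alpha> k] y C_tilde_nonneg by (intro mult_left_mono power_decreasing) auto
    moreover have "C_tilde \<alpha> b * ?y ^ (2 * ?m) \<le> D_const \<alpha> b * ?y ^ (2 * ?m)"
    proof (intro mult_right_mono)
      show "C_tilde \<alpha> b \<le> D_const \<alpha> b"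
        using D_const_ge[of \<alpha> \<alpha>] C_prime_nonneg[of \<alpha> \<alpha>] a by simp
    qed simp
    ultimately show ?thesis by linarith
  qed
  finally show ?thesis .
qed

end

subsection \<open>Averaging over digital shifts\<close>

lemma has_integral_cells:
  fixes f :: "real \<Rightarrow> 'a::banach"
  assumes N: "N > 0" and f: "\<And>c. c < N \<Longrightarrow> (f has_integral I c) {real c / real N..real (Suc c) / real N}"
  shows "(f has_integral (\<Sum>c<N. I c)) {0..1}"
proof -
  have "(f has_integral (\<Sum>c<n. I c)) {0..real n / real N}" if "n \<le> N" for n
    using that
  proof (induction n)
    case 0
    then show ?case by (simp add: has_integral_refl)
  next
    case (Suc n)
    then have "(f has_integral (\<Sum>c<n. I c) + I n) {0..real (Suc n) / real N}"
      by (intro has_integral_combine[OF _ _ _ f]) (auto simp: divide_right_mono)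
    then show ?case by simp
  qed
  from this[of N] show ?thesis using N by simp
qed

lemma cell_integral_close:
  fixes g :: "real \<Rightarrow> real"
  assumes N: "N > 0" and g: "continuous_on UNIV g"
    and e: "\<And>y. y \<in> {real i / real N..real (Suc i) / real N} \<Longrightarrow> \<bar>g y - v\<bar> \<le> e"
  shows "\<bar>integral {real i / real N..real (Suc i) / real N} g - v / real N\<bar> \<le> e / real N"
proof -
  let ?I = "{real i / real N..real (Suc i) / real N}"
  have le: "real i / real N \<le> real (Suc i) / real N" by (rule divide_right_mono) simp_all
  have len: "real (Suc i) / real N - real i / real N = 1 / real N"
    by (simp only: diff_divide_distrib[symmetric]) simp
  have gi: "g integrable_on ?I"
    by (intro integrable_continuous_interval continuous_on_subset[OF g]) simp
  have c: "integral ?I (\<lambda>y. c) = c / real N" for c :: real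
    using le len by (simp del: of_nat_Suc)
  have "integral ?I (\<lambda>y. g y - v) = integral ?I g - v / real N"
    using integral_diff[OF gi integrable_const_ivl, of v] c by (simp only:)
  moreover have "norm (integral ?I (\<lambda>y. g y - v)) \<le> integral ?I (\<lambda>y. e)"
    by (rule integral_norm_bound_integral) (use e gi in \<open>auto intro: integrable_diff integrable_const_ivl\<close>)
  ultimately show ?thesis unfolding c by simp
qed

lemma sob_param_continuous: "continuous_on UNIV (\<lambda>y. integral {a..b} (\<lambda>s. sob \<alpha> s y))"
proof -
  have "continuous_on (UNIV \<times> cbox a b) (\<lambda>z. sob \<alpha> (snd z) (fst z))"
    by (intro continuous_intros)
  then have "continuous_on (UNIV \<times> cbox a b) (\<lambda>(y, s). sob \<alpha> s y)"
    by (simp only: case_prod_beta')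
  from integral_continuous_on_param[OF this] show ?thesis by (simp only: box_real)
qed

context radix
begin

definition kernel_cell_integral :: "nat \<Rightarrow> nat \<Rightarrow> nat \<Rightarrow> nat \<Rightarrow> real" where
  "kernel_cell_integral \<alpha> N i i' = integral {real i' / real N..real (Suc i') / real N}
     (\<lambda>y. integral {real i / real N..real (Suc i) / real N} (\<lambda>s. sob \<alpha> s y))"

lemma wal_cell_integral:
  assumes k: "k < b ^ n" and g: "continuous_on UNIV g"
  shows "((\<lambda>s. of_real (g s) * wal k s) has_integral
    of_real (integral {real i / real (b ^ n)..real (Suc i) / real (b ^ n)} g) * wal k (real i / real b ^ n))
    {real i / real (b ^ n)..real (Suc i) / real (b ^ n)}"
proof -
  let ?I = "{real i / real (b ^ n)..real (Suc i) / real (b ^ n)}"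
  have gi: "(g has_integral integral ?I g) ?I"
    by (rule integrable_integral[OF integrable_continuous_interval[OF continuous_on_subset[OF g subset_UNIV]]])
  have "((\<lambda>s. of_real (g s) * wal k (real i / real b ^ n)) has_integral
      of_real (integral ?I g) * wal k (real i / real b ^ n)) ?I"
    by (rule has_integral_mult_left[OF has_integral_of_real[OF gi]])
  then show ?thesis
  proof (rule has_integral_spike_finite[where S = "{real (Suc i) / real (b ^ n)}", rotated 2])
    fix y assume y: "y \<in> ?I - {real (Suc i) / real (b ^ n)}"
    then have 1: "real i / real b ^ n \<le> y" and 2: "y < real (Suc i) / real b ^ n" by auto
    have p: "0 < real b ^ n" by simp
    have "real i \<le> y * real b ^ n" using 1 by (simp only: pos_divide_le_eq[OF p])
    moreover have "y * real b ^ n < real (Suc i)" using 2 by (simp only: pos_less_divide_eq[OF p])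
    ultimately have "\<lfloor>y * real b ^ n\<rfloor> = int i" by (simp add: floor_eq_iff)
    then have "wal k y = wal k (real i / real b ^ n)" by (rule wal_cell[OF k])
    then show "of_real (g y) * wal k y = of_real (g y) * wal k (real i / real b ^ n)"
      by (rule arg_cong)
  qed simp
qed

text \<open>Below \<open>b ^ n\<close> the Walsh functions are constant on the cells of level
  \<open>n\<close>, so the coefficient depends on the kernel only through its integrals over
  products of two cells.\<close>

lemma kernel_coeff_cells:
  assumes k: "k < b ^ n"
  shows "kernel_coeff \<alpha> k = (\<Sum>i'<b ^ n. \<Sum>i<b ^ n. of_real (kernel_cell_integral \<alpha> (b ^ n) i i') *
    (wal k (real i / real b ^ n) * cnj (wal k (real i' / real b ^ n))))"
proof -
  let ?N = "b ^ n"
  let ?I = "\<lambda>i. {real i / real ?N..real (Suc i) / real ?N}"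
  let ?w = "\<lambda>i. wal k (real i / real b ^ n)"
  have N: "?N > 0" by simp
  have inner: "integral {0..1} (\<lambda>s. of_real (sob \<alpha> s y) * wal k s)
      = (\<Sum>i<?N. of_real (integral (?I i) (\<lambda>s. sob \<alpha> s y)) * ?w i)" for y
    by (rule integral_unique[OF has_integral_cells[OF N]], rule wal_cell_integral[OF k])
       (intro continuous_intros)
  have cell: "((\<lambda>y. of_real (integral (?I i) (\<lambda>s. sob \<alpha> s y)) * cnj (wal k y)) has_integral
      of_real (kernel_cell_integral \<alpha> ?N i i') * cnj (?w i')) (?I i')" for i i'
  proof -
    have "((\<lambda>y. of_real (integral (?I i) (\<lambda>s. sob \<alpha> s y)) * wal k y) has_integral
      of_real (kernel_cell_integral \<alpha> ?N i i') * ?w i') (?I i')"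
      unfolding kernel_cell_integral_def by (rule wal_cell_integral[OF k sob_param_continuous])
    then have "(cnj \<circ> (\<lambda>y. of_real (integral (?I i) (\<lambda>s. sob \<alpha> s y)) * wal k y) has_integral
      cnj (of_real (kernel_cell_integral \<alpha> ?N i i') * ?w i')) (?I i')"
      by (simp only: has_integral_cnj)
    then show ?thesis by (simp add: comp_def)
  qed
  have "((\<lambda>y. (\<Sum>i<?N. ?w i * (of_real (integral (?I i) (\<lambda>s. sob \<alpha> s y)) * cnj (wal k y)))) has_integral
      (\<Sum>i'<?N. \<Sum>i<?N. ?w i * (of_real (kernel_cell_integral \<alpha> ?N i i') * cnj (?w i')))) {0..1}"
    by (intro has_integral_cells[OF N] has_integral_sum has_integral_mult_right cell) simp
  moreover have "(\<Sum>i<?N. ?w i * (of_real (integral (?I i) (\<lambda>s. sob \<alpha> s y)) * cnj (wal k y)))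
    = integral {0..1} (\<lambda>s. of_real (sob \<alpha> s y) * wal k s) * cnj (wal k y)" for y
    unfolding inner sum_distrib_right by (simp only: mult_ac)
  ultimately have "kernel_coeff \<alpha> k = (\<Sum>i'<?N. \<Sum>i<?N. ?w i * (of_real (kernel_cell_integral \<alpha> ?N i i') * cnj (?w i')))"
    unfolding kernel_coeff_def by (simp only: integral_unique)
  then show ?thesis by (simp only: mult_ac)
qed

text \<open>The factor \<open>(real (b ^ n))\<^sup>2\<close> turns the integral into the mean over
  the cell product that contains \<open>(s, t)\<close>, whose diameter shrinks uniformly.\<close>

lemma kernel_cell_integral_close:
  assumes e: "e > 0"
  shows "\<exists>n0. \<forall>n\<ge>n0. \<forall>s\<in>{0..<1}. \<forall>t\<in>{0..<1}.
    \<bar>(real (b ^ n))\<^sup>2 * kernel_cell_integral \<alpha> (b ^ n) (nat \<lfloor>s * real (b ^ n)\<rfloor>) (nat \<lfloor>t * real (b ^ n)\<rfloor>) - sob \<alpha> s t\<bar> \<le> e"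
proof -
  obtain d where d: "d > 0" "\<forall>x\<in>{0..1}. \<forall>y\<in>{0..1}. \<forall>x'\<in>{0..1}. \<forall>y'\<in>{0..1}.
    \<bar>x - x'\<bar> < d \<longrightarrow> \<bar>y - y'\<bar> < d \<longrightarrow> \<bar>sob \<alpha> x y - sob \<alpha> x' y'\<bar> < e"
    using sob_uniform[OF e, of \<alpha>] by blast
  have "(\<lambda>n. (1 / real b) ^ n) \<longlonglongrightarrow> 0" by (intro LIMSEQ_power_zero) simp
  then have "\<forall>\<^sub>F n in sequentially. (1 / real b) ^ n < d" using d(1) by (rule order_tendstoD)
  then obtain n0 where n0: "\<And>n. n \<ge> n0 \<Longrightarrow> (1 / real b) ^ n < d" unfolding eventually_sequentially by blast
  show ?thesis
  proof (intro exI allI impI ballI)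
    fix n s t assume n: "n0 \<le> n" and s: "s \<in> {0..<1::real}" and t: "t \<in> {0..<1::real}"
    let ?N = "b ^ n"
    let ?i = "nat \<lfloor>s * real ?N\<rfloor>" and ?j = "nat \<lfloor>t * real ?N\<rfloor>"
    let ?I = "\<lambda>i. {real i / real ?N..real (Suc i) / real ?N}"
    have N: "?N > 0" "0 < real ?N" by simp_all
    have Nd: "1 / real ?N < d" using n0[OF n] by (simp add: power_one_over)
    have mem: "\<bar>x - s\<bar> < d \<and> x \<in> {0..1}" if s: "s \<in> {0..<1}" and x: "x \<in> ?I (nat \<lfloor>s * real ?N\<rfloor>)" for s x
    proof -
      let ?i = "nat \<lfloor>s * real ?N\<rfloor>"
      have si: "s \<in> {real ?i / real ?N..<real (Suc ?i) / real ?N}"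
        using floor_eq_cell[OF N(1), of s ?i] s by simp
      have le: "?i < ?N" using s by (simp add: nat_less_iff floor_less_iff flip: of_nat_power)
      have "real (Suc ?i) / real ?N \<le> 1" using le N by (simp del: of_nat_power)
      moreover have "0 \<le> real ?i / real ?N" by simp
      ultimately have "x \<in> {0..1}" using x by (meson atLeastAtMost_iff order_trans)
      moreover have "real (Suc ?i) / real ?N - real ?i / real ?N = 1 / real ?N"
        by (simp only: diff_divide_distrib[symmetric]) simp
      then have "\<bar>x - s\<bar> \<le> 1 / real ?N" using x si unfolding abs_le_iff atLeastAtMost_iff atLeastLessThan_iff by linarith
      ultimately show ?thesis using Nd by linarith
    qed
    have s1: "s \<in> {0..1}" and t1: "t \<in> {0..1}" using s t by auto
    have close: "\<bar>sob \<alpha> x y - sob \<alpha> s t\<bar> \<le> e" if "x \<in> ?I ?i" "y \<in> ?I ?j" for x y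
      using d(2) mem[OF s that(1)] mem[OF t that(2)] s1 t1 by (intro less_imp_le) blast
    have 1: "\<bar>integral (?I ?i) (\<lambda>x. sob \<alpha> x y) - sob \<alpha> s t / real ?N\<bar> \<le> e / real ?N" if y: "y \<in> ?I ?j" for y
      by (rule cell_integral_close[OF N(1)]) (use close y in \<open>auto intro!: continuous_intros\<close>)
    have "\<bar>kernel_cell_integral \<alpha> ?N ?i ?j - sob \<alpha> s t / real ?N / real ?N\<bar> \<le> e / real ?N / real ?N"
      unfolding kernel_cell_integral_def by (rule cell_integral_close[OF N(1) sob_param_continuous 1])
    then have "(real ?N)\<^sup>2 * \<bar>kernel_cell_integral \<alpha> ?N ?i ?j - sob \<alpha> s t / real ?N / real ?N\<bar> \<le> (real ?N)\<^sup>2 * (e / real ?N / real ?N)"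
      by (rule mult_left_mono) simp
    moreover have "(real ?N)\<^sup>2 * (e / real ?N / real ?N) = e" using N by (simp add: power2_eq_square)
    moreover have "(real ?N)\<^sup>2 * \<bar>kernel_cell_integral \<alpha> ?N ?i ?j - sob \<alpha> s t / real ?N / real ?N\<bar>
      = \<bar>(real ?N)\<^sup>2 * kernel_cell_integral \<alpha> ?N ?i ?j - sob \<alpha> s t\<bar>"
    proof -
      have "M\<^sup>2 * \<bar>q - r / M / M\<bar> = \<bar>M\<^sup>2 * q - r\<bar>" if "M > 0" for M q r :: real
      proof -
        have "M\<^sup>2 * \<bar>q - r / M / M\<bar> = \<bar>M\<^sup>2 * (q - r / M / M)\<bar>" by (simp add: abs_mult)
        also have "M\<^sup>2 * (q - r / M / M) = M\<^sup>2 * q - r" using that by (simp add: field_simps power2_eq_square)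
        finally show ?thesis .
      qed
      then show ?thesis using N(2) by blast
    qed
    ultimately show "\<bar>(real ?N)\<^sup>2 * kernel_cell_integral \<alpha> ?N ?i ?j - sob \<alpha> s t\<bar> \<le> e" by linarith
  qed
qed

text \<open>
  If \<open>x\<close> has a finite expansion, \<open>digit_add b x y\<close> cannot end in digits \<open>b - 1\<close> only, so its digits
  are the digitwise sums for every \<open>y\<close>.  All net points are of this kind.
\<close>

definition fin_digits :: "real \<Rightarrow> bool" where
  "fin_digits x \<longleftrightarrow> (\<exists>L. \<forall>a\<ge>L. rdigit x (Suc a) = 0)"

lemma fin_digits_add:
  assumes x: "fin_digits x" and y: "0 \<le> y" "y < 1"
  shows "digit_add b x y \<in> {0..<1}"
    "rdigit (digit_add b x y) (Suc n) = (rdigit x (Suc n) + rdigit y (Suc n)) mod b"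
    "wal k (digit_add b x y) = wal k x * wal k y"
proof -
  obtain L where L: "\<And>a. a \<ge> L \<Longrightarrow> rdigit x (Suc a) = 0" using x by (auto simp: fin_digits_def)
  show "digit_add b x y \<in> {0..<1}" using digit_add_facts(1,2)[OF L y] by simp
  show "rdigit (digit_add b x y) (Suc n) = (rdigit x (Suc n) + rdigit y (Suc n)) mod b"
    by (rule digit_add_facts(3)[OF L y])
  show "wal k (digit_add b x y) = wal k x * wal k y"
    by (rule wal_digit_add[OF L y])
qed

lemma floor_eq_digits:
  assumes x: "x \<in> {0..<1}" and y: "y \<in> {0..<1}" and d: "\<And>j. j < n \<Longrightarrow> rdigit x (Suc j) = rdigit y (Suc j)"
  shows "\<lfloor>x * real b ^ n\<rfloor> = \<lfloor>y * real b ^ n\<rfloor>"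
proof -
  have "(\<Sum>a<n. real (badic_digit b x (Suc a)) / real b ^ Suc a) = (\<Sum>a<n. real (badic_digit b y (Suc a)) / real b ^ Suc a)"
    using d by (intro sum.cong refl) (simp add: rdigit_def)
  then have "real_of_int \<lfloor>x * real b ^ n\<rfloor> / real b ^ n = real_of_int \<lfloor>y * real b ^ n\<rfloor> / real b ^ n"
    using badic_partial_sum[of b x n] badic_partial_sum[of b y n] x y by simp
  then show ?thesis by simp
qed

definition shift_ix :: "nat \<Rightarrow> real \<Rightarrow> real \<Rightarrow> nat" where
  "shift_ix n x t = nat \<lfloor>digit_add b x t * real (b ^ n)\<rfloor>"

lemma shift_ix_step:
  assumes x: "fin_digits x" and t: "t \<in> {0..<1}"
  shows "shift_ix n x t = shift_ix n x (real (nat \<lfloor>t * real (b ^ n)\<rfloor>) / real b ^ n)"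
proof -
  let ?c = "nat \<lfloor>t * real (b ^ n)\<rfloor>" and ?t = "real (nat \<lfloor>t * real (b ^ n)\<rfloor>) / real b ^ n"
  have c: "\<lfloor>t * real b ^ n\<rfloor> = int ?c" using t by simp
  have "?c < b ^ n" using t by (simp add: nat_less_iff floor_less_iff flip: of_nat_power)
  then have t': "0 \<le> ?t" "?t < 1" by (simp_all flip: of_nat_power)
  have "\<lfloor>digit_add b x t * real b ^ n\<rfloor> = \<lfloor>digit_add b x ?t * real b ^ n\<rfloor>"
  proof (rule floor_eq_digits)
    fix j assume j: "j < n"
    have "rdigit t (Suc j) = rdigit ?t (Suc j)"
      unfolding rdigit_of_floor[OF j c] rdigit_grid[OF j] ..
    then show "rdigit (digit_add b x t) (Suc j) = rdigit (digit_add b x ?t) (Suc j)"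
      using t t' by (simp only: fin_digits_add(2)[OF x] atLeastLessThan_iff)
  next
    show "digit_add b x t \<in> {0..<1}" by (rule fin_digits_add(1)[OF x]) (use t in auto)
    show "digit_add b x ?t \<in> {0..<1}" by (rule fin_digits_add(1)[OF x t'])
  qed
  then show ?thesis by (simp add: shift_ix_def)
qed

lemma shift_ix_wal:
  assumes x: "fin_digits x" and c: "c < b ^ n" and k: "k < b ^ n"
  shows "wal k (real (shift_ix n x (real c / real b ^ n)) / real b ^ n) = wal k x * wal k (real c / real b ^ n)"
    "shift_ix n x (real c / real b ^ n) < b ^ n"
proof -
  let ?t = "real c / real b ^ n"
  have t: "0 \<le> ?t" "?t < 1" using c by (simp_all flip: of_nat_power)
  note a = fin_digits_add(1)[OF x t]
  have f: "\<lfloor>digit_add b x ?t * real b ^ n\<rfloor> = int (shift_ix n x ?t)"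
    using a by (simp add: shift_ix_def)
  show "wal k (real (shift_ix n x ?t) / real b ^ n) = wal k x * wal k ?t"
    using wal_cell[OF k f] fin_digits_add(3)[OF x t, of k] by simp
  show "shift_ix n x ?t < b ^ n"
    using a by (simp add: shift_ix_def nat_less_iff floor_less_iff flip: of_nat_power)
qed

text \<open>Shifting multiplies every Walsh value by the same nonzero factor. If two cells had the
  same image, all their Walsh values of index below \<open>b ^ n\<close> would coincide, which
  completeness excludes.\<close>

lemma shift_ix_bij:
  assumes x: "fin_digits x"
  shows "bij_betw (\<lambda>c. shift_ix n x (real c / real b ^ n)) {..<b ^ n} {..<b ^ n}"
proof -
  let ?p = "\<lambda>c. shift_ix n x (real c / real b ^ n)"
  have inj: "inj_on ?p {..<b ^ n}"
  proof (rule inj_onI)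
    fix c d assume c: "c \<in> {..<b ^ n}" and d: "d \<in> {..<b ^ n}" and eq: "?p c = ?p d"
    have w: "wal k (real c / real b ^ n) = wal k (real d / real b ^ n)" if k: "k < b ^ n" for k
    proof -
      have c': "c < b ^ n" and d': "d < b ^ n" using c d by auto
      have "wal k x * wal k (real c / real b ^ n) = wal k x * wal k (real d / real b ^ n)"
        unfolding shift_ix_wal(1)[OF x c' k, symmetric] shift_ix_wal(1)[OF x d' k, symmetric] eq ..
      moreover have "wal k x \<noteq> 0" by (metis norm_wal norm_zero zero_neq_one)
      ultimately show ?thesis by simp
    qed
    have "(\<Sum>k<b ^ n. wal k (real c / real b ^ n) * cnj (wal k (real d / real b ^ n))) = (\<Sum>k<b ^ n. 1)"
      by (intro sum.cong refl) (simp add: w wal_cnj)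
    then show "c = d" using wal_complete[of c n d] c d by (auto split: if_splits)
  qed
  moreover have "?p ` {..<b ^ n} = {..<b ^ n}"
    by (rule endo_inj_surj) (use inj shift_ix_wal(2)[OF x, of _ n 0] in auto)
  ultimately show ?thesis by (simp add: bij_betw_def)
qed

definition walsh_sum :: "nat \<Rightarrow> nat \<Rightarrow> real \<Rightarrow> real \<Rightarrow> complex" where
  "walsh_sum \<alpha> n x x' = (\<Sum>k<b ^ n. kernel_coeff \<alpha> k * (cnj (wal k x) * wal k x'))"

text \<open>The cells are renumbered by the permutations that \<open>x\<close> and \<open>x'\<close>
  induce. The factors this creates cancel those in the definition of \<open>walsh_sum\<close>, and
  summing over \<open>k\<close> leaves only \<open>c = c'\<close> by completeness: the same shift
  acts on both points.\<close>

lemma walsh_sum_eq: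
  assumes x: "fin_digits x" and x': "fin_digits x'"
  shows "walsh_sum \<alpha> n x x' = of_real (real (b ^ n) *
    (\<Sum>c<b ^ n. kernel_cell_integral \<alpha> (b ^ n) (shift_ix n x (real c / real b ^ n)) (shift_ix n x' (real c / real b ^ n))))"
proof -
  let ?N = "b ^ n"
  let ?p = "\<lambda>c. shift_ix n x (real c / real b ^ n)" and ?q = "\<lambda>c. shift_ix n x' (real c / real b ^ n)"
  let ?w = "\<lambda>k c. wal k (real c / real b ^ n)"
  have kh: "kernel_coeff \<alpha> k * (cnj (wal k x) * wal k x')
      = (\<Sum>c'<?N. \<Sum>c<?N. of_real (kernel_cell_integral \<alpha> ?N (?p c) (?q c')) * (?w k c * cnj (?w k c')))" if k: "k < ?N" for k
  proof -
    have "kernel_coeff \<alpha> k = (\<Sum>c'<?N. \<Sum>c<?N. of_real (kernel_cell_integral \<alpha> ?N (?p c) (?q c')) * (?w k (?p c) * cnj (?w k (?q c'))))"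
    proof -
      have "kernel_coeff \<alpha> k = (\<Sum>c'<?N. \<Sum>i<?N. of_real (kernel_cell_integral \<alpha> ?N i (?q c')) * (?w k i * cnj (?w k (?q c'))))"
        unfolding kernel_coeff_cells[OF k] by (rule sum.reindex_bij_betw[OF shift_ix_bij[OF x'], symmetric])
      also have "\<dots> = (\<Sum>c'<?N. \<Sum>c<?N. of_real (kernel_cell_integral \<alpha> ?N (?p c) (?q c')) * (?w k (?p c) * cnj (?w k (?q c'))))"
        by (rule sum.cong[OF refl], rule sum.reindex_bij_betw[OF shift_ix_bij[OF x], symmetric])
      finally show ?thesis .
    qed
    also have "\<dots> = (\<Sum>c'<?N. \<Sum>c<?N. of_real (kernel_cell_integral \<alpha> ?N (?p c) (?q c')) * (?w k c * cnj (?w k c')) * (wal k x * cnj (wal k x')))"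
      by (intro sum.cong refl) (simp add: shift_ix_wal(1)[OF x _ k] shift_ix_wal(1)[OF x' _ k] mult_ac)
    also have "\<dots> = (\<Sum>c'<?N. \<Sum>c<?N. of_real (kernel_cell_integral \<alpha> ?N (?p c) (?q c')) * (?w k c * cnj (?w k c'))) * (wal k x * cnj (wal k x'))"
      by (simp only: sum_distrib_right)
    finally have "kernel_coeff \<alpha> k * (cnj (wal k x) * wal k x') = (\<Sum>c'<?N. \<Sum>c<?N. of_real (kernel_cell_integral \<alpha> ?N (?p c) (?q c')) * (?w k c * cnj (?w k c')))
      * ((wal k x * cnj (wal k x)) * (wal k x' * cnj (wal k x')))"
      by (simp only: mult_ac)
    then show ?thesis by (simp only: wal_cnj mult_1_right)
  qed
  have "walsh_sum \<alpha> n x x' = (\<Sum>k<?N. \<Sum>c'<?N. \<Sum>c<?N. of_real (kernel_cell_integral \<alpha> ?N (?p c) (?q c')) * (?w k c * cnj (?w k c')))"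
    unfolding walsh_sum_def by (rule sum.cong[OF refl], rule kh) simp
  also have "\<dots> = (\<Sum>c'<?N. \<Sum>k<?N. \<Sum>c<?N. of_real (kernel_cell_integral \<alpha> ?N (?p c) (?q c')) * (?w k c * cnj (?w k c')))"
    by (rule sum.swap)
  also have "\<dots> = (\<Sum>c'<?N. \<Sum>c<?N. \<Sum>k<?N. of_real (kernel_cell_integral \<alpha> ?N (?p c) (?q c')) * (?w k c * cnj (?w k c')))"
    by (rule sum.cong[OF refl], rule sum.swap)
  also have "\<dots> = (\<Sum>c'<?N. \<Sum>c<?N. if c = c' then of_real (kernel_cell_integral \<alpha> ?N (?p c) (?q c')) * of_nat ?N else 0)"
    unfolding sum_distrib_left[symmetric] by (intro sum.cong refl) (simp add: wal_complete)
  also have "\<dots> = (\<Sum>c<?N. of_real (kernel_cell_integral \<alpha> ?N (?p c) (?q c)) * of_nat ?N)"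
    by (intro sum.cong refl) (simp add: sum.delta)
  finally show ?thesis by (simp add: sum_distrib_left mult.commute)
qed

definition shift_average :: "nat \<Rightarrow> real \<Rightarrow> real \<Rightarrow> real" where
  "shift_average \<alpha> x x' = (LINT t|unit_measure. sob \<alpha> (digit_add b x t) (digit_add b x' t))"

text \<open>\<open>E n\<close> is the kernel averaged over the cells of level \<open>n\<close> and
  evaluated at the two shifted points. Its integral is the partial Walsh sum, and it converges
  uniformly to the kernel at the shifted points.\<close>

lemma shift_average_limit:
  assumes x: "fin_digits x" and x': "fin_digits x'"
  shows "integrable unit_measure (\<lambda>t. sob \<alpha> (digit_add b x t) (digit_add b x' t))"
    "(\<lambda>n. walsh_sum \<alpha> n x x') \<longlonglongrightarrow> of_real (shift_average \<alpha> x x')"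
proof -
  define h where "h = (\<lambda>n c. (real (b ^ n))\<^sup>2 * kernel_cell_integral \<alpha> (b ^ n) (shift_ix n x (real c / real b ^ n)) (shift_ix n x' (real c / real b ^ n)))"
  define E where "E = (\<lambda>n t. h n (nat \<lfloor>t * real (b ^ n)\<rfloor>))"
  let ?f = "\<lambda>t. sob \<alpha> (digit_add b x t) (digit_add b x' t)"
  have N: "b ^ n > 0" for n by simp
  have iE: "integrable unit_measure (E n)" for n
    unfolding E_def by (rule step_integral_unit_measure(1)[OF N])
  have LE: "of_real (LINT t|unit_measure. E n t) = walsh_sum \<alpha> n x x'" for n
  proof -
    have "(LINT t|unit_measure. E n t) = (\<Sum>c<b ^ n. h n c) / real (b ^ n)"
      unfolding E_def by (rule step_integral_unit_measure(2)[OF N])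
    also have "\<dots> = real (b ^ n) * (\<Sum>c<b ^ n. kernel_cell_integral \<alpha> (b ^ n) (shift_ix n x (real c / real b ^ n)) (shift_ix n x' (real c / real b ^ n)))"
      unfolding h_def sum_distrib_left[symmetric] by (simp add: power2_eq_square)
    finally show ?thesis by (simp only: walsh_sum_eq[OF x x'])
  qed
  have En: "E n t = (real (b ^ n))\<^sup>2 * kernel_cell_integral \<alpha> (b ^ n) (nat \<lfloor>digit_add b x t * real (b ^ n)\<rfloor>) (nat \<lfloor>digit_add b x' t * real (b ^ n)\<rfloor>)"
    if t: "t \<in> {0..<1}" for n t
    unfolding E_def h_def shift_ix_step[OF x t, symmetric] shift_ix_step[OF x' t, symmetric] by (simp add: shift_ix_def)
  have close: "\<exists>n0. \<forall>n\<ge>n0. \<forall>t\<in>{0..<1}. \<bar>E n t - ?f t\<bar> \<le> e" if e: "e > 0" for e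
  proof -
    obtain n0 where n0: "\<forall>n\<ge>n0. \<forall>s\<in>{0..<1}. \<forall>t\<in>{0..<1}.
      \<bar>(real (b ^ n))\<^sup>2 * kernel_cell_integral \<alpha> (b ^ n) (nat \<lfloor>s * real (b ^ n)\<rfloor>) (nat \<lfloor>t * real (b ^ n)\<rfloor>) - sob \<alpha> s t\<bar> \<le> e"
      using kernel_cell_integral_close[OF e, of \<alpha>] by blast
    have "\<bar>E n t - ?f t\<bar> \<le> e" if n: "n \<ge> n0" and t: "t \<in> {0..<1}" for n t
      unfolding En[OF t] using n0 n fin_digits_add(1)[OF x, of t] fin_digits_add(1)[OF x', of t] t by auto
    then show ?thesis by blast
  qed
  have lim: "(\<lambda>n. E n t) \<longlonglongrightarrow> ?f t" if t: "t \<in> {0..<1}" for t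
  proof (rule LIMSEQ_I)
    fix r :: real assume r: "0 < r"
    then obtain n0 where n0: "\<forall>n\<ge>n0. \<forall>t\<in>{0..<1}. \<bar>E n t - ?f t\<bar> \<le> r / 2" using close[of "r / 2"] by auto
    show "\<exists>no. \<forall>n\<ge>no. norm (E n t - ?f t) < r"
    proof (intro exI allI impI)
      fix n assume "n0 \<le> n"
      then have "\<bar>E n t - ?f t\<bar> \<le> r / 2" using n0 t by blast
      then show "norm (E n t - ?f t) < r" using r by simp
    qed
  qed
  obtain C where C0: "C \<ge> 0" and C: "\<forall>x\<in>{0..1}. \<forall>y\<in>{0..1}. \<bar>sob \<alpha> x y\<bar> \<le> C"
    using sob_bounded[of \<alpha>] by blast
  obtain n1 where n1: "\<forall>n\<ge>n1. \<forall>t\<in>{0..<1}. \<bar>E n t - ?f t\<bar> \<le> 1" using close[of 1] by auto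
  \<comment> \<open>The dominating constant is valid once the cell means are within 1 of the kernel,
    so dominated convergence is applied from \<open>n1\<close> on.\<close>
  have bnd: "\<bar>E (n + n1) t\<bar> \<le> C + 1" if t: "t \<in> {0..<1}" for n t
  proof -
    have "\<bar>?f t\<bar> \<le> C" using C fin_digits_add(1)[OF x, of t] fin_digits_add(1)[OF x', of t] t by auto
    moreover have "\<bar>E (n + n1) t - ?f t\<bar> \<le> 1" using n1 t by simp
    ultimately show ?thesis by linarith
  qed
  have mf: "?f \<in> borel_measurable unit_measure"
  proof (rule borel_measurable_LIMSEQ_real[where u = E])
    show "(\<lambda>n. E n t) \<longlonglongrightarrow> ?f t" if "t \<in> space unit_measure" for t using lim that by simp
  qed (rule borel_measurable_integrable[OF iE])
  have w: "integrable unit_measure (\<lambda>_. C + 1)" by (simp add: unit_measure.emeasure_eq_measure)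
  have ae1: "AE t in unit_measure. (\<lambda>n. E (n + n1) t) \<longlonglongrightarrow> ?f t"
    using lim by (intro AE_I2 LIMSEQ_ignore_initial_segment) simp
  have ae2: "AE t in unit_measure. norm (E (n + n1) t) \<le> C + 1" for n
    using bnd by (intro AE_I2) simp
  note dc = mf borel_measurable_integrable[OF iE] w ae1 ae2
  show "integrable unit_measure ?f" by (rule integrable_dominated_convergence[OF dc])
  have "(\<lambda>n. LINT t|unit_measure. E (n + n1) t) \<longlonglongrightarrow> shift_average \<alpha> x x'"
    unfolding shift_average_def by (rule integral_dominated_convergence[OF dc])
  then have "(\<lambda>n. LINT t|unit_measure. E n t) \<longlonglongrightarrow> shift_average \<alpha> x x'" by (rule LIMSEQ_offset)
  then have "(\<lambda>n. complex_of_real (LINT t|unit_measure. E n t)) \<longlonglongrightarrow> of_real (shift_average \<alpha> x x')"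
    by (rule tendsto_of_real)
  then show "(\<lambda>n. walsh_sum \<alpha> n x x') \<longlonglongrightarrow> of_real (shift_average \<alpha> x x')" by (simp only: LE)
qed

end

subsection \<open>Digit interlacing\<close>

text \<open>Discarding an element of least value does not lower the average. Starting from
  \<open>W\<close>, elements are removed until \<open>n\<close> are left.\<close>

lemma heavy_subset:
  fixes f :: "'a \<Rightarrow> nat"
  assumes W: "finite W"
  shows "n \<le> card W \<Longrightarrow> \<exists>T\<subseteq>W. card T = n \<and> n * sum f W \<le> card W * sum f T"
proof (induction "card W - n" arbitrary: n)
  case 0
  then show ?case by (intro exI[of _ W]) auto
next
  case (Suc j)
  then have "j = card W - Suc n" "Suc n \<le> card W" by auto
  from Suc.hyps(1)[OF this] obtain T where T: "T \<subseteq> W" "card T = Suc n" "Suc n * sum f W \<le> card W * sum f T"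
    by blast
  have fin: "finite T" "T \<noteq> {}" using T W by (auto intro: finite_subset)
  obtain x where x: "x \<in> T" "\<And>y. y \<in> T \<Longrightarrow> f x \<le> f y"
    using arg_min_if_finite[OF fin, of f] by (metis not_le)
  let ?T = "T - {x}"
  have c: "card ?T = n" using T(2) x(1) fin by simp
  have s: "sum f T = f x + sum f ?T" using fin x(1) by (simp add: sum.remove)
  have "n * f x \<le> sum f ?T"
    using sum_mono[of ?T "\<lambda>_. f x" f] x(2) c by simp
  then have "n * sum f T \<le> Suc n * sum f ?T" unfolding s by (simp add: algebra_simps)
  then have "card W * (n * sum f T) \<le> card W * (Suc n * sum f ?T)" by (rule mult_le_mono2)
  moreover have "n * (Suc n * sum f W) \<le> n * (card W * sum f T)" using T(3) by (rule mult_le_mono2)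
  ultimately have "Suc n * (n * sum f W) \<le> Suc n * (card W * sum f ?T)"
    by (metis (no_types, lifting) le_trans mult.left_commute)
  then have "n * sum f W \<le> card W * sum f ?T" by (simp only: Suc_mult_le_cancel1)
  then show ?case using T(1) c by (intro exI[of _ ?T]) auto
qed

text \<open>The largest of \<open>v\<close> distinct positive integers is at least \<open>v\<close>;
  remove it and proceed by induction.\<close>

lemma sum_ge_triangular:
  fixes W :: "nat set"
  assumes "finite W" "\<And>r. r \<in> W \<Longrightarrow> 1 \<le> r"
  shows "card W * (card W + 1) \<le> 2 * \<Sum>W"
  using assms
proof (induction "card W" arbitrary: W)
  case (Suc n)
  then have ne: "W \<noteq> {}" "finite W" by auto
  let ?M = "Max W"
  have M: "?M \<in> W" using ne by (rule Max_in[rotated])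
  have c: "card (W - {?M}) = n" using Suc.hyps(2) M ne by simp
  have "W \<subseteq> {1..?M}" using Suc.prems ne by auto
  then have "card W \<le> ?M" using card_mono[of "{1..?M}" W] by simp
  moreover have "card (W - {?M}) * (card (W - {?M}) + 1) \<le> 2 * \<Sum>(W - {?M})"
    using Suc c by (intro Suc.hyps(1)) auto
  moreover have "\<Sum>W = ?M + \<Sum>(W - {?M})" by (rule sum.remove[OF ne(2) M])
  ultimately show ?case using c Suc.hyps(2)[symmetric] by (simp add: algebra_simps)
qed simp

lemma sum_block:
  fixes g :: "nat \<Rightarrow> 'a::comm_monoid_add"
  shows "(\<Sum>i\<in>{a * d..<a * d + d}. g i) = (\<Sum>r\<in>{1..d}. g (a * d + (r - 1)))"
proof -
  have "(\<Sum>i\<in>{a * d..<a * d + d}. g i) = (\<Sum>i<d. g (a * d + i))"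
    by (subst sum.atLeastLessThan_shift_0) (simp add: atLeast0LessThan comp_def)
  also have "\<dots> = (\<Sum>r\<in>{1..d}. g (a * d + (r - 1)))"
    unfolding One_nat_def sum.atLeast1_atMost_eq by simp
  finally show ?thesis .
qed

lemma block_index:
  fixes a d r :: nat
  assumes "r \<in> {1..d}"
  shows "(a * d + (r - 1)) mod d + 1 = r" "(a * d + (r - 1)) div d = a" "Suc (a * d + (r - 1)) = r + a * d"
proof -
  have r: "r - 1 < d" "r \<ge> 1" using assms by auto
  then show "(a * d + (r - 1)) mod d + 1 = r" by (simp only: mod_mult_self3 mod_less)
  show "(a * d + (r - 1)) div d = a" using r(1) by (subst div_mult_self3) simp_all
  show "Suc (a * d + (r - 1)) = r + a * d" using r by simp
qed

context radix
begin

lemma digits_number: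
  assumes "\<And>a. t a < b"
  shows "(\<Sum>a<n. t a * b ^ a) < b ^ n" "ndigit (\<Sum>a<n. t a * b ^ a) i = (if i < n then t i else 0)"
proof -
  have lt: "(\<Sum>a<n. t a * b ^ a) < b ^ n" for n
  proof (induction n)
    case (Suc n)
    have "Suc (t n) * b ^ n \<le> b * b ^ n" using assms[of n] by (intro mult_right_mono) simp_all
    then show ?case using Suc by simp
  qed simp
  show "(\<Sum>a<n. t a * b ^ a) < b ^ n" by (rule lt)
  show "ndigit (\<Sum>a<n. t a * b ^ a) i = (if i < n then t i else 0)"
  proof (cases "i < n")
    case True
    then show ?thesis
    proof (induction n)
      case (Suc n)
      have e: "(\<Sum>a<Suc n. t a * b ^ a) = t n * b ^ n + (\<Sum>a<n. t a * b ^ a)" by simp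
      show ?case
      proof (cases "i = n")
        case True
        then show ?thesis unfolding e using ndigit_add_top[OF lt assms] by simp
      next
        case False
        then show ?thesis unfolding e using Suc ndigit_add_low[of i n] by simp
      qed
    qed simp
  next
    case False
    then show ?thesis using ndigit_ge[OF lt] by simp
  qed
qed

text \<open>The counterpart of \<open>interlace\<close> for indices: one-based position
  \<open>r + a * d\<close> is digit \<open>a * d + r - 1\<close> counted from 0.\<close>

definition deinterlace :: "nat \<Rightarrow> nat \<Rightarrow> nat \<Rightarrow> nat" where
  "deinterlace d r k = (\<Sum>a<k. ndigit k (a * d + r - 1) * b ^ a)"

lemma deinterlace_less: "deinterlace d r k < b ^ k"
  unfolding deinterlace_def using digits_number(1)[of "\<lambda>a. ndigit k (a * d + r - 1)"] ndigit_less by blast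

lemma ndigit_deinterlace:
  assumes "r \<ge> 1" "d \<ge> 1"
  shows "ndigit (deinterlace d r k) a = ndigit k (a * d + r - 1)"
proof (cases "a < k")
  case True
  then show ?thesis
    unfolding deinterlace_def using digits_number(2)[of "\<lambda>a. ndigit k (a * d + r - 1)"] ndigit_less by simp
next
  case False
  have "a \<le> a * d" using assms(2) by (cases d) simp_all
  then have "k \<le> a * d + r - 1" using False assms(1) by linarith
  then show ?thesis using False ndigit_ge_self ndigit_ge[OF deinterlace_less] by simp
qed

lemma deinterlace_inj:
  assumes "d \<ge> 1" "\<And>r. r \<in> {1..d} \<Longrightarrow> deinterlace d r k = deinterlace d r l"
  shows "k = l"
proof -
  let ?n = "max k l"
  have "ndigit k i = ndigit l i" for i
  proof -
    have i: "i div d * d + (i mod d + 1) - 1 = i" by simp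
    have "i mod d + 1 \<in> {1..d}" using assms(1) by (simp add: Suc_leI)
    then have "ndigit (deinterlace d (i mod d + 1) k) (i div d) = ndigit (deinterlace d (i mod d + 1) l) (i div d)"
      using assms(2) by simp
    then show ?thesis using ndigit_deinterlace[of "i mod d + 1" d] assms(1) i by simp
  qed
  moreover have "k < b ^ ?n" "l < b ^ ?n"
    by (rule less_le_trans[OF less_power], intro power_increasing, auto)+
  ultimately show ?thesis by (intro ndigit_eq_imp_eq[of k ?n l]) auto
qed

lemma deinterlace_0 [simp]: "deinterlace d r 0 = 0"
  by (simp add: deinterlace_def)

lemma ndigit_len:
  assumes "l \<ge> 1"
  shows "ndigit l (len l - 1) \<noteq> 0"
  using len_decomp(2,3)[OF assms] unfolding lead_def ndigit_def by simp

text \<open>A greedy comparison: the largest position in \<open>T\<close> is at most that of the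
  leading digit of \<open>k\<close>, and the remaining ones are positions of nonzero digits of
  \<open>rest k\<close>.\<close>

lemma mu_ge_positions:
  assumes "finite T" "\<And>i. i \<in> T \<Longrightarrow> ndigit k i \<noteq> 0" "card T \<le> \<alpha>"
  shows "(\<Sum>i\<in>T. i + 1) \<le> mu \<alpha> k"
  using assms
proof (induction \<alpha> arbitrary: T k)
  case (Suc \<alpha>)
  show ?case
  proof (cases "T = {}")
    case False
    let ?t = "Max T"
    have t: "?t \<in> T" using Suc.prems(1) False by (rule Max_in)
    have k1: "k \<ge> 1"
    proof (rule ccontr)
      assume "\<not> k \<ge> 1"
      then have "k = 0" by simp
      then show False using Suc.prems(2)[OF t] by simp
    qed
    have tl: "?t < len k"
    proof (rule ccontr)
      assume "\<not> ?t < len k"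
      then have "ndigit k ?t = 0" using ndigit_ge[of k "len k" ?t] len_bounds[OF k1] by simp
      then show False using Suc.prems(2)[OF t] by simp
    qed
    have "(\<Sum>i\<in>T - {?t}. i + 1) \<le> mu \<alpha> (rest k)"
    proof (rule Suc.IH)
      fix i assume i: "i \<in> T - {?t}"
      then have "i < ?t" using Suc.prems(1) by (simp add: order.strict_iff_order)
      then have "i < len k - 1" using tl by simp
      then show "ndigit (rest k) i \<noteq> 0" using Suc.prems(2)[of i] i by (simp add: rest_def ndigit_mod)
    qed (use Suc.prems t in auto)
    moreover have "(\<Sum>i\<in>T. i + 1) = (?t + 1) + (\<Sum>i\<in>T - {?t}. i + 1)"
      using Suc.prems(1) t by (rule sum.remove)
    ultimately show ?thesis using tl by simp
  qed simp
qed simp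

text \<open>The summand is the one-based position in \<open>k\<close> of the leading digit of part
  \<open>r\<close>. Different parts occupy different residues modulo \<open>d\<close>, so these
  positions are distinct.\<close>

lemma interlaced_positions:
  assumes d: "d \<ge> 1" and W: "W \<subseteq> {1..d}" "\<And>r. r \<in> W \<Longrightarrow> deinterlace d r k \<noteq> 0" and c: "card W \<le> \<alpha>"
  shows "(\<Sum>r\<in>W. (len (deinterlace d r k) - 1) * d + r) \<le> mu \<alpha> k"
proof -
  let ?p = "\<lambda>r. (len (deinterlace d r k) - 1) * d + (r - 1)"
  have fin: "finite W" using W(1) finite_subset by auto
  have inj: "inj_on ?p W"
  proof (rule inj_onI)
    fix r r' assume r: "r \<in> W" "r' \<in> W" and eq: "?p r = ?p r'"
    have "r \<in> {1..d}" "r' \<in> {1..d}" using r W(1) by blast+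
    then have rr: "r - 1 < d" "r' - 1 < d" "r \<ge> 1" "r' \<ge> 1" by auto
    have "?p r mod d = ?p r' mod d" by (simp only: eq)
    then have "r - 1 = r' - 1" using rr by (simp only: mod_mult_self3 mod_less)
    then show "r = r'" using rr by simp
  qed
  have "(\<Sum>i\<in>?p ` W. i + 1) \<le> mu \<alpha> k"
  proof (rule mu_ge_positions)
    fix i assume "i \<in> ?p ` W"
    then obtain r where r: "r \<in> W" "i = ?p r" by blast
    then have r1: "r \<ge> 1" using W(1) by auto
    have "ndigit (deinterlace d r k) (len (deinterlace d r k) - 1) \<noteq> 0"
      using W(2)[OF r(1)] by (intro ndigit_len) simp
    then show "ndigit k i \<noteq> 0" using ndigit_deinterlace[OF r1 d] r1 by (simp add: r(2))
  qed (use fin c card_image_le[OF fin] in \<open>auto intro: le_trans\<close>)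
  also have "(\<Sum>i\<in>?p ` W. i + 1) = (\<Sum>r\<in>W. ?p r + 1)"
    by (rule sum.reindex[OF inj, unfolded comp_def])
  also have "\<dots> = (\<Sum>r\<in>W. (len (deinterlace d r k) - 1) * d + r)"
    using W(1) by (intro sum.cong refl) auto
  finally show ?thesis .
qed

text \<open>With \<open>v\<close> nonzero parts of total length \<open>L\<close>, their leading
  digits occupy positions in \<open>k\<close> of sum \<open>Q = d * L - d * v + \<Sum>W\<close>, and
  \<open>\<Sum>W\<close> is at least \<open>v * (v + 1) / 2\<close>. For
  \<open>v \<le> \<alpha>\<close> the sum \<open>Q\<close> is at most \<open>mu \<alpha> k\<close>;
  otherwise it is at most \<open>v / \<alpha>\<close> times that. In the second case the slack is
  exactly \<open>(2 * d - 1) * \<alpha>\<close>.\<close>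

lemma interlaced_weight:
  fixes k :: nat
  assumes d: "d \<ge> 1" and a: "\<alpha> \<ge> 1"
  defines "W \<equiv> {r \<in> {1..d}. deinterlace d r k \<noteq> 0}"
  shows "(\<Sum>r\<in>W. 2 * min \<alpha> d * len (deinterlace d r k) + \<alpha>) \<le> 2 * mu \<alpha> k + (2 * d - 1) * \<alpha>"
proof -
  have W: "W \<subseteq> {1..d}" "\<And>r. r \<in> W \<Longrightarrow> deinterlace d r k \<noteq> 0" by (auto simp: W_def)
  have fin: "finite W" using W(1) finite_subset by auto
  define v where "v = card W"
  define L where "L = (\<Sum>r\<in>W. len (deinterlace d r k))"
  define Q where "Q = (\<Sum>r\<in>W. (len (deinterlace d r k) - 1) * d + r)"
  have vd: "v \<le> d" using card_mono[OF _ W(1)] by (simp add: v_def)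
  have l1: "len (deinterlace d r k) \<ge> 1" if "r \<in> W" for r
    using W(2)[OF that] by (intro len_pos) simp
  have vL: "v \<le> L"
    using sum_mono[of W "\<lambda>_. 1" "\<lambda>r. len (deinterlace d r k)"] l1 by (simp add: v_def L_def)
  have "Q + d * v = d * L + \<Sum>W"
  proof -
    have "(\<Sum>r\<in>W. ((len (deinterlace d r k) - 1) * d + r) + d) = (\<Sum>r\<in>W. d * len (deinterlace d r k) + r)"
    proof (intro sum.cong refl)
      fix r assume "r \<in> W"
      then obtain j where "len (deinterlace d r k) = Suc j" using l1[of r] by (cases "len (deinterlace d r k)") auto
      then show "(len (deinterlace d r k) - 1) * d + r + d = d * len (deinterlace d r k) + r" by simp
    qed
    then show ?thesis by (simp add: Q_def L_def v_def sum.distrib sum_distrib_left mult.commute)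
  qed
  moreover have "v * (v + 1) \<le> 2 * \<Sum>W"
    unfolding v_def by (rule sum_ge_triangular[OF fin]) (use W(1) in auto)
  ultimately have Q: "2 * (d * L) + v * (v + 1) \<le> 2 * Q + 2 * (d * v)" by linarith
  have sum: "(\<Sum>r\<in>W. 2 * min \<alpha> d * len (deinterlace d r k) + \<alpha>) = 2 * min \<alpha> d * L + \<alpha> * v"
    by (simp add: L_def v_def sum.distrib sum_distrib_left mult.commute)
  have d2: "int ((2 * d - 1) * \<alpha>) = (2 * int d - 1) * int \<alpha>" using d by (simp add: of_nat_diff)
  have Qi: "2 * (int d * int L) + int v * (int v + 1) \<le> 2 * int Q + 2 * (int d * int v)"
  proof -
    have "int (2 * (d * L) + v * (v + 1)) \<le> int (2 * Q + 2 * (d * v))" using Q by (simp only: of_nat_le_iff)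
    then show ?thesis by (simp only: of_nat_add of_nat_mult of_nat_numeral of_nat_1)
  qed
  have "int (2 * min \<alpha> d * L + \<alpha> * v) \<le> int (2 * mu \<alpha> k + (2 * d - 1) * \<alpha>)"
  proof (cases "v \<le> \<alpha>")
    case True
    define c where "c = min \<alpha> d"
    have c: "c \<le> \<alpha>" "c \<le> d" "v \<le> c" "1 \<le> c" using True vd a d by (auto simp: c_def)
    have "Q \<le> mu \<alpha> k" unfolding Q_def by (rule interlaced_positions[OF d W]) (assumption, rule True[unfolded v_def])
    \<comment> \<open>The first product exchanges \<open>d * L\<close> for \<open>c * L\<close>. The
      second bounds the remaining quadratic expression in \<open>v\<close> by
      \<open>(2 * c - 1) * \<alpha>\<close>, with equality at \<open>v = \<alpha>\<close>.\<close>
    moreover have "0 \<le> (int d - int c) * (int L - int v)" using c vL by (intro mult_nonneg_nonneg) auto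
    moreover have "0 \<le> (2 * int c - 1 - int v) * (int \<alpha> - int v)" using c True by (intro mult_nonneg_nonneg) auto
    moreover have "0 \<le> (2 * int d - 2 * int c) * int \<alpha>" using c by (intro mult_nonneg_nonneg) auto
    ultimately have "2 * int c * int L + int \<alpha> * int v \<le> 2 * int (mu \<alpha> k) + (2 * int d - 1) * int \<alpha>"
      using Qi by (simp add: algebra_simps)
    then show ?thesis unfolding of_nat_add d2 by (simp add: c_def)
  next
    case False
    then have c: "min \<alpha> d = \<alpha>" using vd by simp
    \<comment> \<open>Only \<open>\<alpha>\<close> positions can be compared with
      \<open>mu \<alpha> k\<close>; the largest ones have at least the average of all
      \<open>v\<close>.\<close>
    obtain T where T: "T \<subseteq> W" "card T = \<alpha>" "\<alpha> * Q \<le> v * (\<Sum>r\<in>T. (len (deinterlace d r k) - 1) * d + r)"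
      using heavy_subset[OF fin, of \<alpha> "\<lambda>r. (len (deinterlace d r k) - 1) * d + r"] False by (auto simp: v_def Q_def)
    have "(\<Sum>r\<in>T. (len (deinterlace d r k) - 1) * d + r) \<le> mu \<alpha> k"
      by (rule interlaced_positions[OF d]) (use T W in auto)
    then have "v * (\<Sum>r\<in>T. (len (deinterlace d r k) - 1) * d + r) \<le> v * mu \<alpha> k" by (rule mult_le_mono2)
    then have "\<alpha> * Q \<le> v * mu \<alpha> k" using T(3) by linarith
    then have aQ: "int \<alpha> * int Q \<le> int v * int (mu \<alpha> k)" by (simp flip: of_nat_mult)
    have v0: "0 < int v" using False by simp
    have "0 \<le> int \<alpha> * (2 * int Q + 2 * (int d * int v) - (2 * (int d * int L) + int v * (int v + 1)))"
      using Qi by (intro mult_nonneg_nonneg) auto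
    moreover have "0 \<le> int \<alpha> * ((int d - int v) * int L)" using vd by (intro mult_nonneg_nonneg) auto
    ultimately have "int v * (2 * int \<alpha> * int L + int \<alpha> * int v) \<le> int v * (2 * int (mu \<alpha> k) + (2 * int d - 1) * int \<alpha>)"
      using aQ by (simp add: algebra_simps)
    then have "2 * int \<alpha> * int L + int \<alpha> * int v \<le> 2 * int (mu \<alpha> k) + (2 * int d - 1) * int \<alpha>"
      using v0 by (simp only: mult_le_cancel_left_pos)
    then show ?thesis unfolding of_nat_add d2 c by simp
  qed
  then show ?thesis unfolding sum by (simp only: of_nat_le_iff)
qed

lemma interlaced_weight_bound:
  assumes d: "d \<ge> 1" and a: "\<alpha> \<ge> 1"
  shows "(1 / real b) ^ (2 * mu \<alpha> k) \<le> real b ^ ((2 * d - 1) * \<alpha>) * (\<Prod>r\<in>{1..d}. r_weight b \<alpha> d (deinterlace d r k))"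
proof -
  let ?W = "{r \<in> {1..d}. deinterlace d r k \<noteq> 0}"
  let ?e = "\<Sum>r\<in>?W. 2 * min \<alpha> d * len (deinterlace d r k) + \<alpha>"
  have "(\<Prod>r\<in>{1..d}. r_weight b \<alpha> d (deinterlace d r k)) = (\<Prod>r\<in>?W. (1 / real b) ^ (2 * min \<alpha> d * len (deinterlace d r k) + \<alpha>))"
    by (intro prod.mono_neutral_cong_right) (auto simp: r_weight_def len_def power_one_over)
  also have "\<dots> = (1 / real b) ^ ?e" by (simp only: power_sum)
  finally have p: "(\<Prod>r\<in>{1..d}. r_weight b \<alpha> d (deinterlace d r k)) = (1 / real b) ^ ?e" .
  have "(1 / real b) ^ (2 * mu \<alpha> k) = real b ^ ((2 * d - 1) * \<alpha>) * (1 / real b) ^ (2 * mu \<alpha> k + (2 * d - 1) * \<alpha>)"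
    by (simp add: power_add power_one_over)
  also have "\<dots> \<le> real b ^ ((2 * d - 1) * \<alpha>) * (1 / real b) ^ ?e"
    using interlaced_weight[OF d a] by (intro mult_left_mono power_decreasing) auto
  finally show ?thesis unfolding p .
qed

lemma finite_expansion:
  assumes t: "\<And>a. t a < b" and z: "\<And>a. a \<ge> n \<Longrightarrow> t a = 0"
    and x: "x = (\<Sum>a<n. real (t a) / real b ^ Suc a)"
  shows "rdigit x (Suc a) = t a" "fin_digits x" "x \<in> {0..<1}"
proof -
  have e: "x = (\<Sum>a. real (t a) / real b ^ Suc a)"
    unfolding x by (rule suminf_finite[symmetric]) (auto simp: z)
  have inf: "\<exists>c\<ge>n'. t c \<noteq> b - 1" for n'
    using z[of "max n n'"] b2 by (intro exI[of _ "max n n'"]) auto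
  show rdigit: "rdigit x (Suc a) = t a" for a
    unfolding e by (rule digit_sum_rdigit[OF t inf])
  then show "fin_digits x" unfolding fin_digits_def using z by auto
  obtain c where "t c \<noteq> b - 1" using inf by blast
  then show "x \<in> {0..<1}" unfolding e using digit_sum_bounds[OF t] by simp
qed

lemma interlace_digits:
  assumes d: "d \<ge> 1" and y: "\<And>r a. r \<in> {1..d} \<Longrightarrow> a \<ge> m \<Longrightarrow> rdigit (y r) (Suc a) = 0"
  shows "rdigit (interlace b d y) (Suc i) = rdigit (y (i mod d + 1)) (Suc (i div d))"
    "fin_digits (interlace b d y)" "interlace b d y \<in> {0..<1}"
proof -
  let ?t = "\<lambda>i. rdigit (y (i mod d + 1)) (Suc (i div d))"
  have im: "i mod d + 1 \<in> {1..d}" for i using d by (simp add: Suc_leI)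
  have z: "?t i = 0" if "i \<ge> m * d" for i
  proof -
    have "m \<le> i div d" using that d by (simp add: less_eq_div_iff_mult_less_eq)
    then show ?thesis using y im by blast
  qed
  have in_a: "(\<Sum>r=1..d. real (badic_digit b (y r) (Suc a)) / real b ^ (r + a * d))
    = (\<Sum>i\<in>{a * d..<a * d + d}. real (?t i) / real b ^ Suc i)" for a
  proof -
    have "(\<Sum>i\<in>{a * d..<a * d + d}. real (?t i) / real b ^ Suc i)
      = (\<Sum>r=1..d. real (rdigit (y r) (Suc a)) / real b ^ (r + a * d))"
      unfolding sum_block by (rule sum.cong[OF refl]) (simp only: block_index)
    then show ?thesis by (simp add: rdigit_def)
  qed
  have "interlace b d y = (\<Sum>a<m. \<Sum>r=1..d. real (badic_digit b (y r) (Suc a)) / real b ^ (r + a * d))"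
    unfolding interlace_def
  proof (rule suminf_finite)
    fix a assume "a \<notin> {..<m}"
    then show "(\<Sum>r=1..d. real (badic_digit b (y r) (Suc a)) / real b ^ (r + a * d)) = 0"
      using y by (intro sum.neutral ballI) (simp add: rdigit_def)
  qed simp
  also have "\<dots> = (\<Sum>i<m * d. real (?t i) / real b ^ Suc i)"
    unfolding in_a by (rule sum.nat_group)
  finally have e: "interlace b d y = (\<Sum>i<m * d. real (?t i) / real b ^ Suc i)" .
  show "rdigit (interlace b d y) (Suc i) = ?t i" "fin_digits (interlace b d y)" "interlace b d y \<in> {0..<1}"
    using finite_expansion[of ?t "m * d", OF rdigit_less z e] by auto
qed

text \<open>Index and point are interlaced by the same permutation of digits, so the exponent of
  \<open>omega\<close> splits into one sum for each part.\<close>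

lemma wal_interlace:
  assumes d: "d \<ge> 1" and y: "\<And>r a. r \<in> {1..d} \<Longrightarrow> a \<ge> m \<Longrightarrow> rdigit (y r) (Suc a) = 0"
  shows "wal k (interlace b d y) = (\<Prod>r\<in>{1..d}. wal (deinterlace d r k) (y r))"
proof -
  let ?x = "interlace b d y"
  have xd: "rdigit ?x (Suc i) = rdigit (y (i mod d + 1)) (Suc (i div d))" for i
    by (rule interlace_digits(1)[OF d y])
  have "k < b ^ (k * d)"
    by (rule less_le_trans[OF less_power]) (use d in \<open>auto intro!: power_increasing\<close>)
  then have "wal k ?x = omega ^ (\<Sum>i<k * d. ndigit k i * rdigit ?x (Suc i))" by (rule wal_eq)
  also have "(\<Sum>i<k * d. ndigit k i * rdigit ?x (Suc i)) = (\<Sum>a<k. \<Sum>i\<in>{a * d..<a * d + d}. ndigit k i * rdigit ?x (Suc i))"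
    by (rule sum.nat_group[symmetric])
  also have "\<dots> = (\<Sum>a<k. \<Sum>r\<in>{1..d}. ndigit (deinterlace d r k) a * rdigit (y r) (Suc a))"
  proof (rule sum.cong[OF refl])
    fix a
    have "(\<Sum>r\<in>{1..d}. ndigit (deinterlace d r k) a * rdigit (y r) (Suc a)) = (\<Sum>r\<in>{1..d}. ndigit k (a * d + (r - 1)) * rdigit (y r) (Suc a))"
      by (intro sum.cong refl) (simp add: ndigit_deinterlace[OF _ d])
    also have "\<dots> = (\<Sum>i\<in>{a * d..<a * d + d}. ndigit k i * rdigit ?x (Suc i))"
      unfolding sum_block xd by (rule sum.cong[OF refl]) (simp only: block_index)
    finally show "(\<Sum>i\<in>{a * d..<a * d + d}. ndigit k i * rdigit ?x (Suc i)) = (\<Sum>r\<in>{1..d}. ndigit (deinterlace d r k) a * rdigit (y r) (Suc a))" ..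
  qed
  also have "\<dots> = (\<Sum>r\<in>{1..d}. \<Sum>a<k. ndigit (deinterlace d r k) a * rdigit (y r) (Suc a))" by (rule sum.swap)
  finally show ?thesis by (simp only: power_sum[of _ _ "{1..d}"] wal_eq[OF deinterlace_less])
qed

end

subsection \<open>Polynomial lattices\<close>

notation fls_nth (infixl "$$" 75)

lemma poly_to_fls_inv_nth:
  "poly_to_fls_inv f $$ l = (if l \<le> 0 then Polynomial.coeff f (nat (- l)) else 0)"
proof -
  have "poly_to_fls_inv f $$ l = (\<Sum>i\<le>degree f. if i = nat (- l) \<and> l \<le> 0 then Polynomial.coeff f i else 0)"
    unfolding poly_to_fls_inv_def fls_nth_sum fls_mult_const_nth fls_X_inv_power_nth
    by (intro sum.cong refl) auto
  also have "\<dots> = (if l \<le> 0 then Polynomial.coeff f (nat (- l)) else 0)"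
  proof (cases "l \<le> 0")
    case True
    then have "(\<Sum>i\<le>degree f. if i = nat (- l) \<and> l \<le> 0 then Polynomial.coeff f i else 0)
      = (\<Sum>i\<le>degree f. if i = nat (- l) then Polynomial.coeff f i else 0)" by simp
    then show ?thesis using True by (auto simp: coeff_eq_0)
  qed simp
  finally show ?thesis .
qed

lemma poly_to_fls_inv_add: "poly_to_fls_inv (f + g) = poly_to_fls_inv f + poly_to_fls_inv g"
  by (rule fls_eqI) (simp add: poly_to_fls_inv_nth)

lemma poly_to_fls_inv_0 [simp]: "poly_to_fls_inv 0 = 0"
  by (rule fls_eqI) (simp add: poly_to_fls_inv_nth)

lemma poly_to_fls_inv_smult: "poly_to_fls_inv (Polynomial.smult c f) = fls_const c * poly_to_fls_inv f"
  by (rule fls_eqI) (simp add: poly_to_fls_inv_nth)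

lemma poly_to_fls_inv_pCons: "poly_to_fls_inv (pCons a f) = fls_const a + fls_X_inv * poly_to_fls_inv f"
proof (rule fls_eqI)
  fix l :: int
  have "(fls_const a + fls_X_inv * poly_to_fls_inv f) $$ l = (if l = 0 then a else 0) + poly_to_fls_inv f $$ (l + 1)"
    using fls_X_inv_power_times_conv_shift(1)[of 1 "poly_to_fls_inv f"] by simp
  moreover have "Polynomial.coeff (pCons a f) (nat (- l)) = Polynomial.coeff f (nat (- (l + 1)))" if "l < 0"
  proof -
    have "nat (- l) = Suc (nat (- (l + 1)))" using that by simp
    then show ?thesis by simp
  qed
  ultimately show "poly_to_fls_inv (pCons a f) $$ l = (fls_const a + fls_X_inv * poly_to_fls_inv f) $$ l"
    by (cases "l = 0") (auto simp: poly_to_fls_inv_nth)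
qed

lemma poly_to_fls_inv_mult: "poly_to_fls_inv (f * g) = poly_to_fls_inv f * poly_to_fls_inv g"
proof (induction f)
  case (pCons a f)
  have "poly_to_fls_inv (pCons a f * g) = poly_to_fls_inv (Polynomial.smult a g) + poly_to_fls_inv (pCons 0 (f * g))"
    by (simp add: poly_to_fls_inv_add)
  also have "\<dots> = fls_const a * poly_to_fls_inv g + fls_X_inv * (poly_to_fls_inv f * poly_to_fls_inv g)"
    by (simp add: poly_to_fls_inv_smult poly_to_fls_inv_pCons pCons.IH)
  also have "\<dots> = poly_to_fls_inv (pCons a f) * poly_to_fls_inv g"
    by (simp add: poly_to_fls_inv_pCons distrib_right mult.assoc)
  finally show ?case .
qed simp

lemma poly_to_fls_inv_sum: "poly_to_fls_inv (\<Sum>i\<in>I. f i) = (\<Sum>i\<in>I. poly_to_fls_inv (f i))"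
  by (induction I rule: infinite_finite_induct) (simp_all add: poly_to_fls_inv_add)

lemma poly_to_fls_inv_monom: "poly_to_fls_inv (Polynomial.monom c i) = fls_const c * fls_X_inv ^ i"
  by (rule fls_eqI) (auto simp: poly_to_fls_inv_nth)

lemma poly_to_fls_inv_subdegree:
  assumes "f \<noteq> 0"
  shows "poly_to_fls_inv f \<noteq> 0" "fls_subdegree (poly_to_fls_inv f) = - int (degree f)"
proof -
  have nz: "poly_to_fls_inv f $$ (- int (degree f)) \<noteq> 0"
    using assms by (simp add: poly_to_fls_inv_nth)
  then show "poly_to_fls_inv f \<noteq> 0" by auto
  show "fls_subdegree (poly_to_fls_inv f) = - int (degree f)"
    by (rule fls_subdegree_eqI[OF nz]) (auto simp: poly_to_fls_inv_nth coeff_eq_0)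
qed

text \<open>Division with remainder splits the fraction into a polynomial, which has no negative
  powers of the indeterminate, and a proper fraction. The latter starts at index
  \<open>degree p - degree (g mod p)\<close>, which lies between 1 and
  \<open>degree p\<close>.\<close>

lemma fraction_coeff_nonzero:
  fixes p g :: "'a :: field poly"
  assumes p: "p \<noteq> 0" and g: "\<not> p dvd g"
  shows "\<exists>i<degree p. (poly_to_fls_inv g / poly_to_fls_inv p) $$ int (Suc i) \<noteq> 0"
proof -
  let ?h = "g div p" and ?r = "g mod p"
  have r: "?r \<noteq> 0" using g by (simp add: dvd_eq_mod_eq_0)
  have dr: "degree ?r < degree p" using degree_mod_less[OF p, of g] r by simp
  have "poly_to_fls_inv g = poly_to_fls_inv (?h * p + ?r)" by simp
  also have "\<dots> = poly_to_fls_inv ?h * poly_to_fls_inv p + poly_to_fls_inv ?r"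
    by (simp only: poly_to_fls_inv_add poly_to_fls_inv_mult)
  finally have e: "poly_to_fls_inv g / poly_to_fls_inv p = poly_to_fls_inv ?h + poly_to_fls_inv ?r / poly_to_fls_inv p"
    using poly_to_fls_inv_subdegree(1)[OF p] by (simp add: add_divide_distrib)
  let ?q = "poly_to_fls_inv ?r / poly_to_fls_inv p"
  have sd: "fls_subdegree ?q = int (degree p) - int (degree ?r)"
    using fls_divide_subdegree[OF poly_to_fls_inv_subdegree(1)[OF r] poly_to_fls_inv_subdegree(1)[OF p]]
    by (simp only: poly_to_fls_inv_subdegree(2)[OF r] poly_to_fls_inv_subdegree(2)[OF p])
  have "?q \<noteq> 0" using poly_to_fls_inv_subdegree(1)[OF r] poly_to_fls_inv_subdegree(1)[OF p] by simp
  then have "?q $$ (int (degree p) - int (degree ?r)) \<noteq> 0" using nth_fls_subdegree_nonzero[of ?q] unfolding sd by blast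
  moreover define i where "i = degree p - Suc (degree ?r)"
  have i: "i < degree p" "int (Suc i) = int (degree p) - int (degree ?r)" using dr by (auto simp: i_def)
  ultimately have "?q $$ int (Suc i) \<noteq> 0" by (simp only: not_False_eq_True)
  moreover have "poly_to_fls_inv ?h $$ int (Suc i) = 0" by (simp add: poly_to_fls_inv_nth)
  ultimately show ?thesis using i(1) unfolding e by auto
qed

context radix
begin

section \<open>Walsh functions as additive characters of Laurent coefficients\<close>

definition chi :: "'p::prime_card mod_ring \<Rightarrow> complex" where
  "chi z = omega ^ nat (to_int_mod_ring z)"

lemma to_int_range: "0 \<le> to_int_mod_ring (z :: 'p::prime_card mod_ring)" "to_int_mod_ring z < int CARD('p)"
  using range_to_int_mod_ring[where 'a = 'p] by (metis atLeastLessThan_iff rangeI)+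

context
  assumes card: "b = CARD('p::prime_card)"
begin

lemma chi_0: "chi (0 :: 'p mod_ring) = 1"
  by (simp add: chi_def)

lemma chi_add: "chi (x + y :: 'p mod_ring) = chi x * chi y"
proof -
  have "nat (to_int_mod_ring (x + y)) mod b = (nat (to_int_mod_ring x) + nat (to_int_mod_ring y)) mod b"
    unfolding to_int_mod_ring_add using to_int_range[of x] to_int_range[of y]
    by (simp add: card nat_mod_distrib nat_add_distrib)
  from omega_power_cong[OF this] show ?thesis by (simp add: chi_def power_add)
qed

lemma chi_sum: "chi (\<Sum>i\<in>I. f i :: 'p mod_ring) = (\<Prod>i\<in>I. chi (f i))"
  by (induction I rule: infinite_finite_induct) (simp_all add: chi_0 chi_add)

lemma chi_of_nat_mult: "chi (of_nat c * z :: 'p mod_ring) = omega ^ (c * nat (to_int_mod_ring z))"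
proof (induction c)
  case (Suc c)
  have "chi (of_nat (Suc c) * z) = chi z * chi (of_nat c * z)"
    by (simp only: of_nat_Suc distrib_right mult_1 chi_add)
  then show ?case by (simp only: Suc.IH chi_def[of z] mult_Suc power_add)
qed (simp add: chi_0)

text \<open>Multiplication by the \<open>i\<close>-th power of the indeterminate shifts coefficient
  \<open>i + 1\<close> to index 1. The residue of the product is thus the inner product of the
  digits of \<open>k\<close> with the first \<open>m\<close> coefficients.\<close>

lemma tr_poly_nth:
  "(poly_to_fls_inv (tr_poly m k :: 'p mod_ring poly) * \<phi>) $$ 1 = (\<Sum>i<m. of_nat (ndigit k i) * \<phi> $$ int (Suc i))"
proof -
  have "poly_to_fls_inv (tr_poly m k :: 'p mod_ring poly) * \<phi> = (\<Sum>i<m. fls_const (of_nat (ndigit k i)) * (fls_X_inv ^ i * \<phi>))"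
    by (simp add: tr_poly_def poly_to_fls_inv_sum poly_to_fls_inv_monom ndigit_def card[symmetric] sum_distrib_right mult.assoc)
  also have "\<dots> $$ 1 = (\<Sum>i<m. of_nat (ndigit k i) * \<phi> $$ int (Suc i))"
    unfolding fls_nth_sum fls_mult_const_nth fls_X_inv_power_times_conv_shift
    by (intro sum.cong refl) (simp add: add.commute)
  finally show ?thesis .
qed

lemma chi_tr_poly:
  "chi ((poly_to_fls_inv (tr_poly m k :: 'p mod_ring poly) * \<phi>) $$ 1)
    = (\<Prod>i<m. omega ^ (ndigit k i * nat (to_int_mod_ring (\<phi> $$ int (Suc i)))))"
  unfolding tr_poly_nth chi_sum chi_of_nat_mult ..

lemma v_trunc_digits:
  fixes \<phi> :: "'p mod_ring fls"
  shows "rdigit (v_trunc m \<phi>) (Suc a) = (if a < m then nat (to_int_mod_ring (\<phi> $$ int (Suc a))) else 0)"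
proof -
  let ?t = "\<lambda>a. if a < m then nat (to_int_mod_ring (\<phi> $$ int (Suc a))) else 0"
  have "v_trunc m \<phi> = (\<Sum>a<m. real_of_int (to_int_mod_ring (\<phi> $$ int (Suc a))) / real b ^ Suc a)"
    unfolding v_trunc_def card One_nat_def sum.atLeast1_atMost_eq ..
  also have "\<dots> = (\<Sum>a<m. real (?t a) / real b ^ Suc a)"
    by (intro sum.cong refl) (simp add: to_int_range(1))
  finally have v: "v_trunc m \<phi> = (\<Sum>a<m. real (?t a) / real b ^ Suc a)" .
  have "?t a < b" for a
    using to_int_range[of "\<phi> $$ int (Suc a)"] by (auto simp: card nat_less_iff)
  from finite_expansion(1)[of ?t m, OF this _ v] show ?thesis by simp
qed

text \<open>Truncation sets the digits beyond \<open>m\<close> to 0, so only the first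
  \<open>m\<close> digits of \<open>k\<close> matter; this is the reason for \<open>tr_poly\<close>
  in the dual net.\<close>

lemma wal_v_trunc:
  fixes \<phi> :: "'p mod_ring fls"
  shows "wal k (v_trunc m \<phi>) = chi ((poly_to_fls_inv (tr_poly m k) * \<phi>) $$ 1)"
proof -
  have "k < b ^ (k + m)" by (rule less_le_trans[OF less_power]) (auto intro!: power_increasing)
  then have "wal k (v_trunc m \<phi>) = (\<Prod>j<k + m. omega ^ (ndigit k j * rdigit (v_trunc m \<phi>) (Suc j)))"
    by (rule wal_eq_prod)
  also have "\<dots> = (\<Prod>j<m. omega ^ (ndigit k j * nat (to_int_mod_ring (\<phi> $$ int (Suc j)))))"
    by (rule prod.mono_neutral_cong_right) (auto simp: v_trunc_digits)
  finally show ?thesis unfolding chi_tr_poly .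
qed

lemma nat_poly_eq:
  assumes "n < b ^ m"
  shows "nat_poly n = (tr_poly m n :: 'p mod_ring poly)"
proof -
  have fl: "floorlog CARD('p) n = len n" by (simp add: len_def mu1_def card[symmetric])
  have lm: "len n \<le> m"
  proof (cases "n = 0")
    case False
    then have n1: "n \<ge> 1" by simp
    have "b ^ (len n - 1) < b ^ m" using len_bounds[OF n1] assms by linarith
    then have "len n - 1 < m" by (rule power_less_imp_less_exp[rotated]) simp
    then show ?thesis by simp
  qed simp
  have "ndigit n i = 0" if "len n \<le> i" for i
    using that len_bounds[of n] ndigit_ge[of n "len n" i] by (cases "n = 0") simp_all
  then have "(tr_poly (len n) n :: 'p mod_ring poly) = tr_poly m n"
    unfolding tr_poly_def using lm
    by (intro sum.mono_neutral_left) (auto simp: ndigit_def card[symmetric])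
  then show ?thesis by (simp add: nat_poly_def fl)
qed

text \<open>The product of Walsh values is the character of the residue of \<open>n\<close> times a
  fixed fraction with denominator \<open>p\<close>. Outside the dual net that fraction has a nonzero
  coefficient among the first \<open>m\<close>, and the sum over the corresponding digit of
  \<open>n\<close> vanishes.\<close>

lemma lattice_character_sum:
  fixes p :: "'p mod_ring poly"
  assumes p: "degree p = m" "p \<noteq> 0" and nd: "\<not> p dvd (\<Sum>j=1..t. tr_poly m (l j) * q j)"
  shows "(\<Sum>n<b ^ m. \<Prod>j\<in>{1..t}. wal (l j) (poly_lattice_point m t q p n j)) = 0"
proof -
  let ?i = poly_to_fls_inv
  let ?g = "\<Sum>j=1..t. tr_poly m (l j) * q j"
  let ?z = "\<lambda>i. nat (to_int_mod_ring ((?i ?g / ?i p) $$ int (Suc i)))"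
  have tm: "(\<Prod>j\<in>{1..t}. wal (l j) (poly_lattice_point m t q p n j)) = (\<Prod>i<m. omega ^ (ndigit n i * ?z i))"
    if n: "n < b ^ m" for n
  proof -
    have "(\<Prod>j\<in>{1..t}. wal (l j) (poly_lattice_point m t q p n j))
      = (\<Prod>j\<in>{1..t}. chi ((?i (tr_poly m (l j)) * (?i (tr_poly m n) * ?i (q j) / ?i p)) $$ 1))"
      by (intro prod.cong refl) (simp add: poly_lattice_point_def wal_v_trunc nat_poly_eq[OF n])
    also have "\<dots> = chi ((\<Sum>j\<in>{1..t}. ?i (tr_poly m (l j)) * (?i (tr_poly m n) * ?i (q j) / ?i p)) $$ 1)"
      unfolding fls_nth_sum chi_sum ..
    \<comment> \<open>Here the roles change: \<open>n\<close>, so far part of the point, becomes the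
      index, and the fraction \<open>?i ?g / ?i p\<close> becomes the point.\<close>
    also have "(\<Sum>j\<in>{1..t}. ?i (tr_poly m (l j)) * (?i (tr_poly m n) * ?i (q j) / ?i p)) = ?i (tr_poly m n) * (?i ?g / ?i p)"
      unfolding poly_to_fls_inv_sum poly_to_fls_inv_mult sum_divide_distrib sum_distrib_left
      by (intro sum.cong refl) (simp add: mult_ac)
    also have "chi ((?i (tr_poly m n) * (?i ?g / ?i p)) $$ 1) = (\<Prod>i<m. omega ^ (ndigit n i * ?z i))"
      by (rule chi_tr_poly)
    finally show ?thesis .
  qed
  obtain i where i: "i < m" "(?i ?g / ?i p) $$ int (Suc i) \<noteq> 0"
    using fraction_coeff_nonzero[OF p(2) nd] p(1) by blast
  have "?z i mod b \<noteq> 0"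
  proof -
    let ?T = "to_int_mod_ring ((?i ?g / ?i p) $$ int (Suc i))"
    note range = to_int_range[of "(?i ?g / ?i p) $$ int (Suc i)"]
    have "?T \<noteq> 0" using i(2) by (simp only: to_int_mod_ring_hom.hom_0_iff not_False_eq_True)
    then have "0 < ?T" using range(1) by linarith
    then have "0 < nat ?T" by simp
    moreover have "nat ?T < b" using range by (simp only: card nat_less_iff)
    ultimately show ?thesis by simp
  qed
  then have s: "(\<Sum>v<b. omega ^ (v * ?z i)) = 0" using omega_sum[of "?z i" 0] by (simp add: mult.commute)
  have "(\<Sum>n<b ^ m. \<Prod>j\<in>{1..t}. wal (l j) (poly_lattice_point m t q p n j)) = (\<Sum>n<b ^ m. \<Prod>i<m. omega ^ (ndigit n i * ?z i))"
    by (rule sum.cong[OF refl], rule tm) simp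
  also have "\<dots> = (\<Prod>i<m. \<Sum>v<b. omega ^ (v * ?z i))"
    by (rule sum_ndigit_prod[where h = "\<lambda>i v. omega ^ (v * ?z i)"])
  also have "\<dots> = 0" using i(1) s by (intro prod_zero) auto
  finally show ?thesis .
qed

lemma lattice_point_digits:
  fixes p :: "'p mod_ring poly"
  assumes "j \<in> {1..t}" "a \<ge> m"
  shows "rdigit (poly_lattice_point m t q p n j) (Suc a) = 0"
  using assms by (simp add: poly_lattice_point_def v_trunc_digits)

end

end

no_notation fls_nth (infixl "$$" 75)

subsection \<open>The error bound\<close>

definition block :: "nat \<Rightarrow> nat \<Rightarrow> nat" where "block d j = (j - 1) div d + 1"
definition offset :: "nat \<Rightarrow> nat \<Rightarrow> nat" where "offset d j = (j - 1) mod d + 1"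

lemma block_offset:
  assumes "j \<in> {1..d * s}"
  shows "block d j \<in> {1..s}" "offset d j \<in> {1..d}" "d * (block d j - 1) + offset d j = j"
proof -
  have d: "d > 0" using assms by (cases d) auto
  have j: "j - 1 < s * d" "j \<ge> 1" using assms by (auto simp: mult.commute)
  have "(j - 1) div d < s" using j(1) by (rule less_mult_imp_div_less)
  then show "block d j \<in> {1..s}" by (simp add: block_def)
  have "(j - 1) mod d < d" using d by simp
  then show "offset d j \<in> {1..d}" by (simp add: offset_def Suc_le_eq del: mod_less_divisor)
  have "d * ((j - 1) div d) + (j - 1) mod d = j - 1" by (rule mult_div_mod_eq)
  then show "d * (block d j - 1) + offset d j = j" using j(2) by (simp add: block_def offset_def)
qed

lemma block_offset_compose:
  assumes l: "l \<in> {1..s}" and r: "r \<in> {1..d}"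
  shows "d * (l - 1) + r \<in> {1..d * s}" "block d (d * (l - 1) + r) = l" "offset d (d * (l - 1) + r) = r"
proof -
  obtain l' where l': "l = Suc l'" using l by (cases l) auto
  obtain r' where r': "r = Suc r'" using r by (cases r) auto
  have rd: "r' < d" using r r' by simp
  have "Suc l' * d \<le> s * d" using l l' by (intro mult_le_mono1) simp
  then have "d * l' + r \<le> d * s" using r by (simp add: mult.commute)
  then show "d * (l - 1) + r \<in> {1..d * s}" using r by (simp add: l')
  have e: "d * (l - 1) + r - 1 = l' * d + r'" by (simp add: l' r' mult.commute)
  show "block d (d * (l - 1) + r) = l" unfolding block_def e using rd by (simp add: l')
  show "offset d (d * (l - 1) + r) = r" unfolding offset_def e using rd by (simp add: r')
qed

lemma prod_blocks:
  fixes F :: "nat \<Rightarrow> 'a::comm_monoid_mult"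
  shows "(\<Prod>l\<in>{1..s}. \<Prod>r\<in>{1..d}. F (d * (l - 1) + r)) = (\<Prod>j\<in>{1..d * s}. F j)"
  unfolding prod.cartesian_product
proof (rule prod.reindex_bij_witness[where i = "\<lambda>j. (block d j, offset d j)" and j = "\<lambda>(l, r). d * (l - 1) + r"])
  fix a assume "a \<in> {1..s} \<times> {1..d}"
  then obtain l r where a: "a = (l, r)" "l \<in> {1..s}" "r \<in> {1..d}" by blast
  note b = block_offset_compose[OF a(2,3)]
  show "(block d (case a of (l, r) \<Rightarrow> d * (l - 1) + r), offset d (case a of (l, r) \<Rightarrow> d * (l - 1) + r)) = a"
    by (simp only: a(1) case_prod_conv b(2,3))
  show "(case a of (l, r) \<Rightarrow> d * (l - 1) + r) \<in> {1..d * s}" by (simp only: a(1) case_prod_conv b(1))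
  show "F (case a of (l, r) \<Rightarrow> d * (l - 1) + r) = (case a of (l, r) \<Rightarrow> F (d * (l - 1) + r))"
    by (simp only: a(1) case_prod_conv)
next
  fix j assume "j \<in> {1..d * s}"
  note b = block_offset[OF this]
  show "(case (block d j, offset d j) of (l, r) \<Rightarrow> d * (l - 1) + r) = j" by (simp only: case_prod_conv b(3))
  show "(block d j, offset d j) \<in> {1..s} \<times> {1..d}" using b(1,2) by (simp only: mem_Times_iff fst_conv snd_conv)
qed

lemma phi_eq:
  assumes "w \<subseteq> {1..d * s}"
  shows "phi d s w = block d ` w"
proof (intro equalityI subsetI)
  fix l assume "l \<in> phi d s w"
  then obtain j where l: "l \<in> {1..s}" and j: "j \<in> w" "d * (l - 1) + 1 \<le> j" "j \<le> d * l"
    by (auto simp: phi_def)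
  obtain l' where l': "l = Suc l'" using l by (cases l) auto
  have "j - d * l' \<in> {1..d}" using j(2,3) by (auto simp: l')
  from block_offset_compose(2)[OF l this] have "block d j = l" using j(2) by (simp add: l')
  then show "l \<in> block d ` w" using j(1) by blast
next
  fix l assume "l \<in> block d ` w"
  then obtain j where j: "j \<in> w" "l = block d j" by blast
  then have jd: "j \<in> {1..d * s}" using assms by blast
  note b = block_offset[OF jd]
  have "l = Suc (l - 1)" using b(1) j(2) by simp
  then obtain l' where l': "l = Suc l'" by blast
  have "j = d * l' + offset d j" using b(3) unfolding j(2)[symmetric] l' by simp
  then have "j \<in> {d * (l - 1) + 1..d * l}" using b(2) by (auto simp: l')
  then show "l \<in> phi d s w" using j b(1) by (auto simp: phi_def)
qed

context radix
begin

section \<open>Index vectors of the interlaced net and of the underlying lattice\<close>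

definition combine :: "nat \<Rightarrow> nat \<Rightarrow> nat set \<Rightarrow> (nat \<Rightarrow> nat) \<Rightarrow> nat \<Rightarrow> nat" where
  "combine d s u \<kappa> = (\<lambda>j\<in>{1..d * s}. if block d j \<in> u then deinterlace d (offset d j) (\<kappa> (block d j)) else 0)"

lemma combine_apply:
  assumes "l \<in> {1..s}" "r \<in> {1..d}"
  shows "combine d s u \<kappa> (d * (l - 1) + r) = (if l \<in> u then deinterlace d r (\<kappa> l) else 0)"
  unfolding combine_def using block_offset_compose[OF assms] by simp

lemma prod_combine:
  fixes F :: "nat \<Rightarrow> nat \<Rightarrow> 'a::comm_monoid_mult"
  assumes u: "u \<subseteq> {1..s}" and F0: "\<And>j. F j 0 = 1"
  shows "(\<Prod>j\<in>{1..d * s}. F j (combine d s u \<kappa> j)) = (\<Prod>l\<in>u. \<Prod>r\<in>{1..d}. F (d * (l - 1) + r) (deinterlace d r (\<kappa> l)))"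
proof -
  have "(\<Prod>j\<in>{1..d * s}. F j (combine d s u \<kappa> j))
    = (\<Prod>l\<in>{1..s}. \<Prod>r\<in>{1..d}. F (d * (l - 1) + r) (combine d s u \<kappa> (d * (l - 1) + r)))"
    by (rule prod_blocks[symmetric])
  also have "\<dots> = (\<Prod>l\<in>{1..s}. \<Prod>r\<in>{1..d}. F (d * (l - 1) + r) (if l \<in> u then deinterlace d r (\<kappa> l) else 0))"
    by (intro prod.cong refl) (simp only: combine_apply)
  also have "\<dots> = (\<Prod>l\<in>u. \<Prod>r\<in>{1..d}. F (d * (l - 1) + r) (deinterlace d r (\<kappa> l)))"
    using u by (intro prod.mono_neutral_cong_right) (auto simp: F0)
  finally show ?thesis .
qed

lemma wal_combine:
  assumes d: "d \<ge> 1" and u: "u \<subseteq> {1..s}"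
    and y: "\<And>j a. j \<in> {1..d * s} \<Longrightarrow> a \<ge> m \<Longrightarrow> rdigit (y j) (Suc a) = 0"
  shows "(\<Prod>l\<in>u. wal (\<kappa> l) (interlace b d (\<lambda>r. y (d * (l - 1) + r))))
    = (\<Prod>j\<in>{1..d * s}. wal (combine d s u \<kappa> j) (y j))"
proof -
  have "(\<Prod>l\<in>u. wal (\<kappa> l) (interlace b d (\<lambda>r. y (d * (l - 1) + r))))
    = (\<Prod>l\<in>u. \<Prod>r\<in>{1..d}. wal (deinterlace d r (\<kappa> l)) (y (d * (l - 1) + r)))"
  proof (rule prod.cong[OF refl])
    fix l assume "l \<in> u"
    then have l: "l \<in> {1..s}" using u by blast
    show "wal (\<kappa> l) (interlace b d (\<lambda>r. y (d * (l - 1) + r))) = (\<Prod>r\<in>{1..d}. wal (deinterlace d r (\<kappa> l)) (y (d * (l - 1) + r)))"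
      by (rule wal_interlace[OF d]) (rule y[OF block_offset_compose(1)[OF l]])
  qed
  also have "\<dots> = (\<Prod>j\<in>{1..d * s}. wal (combine d s u \<kappa> j) (y j))"
    by (rule prod_combine[OF u, where F = "\<lambda>j k. wal k (y j)", symmetric]) simp
  finally show ?thesis .
qed

lemma weight_combine:
  assumes d: "d \<ge> 1" and a: "\<alpha> \<ge> 1" and u: "u \<subseteq> {1..s}"
  shows "(\<Prod>l\<in>u. D_const \<alpha> b * (1 / real b) ^ (2 * mu \<alpha> (\<kappa> l)))
    \<le> D_tilde \<alpha> b d ^ card u * (\<Prod>j\<in>{1..d * s}. r_weight b \<alpha> d (combine d s u \<kappa> j))"
proof -
  have "(\<Prod>l\<in>u. D_const \<alpha> b * (1 / real b) ^ (2 * mu \<alpha> (\<kappa> l)))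
    \<le> (\<Prod>l\<in>u. D_const \<alpha> b * (real b ^ ((2 * d - 1) * \<alpha>) * (\<Prod>r\<in>{1..d}. r_weight b \<alpha> d (deinterlace d r (\<kappa> l)))))"
  proof (rule prod_mono, rule conjI)
    fix l
    show "0 \<le> D_const \<alpha> b * (1 / real b) ^ (2 * mu \<alpha> (\<kappa> l))" using D_const_nonneg[OF a] by simp
    show "D_const \<alpha> b * (1 / real b) ^ (2 * mu \<alpha> (\<kappa> l))
      \<le> D_const \<alpha> b * (real b ^ ((2 * d - 1) * \<alpha>) * (\<Prod>r\<in>{1..d}. r_weight b \<alpha> d (deinterlace d r (\<kappa> l))))"
      by (rule mult_left_mono[OF interlaced_weight_bound[OF d a] D_const_nonneg[OF a]])
  qed
  also have "\<dots> = D_tilde \<alpha> b d ^ card u * (\<Prod>l\<in>u. \<Prod>r\<in>{1..d}. r_weight b \<alpha> d (deinterlace d r (\<kappa> l)))"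
    by (simp add: prod.distrib D_tilde_def power_mult_distrib mult_ac)
  also have "(\<Prod>l\<in>u. \<Prod>r\<in>{1..d}. r_weight b \<alpha> d (deinterlace d r (\<kappa> l))) = (\<Prod>j\<in>{1..d * s}. r_weight b \<alpha> d (combine d s u \<kappa> j))"
    by (rule prod_combine[OF u, where F = "\<lambda>j. r_weight b \<alpha> d", symmetric]) (simp add: r_weight_def)
  finally show ?thesis .
qed

definition combined_support :: "nat \<Rightarrow> nat \<Rightarrow> nat set \<Rightarrow> (nat \<Rightarrow> nat) \<Rightarrow> nat set" where
  "combined_support d s u \<kappa> = {j \<in> {1..d * s}. combine d s u \<kappa> j \<noteq> 0}"

text \<open>A positive index has at least one nonzero part, since all parts together determine it.
  Hence the coordinates \<open>u\<close> of the kernel term reappear as \<open>phi\<close> of the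
  support, so weight and power of \<open>D_tilde\<close> agree on both sides.\<close>

lemma phi_combined_support:
  assumes d: "d \<ge> 1" and u: "u \<subseteq> {1..s}" and k: "\<And>l. l \<in> u \<Longrightarrow> \<kappa> l \<ge> 1"
  shows "phi d s (combined_support d s u \<kappa>) = u"
proof -
  have "combined_support d s u \<kappa> \<subseteq> {1..d * s}" by (auto simp: combined_support_def)
  then have "phi d s (combined_support d s u \<kappa>) = block d ` combined_support d s u \<kappa>" by (rule phi_eq)
  also have "\<dots> = u"
  proof (intro equalityI subsetI)
    fix l assume "l \<in> block d ` combined_support d s u \<kappa>"
    then show "l \<in> u" by (auto simp: combined_support_def combine_def split: if_splits)
  next
    fix l assume l: "l \<in> u"
    have "\<exists>r\<in>{1..d}. deinterlace d r (\<kappa> l) \<noteq> 0"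
    proof (rule ccontr)
      assume n: "\<not> ?thesis"
      have "\<kappa> l = 0" by (rule deinterlace_inj[OF d]) (use n in simp)
      then show False using k[OF l] by simp
    qed
    then obtain r where r: "r \<in> {1..d}" "deinterlace d r (\<kappa> l) \<noteq> 0" by blast
    have ls: "l \<in> {1..s}" using l u by blast
    have "d * (l - 1) + r \<in> combined_support d s u \<kappa>"
      using block_offset_compose(1)[OF ls r(1)] combine_apply[OF ls r(1), of u \<kappa>] l r(2) by (simp add: combined_support_def)
    then show "l \<in> block d ` combined_support d s u \<kappa>"
      using block_offset_compose(2)[OF ls r(1)] by (intro image_eqI) auto
  qed
  finally show ?thesis .
qed

lemma zero_extend_combined_support:
  "zero_extend (d * s) (combined_support d s u \<kappa>) (restrict (combine d s u \<kappa>) (combined_support d s u \<kappa>)) = combine d s u \<kappa>"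
  by (rule ext) (auto simp: zero_extend_def combined_support_def combine_def)

lemma combine_inj:
  assumes d: "d \<ge> 1" and u: "u \<subseteq> {1..s}" and k: "\<kappa> \<in> extensional u" "\<kappa>' \<in> extensional u"
    and eq: "combine d s u \<kappa> = combine d s u \<kappa>'"
  shows "\<kappa> = \<kappa>'"
proof (rule extensionalityI[OF k])
  fix l assume l: "l \<in> u"
  then have ls: "l \<in> {1..s}" using u by blast
  show "\<kappa> l = \<kappa>' l"
  proof (rule deinterlace_inj[OF d])
    fix r assume r: "r \<in> {1..d}"
    show "deinterlace d r (\<kappa> l) = deinterlace d r (\<kappa>' l)"
      using combine_apply[OF ls r, of u \<kappa>] combine_apply[OF ls r, of u \<kappa>'] l eq by simp
  qed
qed

text \<open>Since only diagonal coefficients occur, expanding the product makes the double sum over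
  points a square modulus for each index vector.\<close>

lemma walsh_double_sum:
  assumes u: "finite u"
  shows "norm (\<Sum>i<B. \<Sum>i'<B. \<Prod>l\<in>u. walsh_sum \<alpha> n (X i l) (X i' l))
    \<le> (\<Sum>\<kappa>\<in>u \<rightarrow>\<^sub>E {..<b ^ n}. (\<Prod>l\<in>u. norm (kernel_coeff \<alpha> (\<kappa> l))) * (norm (\<Sum>i<B. \<Prod>l\<in>u. wal (\<kappa> l) (X i l)))\<^sup>2)"
proof -
  let ?K = "u \<rightarrow>\<^sub>E {..<b ^ n}" and ?W = "\<lambda>\<kappa> i. \<Prod>l\<in>u. wal (\<kappa> l) (X i l)"
  have "(\<Sum>i<B. \<Sum>i'<B. \<Prod>l\<in>u. walsh_sum \<alpha> n (X i l) (X i' l))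
    = (\<Sum>i<B. \<Sum>i'<B. \<Sum>\<kappa>\<in>?K. (\<Prod>l\<in>u. kernel_coeff \<alpha> (\<kappa> l)) * (cnj (?W \<kappa> i) * ?W \<kappa> i'))"
    unfolding walsh_sum_def
    by (subst prod_sum_PiE[OF u]) (simp_all add: prod.distrib)
  also have "\<dots> = (\<Sum>i<B. \<Sum>\<kappa>\<in>?K. \<Sum>i'<B. (\<Prod>l\<in>u. kernel_coeff \<alpha> (\<kappa> l)) * (cnj (?W \<kappa> i) * ?W \<kappa> i'))"
    by (rule sum.cong[OF refl], rule sum.swap)
  also have "\<dots> = (\<Sum>\<kappa>\<in>?K. \<Sum>i<B. \<Sum>i'<B. (\<Prod>l\<in>u. kernel_coeff \<alpha> (\<kappa> l)) * (cnj (?W \<kappa> i) * ?W \<kappa> i'))"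
    by (rule sum.swap)
  also have "\<dots> = (\<Sum>\<kappa>\<in>?K. (\<Prod>l\<in>u. kernel_coeff \<alpha> (\<kappa> l)) * (cnj (\<Sum>i<B. ?W \<kappa> i) * (\<Sum>i<B. ?W \<kappa> i)))"
    unfolding cnj_sum unfolding sum_product unfolding sum_distrib_left ..
  finally have e: "(\<Sum>i<B. \<Sum>i'<B. \<Prod>l\<in>u. walsh_sum \<alpha> n (X i l) (X i' l))
    = (\<Sum>\<kappa>\<in>?K. (\<Prod>l\<in>u. kernel_coeff \<alpha> (\<kappa> l)) * (cnj (\<Sum>i<B. ?W \<kappa> i) * (\<Sum>i<B. ?W \<kappa> i)))" .
  show ?thesis
    unfolding e by (rule order_trans[OF norm_sum])
      (simp only: norm_mult complex_mod_cnj prod_norm power2_eq_square order_refl)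
qed

end

lemma infsum_ennreal_ge:
  fixes f :: "'a \<Rightarrow> ennreal"
  assumes "finite F" "F \<subseteq> A"
  shows "sum f F \<le> infsum f A"
  using assms by (subst nonneg_infsum_complete) (auto intro: SUP_upper)

context radix
begin

definition dual_coeffs :: "nat \<Rightarrow> nat \<Rightarrow> nat \<Rightarrow> (nat \<Rightarrow> 'p::prime_card mod_ring poly) \<Rightarrow> 'p mod_ring poly
    \<Rightarrow> nat \<Rightarrow> nat set \<Rightarrow> (nat \<Rightarrow> nat) set" where
  "dual_coeffs m d s q p n u = {\<kappa> \<in> u \<rightarrow>\<^sub>E {1..<b ^ n}. combine d s u \<kappa> \<in> dual_net m (d * s) q p}"

text \<open>Each pair \<open>(u, \<kappa>)\<close> is sent to the support and the nonzero entries of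
  its parts. The map is injective: the support returns \<open>u\<close> through \<open>phi\<close>,
  and extension by zero returns the parts and with them \<open>\<kappa>\<close>. So the left side is
  dominated termwise by a finite portion of the right side, which may be infinite.\<close>

lemma dual_sum_bound:
  fixes \<gamma> :: "nat set \<Rightarrow> real" and p :: "'p::prime_card mod_ring poly"
  assumes d: "d \<ge> 1" and a: "\<alpha> \<ge> 1" and g: "\<And>u. u \<subseteq> {1..s} \<Longrightarrow> \<gamma> u \<ge> 0"
  shows "ennreal (\<Sum>u\<in>Pow {1..s} - {{}}. \<gamma> u * (\<Sum>\<kappa>\<in>dual_coeffs m d s q p n u. \<Prod>l\<in>u. D_const \<alpha> b * (1 / real b) ^ (2 * mu \<alpha> (\<kappa> l))))
    \<le> (\<Sum>w\<in>Pow {1..d * s} - {{}}. ennreal (\<gamma> (phi d s w) * D_tilde \<alpha> b d ^ card (phi d s w)) *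
        (\<Sum>\<^sub>\<infinity>l\<in>{l \<in> w \<rightarrow>\<^sub>E {1..}. zero_extend (d * s) w l \<in> dual_net m (d * s) q p}.
           ennreal (\<Prod>j\<in>w. r_weight b \<alpha> d (l j))))"
proof -
  let ?U = "Pow {1..s} - {{}}" and ?W = "Pow {1..d * s} - {{}}"
  let ?K = "dual_coeffs m d s q p n"
  let ?T = "\<lambda>w. {l \<in> w \<rightarrow>\<^sub>E {1..}. zero_extend (d * s) w l \<in> dual_net m (d * s) q p}"
  let ?c = "\<lambda>w. \<gamma> (phi d s w) * D_tilde \<alpha> b d ^ card (phi d s w)"
  define S where "S = Sigma ?U ?K"
  define f where "f = (\<lambda>(u, \<kappa>). (combined_support d s u \<kappa>, restrict (combine d s u \<kappa>) (combined_support d s u \<kappa>)))"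
  define G where "G = (\<lambda>(w, l). ennreal (?c w) * ennreal (\<Prod>j\<in>w. r_weight b \<alpha> d (l j)))"
  have finK: "finite (?K u)" if "u \<in> ?U" for u
  proof -
    have "finite u" using that finite_subset by auto
    then have "finite (u \<rightarrow>\<^sub>E {1..<b ^ n})" by (intro finite_PiE) auto
    then show ?thesis by (simp add: dual_coeffs_def)
  qed
  have finS: "finite S" unfolding S_def by (intro finite_SigmaI finK) auto
  have Dt: "0 \<le> D_tilde \<alpha> b d" using D_const_nonneg[OF a] by (simp add: D_tilde_def)
  have S: "u \<subseteq> {1..s}" "u \<noteq> {}" "\<kappa> \<in> u \<rightarrow>\<^sub>E {1..<b ^ n}" "combine d s u \<kappa> \<in> dual_net m (d * s) q p"
    "phi d s (combined_support d s u \<kappa>) = u" if "(u, \<kappa>) \<in> S" for u \<kappa>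
  proof -
    show u: "u \<subseteq> {1..s}" "u \<noteq> {}" and k: "\<kappa> \<in> u \<rightarrow>\<^sub>E {1..<b ^ n}" and "combine d s u \<kappa> \<in> dual_net m (d * s) q p"
      using that by (auto simp: S_def dual_coeffs_def)
    show "phi d s (combined_support d s u \<kappa>) = u" by (rule phi_combined_support[OF d u(1)]) (use k in auto)
  qed
  have rw: "0 \<le> r_weight b \<alpha> d k" for k by (simp add: r_weight_def)
  have tm: "ennreal (\<gamma> u * (\<Prod>l\<in>u. D_const \<alpha> b * (1 / real b) ^ (2 * mu \<alpha> (\<kappa> l)))) \<le> G (f (u, \<kappa>))"
    if uk: "(u, \<kappa>) \<in> S" for u \<kappa>
  proof -
    let ?w = "combined_support d s u \<kappa>"
    have "(\<Prod>l\<in>u. D_const \<alpha> b * (1 / real b) ^ (2 * mu \<alpha> (\<kappa> l)))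
      \<le> D_tilde \<alpha> b d ^ card u * (\<Prod>j\<in>{1..d * s}. r_weight b \<alpha> d (combine d s u \<kappa> j))"
      by (rule weight_combine[OF d a S(1)[OF uk]])
    also have "(\<Prod>j\<in>{1..d * s}. r_weight b \<alpha> d (combine d s u \<kappa> j)) = (\<Prod>j\<in>?w. r_weight b \<alpha> d (restrict (combine d s u \<kappa>) ?w j))"
      by (rule prod.mono_neutral_cong_right) (auto simp: combined_support_def r_weight_def)
    finally have "\<gamma> u * (\<Prod>l\<in>u. D_const \<alpha> b * (1 / real b) ^ (2 * mu \<alpha> (\<kappa> l)))
      \<le> \<gamma> u * (D_tilde \<alpha> b d ^ card u * (\<Prod>j\<in>?w. r_weight b \<alpha> d (restrict (combine d s u \<kappa>) ?w j)))"
      by (rule mult_left_mono[OF _ g[OF S(1)[OF uk]]])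
    also have "\<dots> = ?c ?w * (\<Prod>j\<in>?w. r_weight b \<alpha> d (restrict (combine d s u \<kappa>) ?w j))"
      by (simp only: S(5)[OF uk] mult.assoc)
    finally have "ennreal (\<gamma> u * (\<Prod>l\<in>u. D_const \<alpha> b * (1 / real b) ^ (2 * mu \<alpha> (\<kappa> l))))
      \<le> ennreal (?c ?w * (\<Prod>j\<in>?w. r_weight b \<alpha> d (restrict (combine d s u \<kappa>) ?w j)))"
      by (rule ennreal_leI)
    also have "\<dots> = G (f (u, \<kappa>))"
      unfolding G_def f_def case_prod_conv
      by (rule ennreal_mult) (use g[OF S(1)[OF uk]] Dt rw in \<open>auto simp: S(5)[OF uk] intro!: prod_nonneg\<close>)
    finally show ?thesis .
  qed
  have inj: "inj_on f S"
  proof (rule inj_onI)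
    fix x y assume x: "x \<in> S" and y: "y \<in> S" and eq: "f x = f y"
    obtain u \<kappa> u' \<kappa>' where xy: "x = (u, \<kappa>)" "y = (u', \<kappa>')" by (cases x, cases y) blast
    have w: "combined_support d s u \<kappa> = combined_support d s u' \<kappa>'"
      and l: "restrict (combine d s u \<kappa>) (combined_support d s u \<kappa>) = restrict (combine d s u' \<kappa>') (combined_support d s u' \<kappa>')"
      using eq unfolding f_def xy case_prod_conv prod.inject by blast+
    have uu: "u = u'"
      using S(5)[OF x[unfolded xy]] S(5)[OF y[unfolded xy]] unfolding w by (rule trans[OF sym])
    have c: "combine d s u \<kappa> = combine d s u' \<kappa>'"
      using zero_extend_combined_support[of d s u \<kappa>] zero_extend_combined_support[of d s u' \<kappa>'] unfolding l unfolding w by (rule trans[OF sym])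
    have "\<kappa> = \<kappa>'"
    proof (rule combine_inj[OF d])
      show "u \<subseteq> {1..s}" by (rule S(1)[OF x[unfolded xy]])
      show "\<kappa> \<in> extensional u" using S(3)[OF x[unfolded xy]] by (simp add: PiE_iff)
      show "\<kappa>' \<in> extensional u" using S(3)[OF y[unfolded xy]] uu by (simp add: PiE_iff)
    qed (rule c[folded uu])
    then show "x = y" by (simp add: xy uu)
  qed
  have img: "f ` S \<subseteq> Sigma ?W ?T"
  proof (rule image_subsetI)
    fix x assume x: "x \<in> S"
    obtain u \<kappa> where uk: "x = (u, \<kappa>)" by (cases x)
    note Sx = S[OF x[unfolded uk]]
    let ?w = "combined_support d s u \<kappa>"
    have "?w \<noteq> {}" using Sx(2,5) by (auto simp: phi_def)
    moreover have "?w \<subseteq> {1..d * s}" by (auto simp: combined_support_def)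
    moreover have "restrict (combine d s u \<kappa>) ?w \<in> ?w \<rightarrow>\<^sub>E {1..}" by (auto simp: combined_support_def)
    ultimately show "f x \<in> Sigma ?W ?T" using Sx(4) by (simp add: f_def uk zero_extend_combined_support)
  qed
  have "ennreal (\<Sum>u\<in>?U. \<gamma> u * (\<Sum>\<kappa>\<in>?K u. \<Prod>l\<in>u. D_const \<alpha> b * (1 / real b) ^ (2 * mu \<alpha> (\<kappa> l))))
    = ennreal (\<Sum>(u, \<kappa>)\<in>S. \<gamma> u * (\<Prod>l\<in>u. D_const \<alpha> b * (1 / real b) ^ (2 * mu \<alpha> (\<kappa> l))))"
  proof -
    have "(\<Sum>u\<in>?U. \<gamma> u * (\<Sum>\<kappa>\<in>?K u. \<Prod>l\<in>u. D_const \<alpha> b * (1 / real b) ^ (2 * mu \<alpha> (\<kappa> l))))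
      = (\<Sum>u\<in>?U. \<Sum>\<kappa>\<in>?K u. \<gamma> u * (\<Prod>l\<in>u. D_const \<alpha> b * (1 / real b) ^ (2 * mu \<alpha> (\<kappa> l))))"
      by (simp only: sum_distrib_left)
    also have "\<dots> = (\<Sum>(u, \<kappa>)\<in>S. \<gamma> u * (\<Prod>l\<in>u. D_const \<alpha> b * (1 / real b) ^ (2 * mu \<alpha> (\<kappa> l))))"
      unfolding S_def by (rule sum.Sigma) (use finK in auto)
    finally show ?thesis by (rule arg_cong)
  qed
  also have "\<dots> = (\<Sum>(u, \<kappa>)\<in>S. ennreal (\<gamma> u * (\<Prod>l\<in>u. D_const \<alpha> b * (1 / real b) ^ (2 * mu \<alpha> (\<kappa> l)))))"
  proof (subst sum_ennreal[symmetric])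
    show "0 \<le> (case x of (u, \<kappa>) \<Rightarrow> \<gamma> u * (\<Prod>l\<in>u. D_const \<alpha> b * (1 / real b) ^ (2 * mu \<alpha> (\<kappa> l))))" if "x \<in> S" for x
    proof -
      obtain u \<kappa> where uk: "x = (u, \<kappa>)" by (cases x)
      show ?thesis unfolding uk case_prod_conv
        using g[OF S(1)[OF that[unfolded uk]]] D_const_nonneg[OF a]
        by (intro mult_nonneg_nonneg prod_nonneg ballI) simp_all
    qed
  qed (simp add: case_prod_beta)
  also have "\<dots> \<le> (\<Sum>x\<in>S. G (f x))"
    by (rule sum_mono) (use tm in auto)
  also have "\<dots> = (\<Sum>y\<in>f ` S. G y)" by (rule sum.reindex[OF inj, unfolded comp_def, symmetric])
  also have "\<dots> = (\<Sum>(w, l)\<in>Sigma ?W (\<lambda>w. {l. (w, l) \<in> f ` S}). G (w, l))"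
  proof (rule sum.cong)
    show "f ` S = Sigma ?W (\<lambda>w. {l. (w, l) \<in> f ` S})"
    proof (rule Set.set_eqI)
      fix y :: "nat set \<times> (nat \<Rightarrow> nat)"
      obtain w l where y: "y = (w, l)" by (cases y)
      have "w \<in> ?W" if "(w, l) \<in> f ` S" using subsetD[OF img that] by (simp only: mem_Sigma_iff)
      then show "y \<in> f ` S \<longleftrightarrow> y \<in> Sigma ?W (\<lambda>w. {l. (w, l) \<in> f ` S})"
        unfolding y mem_Sigma_iff mem_Collect_eq by blast
    qed
  qed auto
  also have "\<dots> = (\<Sum>w\<in>?W. \<Sum>l\<in>{l. (w, l) \<in> f ` S}. G (w, l))"
  proof (rule sum.Sigma[symmetric])
    show "\<forall>w\<in>?W. finite {l. (w, l) \<in> f ` S}"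
    proof
      fix w
      have "{l. (w, l) \<in> f ` S} \<subseteq> snd ` f ` S"
        by (rule subsetI, rule image_eqI[where x = "(w, _)"]) (simp_all only: snd_conv mem_Collect_eq)
      then show "finite {l. (w, l) \<in> f ` S}" using finS by (meson finite_imageI finite_subset)
    qed
  qed simp
  also have "\<dots> \<le> (\<Sum>w\<in>?W. ennreal (?c w) * (\<Sum>\<^sub>\<infinity>l\<in>?T w. ennreal (\<Prod>j\<in>w. r_weight b \<alpha> d (l j))))"
  proof (rule sum_mono)
    fix w assume w: "w \<in> ?W"
    have sub: "{l. (w, l) \<in> f ` S} \<subseteq> ?T w" using img by blast
    have "{l. (w, l) \<in> f ` S} \<subseteq> snd ` f ` S"
        by (rule subsetI, rule image_eqI[where x = "(w, _)"]) (simp_all only: snd_conv mem_Collect_eq)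
    then have "finite {l. (w, l) \<in> f ` S}" using finS by (meson finite_imageI finite_subset)
    then have "(\<Sum>l\<in>{l. (w, l) \<in> f ` S}. ennreal (\<Prod>j\<in>w. r_weight b \<alpha> d (l j)))
      \<le> (\<Sum>\<^sub>\<infinity>l\<in>?T w. ennreal (\<Prod>j\<in>w. r_weight b \<alpha> d (l j)))"
      using sub by (rule infsum_ennreal_ge)
    then show "(\<Sum>l\<in>{l. (w, l) \<in> f ` S}. G (w, l)) \<le> ennreal (?c w) * (\<Sum>\<^sub>\<infinity>l\<in>?T w. ennreal (\<Prod>j\<in>w. r_weight b \<alpha> d (l j)))"
      unfolding G_def case_prod_conv sum_distrib_left[symmetric] by (rule mult_left_mono) simp
  qed
  finally show ?thesis .
qed

text \<open>Passing to the parts turns the Walsh product at an interlaced point into one at a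
  lattice point. In the dual net the bound is trivial; outside it the character sum
  vanishes.\<close>

lemma norm_lattice_sum:
  fixes p :: "'p::prime_card mod_ring poly"
  assumes card: "b = CARD('p)" and p: "degree p = m" "p \<noteq> 0" and d: "d \<ge> 1"
    and u: "u \<subseteq> {1..s}"
  shows "norm (\<Sum>i<b ^ m. \<Prod>l\<in>u. wal (\<kappa> l) (vec_interlace b d s (poly_lattice_point m (d * s) q p i) l))
    \<le> (if combine d s u \<kappa> \<in> dual_net m (d * s) q p then real (b ^ m) else 0)"
proof -
  let ?y = "poly_lattice_point m (d * s) q p" and ?c = "combine d s u \<kappa>"
  have e: "(\<Prod>l\<in>u. wal (\<kappa> l) (vec_interlace b d s (?y i) l)) = (\<Prod>j\<in>{1..d * s}. wal (?c j) (?y i j))" for i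
  proof -
    have "(\<Prod>l\<in>u. wal (\<kappa> l) (vec_interlace b d s (?y i) l)) = (\<Prod>l\<in>u. wal (\<kappa> l) (interlace b d (\<lambda>r. ?y i (d * (l - 1) + r))))"
      using u by (intro prod.cong refl) (auto simp: vec_interlace_def)
    then show ?thesis using wal_combine[OF d u lattice_point_digits[OF card], of m] by simp
  qed
  have n: "norm (\<Prod>j\<in>{1..d * s}. wal (?c j) (?y i j)) = 1" for i by (simp add: prod_norm[symmetric])
  show ?thesis
  proof (cases "?c \<in> dual_net m (d * s) q p")
    case True
    have "norm (\<Sum>i<b ^ m. \<Prod>j\<in>{1..d * s}. wal (?c j) (?y i j)) \<le> (\<Sum>i<b ^ m. 1)"
      by (rule order_trans[OF norm_sum]) (simp only: n order_refl)
    then show ?thesis unfolding e using True by simp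
  next
    case False
    have "?c \<in> {1..d * s} \<rightarrow>\<^sub>E UNIV" by (simp add: combine_def)
    then have "\<not> p dvd (\<Sum>j=1..d * s. tr_poly m (?c j) * q j)"
      using False by (simp add: dual_net_def cong_0_iff)
    from lattice_character_sum[OF card p this] show ?thesis unfolding e using False by simp
  qed
qed

end

theorem theorem1:
  fixes b m s \<alpha> d :: nat
    and \<gamma> :: "nat set \<Rightarrow> real"
    and p :: "'p::prime_card mod_ring poly"
    and q :: "nat \<Rightarrow> 'p mod_ring poly"
    and H :: "((nat \<Rightarrow> real) \<Rightarrow> real) set"
    and ip :: "((nat \<Rightarrow> real) \<Rightarrow> real) \<Rightarrow> ((nat \<Rightarrow> real) \<Rightarrow> real) \<Rightarrow> real"
  assumes "prime b" and "b = CARD('p)"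
    and "m \<ge> 1" and "s \<ge> 1" and "\<alpha> \<ge> 2" and "d \<ge> 1"
    and "\<And>u. u \<subseteq> {1..s} \<Longrightarrow> \<gamma> u \<ge> 0"
    and "degree p = m"
    and "rkhs (half_open_cube s) (sobolev_kernel s \<alpha> \<gamma>) H ip"
  shows "mean_square_wce b s H ip (b ^ m)
             (\<lambda>n. vec_interlace b d s (poly_lattice_point m (d * s) q p n))
         \<le> (\<Sum>w\<in>Pow {1..d * s} - {{}}.
               ennreal (\<gamma> (phi d s w) * D_tilde \<alpha> b d ^ card (phi d s w)) *
               (\<Sum>\<^sub>\<infinity>l\<in>{l \<in> w \<rightarrow>\<^sub>E {1..}. zero_extend (d * s) w l \<in> dual_net m (d * s) q p}.
                  ennreal (\<Prod>j\<in>w. r_weight b \<alpha> d (l j))))" (is "?L \<le> ?R")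
proof -
  note card = assms(2) and m = assms(3) and \<alpha> = assms(5) and d = assms(6) and g = assms(7)
    and p = assms(8) and rk = assms(9)
  interpret radix b by standard (rule prime_ge_2_nat[OF assms(1)])
  have a: "\<alpha> \<ge> 1" using \<alpha> by simp
  interpret sobolev_rkhs s \<alpha> \<gamma> H ip by (rule sobolev_rkhs.intro[OF rk a])
  have p0: "p \<noteq> 0" using p m by auto
  let ?N = "b ^ m" and ?U = "Pow {1..s} - {{}}"
  let ?x = "\<lambda>n. vec_interlace b d s (poly_lattice_point m (d * s) q p n)"
  let ?P = "\<lambda>\<sigma> n. vec_digit_add b s (?x n) \<sigma>"
  have N: "?N > 0" by simp
  have fd: "fin_digits (?x n l)" if l: "l \<in> {1..s}" for n l
  proof -
    have "?x n l = interlace b d (\<lambda>r. poly_lattice_point m (d * s) q p n (d * (l - 1) + r))"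
      using l by (simp add: vec_interlace_def)
    moreover have "fin_digits (interlace b d (\<lambda>r. poly_lattice_point m (d * s) q p n (d * (l - 1) + r)))"
      by (rule interlace_digits(2)[OF d]) (rule lattice_point_digits[OF card block_offset_compose(1)[OF l]])
    ultimately show ?thesis by simp
  qed
  have Pl: "?P \<sigma> n l = digit_add b (?x n l) (\<sigma> l)" if "l \<in> {1..s}" for \<sigma> n l
    using that by (simp add: vec_digit_add_def)
  have Pc: "?P \<sigma> n \<in> half_open_cube s" if \<sigma>: "\<sigma> \<in> half_open_cube s" for \<sigma> n
    unfolding half_open_cube_def
  proof (rule PiE_I)
    fix l assume l: "l \<in> {1..s}"
    show "?P \<sigma> n l \<in> {0..<1}"
      unfolding Pl[OF l] using cube_component[OF \<sigma> l] by (intro fin_digits_add(1) fd l) auto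
  next
    fix l assume "l \<notin> {1..s}"
    then show "?P \<sigma> n l = undefined" by (simp only: vec_digit_add_def restrict_apply if_False)
  qed
  define A where "A = (\<Sum>u\<in>?U. \<gamma> u * ((\<Sum>i<?N. \<Sum>i'<?N. \<Prod>l\<in>u. shift_average \<alpha> (?x i l) (?x i' l)) / (real ?N)\<^sup>2))"
  have term_int: "integrable (cube_measure s) (\<lambda>\<sigma>. \<Prod>l\<in>u. sob \<alpha> (?P \<sigma> i l) (?P \<sigma> i' l))"
    "(LINT \<sigma>|cube_measure s. (\<Prod>l\<in>u. sob \<alpha> (?P \<sigma> i l) (?P \<sigma> i' l))) = (\<Prod>l\<in>u. shift_average \<alpha> (?x i l) (?x i' l))"
    if u: "u \<in> ?U" for u i i'
  proof -
    have us: "u \<subseteq> {1..s}" using u by blast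
    have e: "(\<Prod>l\<in>u. sob \<alpha> (?P \<sigma> i l) (?P \<sigma> i' l))
      = (\<Prod>l\<in>u. sob \<alpha> (digit_add b (?x i l) (\<sigma> l)) (digit_add b (?x i' l) (\<sigma> l)))" for \<sigma>
      using us by (intro prod.cong refl) (auto simp: Pl)
    have i: "integrable unit_measure (\<lambda>t. sob \<alpha> (digit_add b (?x i l) t) (digit_add b (?x i' l) t))" if "l \<in> u" for l
      using us that by (intro shift_average_limit(1) fd) auto
    note c = cube_integral_prod[where f = "\<lambda>l t. sob \<alpha> (digit_add b (?x i l) t) (digit_add b (?x i' l) t)", OF us i]
    show "integrable (cube_measure s) (\<lambda>\<sigma>. \<Prod>l\<in>u. sob \<alpha> (?P \<sigma> i l) (?P \<sigma> i' l))"
      unfolding e by (rule c(1))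
    show "(LINT \<sigma>|cube_measure s. (\<Prod>l\<in>u. sob \<alpha> (?P \<sigma> i l) (?P \<sigma> i' l))) = (\<Prod>l\<in>u. shift_average \<alpha> (?x i l) (?x i' l))"
      unfolding e shift_average_def by (rule c(2))
  qed
  have int: "integrable (cube_measure s) (\<lambda>\<sigma>. err_form s \<alpha> \<gamma> ?N (?P \<sigma>))"
    unfolding err_form_def pair_avg_def
    by (intro Bochner_Integration.integrable_sum integrable_mult_right integrable_divide term_int(1))
  have LA: "(LINT \<sigma>|cube_measure s. err_form s \<alpha> \<gamma> ?N (?P \<sigma>)) = A"
  proof -
    have "(LINT \<sigma>|cube_measure s. err_form s \<alpha> \<gamma> ?N (?P \<sigma>))
      = (\<Sum>u\<in>?U. \<gamma> u * ((\<Sum>i<?N. \<Sum>i'<?N. LINT \<sigma>|cube_measure s. (\<Prod>l\<in>u. sob \<alpha> (?P \<sigma> i l) (?P \<sigma> i' l))) / (real ?N)\<^sup>2))"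
      unfolding err_form_def pair_avg_def
    proof (subst Bochner_Integration.integral_sum)
      show "integrable (cube_measure s) (\<lambda>\<sigma>. \<gamma> u * ((\<Sum>i<?N. \<Sum>i'<?N. \<Prod>l\<in>u. sob \<alpha> (?P \<sigma> i l) (?P \<sigma> i' l)) / (real ?N)\<^sup>2))" if "u \<in> ?U" for u
        using that by (intro Bochner_Integration.integrable_sum integrable_mult_right integrable_divide term_int(1))
      show "(\<Sum>u\<in>?U. LINT \<sigma>|cube_measure s. \<gamma> u * ((\<Sum>i<?N. \<Sum>i'<?N. \<Prod>l\<in>u. sob \<alpha> (?P \<sigma> i l) (?P \<sigma> i' l)) / (real ?N)\<^sup>2))
        = (\<Sum>u\<in>?U. \<gamma> u * ((\<Sum>i<?N. \<Sum>i'<?N. LINT \<sigma>|cube_measure s. (\<Prod>l\<in>u. sob \<alpha> (?P \<sigma> i l) (?P \<sigma> i' l))) / (real ?N)\<^sup>2))"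
      proof (rule sum.cong[OF refl])
        fix u assume u: "u \<in> ?U"
        have "(LINT \<sigma>|cube_measure s. (\<Sum>i<?N. \<Sum>i'<?N. \<Prod>l\<in>u. sob \<alpha> (?P \<sigma> i l) (?P \<sigma> i' l)))
          = (\<Sum>i<?N. \<Sum>i'<?N. LINT \<sigma>|cube_measure s. (\<Prod>l\<in>u. sob \<alpha> (?P \<sigma> i l) (?P \<sigma> i' l)))"
          using term_int(1)[OF u] by (simp add: Bochner_Integration.integral_sum Bochner_Integration.integrable_sum del: of_nat_power)
        then show "(LINT \<sigma>|cube_measure s. \<gamma> u * ((\<Sum>i<?N. \<Sum>i'<?N. \<Prod>l\<in>u. sob \<alpha> (?P \<sigma> i l) (?P \<sigma> i' l)) / (real ?N)\<^sup>2))
          = \<gamma> u * ((\<Sum>i<?N. \<Sum>i'<?N. LINT \<sigma>|cube_measure s. (\<Prod>l\<in>u. sob \<alpha> (?P \<sigma> i l) (?P \<sigma> i' l))) / (real ?N)\<^sup>2)"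
          by simp
      qed
    qed
    also have "\<dots> = A" unfolding A_def by (intro sum.cong refl) (simp only: term_int(2))
    finally show ?thesis .
  qed
  have "?L \<le> (\<integral>\<^sup>+ \<sigma>. ennreal (err_form s \<alpha> \<gamma> ?N (?P \<sigma>)) \<partial>cube_measure s)"
    unfolding mean_square_wce_def
    by (rule nn_integral_mono) (rule worst_case_error_bound(1)[OF N], rule Pc, simp add: space_cube)
  \<comment> \<open>The form is nonnegative at every shift, so the extended integral is the ordinary
    one.\<close>
  also have "\<dots> = ennreal A"
    unfolding LA[symmetric]
    by (rule nn_integral_eq_integral[OF int], rule AE_I2, rule worst_case_error_bound(2)[OF N], rule Pc, simp add: space_cube)
  also have "ennreal A \<le> ?R"
  proof -
    \<comment> \<open>\<open>A\<close> with each shift average replaced by its partial Walsh sum.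
      The bound for \<open>Z n\<close> is uniform in \<open>n\<close>, so it passes to the limit
      \<open>A\<close>.\<close>
    define Z where "Z = (\<lambda>n. \<Sum>u\<in>?U. of_real (\<gamma> u) * ((\<Sum>i<?N. \<Sum>i'<?N. \<Prod>l\<in>u. walsh_sum \<alpha> n (?x i l) (?x i' l)) / of_real ((real ?N)\<^sup>2)))"
    have Zlim: "Z \<longlonglongrightarrow> of_real A"
    proof -
      have "Z \<longlonglongrightarrow> (\<Sum>u\<in>?U. of_real (\<gamma> u) * ((\<Sum>i<?N. \<Sum>i'<?N. \<Prod>l\<in>u. of_real (shift_average \<alpha> (?x i l) (?x i' l))) / of_real ((real ?N)\<^sup>2)))"
        unfolding Z_def
        by (intro tendsto_sum tendsto_mult tendsto_const tendsto_divide tendsto_prod shift_average_limit(2) fd) auto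
      then show ?thesis by (simp add: A_def)
    qed
    have Zb: "norm (Z n) \<le> (\<Sum>u\<in>?U. \<gamma> u * (\<Sum>\<kappa>\<in>dual_coeffs m d s q p n u. \<Prod>l\<in>u. D_const \<alpha> b * (1 / real b) ^ (2 * mu \<alpha> (\<kappa> l))))" for n
      unfolding Z_def
    proof (rule order_trans[OF norm_sum sum_mono])
      fix u assume u: "u \<in> ?U"
      then have us: "u \<subseteq> {1..s}" and uf: "finite u" using finite_subset by auto
      let ?K = "u \<rightarrow>\<^sub>E {..<b ^ n}" and ?W = "\<lambda>\<kappa>. norm (\<Sum>i<?N. \<Prod>l\<in>u. wal (\<kappa> l) (?x i l))"
      let ?D = "\<lambda>\<kappa>. \<Prod>l\<in>u. D_const \<alpha> b * (1 / real b) ^ (2 * mu \<alpha> (\<kappa> l))"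
      have D0: "0 \<le> ?D \<kappa>" for \<kappa> using D_const_nonneg[OF a] by (intro prod_nonneg ballI) simp
      have "(\<Prod>l\<in>u. norm (kernel_coeff \<alpha> (\<kappa> l))) * (?W \<kappa>)\<^sup>2 \<le> (if \<kappa> \<in> dual_coeffs m d s q p n u then ?D \<kappa> * (real ?N)\<^sup>2 else 0)"
        if \<kappa>: "\<kappa> \<in> ?K" for \<kappa>
      proof (cases "\<exists>l\<in>u. \<kappa> l = 0")
        \<comment> \<open>The kernel factor has mean zero, so its coefficient at index 0 vanishes;
          only vectors with positive entries contribute.\<close>
        case True
        then obtain l where l: "l \<in> u" "\<kappa> l = 0" by blast
        have "(\<Prod>l\<in>u. norm (kernel_coeff \<alpha> (\<kappa> l))) = 0"
          by (rule prod_zero[OF uf bexI[OF _ l(1)]]) (simp add: l(2) kernel_coeff_0[OF a])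
        then show ?thesis using D0 by simp
      next
        case False
        then have k1: "\<kappa> l \<ge> 1" if "l \<in> u" for l using that by (metis One_nat_def Suc_leI gr0I)
        have Wb: "?W \<kappa> \<le> (if combine d s u \<kappa> \<in> dual_net m (d * s) q p then real ?N else 0)"
          by (rule norm_lattice_sum[OF card p p0 d us])
        have kb: "(\<Prod>l\<in>u. norm (kernel_coeff \<alpha> (\<kappa> l))) \<le> ?D \<kappa>"
          by (rule prod_mono) (use kernel_coeff_bound[OF k1 a] in auto)
        have mem: "\<kappa> \<in> dual_coeffs m d s q p n u \<longleftrightarrow> combine d s u \<kappa> \<in> dual_net m (d * s) q p"
          using \<kappa> k1 by (auto simp: dual_coeffs_def PiE_iff)
        show ?thesis
        proof (cases "combine d s u \<kappa> \<in> dual_net m (d * s) q p")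
          case True
          then have "?W \<kappa> \<le> real ?N" using Wb by simp
          then have "(?W \<kappa>)\<^sup>2 \<le> (real ?N)\<^sup>2" by (intro power_mono) auto
          then have "(\<Prod>l\<in>u. norm (kernel_coeff \<alpha> (\<kappa> l))) * (?W \<kappa>)\<^sup>2 \<le> ?D \<kappa> * (real ?N)\<^sup>2"
            using kb D0 by (intro mult_mono) auto
          then show ?thesis using True mem by (simp only: if_True)
        next
          case False
          then have "?W \<kappa> = 0" using Wb by simp
          then show ?thesis using False mem by simp
        qed
      qed
      then have "(\<Sum>\<kappa>\<in>?K. (\<Prod>l\<in>u. norm (kernel_coeff \<alpha> (\<kappa> l))) * (?W \<kappa>)\<^sup>2)
        \<le> (\<Sum>\<kappa>\<in>?K. if \<kappa> \<in> dual_coeffs m d s q p n u then ?D \<kappa> * (real ?N)\<^sup>2 else 0)"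
        by (rule sum_mono)
      also have "\<dots> = (\<Sum>\<kappa>\<in>dual_coeffs m d s q p n u. ?D \<kappa> * (real ?N)\<^sup>2)"
      proof (rule sum.mono_neutral_cong_right)
        show "finite ?K" using uf by (intro finite_PiE) auto
        show "dual_coeffs m d s q p n u \<subseteq> ?K" by (auto simp: dual_coeffs_def PiE_iff extensional_def)
      qed auto
      finally have "norm (\<Sum>i<?N. \<Sum>i'<?N. \<Prod>l\<in>u. walsh_sum \<alpha> n (?x i l) (?x i' l))
        \<le> (\<Sum>\<kappa>\<in>dual_coeffs m d s q p n u. ?D \<kappa>) * (real ?N)\<^sup>2"
        using walsh_double_sum[OF uf, where B = ?N and \<alpha> = \<alpha> and n = n and X = ?x] by (simp only: sum_distrib_right)
      then have "norm (\<Sum>i<?N. \<Sum>i'<?N. \<Prod>l\<in>u. walsh_sum \<alpha> n (?x i l) (?x i' l)) / (real ?N)\<^sup>2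
        \<le> (\<Sum>\<kappa>\<in>dual_coeffs m d s q p n u. ?D \<kappa>)"
        by (simp add: divide_le_eq)
      then have "\<gamma> u * (norm (\<Sum>i<?N. \<Sum>i'<?N. \<Prod>l\<in>u. walsh_sum \<alpha> n (?x i l) (?x i' l)) / (real ?N)\<^sup>2)
        \<le> \<gamma> u * (\<Sum>\<kappa>\<in>dual_coeffs m d s q p n u. ?D \<kappa>)"
        by (rule mult_left_mono[OF _ g[OF us]])
      then show "norm (of_real (\<gamma> u) * ((\<Sum>i<?N. \<Sum>i'<?N. \<Prod>l\<in>u. walsh_sum \<alpha> n (?x i l) (?x i' l)) / of_real ((real ?N)\<^sup>2)))
        \<le> \<gamma> u * (\<Sum>\<kappa>\<in>dual_coeffs m d s q p n u. ?D \<kappa>)"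
        using g[OF us] by (simp only: norm_mult norm_divide norm_of_real abs_of_nonneg abs_power2)
    qed
    have "ennreal (Re (Z n)) \<le> ?R" for n
    proof -
      have "Re (Z n) \<le> norm (Z n)" by (rule complex_Re_le_cmod)
      then have "ennreal (Re (Z n)) \<le> ennreal (\<Sum>u\<in>?U. \<gamma> u * (\<Sum>\<kappa>\<in>dual_coeffs m d s q p n u. \<Prod>l\<in>u. D_const \<alpha> b * (1 / real b) ^ (2 * mu \<alpha> (\<kappa> l))))"
        using Zb[of n] by (intro ennreal_leI) linarith
      also have "\<dots> \<le> ?R" by (rule dual_sum_bound[OF d a g])
      finally show ?thesis .
    qed
    moreover have "(\<lambda>n. ennreal (Re (Z n))) \<longlonglongrightarrow> ennreal (Re (of_real A))"
      by (intro tendsto_ennrealI tendsto_Re Zlim)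
    ultimately show ?thesis by (intro LIMSEQ_le_const2[of _ "ennreal A"]) auto
  qed
  finally show ?thesis .
qed

end
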